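(* Let $M=G/K$ be an irreducible Hermitian symmetric space of noncompact type and $N$ a connected complete totally geodesic submanifold in $M$ through the origin $o$. If $\mathfrak a_N$ has a complexification as LTS in $\mathfrak p$, then $\Omega_\eta|_N=\Omega_{\eta,N}$ for any continuous injective odd function $\eta:\mathbb R\to\mathbb R$. In particular, the following diagram of pairs commutes: $$\begin{array}{ccc}(M,A)&\xrightarrow[\text{diffeo.}]{\ \Omega_\eta\times\Omega_\eta|_A\ }&(D_\eta,\square_{\eta,\mathfrak a})\\ \uparrow&&\uparrow\\ (N,A_N)&\xrightarrow[\text{diffeo.}]{\ \Omega_{\eta,N}\times\Omega_{\eta,N}|_{A_N}\ }&(D_{\eta,N},\square_{\eta,\mathfrak a_N})\end{array}$$ Here the vertical arrows are inclusions, and the horizontal arrows are diffeomorphisms: $\Omega_\eta:M\to D_\eta$ and $\Omega_\eta|_A:A\to\square_{\eta,\mathfrak a}$ in the top row, $\Omega_{\eta,N}:N\to D_{\eta,N}$ and $\Omega_{\eta,N}|_{A_N}:A_N\to\square_{\eta,\mathfrak a_N}$ in the bottom row. Conversely, if $(N,A_N)$ is mapped onto $(D_{\eta,N},\square_{\eta,\mathfrak a_N})$ by $\Omega_\eta\times\Omega_\eta$ (that is, $\Omega_\eta(N)=D_{\eta,N}$ and $\Omega_\eta(A_N)=\square_{\eta,\mathfrak a_N}$) for any continuous injective odd function $\eta:\mathbb R\to\mathbb R$, then $\mathfrak a_N$ has a complexification as LTS in $\mathfrak p$.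
   Context: $G$ is the identity component of the isometry group of $M$, $K$ the stabilizer of the origin $o$; $\mathfrak g=\mathfrak k\oplus\mathfrak p$ is the Cartan decomposition with Cartan involution $\theta$, $B$ the Killing form, $\langle X,Y\rangle=-B(X,\theta Y)$, $\mathfrak p\cong T_oM$, $J_o=\mathrm{ad}(\zeta)|_{\mathfrak p}$ the complex structure on $\mathfrak p$ ($\zeta$ in the center of $\mathfrak k$), $\mathrm{Exp}_o:\mathfrak p\to M$ the Riemannian exponential map. For a maximal abelian subspace $\mathfrak a\subset\mathfrak p$ of dimension $r$, the restricted root system $\Sigma\subset\mathfrak a^*$ is of type $C_r$ or $BC_r$: there is an orthogonal basis $e_1,\dots,e_r$ of the dual space of $\mathfrak a$ with $\Sigma=\{\pm e_i\pm e_j\ (i<j)\}\cup\{\pm2e_i\}$, or this set together with $\{\pm e_i\}$. $H_i\in\mathfrak a$ is defined by $2e_i=B(H_i,\cdot)|_{\mathfrak a}$; the $H_i$ are orthogonal with common squared norm $C$, and $\widetilde H_i=\frac2CH_i$ (a basis of $\mathfrak a$). $A=\mathrm{Exp}_o\mathfrak a$, and $K\cdot A=M$. For a continuous injective odd $\eta:\mathbb R\to\mathbb R$, the strongly diagonal realization $\Omega_\eta:M\to\mathfrak p$ is the (well-defined) map $\Omega_\eta(k\,\mathrm{Exp}_o\sum x_i\widetilde H_i)=\mathrm{Ad}(k)\sum\eta(x_i)\widetilde H_i$, $k\in K$; it does not depend on $\mathfrak a$. Put $s_\eta=\sup_{x\in\mathbb R}\eta(x)$, $\square_{\eta,\mathfrak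 a}=\{\sum x_i\widetilde H_i:|x_i|<s_\eta\}$, $D_\eta=\mathrm{Ad}(K)\square_{\eta,\mathfrak a}$. For $N$: put $\mathfrak p_N=T_oN\subset\mathfrak p$, a Lie triple system (LTS), i.e. $[[\mathfrak p_N,\mathfrak p_N],\mathfrak p_N]\subset\mathfrak p_N$; $\mathfrak g_N=[\mathfrak p_N,\mathfrak p_N]\oplus\mathfrak p_N$, $G_N$ the corresponding connected Lie subgroup of $G$, so $N=G_N\cdot o$, and $K_N$ the isotropy subgroup of $G_N$ at $o$. $\mathfrak a_N$ is a maximal abelian subspace of $\mathfrak p_N$, $r_N=\dim\mathfrak a_N$, $A_N=\mathrm{Exp}_o\mathfrak a_N$, and $\mathfrak a$ is a fixed maximal abelian subspace of $\mathfrak p$ containing $\mathfrak a_N$. One has $N=K_N\cdot A_N$. An abelian subspace $\mathfrak a'\subset\mathfrak p$ has a complexification as LTS in $\mathfrak p$ if $(\mathfrak a')^{\mathbb C}:=\mathfrak a'\oplus J_o\mathfrak a'$ is a complex Lie triple system, i.e. a complex subspace of $\mathfrak p$ with $[[(\mathfrak a')^{\mathbb C},(\mathfrak a')^{\mathbb C}],(\mathfrak a')^{\mathbb C}]\subset(\mathfrak a')^{\mathbb C}$. Canonical basis: there is a subset $I'=\{i_1<\dots<i_{r_N}\}\subset I=\{1,\dots,r\}$ such that $\mathfrak a_N$ has a (unique) basis of the form $V_m=\widetilde H_{i_m}+\sum_{i\in I\setminus I'}a^i_m\widetilde H_i$, $a_m^i\in\mathbb R$, $m=1,\dots,r_N$;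 fix such a choice. Put $\square_{\eta,\mathfrak a_N}=\{\sum_m x_mV_m:|x_m|<s_\eta\}$ and $D_{\eta,N}=\mathrm{Ad}(K_N)\square_{\eta,\mathfrak a_N}\subset\mathfrak p_N$. When $\mathfrak a_N$ has a complexification as LTS, $\Omega_{\eta,N}:N\to\mathfrak p_N$ is the (well-defined) map $\Omega_{\eta,N}(k\,\mathrm{Exp}_o\sum_m x_mV_m)=\mathrm{Ad}(k)\sum_m\eta(x_m)V_m$, $k\in K_N$.
   Formalization: The horizontal arrows are proved to be homeomorphisms for every continuous injective odd η, and diffeomorphisms only when η is a smooth diffeomorphism onto its image; for η(x)=x³ the inverse of Ω_η on A is not differentiable at 0. *)

theory Defs
  imports "HOL-Analysis.Analysis"
begin

text \<open>
  An irreducible Hermitian symmetric space of noncompact type is handled through its Lie algebra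
  of infinitesimal isometries.  That Lie algebra lives on the type \<open>'g\<close>; only the vector space
  structure and the topology of \<open>'g\<close> are used.  The inner product of the class
  \<open>euclidean_space\<close> is an arbitrary auxiliary one and is unrelated to the invariant
  metric of the symmetric space.
\<close>

section \<open>Smooth maps and submanifolds in Euclidean spaces\<close>

primrec times_differentiable_on ::
  "nat \<Rightarrow> 'a::euclidean_space set \<Rightarrow> ('a \<Rightarrow> 'b::euclidean_space) \<Rightarrow> bool" where
  "times_differentiable_on 0 U f \<longleftrightarrow> continuous_on U f"
| "times_differentiable_on (Suc k) U f \<longleftrightarrow>
     (\<exists>f'. (\<forall>x\<in>U. (f has_derivative f' x) (at x)) \<and>
           (\<forall>v. times_differentiable_on k U (\<lambda>x. f' x v)))"

text \<open>Smoothness on an arbitrary subset: locally the restriction of a \<open>C\<^sup>\<infinity>\<close> map defined on an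
  open subset of the ambient space.\<close>

definition smooth_map_on ::
  "'a::euclidean_space set \<Rightarrow> ('a \<Rightarrow> 'b::euclidean_space) \<Rightarrow> bool" where
  "smooth_map_on S f \<longleftrightarrow>
     (\<forall>x\<in>S. \<exists>U F. open U \<and> x \<in> U \<and> (\<forall>k. times_differentiable_on k U F) \<and> (\<forall>y\<in>S \<inter> U. F y = f y))"

definition diffeomorphism ::
  "'a::euclidean_space set \<Rightarrow> 'b::euclidean_space set \<Rightarrow> ('a \<Rightarrow> 'b) \<Rightarrow> bool" where
  "diffeomorphism S T f \<longleftrightarrow>
     bij_betw f S T \<and> smooth_map_on S f \<and> smooth_map_on T (the_inv_into S f)"

definition embedded_submanifold :: "'a::euclidean_space set \<Rightarrow> bool" where
  "embedded_submanifold S \<longleftrightarrow>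
     (\<forall>x\<in>S. \<exists>U V \<phi> L. open U \<and> x \<in> U \<and> open V \<and> subspace (L :: 'a set) \<and>
        diffeomorphism U V \<phi> \<and> \<phi> ` (S \<inter> U) = V \<inter> L)"


section \<open>Hermitian symmetric Lie algebras\<close>

definition lie_algebra :: "('g::euclidean_space \<Rightarrow> 'g \<Rightarrow> 'g) \<Rightarrow> bool" where
  "lie_algebra br \<longleftrightarrow> bilinear br \<and> (\<forall>X. br X X = 0) \<and>
     (\<forall>X Y Z. br X (br Y Z) + br Y (br Z X) + br Z (br X Y) = 0)"

definition killing :: "('g::euclidean_space \<Rightarrow> 'g \<Rightarrow> 'g) \<Rightarrow> 'g \<Rightarrow> 'g \<Rightarrow> real" where
  "killing br X Y = (\<Sum>b\<in>Basis. br X (br Y b) \<bullet> b)"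

definition cartan_ip ::
  "('g::euclidean_space \<Rightarrow> 'g \<Rightarrow> 'g) \<Rightarrow> ('g \<Rightarrow> 'g) \<Rightarrow> 'g \<Rightarrow> 'g \<Rightarrow> real" where
  "cartan_ip br \<theta> X Y = - killing br X (\<theta> Y)"

definition cartan_involution ::
  "('g::euclidean_space \<Rightarrow> 'g \<Rightarrow> 'g) \<Rightarrow> ('g \<Rightarrow> 'g) \<Rightarrow> bool" where
  "cartan_involution br \<theta> \<longleftrightarrow> linear \<theta> \<and> (\<forall>X. \<theta> (\<theta> X) = X) \<and>
     (\<forall>X Y. \<theta> (br X Y) = br (\<theta> X) (\<theta> Y)) \<and> (\<forall>X. X \<noteq> 0 \<longrightarrow> cartan_ip br \<theta> X X > 0)"

definition k_part :: "('g::euclidean_space \<Rightarrow> 'g) \<Rightarrow> 'g set" where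
  "k_part \<theta> = {X. \<theta> X = X}"

definition p_part :: "('g::euclidean_space \<Rightarrow> 'g) \<Rightarrow> 'g set" where
  "p_part \<theta> = {X. \<theta> X = - X}"

text \<open>
  Irreducible Hermitian symmetric space of noncompact type, in terms of its orthogonal symmetric
  Lie algebra: noncompact type (\<open>\<theta>\<close> is a Cartan involution, so the Killing form is negative definite
  on the \<open>k\<close>-part, positive definite on the \<open>p\<close>-part, and the algebra is semisimple), effective
  (no nonzero ideal in the \<open>k\<close>-part), irreducible isotropy representation, and complex structure
  \<open>J\<^sub>o = ad \<zeta>\<close> on the \<open>p\<close>-part with \<open>\<zeta>\<close> in the center of the \<open>k\<close>-part.
\<close>

definition irreducible_hermitian_noncompact ::
  "('g::euclidean_space \<Rightarrow> 'g \<Rightarrow> 'g) \<Rightarrow> ('g \<Rightarrow> 'g) \<Rightarrow> 'g \<Rightarrow> bool" where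
  "irreducible_hermitian_noncompact br \<theta> \<zeta> \<longleftrightarrow>
     lie_algebra br \<and> cartan_involution br \<theta> \<and>
     (\<forall>I. subspace I \<and> I \<subseteq> k_part \<theta> \<and> (\<forall>X. \<forall>Y\<in>I. br X Y \<in> I) \<longrightarrow> I = {0}) \<and>
     (\<forall>W. subspace W \<and> W \<subseteq> p_part \<theta> \<and> (\<forall>X\<in>k_part \<theta>. \<forall>Y\<in>W. br X Y \<in> W) \<longrightarrow>
          W = {0} \<or> W = p_part \<theta>) \<and>
     \<zeta> \<in> k_part \<theta> \<and> (\<forall>X\<in>k_part \<theta>. br \<zeta> X = 0) \<and>
     (\<forall>X\<in>p_part \<theta>. br \<zeta> (br \<zeta> X) = - X)"

definition lie_triple_system :: "('g::euclidean_space \<Rightarrow> 'g \<Rightarrow> 'g) \<Rightarrow> 'g set \<Rightarrow> bool" where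
  "lie_triple_system br V \<longleftrightarrow> subspace V \<and> (\<forall>X\<in>V. \<forall>Y\<in>V. \<forall>Z\<in>V. br (br X Y) Z \<in> V)"

definition maximal_abelian :: "('g::euclidean_space \<Rightarrow> 'g \<Rightarrow> 'g) \<Rightarrow> 'g set \<Rightarrow> 'g set \<Rightarrow> bool" where
  "maximal_abelian br P a \<longleftrightarrow>
     subspace a \<and> a \<subseteq> P \<and> (\<forall>X\<in>a. \<forall>Y\<in>a. br X Y = 0) \<and>
     (\<forall>b. subspace b \<and> b \<subseteq> P \<and> (\<forall>X\<in>b. \<forall>Y\<in>b. br X Y = 0) \<and> a \<subseteq> b \<longrightarrow> b = a)"

definition complexification ::
  "('g::euclidean_space \<Rightarrow> 'g \<Rightarrow> 'g) \<Rightarrow> 'g \<Rightarrow> 'g set \<Rightarrow> 'g set" where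
  "complexification br \<zeta> a = {X + br \<zeta> Y |X Y. X \<in> a \<and> Y \<in> a}"

definition has_lts_complexification ::
  "('g::euclidean_space \<Rightarrow> 'g \<Rightarrow> 'g) \<Rightarrow> 'g \<Rightarrow> 'g set \<Rightarrow> bool" where
  "has_lts_complexification br \<zeta> a \<longleftrightarrow>
     lie_triple_system br (complexification br \<zeta> a) \<and>
     (\<forall>X\<in>complexification br \<zeta> a. br \<zeta> X \<in> complexification br \<zeta> a)"


section \<open>The symmetric space \<open>M = G/K\<close>\<close>

definition exp_ad :: "('g::euclidean_space \<Rightarrow> 'g \<Rightarrow> 'g) \<Rightarrow> 'g \<Rightarrow> 'g \<Rightarrow> 'g" where
  "exp_ad br X Y = (\<Sum>n. (1 / fact n) *\<^sub>R ((br X ^^ n) Y))"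

text \<open>The subgroup generated by all \<open>exp (ad X)\<close> with \<open>X \<in> S\<close>.  If \<open>S\<close> is a subalgebra, this is the
  connected Lie subgroup with Lie algebra \<open>S\<close>.  Inverses need not be added, since
  \<open>exp (ad (- X))\<close> is the inverse of \<open>exp (ad X)\<close>.\<close>

inductive_set adjoint_group ::
  "('g::euclidean_space \<Rightarrow> 'g \<Rightarrow> 'g) \<Rightarrow> 'g set \<Rightarrow> ('g \<Rightarrow> 'g) set"
  for br :: "'g::euclidean_space \<Rightarrow> 'g \<Rightarrow> 'g" and S :: "'g set" where
  "id \<in> adjoint_group br S"
| "X \<in> S \<Longrightarrow> g \<in> adjoint_group br S \<Longrightarrow> exp_ad br X \<circ> g \<in> adjoint_group br S"

text \<open>For a symmetric space of noncompact type the identity component \<open>G\<close> of the isometry group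
  has trivial center, so it is identified with its adjoint group.  Under this identification
  \<open>Ad g\<close> is \<open>g\<close> itself, and the stabilizer \<open>K\<close> of the origin consists of the elements of \<open>G\<close>
  commuting with \<open>\<theta>\<close>.\<close>

definition isometry_group :: "('g::euclidean_space \<Rightarrow> 'g \<Rightarrow> 'g) \<Rightarrow> ('g \<Rightarrow> 'g) set" where
  "isometry_group br = adjoint_group br UNIV"

definition isotropy_group ::
  "('g::euclidean_space \<Rightarrow> 'g \<Rightarrow> 'g) \<Rightarrow> ('g \<Rightarrow> 'g) \<Rightarrow> ('g \<Rightarrow> 'g) set" where
  "isotropy_group br \<theta> = {g \<in> isometry_group br. g \<circ> \<theta> = \<theta> \<circ> g}"

text \<open>The points of \<open>M\<close> are the left cosets \<open>g K\<close>; the origin is \<open>K\<close>.\<close>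

definition origin :: "('g::euclidean_space \<Rightarrow> 'g \<Rightarrow> 'g) \<Rightarrow> ('g \<Rightarrow> 'g) \<Rightarrow> ('g \<Rightarrow> 'g) set" where
  "origin br \<theta> = isotropy_group br \<theta>"

definition act :: "('g \<Rightarrow> 'g) \<Rightarrow> ('g \<Rightarrow> 'g) set \<Rightarrow> ('g \<Rightarrow> 'g) set" where
  "act g p = (\<lambda>h. g \<circ> h) ` p"

definition sym_space :: "('g::euclidean_space \<Rightarrow> 'g \<Rightarrow> 'g) \<Rightarrow> ('g \<Rightarrow> 'g) \<Rightarrow> ('g \<Rightarrow> 'g) set set" where
  "sym_space br \<theta> = (\<lambda>g. act g (origin br \<theta>)) ` isometry_group br"

text \<open>Riemannian exponential map at the origin.  The geodesics of \<open>M\<close> through \<open>g o\<close> are exactly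
  the curves \<open>t \<mapsto> g Exp\<^sub>o (t X)\<close> with \<open>g \<in> G\<close> and \<open>X\<close> in the \<open>p\<close>-part, for every choice of the
  invariant metric.\<close>

definition Exp_o ::
  "('g::euclidean_space \<Rightarrow> 'g \<Rightarrow> 'g) \<Rightarrow> ('g \<Rightarrow> 'g) \<Rightarrow> 'g \<Rightarrow> ('g \<Rightarrow> 'g) set" where
  "Exp_o br \<theta> X = act (exp_ad br X) (origin br \<theta>)"

text \<open>
  \<open>Exp\<^sub>o\<close> is a diffeomorphism of the \<open>p\<close>-part onto \<open>M\<close> (Cartan-Hadamard), so the manifold
  structure of \<open>M\<close> is the one given by this single global chart.  Subsets of \<open>M\<close> are transported
  to subsets of the \<open>p\<close>-part by \<open>chart_image\<close>.
\<close>

definition chart_image ::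
  "('g::euclidean_space \<Rightarrow> 'g \<Rightarrow> 'g) \<Rightarrow> ('g \<Rightarrow> 'g) \<Rightarrow> ('g \<Rightarrow> 'g) set set \<Rightarrow> 'g set" where
  "chart_image br \<theta> S = {X \<in> p_part \<theta>. Exp_o br \<theta> X \<in> S}"

definition homeomorphic_map_from_M ::
  "('g::euclidean_space \<Rightarrow> 'g \<Rightarrow> 'g) \<Rightarrow> ('g \<Rightarrow> 'g) \<Rightarrow> ('g \<Rightarrow> 'g) set set \<Rightarrow> 'g set \<Rightarrow>
   (('g \<Rightarrow> 'g) set \<Rightarrow> 'g) \<Rightarrow> bool" where
  "homeomorphic_map_from_M br \<theta> S T F \<longleftrightarrow>
     (\<exists>h. homeomorphism (chart_image br \<theta> S) T (F \<circ> Exp_o br \<theta>) h)"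

definition diffeomorphic_map_from_M ::
  "('g::euclidean_space \<Rightarrow> 'g \<Rightarrow> 'g) \<Rightarrow> ('g \<Rightarrow> 'g) \<Rightarrow> ('g \<Rightarrow> 'g) set set \<Rightarrow> 'g set \<Rightarrow>
   (('g \<Rightarrow> 'g) set \<Rightarrow> 'g) \<Rightarrow> bool" where
  "diffeomorphic_map_from_M br \<theta> S T F \<longleftrightarrow>
     diffeomorphism (chart_image br \<theta> S) T (F \<circ> Exp_o br \<theta>)"


section \<open>Totally geodesic submanifolds\<close>

text \<open>Tangent vectors of \<open>N\<close> at \<open>g o\<close>, as elements of the \<open>p\<close>-part via the differential at \<open>0\<close> of
  \<open>X \<mapsto> g Exp\<^sub>o X\<close>.  For an embedded submanifold, curves differentiable at the base point give
  precisely the tangent space.\<close>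

definition tangent_vectors ::
  "('g::euclidean_space \<Rightarrow> 'g \<Rightarrow> 'g) \<Rightarrow> ('g \<Rightarrow> 'g) \<Rightarrow> ('g \<Rightarrow> 'g) \<Rightarrow> ('g \<Rightarrow> 'g) set set \<Rightarrow> 'g set" where
  "tangent_vectors br \<theta> g N =
     {X \<in> p_part \<theta>. \<exists>c :: real \<Rightarrow> 'g. c 0 = 0 \<and> (c has_vector_derivative X) (at 0) \<and>
        (\<forall>t. c t \<in> p_part \<theta> \<and> act g (Exp_o br \<theta> (c t)) \<in> N)}"

text \<open>A submanifold is totally geodesic and complete iff every geodesic of \<open>M\<close> tangent to it at one
  of its points stays in it for all times.\<close>

definition complete_totally_geodesic ::
  "('g::euclidean_space \<Rightarrow> 'g \<Rightarrow> 'g) \<Rightarrow> ('g \<Rightarrow> 'g) \<Rightarrow> ('g \<Rightarrow> 'g) set set \<Rightarrow> bool" where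
  "complete_totally_geodesic br \<theta> N \<longleftrightarrow>
     N \<subseteq> sym_space br \<theta> \<and> embedded_submanifold (chart_image br \<theta> N) \<and>
     (\<forall>g\<in>isometry_group br. act g (origin br \<theta>) \<in> N \<longrightarrow>
        (\<forall>X\<in>tangent_vectors br \<theta> g N. \<forall>t::real. act g (Exp_o br \<theta> (t *\<^sub>R X)) \<in> N))"

definition connected_in_M ::
  "('g::euclidean_space \<Rightarrow> 'g \<Rightarrow> 'g) \<Rightarrow> ('g \<Rightarrow> 'g) \<Rightarrow> ('g \<Rightarrow> 'g) set set \<Rightarrow> bool" where
  "connected_in_M br \<theta> N \<longleftrightarrow> connected (chart_image br \<theta> N)"

definition p_sub ::
  "('g::euclidean_space \<Rightarrow> 'g \<Rightarrow> 'g) \<Rightarrow> ('g \<Rightarrow> 'g) \<Rightarrow> ('g \<Rightarrow> 'g) set set \<Rightarrow> 'g set" where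
  "p_sub br \<theta> N = tangent_vectors br \<theta> id N"

definition g_sub ::
  "('g::euclidean_space \<Rightarrow> 'g \<Rightarrow> 'g) \<Rightarrow> ('g \<Rightarrow> 'g) \<Rightarrow> ('g \<Rightarrow> 'g) set set \<Rightarrow> 'g set" where
  "g_sub br \<theta> N =
     {X + Y |X Y. X \<in> span {br U V |U V. U \<in> p_sub br \<theta> N \<and> V \<in> p_sub br \<theta> N} \<and> Y \<in> p_sub br \<theta> N}"

definition K_sub ::
  "('g::euclidean_space \<Rightarrow> 'g \<Rightarrow> 'g) \<Rightarrow> ('g \<Rightarrow> 'g) \<Rightarrow> ('g \<Rightarrow> 'g) set set \<Rightarrow> ('g \<Rightarrow> 'g) set" where
  "K_sub br \<theta> N =
     {g \<in> adjoint_group br (g_sub br \<theta> N). act g (origin br \<theta>) = origin br \<theta>}"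


section \<open>Restricted roots\<close>

text \<open>Elements of the dual space \<open>a\<^sup>*\<close> are represented by functions that are \<open>undefined\<close> outside
  \<open>a\<close>; each is the restriction of a linear form on the whole Lie algebra.\<close>

definition restricted_roots ::
  "('g::euclidean_space \<Rightarrow> 'g \<Rightarrow> 'g) \<Rightarrow> 'g set \<Rightarrow> ('g \<Rightarrow> real) set" where
  "restricted_roots br a =
     {restrict l a |l. linear l \<and> (\<exists>H\<in>a. l H \<noteq> 0) \<and> (\<exists>X. X \<noteq> 0 \<and> (\<forall>H\<in>a. br H X = l H *\<^sub>R X))}"

definition roots_C :: "'g set \<Rightarrow> nat \<Rightarrow> (nat \<Rightarrow> 'g \<Rightarrow> real) \<Rightarrow> ('g \<Rightarrow> real) set" where
  "roots_C a r e =
     {restrict (\<lambda>H. s * e i H + t * e j H) a |s t i j. s \<in> {-1, 1} \<and> t \<in> {-1, 1} \<and> 1 \<le> i \<and> i < j \<and> j \<le> r} \<union>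
     {restrict (\<lambda>H. s * (2 * e i H)) a |s i. s \<in> {-1, 1} \<and> i \<in> {1..r}}"

definition roots_BC :: "'g set \<Rightarrow> nat \<Rightarrow> (nat \<Rightarrow> 'g \<Rightarrow> real) \<Rightarrow> ('g \<Rightarrow> real) set" where
  "roots_BC a r e =
     roots_C a r e \<union> {restrict (\<lambda>H. s * e i H) a |s i. s \<in> {-1, 1} \<and> i \<in> {1..r}}"

definition dual_vector ::
  "('g::euclidean_space \<Rightarrow> 'g \<Rightarrow> 'g) \<Rightarrow> 'g set \<Rightarrow> ('g \<Rightarrow> real) \<Rightarrow> 'g" where
  "dual_vector br a l = (THE H. H \<in> a \<and> (\<forall>Y\<in>a. l Y = killing br H Y))"

text \<open>The inner product induced on \<open>a\<^sup>*\<close>; on the \<open>p\<close>-part the invariant inner product is the Killing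
  form.  Pairwise orthogonal nonzero forms, as many as the dimension of \<open>a\<close>, are an orthogonal
  basis of \<open>a\<^sup>*\<close>.\<close>

definition dual_ip ::
  "('g::euclidean_space \<Rightarrow> 'g \<Rightarrow> 'g) \<Rightarrow> 'g set \<Rightarrow> ('g \<Rightarrow> real) \<Rightarrow> ('g \<Rightarrow> real) \<Rightarrow> real" where
  "dual_ip br a l m = killing br (dual_vector br a l) (dual_vector br a m)"

definition root_frame ::
  "('g::euclidean_space \<Rightarrow> 'g \<Rightarrow> 'g) \<Rightarrow> 'g set \<Rightarrow> nat \<Rightarrow> (nat \<Rightarrow> 'g \<Rightarrow> real) \<Rightarrow> bool" where
  "root_frame br a r e \<longleftrightarrow>
     r = dim a \<and> (\<forall>i\<in>{1..r}. linear (e i) \<and> (\<exists>H\<in>a. e i H \<noteq> 0)) \<and>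
     (\<forall>i\<in>{1..r}. \<forall>j\<in>{1..r}. i \<noteq> j \<longrightarrow> dual_ip br a (e i) (e j) = 0) \<and>
     (restricted_roots br a = roots_C a r e \<or> restricted_roots br a = roots_BC a r e)"

definition Hvec ::
  "('g::euclidean_space \<Rightarrow> 'g \<Rightarrow> 'g) \<Rightarrow> 'g set \<Rightarrow> (nat \<Rightarrow> 'g \<Rightarrow> real) \<Rightarrow> nat \<Rightarrow> 'g" where
  "Hvec br a e i = dual_vector br a (\<lambda>Y. 2 * e i Y)"

text \<open>All \<open>H\<^sub>i\<close> have the same squared norm \<open>C\<close>.\<close>

definition Htilde ::
  "('g::euclidean_space \<Rightarrow> 'g \<Rightarrow> 'g) \<Rightarrow> 'g set \<Rightarrow> (nat \<Rightarrow> 'g \<Rightarrow> real) \<Rightarrow> nat \<Rightarrow> 'g" where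
  "Htilde br a e i = (2 / killing br (Hvec br a e i) (Hvec br a e i)) *\<^sub>R Hvec br a e i"

definition canonical_basis ::
  "('g::euclidean_space \<Rightarrow> 'g \<Rightarrow> 'g) \<Rightarrow> 'g set \<Rightarrow> nat \<Rightarrow> (nat \<Rightarrow> 'g \<Rightarrow> real) \<Rightarrow>
   'g set \<Rightarrow> nat \<Rightarrow> (nat \<Rightarrow> nat) \<Rightarrow> (nat \<Rightarrow> 'g) \<Rightarrow> bool" where
  "canonical_basis br a r e a\<^sub>N r\<^sub>N idx V \<longleftrightarrow>
     r\<^sub>N = dim a\<^sub>N \<and> strict_mono_on {1..r\<^sub>N} idx \<and> idx ` {1..r\<^sub>N} \<subseteq> {1..r} \<and>
     span (V ` {1..r\<^sub>N}) = a\<^sub>N \<and>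
     (\<exists>c :: nat \<Rightarrow> nat \<Rightarrow> real. \<forall>m\<in>{1..r\<^sub>N}.
        V m = Htilde br a e (idx m) + (\<Sum>i\<in>{1..r} - idx ` {1..r\<^sub>N}. c m i *\<^sub>R Htilde br a e i))"


section \<open>Strongly diagonal realizations\<close>

definition continuous_injective_odd :: "(real \<Rightarrow> real) \<Rightarrow> bool" where
  "continuous_injective_odd \<eta> \<longleftrightarrow> continuous_on UNIV \<eta> \<and> inj \<eta> \<and> (\<forall>x. \<eta> (- x) = - \<eta> x)"

text \<open>The map \<open>k Exp\<^sub>o (\<Sum>\<^sub>i x\<^sub>i W\<^sub>i) \<mapsto> Ad(k) (\<Sum>\<^sub>i \<eta>(x\<^sub>i) W\<^sub>i)\<close>, \<open>k \<in> L\<close>, \<open>i = 1, \<dots>, n\<close>.\<close>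

definition diagonal_map ::
  "('g::euclidean_space \<Rightarrow> 'g \<Rightarrow> 'g) \<Rightarrow> ('g \<Rightarrow> 'g) \<Rightarrow> ('g \<Rightarrow> 'g) set \<Rightarrow> nat \<Rightarrow> (nat \<Rightarrow> 'g) \<Rightarrow>
   (real \<Rightarrow> real) \<Rightarrow> ('g \<Rightarrow> 'g) set \<Rightarrow> 'g" where
  "diagonal_map br \<theta> L n W \<eta> p =
     (THE Y. \<exists>k\<in>L. \<exists>x :: nat \<Rightarrow> real.
        p = act k (Exp_o br \<theta> (\<Sum>i\<in>{1..n}. x i *\<^sub>R W i)) \<and> Y = k (\<Sum>i\<in>{1..n}. \<eta> (x i) *\<^sub>R W i))"

text \<open>The supremum of \<open>\<eta>\<close> may be infinite.\<close>

definition square :: "nat \<Rightarrow> (nat \<Rightarrow> 'g::euclidean_space) \<Rightarrow> (real \<Rightarrow> real) \<Rightarrow> 'g set" where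
  "square n W \<eta> =
     {\<Sum>i\<in>{1..n}. x i *\<^sub>R W i |x :: nat \<Rightarrow> real. \<forall>i\<in>{1..n}. ereal \<bar>x i\<bar> < (SUP y. ereal (\<eta> y))}"

definition Omega ::
  "('g::euclidean_space \<Rightarrow> 'g \<Rightarrow> 'g) \<Rightarrow> ('g \<Rightarrow> 'g) \<Rightarrow> 'g set \<Rightarrow> nat \<Rightarrow> (nat \<Rightarrow> 'g \<Rightarrow> real) \<Rightarrow>
   (real \<Rightarrow> real) \<Rightarrow> ('g \<Rightarrow> 'g) set \<Rightarrow> 'g" where
  "Omega br \<theta> a r e \<eta> = diagonal_map br \<theta> (isotropy_group br \<theta>) r (Htilde br a e) \<eta>"

definition D_domain ::
  "('g::euclidean_space \<Rightarrow> 'g \<Rightarrow> 'g) \<Rightarrow> ('g \<Rightarrow> 'g) \<Rightarrow> 'g set \<Rightarrow> nat \<Rightarrow> (nat \<Rightarrow> 'g \<Rightarrow> real) \<Rightarrow>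
   (real \<Rightarrow> real) \<Rightarrow> 'g set" where
  "D_domain br \<theta> a r e \<eta> = (\<Union>k\<in>isotropy_group br \<theta>. k ` square r (Htilde br a e) \<eta>)"

definition Omega_sub ::
  "('g::euclidean_space \<Rightarrow> 'g \<Rightarrow> 'g) \<Rightarrow> ('g \<Rightarrow> 'g) \<Rightarrow> ('g \<Rightarrow> 'g) set set \<Rightarrow> nat \<Rightarrow> (nat \<Rightarrow> 'g) \<Rightarrow>
   (real \<Rightarrow> real) \<Rightarrow> ('g \<Rightarrow> 'g) set \<Rightarrow> 'g" where
  "Omega_sub br \<theta> N r\<^sub>N V \<eta> = diagonal_map br \<theta> (K_sub br \<theta> N) r\<^sub>N V \<eta>"

definition D_domain_sub ::
  "('g::euclidean_space \<Rightarrow> 'g \<Rightarrow> 'g) \<Rightarrow> ('g \<Rightarrow> 'g) \<Rightarrow> ('g \<Rightarrow> 'g) set set \<Rightarrow> nat \<Rightarrow> (nat \<Rightarrow> 'g) \<Rightarrow>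
   (real \<Rightarrow> real) \<Rightarrow> 'g set" where
  "D_domain_sub br \<theta> N r\<^sub>N V \<eta> = (\<Union>k\<in>K_sub br \<theta> N. k ` square r\<^sub>N V \<eta>)"

end

theory Submission
  imports Defs "HOL-Computational_Algebra.Polynomial"
begin

text \<open>
  In the chart \<open>Exp\<^sub>o\<close> the diagonal realization of \<open>M\<close> is \<open>X \<mapsto> 2 [\<zeta>, \<eta>(ad X / 2) \<zeta>]\<close>, where \<open>\<eta>\<close>
  is applied to the self-adjoint operator \<open>ad X / 2\<close> through its eigenvalues.  Indeed, for \<open>X\<close> in \<open>a\<close>
  only the weights \<open>0\<close> and \<open>\<plusminus>2e\<^sub>i\<close> occur in \<open>\<zeta>\<close>, and conjugation by \<open>K\<close> is harmless because \<open>K\<close> fixes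
  \<open>\<zeta>\<close> up to a sign.  Smoothness therefore reduces to that of the functional calculus
  \<open>A \<mapsto> f(A)\<close> on self-adjoint operators.

  A complete connected totally geodesic \<open>N\<close> through \<open>o\<close> is \<open>Exp\<^sub>o\<close> of its tangent space at \<open>o\<close>, a Lie
  triple system.  In the coordinates of the frame, \<open>[[[\<zeta>, X], Y], Z] = 4 [\<zeta>, X Y Z]\<close> with coordinatewise
  products on \<open>a\<close>, so the complexification of \<open>a\<^sub>N\<close> is a Lie triple system iff \<open>a\<^sub>N\<close> is closed under
  products of three elements.  The canonical basis vectors of such a subspace have coefficients in
  \<open>{-1, 0, 1}\<close> and disjoint supports, so every odd \<open>\<eta>\<close> acts diagonally on them.  Conversely,
  \<open>\<eta>(x) = x\<^sup>3\<close> gives closure under cubes, hence by polarization under triple products.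
\<close>

section \<open>Spectral theory of self-adjoint operators\<close>

text \<open>Eigenvectors of \<open>ad X\<close> may jump where eigenvalues meet, so f(A) cannot be
  differentiated through the eigenbasis that defines it. For a polynomial p the derivatives of p(A)
  are sums of words in A and the directions. Read in an eigenbasis, each direction costs one divided
  difference of p, hence one derivative, and the bound depends only on the size of that derivative
  on the spectrum. Polynomials approximating f in C^k therefore have uniformly convergent
  derivatives.

  That q = T_oN is a Lie triple system rests on the differential of Exp_o at X, which is sinh(ad X)
  / ad X after translation to o. The geodesic symmetry at the midpoint Exp_o(X/2) preserves N, which
  shows that this operator maps q to itself; its second-order term in X puts [X, [X, q]] into q.

  M has a single chart and its points are cosets, so continuity and differentiability of the action
  of G are drawn from one identity: g Exp_o Y = Exp_o W forces exp(2 ad W) = g exp(2 ad Y) g*, with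
  g* the adjoint of g for \<open>cartan_ip\<close>.\<close>

locale inner_form =
  fixes ip :: "'g::euclidean_space \<Rightarrow> 'g \<Rightarrow> real"
  assumes ip_bilinear: "bilinear ip"
    and ip_sym: "ip x y = ip y x"
    and ip_pos: "x \<noteq> 0 \<Longrightarrow> ip x x > 0"
begin

lemma ip_linear_left: "linear (\<lambda>x. ip x y)" and ip_linear_right: "linear (ip x)"
  using ip_bilinear by (auto simp: bilinear_def)

lemma ip_bounded: "bounded_bilinear ip"
  using ip_bilinear by (simp add: bilinear_conv_bounded_bilinear)

lemma ip_scaleR [simp]: "ip (c *\<^sub>R x) y = c * ip x y" "ip x (c *\<^sub>R y) = c * ip x y"
  using bilinear_lmul[OF ip_bilinear] bilinear_rmul[OF ip_bilinear] by auto

lemmas ip_simps = ip_scaleR bilinear_ladd[OF ip_bilinear] bilinear_radd[OF ip_bilinear]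
  bilinear_lneg[OF ip_bilinear] bilinear_rneg[OF ip_bilinear]
  bilinear_lzero[OF ip_bilinear] bilinear_rzero[OF ip_bilinear]
  bilinear_lsub[OF ip_bilinear] bilinear_rsub[OF ip_bilinear]

lemma ip_sum_left: "ip (\<Sum>i\<in>I. f i) y = (\<Sum>i\<in>I. ip (f i) y)"
  using linear_sum[OF ip_linear_left] by blast

lemma ip_sum_right: "ip x (\<Sum>i\<in>I. f i) = (\<Sum>i\<in>I. ip x (f i))"
  using linear_sum[OF ip_linear_right] by blast

lemma ip_eq_0_iff: "ip x x = 0 \<longleftrightarrow> x = 0"
  using ip_pos[of x] by (cases "x = 0") (auto simp: ip_simps)

lemma ip_ge_0: "ip x x \<ge> 0"
  using ip_pos[of x] by (cases "x = 0") (auto simp: ip_simps)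

lemma ip_eqI:
  assumes "\<And>z. ip x z = ip y z"
  shows "x = y"
  using assms[of "x - y"] ip_eq_0_iff[of "x - y"] by (simp add: ip_simps)

lemma ip_continuous_on [continuous_intros]:
  "continuous_on S f \<Longrightarrow> continuous_on S g \<Longrightarrow> continuous_on S (\<lambda>x. ip (f x) (g x))"
  by (rule bounded_bilinear.continuous_on[OF ip_bounded])

text \<open>By compactness \<open>ip\<close> attains a positive minimum on the Euclidean unit
  sphere. This turns estimates made with \<open>ip\<close> into estimates for the auxiliary norm of
  the type.\<close>

lemma ip_norm_bound: "\<exists>C>0. \<forall>x. norm x ^ 2 \<le> C * ip x x"
proof -
  have c: "continuous_on (sphere 0 1) (\<lambda>x. ip x x)"
    by (intro continuous_intros)
  have ne: "sphere (0::'g) 1 \<noteq> {}"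
    by simp
  obtain u where u: "u \<in> sphere 0 1" "\<And>y. y \<in> sphere 0 1 \<Longrightarrow> ip u u \<le> ip y y"
    using continuous_attains_inf[OF compact_sphere ne c] by blast
  have pu: "ip u u > 0" using u(1) ip_pos[of u] by fastforce
  have "norm x ^ 2 \<le> (1 / ip u u) * ip x x" for x
  proof (cases "x = 0")
    case False
    have "ip u u \<le> ip (x /\<^sub>R norm x) (x /\<^sub>R norm x)"
      using False by (intro u(2)) simp
    also have "\<dots> = ip x x / norm x ^ 2"
      by (simp add: ip_simps power2_eq_square field_simps)
    finally show ?thesis using False pu by (simp add: field_simps)
  qed (simp add: ip_simps)
  then show ?thesis using pu by (intro exI[of _ "1 / ip u u"]) auto
qed

definition onb :: "'g set \<Rightarrow> 'g set \<Rightarrow> bool" where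
  "onb B S \<longleftrightarrow> finite B \<and> B \<subseteq> S \<and> (\<forall>b\<in>B. \<forall>c\<in>B. ip b c = (if b = c then 1 else 0)) \<and>
     (\<forall>x\<in>S. x = (\<Sum>b\<in>B. ip x b *\<^sub>R b))"

lemma onb_expand: "onb B UNIV \<Longrightarrow> (\<Sum>b\<in>B. ip x b *\<^sub>R b) = x"
  by (metis onb_def UNIV_I)

text \<open>A maximizer \<open>u\<close> of \<open>ip (A x) x\<close> over the
  \<open>ip\<close>-unit vectors of \<open>S\<close> is an eigenvector: the residual
  \<open>w\<close> lies in \<open>S\<close> and is orthogonal to \<open>u\<close>, and moving from
  \<open>u\<close> towards \<open>w\<close> raises the Rayleigh quotient to first order at the rate
  \<open>2 * ip w w\<close>.\<close>

lemma self_adjoint_eigenvector: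
  assumes S: "subspace S" "S \<noteq> {0}" and A: "linear A" "A ` S \<subseteq> S"
    and sa: "\<And>x y. x \<in> S \<Longrightarrow> y \<in> S \<Longrightarrow> ip (A x) y = ip x (A y)"
  shows "\<exists>u\<in>S. u \<noteq> 0 \<and> (\<exists>l. A u = l *\<^sub>R u)"
proof -
  obtain C where C: "C > 0" "\<And>x. norm x ^ 2 \<le> C * ip x x" using ip_norm_bound by blast
  let ?T = "{x \<in> S. ip x x = 1}"
  have "closed {x. ip x x = 1}"
    by (intro closed_Collect_eq continuous_intros)
  then have "closed ?T"
    using closed_subspace[OF S(1)] by (metis closed_Int Collect_conj_eq Collect_mem_eq)
  moreover have "bounded ?T"
  proof (rule boundedI)
    fix x assume "x \<in> ?T"
    then have "norm x ^ 2 \<le> C" using C(2)[of x] by simp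
    then show "norm x \<le> sqrt C" by (simp add: real_le_rsqrt)
  qed
  ultimately have cT: "compact ?T" by (simp add: compact_eq_bounded_closed)
  obtain x0 where x0: "x0 \<in> S" "x0 \<noteq> 0" using S subspace_0 by blast
  have p0: "ip x0 x0 > 0" by (rule ip_pos[OF x0(2)])
  have "x0 /\<^sub>R sqrt (ip x0 x0) \<in> ?T"
    using x0 p0 S(1) by (simp add: ip_simps subspace_scale field_simps flip: real_sqrt_mult)
  then have ne: "?T \<noteq> {}" by blast
  have cA: "continuous_on UNIV A"
    using A(1) linear_continuous_on linear_linear by blast
  have c: "continuous_on ?T (\<lambda>x. ip (A x) x)"
    by (intro continuous_intros continuous_on_subset[OF cA]) auto
  obtain u where u: "u \<in> ?T" "\<And>y. y \<in> ?T \<Longrightarrow> ip (A y) y \<le> ip (A u) u"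
    using continuous_attains_sup[OF cT ne c] by blast
  define l where "l = ip (A u) u"
  have gen: "ip (A y) y \<le> l * ip y y" if "y \<in> S" for y
  proof (cases "y = 0")
    case False
    have p: "ip y y > 0" by (rule ip_pos[OF False])
    have "y /\<^sub>R sqrt (ip y y) \<in> ?T"
      using that p S(1) by (simp add: ip_simps subspace_scale field_simps flip: real_sqrt_mult)
    from u(2)[OF this] have "ip (A (y /\<^sub>R sqrt (ip y y))) (y /\<^sub>R sqrt (ip y y)) \<le> l" by (simp add: l_def)
    then have "ip (A y) y / ip y y \<le> l"
      using p by (simp add: ip_simps linear_scale[OF A(1)] field_simps flip: real_sqrt_mult)
    then show ?thesis using p by (simp add: field_simps)
  qed (simp add: ip_simps)
  define w where "w = A u - l *\<^sub>R u"
  have uS: "u \<in> S" and uu: "ip u u = 1" using u(1) by auto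
  have wS: "w \<in> S" using A(2) uS S(1) by (auto simp: w_def intro!: subspace_diff subspace_scale)
  have wu: "ip w u = 0" using uu by (simp add: w_def ip_simps l_def)
  have Auw: "ip (A u) w = ip w w"
    using wu ip_sym[of u w] by (simp add: w_def ip_simps)
  have Awu: "ip (A w) u = ip w w" using Auw sa[OF wS uS] ip_sym by metis
  have ineq: "2 * t * ip w w + t^2 * (ip (A w) w - l * ip w w) \<le> 0" for t
  proof -
    have "ip (A (u + t *\<^sub>R w)) (u + t *\<^sub>R w) \<le> l * ip (u + t *\<^sub>R w) (u + t *\<^sub>R w)"
      using gen uS wS S(1) by (simp add: subspace_add subspace_scale)
    then show ?thesis
      using wu ip_sym[of u w] uu Auw Awu l_def
      by (simp add: linear_add[OF A(1)] linear_scale[OF A(1)] ip_simps algebra_simps power2_eq_square)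
  qed
  have "ip w w = 0"
  proof (rule ccontr)
    assume "ip w w \<noteq> 0"
    then have p: "ip w w > 0" using ip_ge_0[of w] by linarith
    \<comment> \<open>\<open>M\<close> dominates the coefficient of \<open>t^2\<close>; with
      \<open>t = ip w w / M\<close> the linear term of \<open>ineq\<close> is twice the bound on the
      quadratic one.\<close>
    define M where "M = \<bar>ip (A w) w - l * ip w w\<bar> + 1"
    have M: "M > 0" "ip (A w) w - l * ip w w \<ge> - M" by (auto simp: M_def)
    let ?t = "ip w w / M"
    have "?t > 0" using p M by simp
    have "?t^2 * (ip (A w) w - l * ip w w) \<ge> ?t^2 * (- M)"
      using M by (intro mult_left_mono) auto
    moreover have "?t^2 * M = ?t * ip w w" using M by (simp add: power2_eq_square field_simps)
    ultimately have "2 * ?t * ip w w - ?t * ip w w \<le> 0" using ineq[of ?t] by simp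
    then have "?t * ip w w \<le> 0" by simp
    then show False using \<open>?t > 0\<close> p
      by (metis mult_pos_pos not_less)
  qed
  then have "A u = l *\<^sub>R u" using ip_eq_0_iff[of w] by (simp add: w_def)
  moreover have "u \<noteq> 0" using uu by (auto simp: ip_simps)
  ultimately show ?thesis using uS by blast
qed

text \<open>Induction on the dimension: if some operator is not a scalar on \<open>S\<close>, one of
  its eigenspaces is proper, and commutativity makes it invariant under the whole family.\<close>

lemma common_eigenvector:
  assumes "subspace S" "S \<noteq> {0}"
    and "\<And>A. A \<in> \<A> \<Longrightarrow> linear A" "\<And>A. A \<in> \<A> \<Longrightarrow> A ` S \<subseteq> S"
    and "\<And>A x y. A \<in> \<A> \<Longrightarrow> x \<in> S \<Longrightarrow> y \<in> S \<Longrightarrow> ip (A x) y = ip x (A y)"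
    and "\<And>A B x. A \<in> \<A> \<Longrightarrow> B \<in> \<A> \<Longrightarrow> x \<in> S \<Longrightarrow> A (B x) = B (A x)"
  shows "\<exists>u\<in>S. u \<noteq> 0 \<and> (\<forall>A\<in>\<A>. \<exists>l. A u = l *\<^sub>R u)"
  using assms
proof (induction "dim S" arbitrary: S rule: less_induct)
  case less
  show ?case
  proof (cases "\<forall>A\<in>\<A>. \<exists>l. \<forall>x\<in>S. A x = l *\<^sub>R x")
    case True
    obtain u where "u \<in> S" "u \<noteq> 0" using less.prems(1,2) subspace_0 by blast
    then show ?thesis using True by (intro bexI[of _ u]) auto
  next
    case False
    then obtain A where A: "A \<in> \<A>" "\<And>l. \<exists>x\<in>S. A x \<noteq> l *\<^sub>R x" by blast
    obtain u l where u: "u \<in> S" "u \<noteq> 0" "A u = l *\<^sub>R u"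
      using self_adjoint_eigenvector[of S A] less.prems A(1) by blast
    have lA: "linear A" using less.prems A by blast
    let ?E = "{x \<in> S. A x = l *\<^sub>R x}"
    have sE: "subspace ?E"
      using less.prems(1) lA
      by (auto simp: subspace_def linear_0 linear_add linear_scale algebra_simps)
    have "?E \<subset> S" using A(2)[of l] by blast
    then have d: "dim ?E < dim S"
      using sE less.prems(1) by (metis dim_psubset span_eq_iff)
    have "\<exists>u\<in>?E. u \<noteq> 0 \<and> (\<forall>A\<in>\<A>. \<exists>l. A u = l *\<^sub>R u)"
    proof (rule less.hyps[OF d sE])
      show "?E \<noteq> {0}" using u by blast
      show "linear B" if "B \<in> \<A>" for B using less.prems that by blast
      show "B ` ?E \<subseteq> ?E" if "B \<in> \<A>" for B
      proof clarify
        fix x assume x: "x \<in> S" "A x = l *\<^sub>R x"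
        have "A (B x) = B (A x)" using less.prems(6)[OF A(1) that x(1)] .
        also have "\<dots> = l *\<^sub>R B x" using x less.prems(3)[OF that] by (simp add: linear_scale)
        finally show "B x \<in> S \<and> A (B x) = l *\<^sub>R B x" using x less.prems(4)[OF that] by blast
      qed
    qed (use less.prems in auto)
    then show ?thesis by blast
  qed
qed

text \<open>A normalized common eigenvector is split off; self-adjointness makes its orthogonal
  complement in \<open>S\<close> invariant, so induction applies there.\<close>

lemma common_eigenbasis:
  assumes "subspace S"
    and "\<And>A. A \<in> \<A> \<Longrightarrow> linear A" "\<And>A. A \<in> \<A> \<Longrightarrow> A ` S \<subseteq> S"
    and "\<And>A x y. A \<in> \<A> \<Longrightarrow> x \<in> S \<Longrightarrow> y \<in> S \<Longrightarrow> ip (A x) y = ip x (A y)"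
    and "\<And>A B x. A \<in> \<A> \<Longrightarrow> B \<in> \<A> \<Longrightarrow> x \<in> S \<Longrightarrow> A (B x) = B (A x)"
  shows "\<exists>B. onb B S \<and> (\<forall>b\<in>B. \<forall>A\<in>\<A>. \<exists>l. A b = l *\<^sub>R b)"
  using assms
proof (induction "dim S" arbitrary: S rule: less_induct)
  case less
  show ?case
  proof (cases "S = {0}")
    case True
    then show ?thesis by (intro exI[of _ "{}"]) (auto simp: onb_def)
  next
    case False
    have "\<exists>u\<in>S. u \<noteq> 0 \<and> (\<forall>A\<in>\<A>. \<exists>l. A u = l *\<^sub>R u)"
      by (rule common_eigenvector[OF less.prems(1) False]) (fact less.prems)+
    then obtain v where v: "v \<in> S" "v \<noteq> 0" "\<forall>A\<in>\<A>. \<exists>l. A v = l *\<^sub>R v"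
      by blast
    define u where "u = v /\<^sub>R sqrt (ip v v)"
    have uu: "ip u u = 1"
      using ip_pos[OF v(2)] by (simp add: u_def ip_simps field_simps flip: real_sqrt_mult)
    have uS: "u \<in> S" using v less.prems(1) by (simp add: u_def subspace_scale)
    have ue: "\<exists>l. A u = l *\<^sub>R u" if A: "A \<in> \<A>" for A
    proof -
      obtain l where "A v = l *\<^sub>R v" using v(3) A by blast
      then have "A u = l *\<^sub>R u" using less.prems(2)[OF A] by (simp add: u_def linear_scale)
      then show ?thesis by blast
    qed
    let ?E = "{x \<in> S. ip x u = 0}"
    have sE: "subspace ?E"
      using less.prems(1) by (auto simp: subspace_def ip_simps)
    have "u \<notin> ?E" using uu by simp
    then have "?E \<subset> S" using uS by blast
    then have d: "dim ?E < dim S"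
      using sE less.prems(1) by (metis dim_psubset span_eq_iff)
    have "\<exists>B. onb B ?E \<and> (\<forall>b\<in>B. \<forall>A\<in>\<A>. \<exists>l. A b = l *\<^sub>R b)"
    proof (rule less.hyps[OF d sE])
      show "A ` ?E \<subseteq> ?E" if "A \<in> \<A>" for A
      proof clarify
        fix x assume x: "x \<in> S" "ip x u = 0"
        obtain l where l: "A u = l *\<^sub>R u" using ue[OF \<open>A \<in> \<A>\<close>] by blast
        have "ip (A x) u = ip x (A u)" using less.prems(4)[OF \<open>A \<in> \<A>\<close> x(1) uS] .
        then have "ip (A x) u = 0" using l x by (simp add: ip_simps)
        then show "A x \<in> S \<and> ip (A x) u = 0" using less.prems(3)[OF \<open>A \<in> \<A>\<close>] x by blast
      qed
    qed (use less.prems in auto)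
    then obtain B where B: "onb B ?E" "\<forall>b\<in>B. \<forall>A\<in>\<A>. \<exists>l. A b = l *\<^sub>R b" by blast
    have uB: "u \<notin> B" using B(1) uu by (auto simp: onb_def)
    have fB: "finite B" using B by (auto simp: onb_def)
    have "onb (insert u B) S"
      unfolding onb_def
    proof (intro conjI ballI)
      show "finite (insert u B)" using fB by simp
      show "insert u B \<subseteq> S" using uS B(1) by (auto simp: onb_def)
      show "ip b c = (if b = c then 1 else 0)" if "b \<in> insert u B" "c \<in> insert u B" for b c
      proof -
        have bu: "ip b u = 0" if "b \<in> B" for b using that B(1) by (auto simp: onb_def)
        have ub: "ip u b = 0" if "b \<in> B" for b using bu[OF that] ip_sym by metis
        show ?thesis
        proof (cases "b = u"; cases "c = u")
          assume "b \<noteq> u" "c \<noteq> u"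
          then have "b \<in> B" "c \<in> B" using that by auto
          then show ?thesis using B(1) unfolding onb_def by blast
        qed (use that uB uu bu ub in auto)
      qed
      show "x = (\<Sum>b\<in>insert u B. ip x b *\<^sub>R b)" if "x \<in> S" for x
      proof -
        let ?y = "x - ip x u *\<^sub>R u"
        have "?y \<in> ?E" using that uS less.prems(1) uu
          by (auto simp: ip_simps intro!: subspace_diff subspace_scale)
        then have "?y = (\<Sum>b\<in>B. ip ?y b *\<^sub>R b)" using B(1) by (auto simp: onb_def)
        also have "\<dots> = (\<Sum>b\<in>B. ip x b *\<^sub>R b)"
        proof (rule sum.cong)
          fix b assume "b \<in> B"
          then have "ip u b = 0" using B(1) ip_sym by (auto simp: onb_def)
          then show "ip ?y b *\<^sub>R b = ip x b *\<^sub>R b" by (simp add: ip_simps)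
        qed simp
        finally show ?thesis using uB fB by (simp add: algebra_simps)
      qed
    qed
    moreover have "\<forall>b\<in>insert u B. \<forall>A\<in>\<A>. \<exists>l. A b = l *\<^sub>R b" using B(2) ue by blast
    ultimately show ?thesis by blast
  qed
qed

lemma onb_exists: "subspace S \<Longrightarrow> \<exists>B. onb B S"
  using common_eigenbasis[of S "{}"] by auto

section \<open>Functional calculus of self-adjoint operators\<close>

definition eigenbasis :: "('g \<Rightarrow> 'g) \<Rightarrow> 'g set \<Rightarrow> bool" where
  "eigenbasis A B \<longleftrightarrow> onb B UNIV \<and> (\<forall>b\<in>B. A b = ip (A b) b *\<^sub>R b)"

definition self_adjoint :: "('g \<Rightarrow> 'g) \<Rightarrow> bool" where
  "self_adjoint A \<longleftrightarrow> linear A \<and> (\<forall>x y. ip (A x) y = ip x (A y))"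

lemma onb_unit: "onb B S \<Longrightarrow> b \<in> B \<Longrightarrow> ip b b = 1"
  by (auto simp: onb_def)

lemma eigenbasis_exists:
  assumes "self_adjoint A"
  shows "\<exists>B. eigenbasis A B"
proof -
  obtain B where B: "onb B UNIV" "\<forall>b\<in>B. \<forall>A'\<in>{A}. \<exists>l. A' b = l *\<^sub>R b"
    using common_eigenbasis[of UNIV "{A}"] assms by (auto simp: self_adjoint_def)
  have "A b = ip (A b) b *\<^sub>R b" if b: "b \<in> B" for b
  proof -
    obtain l where "A b = l *\<^sub>R b" using B b by blast
    then show ?thesis using onb_unit[OF B(1) b] by (simp add: ip_simps)
  qed
  then show ?thesis using B by (auto simp: eigenbasis_def)
qed

definition fun_calc :: "(real \<Rightarrow> real) \<Rightarrow> ('g \<Rightarrow> 'g) \<Rightarrow> 'g \<Rightarrow> 'g" where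
  "fun_calc f A v = (let B = (SOME B. eigenbasis A B) in \<Sum>b\<in>B. (f (ip (A b) b) * ip v b) *\<^sub>R b)"

lemma fun_calc_linear: "linear (fun_calc f A)"
  unfolding fun_calc_def Let_def
  by (rule linearI) (auto simp: ip_simps algebra_simps sum.distrib scaleR_sum_right)

text \<open>An eigenvector for \<open>l\<close> has components only along basis vectors with the
  same eigenvalue \<open>l\<close>. Hence the eigenbasis chosen by \<open>SOME\<close> in
  \<open>fun_calc\<close> does not influence the result.\<close>

lemma fun_calc_eigenvector:
  assumes A: "self_adjoint A" and u: "A u = l *\<^sub>R u"
  shows "fun_calc f A u = f l *\<^sub>R u"
proof -
  define B where "B = (SOME B. eigenbasis A B)"
  have B: "eigenbasis A B" using someI_ex[OF eigenbasis_exists[OF A]] by (simp add: B_def)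
  have "fun_calc f A u = (\<Sum>b\<in>B. (f (ip (A b) b) * ip u b) *\<^sub>R b)"
    by (simp add: fun_calc_def B_def)
  also have "\<dots> = (\<Sum>b\<in>B. (f l * ip u b) *\<^sub>R b)"
  proof (rule sum.cong)
    fix b assume b: "b \<in> B"
    have "ip (A u) b = ip u (A b)" using A by (simp add: self_adjoint_def)
    moreover have "A b = ip (A b) b *\<^sub>R b" using B b by (simp add: eigenbasis_def)
    ultimately have "ip (l *\<^sub>R u) b = ip u (ip (A b) b *\<^sub>R b)"
      using u by simp
    then have "l * ip u b = ip (A b) b * ip u b" by (simp only: ip_simps)
    then have "ip u b = 0 \<or> ip (A b) b = l" by auto
    then show "(f (ip (A b) b) * ip u b) *\<^sub>R b = (f l * ip u b) *\<^sub>R b" by auto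
  qed simp
  also have "\<dots> = f l *\<^sub>R (\<Sum>b\<in>B. ip u b *\<^sub>R b)" by (simp add: scaleR_sum_right)
  also have "(\<Sum>b\<in>B. ip u b *\<^sub>R b) = u" using onb_expand[of B u] B by (simp add: eigenbasis_def)
  finally show ?thesis .
qed

lemma linear_eq_on_onb:
  assumes "onb B UNIV" "linear f" "linear g" "\<And>b. b \<in> B \<Longrightarrow> f b = g b"
  shows "f x = g x"
proof -
  have "f (\<Sum>b\<in>B. ip x b *\<^sub>R b) = g (\<Sum>b\<in>B. ip x b *\<^sub>R b)"
    by (simp add: linear_sum[OF assms(2)] linear_sum[OF assms(3)] linear_scale[OF assms(2)]
       linear_scale[OF assms(3)] assms(4))
  then show ?thesis by (simp only: onb_expand[OF assms(1)])
qed

lemma fun_calc_onb: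
  assumes "self_adjoint A" "onb B UNIV" "\<And>b. b \<in> B \<Longrightarrow> A b = l b *\<^sub>R b"
  shows "fun_calc f A v = (\<Sum>b\<in>B. (f (l b) * ip v b) *\<^sub>R b)"
proof -
  have "fun_calc f A v = fun_calc f A (\<Sum>b\<in>B. ip v b *\<^sub>R b)"
    by (simp only: onb_expand[OF assms(2)])
  also have "\<dots> = (\<Sum>b\<in>B. ip v b *\<^sub>R fun_calc f A b)"
    by (simp add: linear_sum[OF fun_calc_linear] linear_scale[OF fun_calc_linear])
  also have "\<dots> = (\<Sum>b\<in>B. (f (l b) * ip v b) *\<^sub>R b)"
    using fun_calc_eigenvector[OF assms(1) assms(3)] by (intro sum.cong) (auto simp: mult.commute)
  finally show ?thesis .
qed

lemma onb_ip_sum: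
  assumes "onb B UNIV"
  shows "ip x y = (\<Sum>b\<in>B. ip x b * ip y b)"
proof -
  have "ip x y = ip (\<Sum>b\<in>B. ip x b *\<^sub>R b) y" by (simp only: onb_expand[OF assms])
  also have "\<dots> = (\<Sum>b\<in>B. ip x b * ip b y)" by (simp add: ip_sum_left)
  finally show ?thesis by (simp add: ip_sym[of _ y])
qed

lemma onb_coeff:
  assumes "onb B S" "b \<in> B"
  shows "ip (\<Sum>c\<in>B. f c *\<^sub>R c) b = f b"
proof -
  have "ip (\<Sum>c\<in>B. f c *\<^sub>R c) b = (\<Sum>c\<in>B. f c * ip c b)" by (simp add: ip_sum_left ip_simps)
  also have "\<dots> = (\<Sum>c\<in>B. if c = b then f c else 0)"
    using assms by (intro sum.cong) (auto simp: onb_def)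
  also have "\<dots> = f b" using assms by (simp add: onb_def)
  finally show ?thesis .
qed

end

section \<open>Closure properties of maps of class C^k\<close>

lemma times_differentiable_on_zero: "times_differentiable_on k U (\<lambda>x. 0)"
  by (induction k) (auto intro!: exI[of _ "\<lambda>x h. 0"])

lemma times_differentiable_on_add:
  "times_differentiable_on k U f \<Longrightarrow> times_differentiable_on k U g \<Longrightarrow>
    times_differentiable_on k U (\<lambda>x. f x + g x)"
proof (induction k arbitrary: f g)
  case 0
  then show ?case by (simp add: continuous_on_add)
next
  case (Suc k)
  obtain f' g' where "\<forall>x\<in>U. (f has_derivative f' x) (at x)" "\<forall>v. times_differentiable_on k U (\<lambda>x. f' x v)"
    "\<forall>x\<in>U. (g has_derivative g' x) (at x)" "\<forall>v. times_differentiable_on k U (\<lambda>x. g' x v)"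
    using Suc.prems by auto
  then show ?case
    using Suc.IH by (auto intro!: exI[of _ "\<lambda>x v. f' x v + g' x v"] has_derivative_add)
qed

lemma times_differentiable_on_cong:
  assumes U: "open U" and eq: "\<And>x. x \<in> U \<Longrightarrow> f x = g x" and f: "times_differentiable_on k U f"
  shows "times_differentiable_on k U g"
proof (cases k)
  case 0
  then show ?thesis using f continuous_on_cong[OF refl eq, of U] by simp
next
  case (Suc i)
  then obtain f' where f': "\<forall>x\<in>U. (f has_derivative f' x) (at x)" "\<forall>v. times_differentiable_on i U (\<lambda>x. f' x v)"
    using f by auto
  have "(g has_derivative f' x) (at x)" if "x \<in> U" for x
    using f'(1) that by (intro has_derivative_transform_within_open[OF _ U that eq]) auto
  then show ?thesis using Suc f' by auto
qed

lemma times_differentiable_on_sum_list: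
  "(\<And>l. l \<in> set L \<Longrightarrow> times_differentiable_on k U (f l)) \<Longrightarrow>
    times_differentiable_on k U (\<lambda>x. \<Sum>l\<leftarrow>L. f l x)"
  by (induction L) (auto simp: times_differentiable_on_zero intro!: times_differentiable_on_add)

section \<open>Polynomials and divided differences\<close>

text \<open>Leibniz's rule stops after two terms because the derivative of \<open>L\<close> is
  constant.\<close>

lemma higher_pderiv_mult_left:
  fixes L q :: "real poly"
  assumes "pderiv L = 1"
  shows "(pderiv ^^ Suc n) (L * q) = L * (pderiv ^^ Suc n) q + smult (of_nat (Suc n)) ((pderiv ^^ n) q)"
proof (induction n)
  case (Suc n)
  have "smult (c + 2) r = r + smult (1 + c) r" for c :: real and r
    using smult_add_left[of 1 "1 + c" r] by (simp add: add_ac)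
  then show ?case
    using Suc by (simp add: assms pderiv_mult pderiv_add pderiv_smult add_ac)
qed (simp add: assms pderiv_mult)

text \<open>The quotient q in p(t) = (t - y) q(t) + p(y) is a divided difference. Its derivative of
  order j at t equals 1/(j+1) times the derivative of order j+1 of p at some point of [-R, R]. So
  dividing costs one derivative and no constant.\<close>

lemma synthetic_div_deriv_bound:
  fixes p :: "real poly"
  assumes y: "\<bar>y\<bar> \<le> R" and t: "\<bar>t\<bar> \<le> R"
    and M: "\<And>t. \<bar>t\<bar> \<le> R \<Longrightarrow> \<bar>poly ((pderiv ^^ Suc j) p) t\<bar> \<le> M"
  shows "\<bar>poly ((pderiv ^^ j) (synthetic_div p y)) t\<bar> \<le> M"
proof -
  define q where "q = synthetic_div p y"
  have "p = [:- y, 1:] * q + [:poly p y:]"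
    using synthetic_div_correct'[of y p] by (simp add: q_def)
  then have "(pderiv ^^ Suc j) p = (pderiv ^^ j) (pderiv ([:- y, 1:] * q + [:poly p y:]))"
    by (metis funpow_Suc_right o_apply)
  also have "\<dots> = (pderiv ^^ Suc j) ([:- y, 1:] * q)"
    by (simp only: pderiv_add pderiv_pCons funpow_Suc_right o_apply) simp
  finally have pq: "(pderiv ^^ Suc j) p =
      [:- y, 1:] * (pderiv ^^ Suc j) q + smult (of_nat (Suc j)) ((pderiv ^^ j) q)"
    using higher_pderiv_mult_left[of "[:- y, 1:]" j q]
    by (simp add: pderiv_pCons del: funpow.simps mult_pCons_left)
  define g where "g = (pderiv ^^ j) q"
  have pq': "poly ((pderiv ^^ Suc j) p) s = (s - y) * poly (pderiv g) s + (1 + real j) * poly g s" for s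
    by (simp only: pq) (simp add: g_def algebra_simps)
  have *: "\<exists>s. \<bar>s\<bar> \<le> R \<and> poly ((pderiv ^^ Suc j) p) s = (1 + real j) * poly g t"
  proof (cases "t = y")
    case True
    then show ?thesis using pq' y by auto
  next
    case False
    \<comment> \<open>Cauchy's mean value theorem is applied to \<open>G\<close> and
      \<open>H\<close>, which both vanish at \<open>y\<close>. By \<open>pq'\<close> the derivative
      of \<open>G\<close> is \<open>(s - y) ^ j\<close> times the derivative of order
      \<open>Suc j\<close> of \<open>p\<close>.\<close>
    define G where "G s = (s - y) ^ Suc j * poly g s" for s
    define H where "H s = (s - y) ^ Suc j" for s
    have dH: "(H has_real_derivative (1 + real j) * (s - y) ^ j) (at s)" for s
    proof -
      have "((\<lambda>s. s - y) has_real_derivative 1) (at s)" by (auto intro!: derivative_eq_intros)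
      from DERIV_power_Suc[OF this, of j] show ?thesis
        unfolding H_def[abs_def] by (simp only: mult_1)
    qed
    have dG: "(G has_real_derivative (s - y) ^ j * poly ((pderiv ^^ Suc j) p) s) (at s)" for s
    proof -
      have "(G has_real_derivative (s - y) ^ Suc j * poly (pderiv g) s + ((1 + real j) * (s - y) ^ j) * poly g s) (at s)"
        unfolding G_def[abs_def] by (rule DERIV_mult'[OF dH[unfolded H_def[abs_def]] poly_DERIV])
      then show ?thesis unfolding pq' by (simp add: algebra_simps)
    qed
    define u v where "u = min t y" and "v = max t y"
    have uv: "u < v" using False by (auto simp: u_def v_def)
    obtain s where s: "u < s" "s < v"
      "(G v - G u) * ((1 + real j) * (s - y) ^ j) = (H v - H u) * ((s - y) ^ j * poly ((pderiv ^^ Suc j) p) s)"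
      using GMVT'[OF uv, of G H "\<lambda>s. (1 + real j) * (s - y) ^ j"
          "\<lambda>s. (s - y) ^ j * poly ((pderiv ^^ Suc j) p) s"] dG dH DERIV_isCont by blast
    have "s \<noteq> y" using s(1,2) by (auto simp: u_def v_def)
    then have nz: "(s - y) ^ j \<noteq> 0" by simp
    have "(s - y) ^ j * ((G v - G u) * (1 + real j)) = (s - y) ^ j * ((H v - H u) * poly ((pderiv ^^ Suc j) p) s)"
      using s(3) by (simp only: mult_ac)
    then have "(G v - G u) * (1 + real j) = (H v - H u) * poly ((pderiv ^^ Suc j) p) s"
      using nz mult_left_cancel by blast
    moreover have "G v - G u = (G t - G y) \<and> H v - H u = H t - H y \<or>
        G v - G u = - (G t - G y) \<and> H v - H u = - (H t - H y)"
      by (auto simp: u_def v_def min_def max_def)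
    ultimately have "(G t - G y) * (1 + real j) = (H t - H y) * poly ((pderiv ^^ Suc j) p) s"
      by (elim disjE conjE) (simp_all only: mult_minus_left neg_equal_iff_equal)
    then have "(t - y) ^ Suc j * ((1 + real j) * poly g t) = (t - y) ^ Suc j * poly ((pderiv ^^ Suc j) p) s"
      by (simp add: G_def H_def algebra_simps)
    then have "(1 + real j) * poly g t = poly ((pderiv ^^ Suc j) p) s"
      using False by (metis mult_cancel_left power_not_zero right_minus_eq)
    moreover have "\<bar>s\<bar> \<le> R" using s(1,2) y t by (auto simp: u_def v_def)
    ultimately show ?thesis by auto
  qed
  then obtain s where s: "\<bar>s\<bar> \<le> R" "poly ((pderiv ^^ Suc j) p) s = (1 + real j) * poly g t" by blast
  have "\<bar>poly g t\<bar> \<le> (1 + real j) * \<bar>poly g t\<bar>" by (simp add: algebra_simps)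
  also have "\<dots> = \<bar>poly ((pderiv ^^ Suc j) p) s\<bar>" unfolding s(2) abs_mult by simp
  also have "\<dots> \<le> M" using M s(1) by blast
  finally show ?thesis by (simp add: g_def q_def)
qed

lemma poly_antiderivative:
  fixes q :: "real poly"
  shows "\<exists>p. pderiv p = q \<and> poly p 0 = c"
proof -
  define p where "p = (\<Sum>n\<le>degree q. monom (coeff q n / (1 + real n)) (Suc n)) + [:c:]"
  have pd_sum: "pderiv (\<Sum>n\<in>I. f n) = (\<Sum>n\<in>I. pderiv (f n))" for f :: "nat \<Rightarrow> real poly" and I
    by (induction I rule: infinite_finite_induct) (auto simp: pderiv_add)
  have "pderiv p = (\<Sum>n\<le>degree q. monom (coeff q n) n)"
    by (simp add: p_def pderiv_add pd_sum pderiv_monom pderiv_pCons)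
  also have "\<dots> = q" by (rule poly_as_sum_of_monoms)
  finally have "pderiv p = q" .
  moreover have "poly p 0 = c" by (simp add: p_def poly_sum poly_monom)
  ultimately show ?thesis by blast
qed

text \<open>Weierstrass approximates the highest derivative. Antiderivatives that agree with
  \<open>D\<close> at 0 then approximate the lower ones, each integration multiplying the error by
  at most \<open>R\<close>.\<close>

lemma smooth_polynomial_approximation:
  fixes D :: "nat \<Rightarrow> real \<Rightarrow> real"
  assumes R: "R > 0" and e: "e > 0"
    and D: "\<And>j t. j < k \<Longrightarrow> \<bar>t\<bar> \<le> R \<Longrightarrow> (D j has_real_derivative D (Suc j) t) (at t)"
    and c: "continuous_on {-R..R} (D k)"
  shows "\<exists>p. \<forall>j\<le>k. \<forall>t. \<bar>t\<bar> \<le> R \<longrightarrow> \<bar>poly ((pderiv ^^ j) p) t - D j t\<bar> \<le> e"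
  using e D c
proof (induction k arbitrary: D e)
  case 0
  obtain g where g: "real_polynomial_function g" "\<And>t. t \<in> {-R..R} \<Longrightarrow> \<bar>D 0 t - g t\<bar> < e"
    using Stone_Weierstrass_real_polynomial_function[of "{-R..R}" "D 0" e] 0 by auto
  obtain a n where an: "g = (\<lambda>x. \<Sum>i\<le>n. a i * x ^ i)"
    using g(1) real_polynomial_function_iff_sum by blast
  define p where "p = (\<Sum>i\<le>n. monom (a i) i)"
  have "poly p t = g t" for t by (simp add: p_def an poly_sum poly_monom)
  then have "\<bar>t\<bar> \<le> R \<Longrightarrow> \<bar>poly p t - D 0 t\<bar> \<le> e" for t using g(2)[of t] by (auto simp: abs_le_iff)
  then show ?case by (intro exI[of _ p]) auto
next
  case (Suc k)
  \<comment> \<open>The bound \<open>e\<close> is kept for the derivatives already approximated;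
    \<open>e / R\<close> pays for one integration over a length of at most \<open>R\<close>.\<close>
  define e' where "e' = min e (e / R)"
  have e': "e' > 0" "e' \<le> e" "e' * R \<le> e"
  proof -
    show "e' > 0" "e' \<le> e" using Suc.prems(1) R by (auto simp: e'_def)
    have "e' \<le> e / R" by (simp add: e'_def)
    then show "e' * R \<le> e" using R by (simp add: field_simps)
  qed
  obtain q where q: "\<forall>j\<le>k. \<forall>t. \<bar>t\<bar> \<le> R \<longrightarrow> \<bar>poly ((pderiv ^^ j) q) t - D (Suc j) t\<bar> \<le> e'"
    using Suc.IH[of e' "\<lambda>j. D (Suc j)"] e'(1) Suc.prems by auto
  obtain p where p: "pderiv p = q" "poly p 0 = D 0 0" using poly_antiderivative by blast
  have "\<bar>poly ((pderiv ^^ j) p) t - D j t\<bar> \<le> e" if j: "j \<le> Suc k" and t: "\<bar>t\<bar> \<le> R" for j t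
  proof (cases j)
    case (Suc i)
    then have "(pderiv ^^ j) p = (pderiv ^^ i) q" by (simp only: funpow_Suc_right o_apply p)
    then show ?thesis using q[rule_format, of i t] Suc j t e'(2) by simp
  next
    case 0
    define F where "F s = poly p s - D 0 s" for s
    have d: "(F has_derivative (\<lambda>h. h * (poly q s - D (Suc 0) s))) (at s within {-R..R})" if "s \<in> {-R..R}" for s
    proof -
      have "\<bar>s\<bar> \<le> R" using that by auto
      then have "(D 0 has_real_derivative D (Suc 0) s) (at s)" by (rule Suc.prems(2)[OF zero_less_Suc])
      then have "(F has_real_derivative (poly q s - D (Suc 0) s)) (at s)"
        unfolding F_def[abs_def] using DERIV_diff[OF poly_DERIV[of p s]] p(1) by metis
      then have "(F has_derivative (*) (poly q s - D (Suc 0) s)) (at s)"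
        by (simp only: has_field_derivative_def)
      moreover have "(*) (poly q s - D (Suc 0) s) = (\<lambda>h. h * (poly q s - D (Suc 0) s))"
        by (rule ext) (rule mult.commute)
      ultimately show ?thesis
        by (metis has_derivative_at_withinI)
    qed
    have "norm (F t - F 0) \<le> e' * norm (t - 0)"
    proof (rule differentiable_bound[where S="{-R..R}" and f'="\<lambda>s h. h * (poly q s - D (Suc 0) s)"])
      fix s assume s: "s \<in> {-R..R}"
      show "onorm (\<lambda>h. h * (poly q s - D (Suc 0) s)) \<le> e'"
      proof (rule onorm_bound)
        fix h :: real
        have "\<bar>poly q s - D (Suc 0) s\<bar> \<le> e'" using q[rule_format, of 0 s] s by (simp add: abs_le_iff)
        then have "\<bar>h\<bar> * \<bar>poly q s - D (Suc 0) s\<bar> \<le> \<bar>h\<bar> * e'" by (rule mult_left_mono) simp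
        then show "norm (h * (poly q s - D (Suc 0) s)) \<le> e' * norm h"
          by (simp add: abs_mult mult.commute)
      qed (use e' in simp)
    qed (use d t R in \<open>auto simp: abs_le_iff\<close>)
    also have "\<dots> \<le> e' * R" using t e'(1) by simp
    also have "\<dots> \<le> e" by (rule e')
    finally have "\<bar>F t - F 0\<bar> \<le> e" by simp
    moreover have "F 0 = 0" by (simp add: F_def p)
    ultimately show ?thesis using 0 by (simp add: F_def)
  qed
  then show ?case by blast
qed

section \<open>Smoothness of the functional calculus\<close>

text \<open>\<open>word A x n hs v\<close> is the sum of all products of \<open>n\<close> operators applied to \<open>v\<close>, where \<open>A h\<close> for \<open>h\<close>
  in \<open>hs\<close> occur in this order and the remaining factors are \<open>A x\<close>.  Up to permutations of \<open>hs\<close> these are the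
  terms of the iterated derivatives of \<open>x \<mapsto> A x\<^sup>n v\<close>.\<close>

fun word :: "('a \<Rightarrow> 'g \<Rightarrow> 'g) \<Rightarrow> 'a \<Rightarrow> nat \<Rightarrow> 'a list \<Rightarrow> 'g \<Rightarrow> 'g::euclidean_space" where
  "word A x 0 [] v = v"
| "word A x 0 (h # hs) v = 0"
| "word A x (Suc n) [] v = A x (word A x n [] v)"
| "word A x (Suc n) (h # hs) v = A x (word A x n (h # hs) v) + A h (word A x n hs v)"

text \<open>Differentiating \<open>word\<close> in direction \<open>k\<close> replaces one factor
  \<open>A x\<close> by \<open>A k\<close>, which may stand anywhere relative to the directions
  already present. The insertions enumerate these places.\<close>

fun inserts :: "'a \<Rightarrow> 'a list \<Rightarrow> 'a list list" where
  "inserts k [] = [[k]]"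
| "inserts k (h # hs) = (k # h # hs) # map ((#) h) (inserts k hs)"

lemma length_inserts: "l \<in> set (inserts k hs) \<Longrightarrow> length l = Suc (length hs)"
  by (induction hs arbitrary: l) auto

lemma prod_norm_inserts:
  "l \<in> set (inserts k hs) \<Longrightarrow> prod_list (map norm l) = norm k * prod_list (map norm hs)"
  for hs :: "'a::real_normed_vector list"
  by (induction hs arbitrary: l) (auto simp: mult_ac)

lemma length_inserts_list: "length (inserts k hs) = Suc (length hs)"
  by (induction hs) auto

lemma word_0_inserts: "(\<Sum>l\<leftarrow>inserts k hs. word A x 0 l v) = 0"
proof -
  have "word A x 0 l v = 0" if "l \<in> set (inserts k hs)" for l
    using length_inserts[OF that] by (cases l) auto
  then have "map (\<lambda>l. word A x 0 l v) (inserts k hs) = map (\<lambda>l. 0) (inserts k hs)" by (rule map_cong[OF refl])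
  then show ?thesis by (metis sum_list_0)
qed

lemma sum_list_word_Cons:
  assumes "bounded_bilinear A"
  shows "(\<Sum>l\<leftarrow>L. word A x (Suc n) (h # l) v) =
    A x (\<Sum>l\<leftarrow>L. word A x n (h # l) v) + A h (\<Sum>l\<leftarrow>L. word A x n l v)"
  by (induction L)
     (auto simp: bounded_bilinear.zero_right[OF assms] bounded_bilinear.add_right[OF assms])

lemma word_has_derivative:
  assumes A: "bounded_bilinear A"
  shows "((\<lambda>x. word A x n hs v) has_derivative (\<lambda>k. \<Sum>l\<leftarrow>inserts k hs. word A x n l v)) (at x)"
proof (induction n arbitrary: hs)
  case 0
  show ?case unfolding word_0_inserts by (cases hs) auto
next
  case (Suc n)
  note FD = bounded_bilinear.FDERIV[OF A, where s=UNIV]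
  show ?case
  proof (cases hs)
    case Nil
    have "((\<lambda>x. A x (word A x n [] v)) has_derivative
        (\<lambda>k. A x (\<Sum>l\<leftarrow>inserts k []. word A x n l v) + A k (word A x n [] v))) (at x)"
      by (rule FD[OF has_derivative_ident Suc])
    then show ?thesis using Nil by simp
  next
    case (Cons h hs')
    have "((\<lambda>x. A x (word A x n hs v) + A h (word A x n hs' v)) has_derivative
        (\<lambda>k. (A x (\<Sum>l\<leftarrow>inserts k hs. word A x n l v) + A k (word A x n hs v)) +
             A h (\<Sum>l\<leftarrow>inserts k hs'. word A x n l v))) (at x)"
      by (intro has_derivative_add FD has_derivative_ident Suc
          bounded_linear.has_derivative[OF bounded_bilinear.bounded_linear_right[OF A]])
    moreover have "(A x (\<Sum>l\<leftarrow>inserts k hs. word A x n l v) + A k (word A x n hs v)) +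
             A h (\<Sum>l\<leftarrow>inserts k hs'. word A x n l v) =
        (\<Sum>l\<leftarrow>inserts k hs. word A x (Suc n) l v)" for k
    proof -
      have "(\<Sum>l\<leftarrow>inserts k hs. word A x (Suc n) l v) = word A x (Suc n) (k # hs) v +
          (\<Sum>l\<leftarrow>inserts k hs'. word A x (Suc n) (h # l) v)"
        by (simp add: Cons comp_def del: word.simps)
      also have "\<dots> = (A x (word A x n (k # hs) v) + A k (word A x n hs v)) +
          (A x (\<Sum>l\<leftarrow>inserts k hs'. word A x n (h # l) v) + A h (\<Sum>l\<leftarrow>inserts k hs'. word A x n l v))"
        by (simp only: sum_list_word_Cons[OF A] word.simps(4)[of A x n k hs v])
      finally show ?thesis by (simp add: Cons comp_def bounded_bilinear.add_right[OF A] del: word.simps)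
    qed
    ultimately have "((\<lambda>x. A x (word A x n hs v) + A h (word A x n hs' v)) has_derivative
        (\<lambda>k. \<Sum>l\<leftarrow>inserts k hs. word A x (Suc n) l v)) (at x)" by (simp only:)
    then show ?thesis by (simp only: Cons word.simps)
  qed
qed

text \<open>The terms of the iterated derivatives of p(A x) v; the empty list gives p(A x) v
  itself.\<close>

definition pword :: "('a \<Rightarrow> 'g \<Rightarrow> 'g) \<Rightarrow> 'a \<Rightarrow> real poly \<Rightarrow> 'a list \<Rightarrow> 'g \<Rightarrow> 'g::euclidean_space" where
  "pword A x p hs v = (\<Sum>n\<le>degree p. coeff p n *\<^sub>R word A x n hs v)"

lemma pword_altdef:
  assumes "degree p \<le> m"
  shows "pword A x p hs v = (\<Sum>n\<le>m. coeff p n *\<^sub>R word A x n hs v)"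
  unfolding pword_def using assms
  by (intro sum.mono_neutral_left) (auto simp: not_le coeff_eq_0)

lemma pword_0 [simp]: "pword A x 0 hs v = 0"
  by (simp add: pword_def)

lemma pword_add: "pword A x (p + q) hs v = pword A x p hs v + pword A x q hs v"
proof -
  let ?m = "max (degree p) (degree q)"
  show ?thesis
    by (simp add: pword_altdef[of _ ?m] degree_add_le scaleR_add_left sum.distrib)
qed

lemma pword_smult: "pword A x (smult c p) hs v = c *\<^sub>R pword A x p hs v"
  by (simp add: pword_altdef[of _ "degree p"] scaleR_sum_right)

lemma pword_diff: "pword A x (p - q) hs v = pword A x p hs v - pword A x q hs v"
  using pword_add[of A x p "smult (-1) q" hs v] pword_smult[of A x "-1" q hs v] by simp

lemma pword_pCons_Nil:
  assumes A: "bounded_bilinear A"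
  shows "pword A x (pCons a q) [] v = a *\<^sub>R v + A x (pword A x q [] v)"
proof -
  have "pword A x (pCons a q) [] v = (\<Sum>n\<le>Suc (degree q). coeff (pCons a q) n *\<^sub>R word A x n [] v)"
    by (rule pword_altdef) (simp add: degree_pCons_le)
  also have "\<dots> = a *\<^sub>R v + (\<Sum>n\<le>degree q. coeff q n *\<^sub>R A x (word A x n [] v))"
    by (simp only: sum.atMost_Suc_shift) simp
  finally show ?thesis
    by (simp add: pword_def bounded_bilinear.sum_right[OF A] bounded_bilinear.scaleR_right[OF A])
qed

lemma pword_pCons_Cons:
  assumes A: "bounded_bilinear A"
  shows "pword A x (pCons a q) (h # hs) v = A x (pword A x q (h # hs) v) + A h (pword A x q hs v)"
proof -
  have "pword A x (pCons a q) (h # hs) v = (\<Sum>n\<le>Suc (degree q). coeff (pCons a q) n *\<^sub>R word A x n (h # hs) v)"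
    by (rule pword_altdef) (simp add: degree_pCons_le)
  also have "\<dots> = (\<Sum>n\<le>degree q. coeff q n *\<^sub>R (A x (word A x n (h # hs) v) + A h (word A x n hs v)))"
    by (simp only: sum.atMost_Suc_shift) simp
  finally show ?thesis
    by (simp add: pword_def bounded_bilinear.sum_right[OF A] bounded_bilinear.scaleR_right[OF A]
        scaleR_add_right sum.distrib)
qed

lemma pword_has_derivative:
  assumes A: "bounded_bilinear A"
  shows "((\<lambda>x. pword A x p hs v) has_derivative (\<lambda>k. \<Sum>l\<leftarrow>inserts k hs. pword A x p l v)) (at x)"
proof -
  have "((\<lambda>x. pword A x p hs v) has_derivative
      (\<lambda>k. \<Sum>n\<le>degree p. coeff p n *\<^sub>R (\<Sum>l\<leftarrow>inserts k hs. word A x n l v))) (at x)"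
    unfolding pword_def by (intro has_derivative_sum has_derivative_scaleR_right word_has_derivative A)
  moreover have "(\<Sum>n\<le>degree p. coeff p n *\<^sub>R (\<Sum>l\<leftarrow>L. word A x n l v)) = (\<Sum>l\<leftarrow>L. pword A x p l v)" for L
    by (induction L) (auto simp: pword_def scaleR_add_right sum.distrib)
  ultimately show ?thesis by simp
qed

context inner_form
begin

lemma pword_Nil_eigen:
  assumes A: "bounded_bilinear A" and sa: "self_adjoint (A x)" and b: "A x b = l *\<^sub>R b"
  shows "ip (pword A x p [] v) b = poly p l * ip v b"
proof (induction p)
  case (pCons a q)
  have "ip (A x (pword A x q [] v)) b = l * ip (pword A x q [] v) b"
    using sa b by (simp add: self_adjoint_def)
  then show ?case by (simp add: pword_pCons_Nil[OF A] ip_simps pCons.IH algebra_simps)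
qed (simp add: ip_simps)

text \<open>The powers of \<open>A x\<close> to the left of the first direction \<open>h\<close> act
  on \<open>b\<close> as powers of \<open>l\<close>. Collecting them turns \<open>p\<close> into the
  divided difference (p(t) - p(l)) / (t - l) for the remaining word.\<close>

lemma pword_Cons_eigen:
  assumes A: "bounded_bilinear A" and sa: "self_adjoint (A x)" and b: "A x b = l *\<^sub>R b"
  shows "ip (pword A x p (h # hs) v) b = ip (A h (pword A x (synthetic_div p l) hs v)) b"
proof (induction p)
  case (pCons a q)
  have "ip (pword A x (pCons a q) (h # hs) v) b =
      l * ip (pword A x q (h # hs) v) b + ip (A h (pword A x q hs v)) b"
    using sa b by (simp add: pword_pCons_Cons[OF A] ip_simps self_adjoint_def)
  also have "\<dots> = ip (A h (pword A x (q + smult l (synthetic_div q l)) hs v)) b"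
    by (simp add: pCons.IH pword_add pword_smult ip_simps bounded_bilinear.add_right[OF A]
        bounded_bilinear.scaleR_right[OF A])
  also have "q + smult l (synthetic_div q l) = synthetic_div (pCons a q) l"
    by (simp add: synthetic_div_correct synthetic_div_pCons)
  finally show ?case .
qed (simp add: ip_simps bounded_bilinear.zero_right[OF A])

lemma fun_calc_poly:
  assumes A: "bounded_bilinear A" and sa: "self_adjoint (A x)"
  shows "fun_calc (poly p) (A x) v = pword A x p [] v"
proof -
  obtain B where B: "eigenbasis (A x) B" using eigenbasis_exists[OF sa] by blast
  then have o: "onb B UNIV" by (simp add: eigenbasis_def)
  have e: "b \<in> B \<Longrightarrow> A x b = ip (A x b) b *\<^sub>R b" for b using B by (simp add: eigenbasis_def)
  have "fun_calc (poly p) (A x) v = (\<Sum>b\<in>B. (poly p (ip (A x b) b) * ip v b) *\<^sub>R b)"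
    by (rule fun_calc_onb[OF sa o e])
  also have "\<dots> = (\<Sum>b\<in>B. ip (pword A x p [] v) b *\<^sub>R b)"
    by (intro sum.cong) (use pword_Nil_eigen[OF A sa e] in auto)
  finally show ?thesis by (simp only: onb_expand[OF o])
qed

lemma onb_card_le:
  fixes B :: "'g set"
  assumes "onb B UNIV"
  shows "card B \<le> DIM('g)"
proof -
  have "independent B"
    unfolding dependent_def
  proof clarify
    fix b assume b: "b \<in> B" "b \<in> span (B - {b})"
    have "span (B - {b}) \<subseteq> {x. ip x b = 0}"
      by (rule span_minimal) (use assms b(1) in \<open>auto simp: onb_def subspace_def ip_simps\<close>)
    then have "ip b b = 0" using b(2) by blast
    then show False using onb_unit[OF assms b(1)] by simp
  qed
  then show ?thesis using independent_bound by blast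
qed

definition spectrum_bound :: "('g \<Rightarrow> 'g) \<Rightarrow> real \<Rightarrow> bool" where
  "spectrum_bound A R \<longleftrightarrow> (\<forall>u l. u \<noteq> 0 \<longrightarrow> A u = l *\<^sub>R u \<longrightarrow> \<bar>l\<bar> \<le> R)"

text \<open>One constant must serve all orthonormal bases at once, because the eigenbasis of
  \<open>A x\<close> varies with \<open>x\<close> in no controlled way.\<close>

lemma onb_norm_bound:
  obtains C where "C \<ge> 1" "\<And>B b. onb B UNIV \<Longrightarrow> b \<in> B \<Longrightarrow> norm b \<le> C"
    "\<And>B b v. onb B UNIV \<Longrightarrow> b \<in> B \<Longrightarrow> \<bar>ip v b\<bar> \<le> C * norm v"
    "\<And>B w c. onb B UNIV \<Longrightarrow> (\<And>b. b \<in> B \<Longrightarrow> \<bar>ip w b\<bar> \<le> c) \<Longrightarrow> c \<ge> 0 \<Longrightarrow> norm w \<le> C * c"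
proof -
  obtain C0 where C0: "C0 > 0" "\<And>x. norm x ^ 2 \<le> C0 * ip x x" using ip_norm_bound by blast
  define C1 where "C1 = sqrt C0"
  have C1: "C1 > 0" "onb B UNIV \<Longrightarrow> b \<in> B \<Longrightarrow> norm b \<le> C1" for B b
    using C0(1) C0(2)[of b] onb_unit[of B UNIV b] by (auto simp: C1_def intro: real_le_rsqrt)
  obtain K where K: "K > 0" "\<And>x y. norm (ip x y) \<le> norm x * norm y * K"
    using bounded_bilinear.pos_bounded[OF ip_bounded] by blast
  define C where "C = Max {1, C1, K * C1, real DIM('g) * C1}"
  have C: "C \<ge> 1" "C \<ge> C1" "C \<ge> K * C1" "C \<ge> real DIM('g) * C1" by (auto simp: C_def)
  show ?thesis
  proof (rule that[of C])
    show "norm b \<le> C" if "onb B UNIV" "b \<in> B" for B b using C1(2)[OF that] C(2) by simp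
    show "\<bar>ip v b\<bar> \<le> C * norm v" if "onb B UNIV" "b \<in> B" for B b v
    proof -
      have "\<bar>ip v b\<bar> \<le> norm v * norm b * K" using K(2)[of v b] by simp
      also have "\<dots> \<le> norm v * C1 * K"
        using C1(2)[OF that] K(1) by (intro mult_right_mono mult_left_mono) auto
      also have "\<dots> = (K * C1) * norm v" by simp
      also have "\<dots> \<le> C * norm v" by (intro mult_right_mono C) auto
      finally show ?thesis .
    qed
    show "norm w \<le> C * c" if B: "onb B UNIV" and c: "\<And>b. b \<in> B \<Longrightarrow> \<bar>ip w b\<bar> \<le> c" "c \<ge> 0" for B w c
    proof -
      have "norm w = norm (\<Sum>b\<in>B. ip w b *\<^sub>R b)" by (simp only: onb_expand[OF B])
      also have "\<dots> \<le> (\<Sum>b\<in>B. norm (ip w b *\<^sub>R b))" by (rule norm_sum)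
      also have "\<dots> \<le> (\<Sum>b\<in>B. c * C1)"
        unfolding norm_scaleR using c C1(2)[OF B] by (intro sum_mono mult_mono) auto
      also have "\<dots> = real (card B) * (C1 * c)" by simp
      also have "\<dots> \<le> real DIM('g) * (C1 * c)"
        using onb_card_le[OF B] C1(1) c(2) by (intro mult_right_mono) auto
      also have "\<dots> = (real DIM('g) * C1) * c" by simp
      also have "\<dots> \<le> C * c" by (intro mult_right_mono C c)
      finally show ?thesis .
    qed
  qed (rule C)
qed

text \<open>Induction on the directions: \<open>pword_Cons_eigen\<close> trades one direction for
  one divided difference, and \<open>synthetic_div_deriv_bound\<close> charges one derivative for
  it. The constant depends neither on \<open>x\<close> nor on \<open>p\<close>, so it survives
  passage to the limit over polynomials.\<close>

lemma pword_bound: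
  assumes A: "bounded_bilinear A"
  shows "\<exists>K\<ge>0. \<forall>hs x R p v M. self_adjoint (A x) \<longrightarrow> spectrum_bound (A x) R \<longrightarrow>
    (\<forall>t. \<bar>t\<bar> \<le> R \<longrightarrow> \<bar>poly ((pderiv ^^ length hs) p) t\<bar> \<le> M) \<longrightarrow> M \<ge> 0 \<longrightarrow>
    norm (pword A x p hs v) \<le> K ^ Suc (length hs) * prod_list (map norm hs) * M * norm v"
proof -
  obtain C where C: "C \<ge> 1" "\<And>B b. onb B UNIV \<Longrightarrow> b \<in> B \<Longrightarrow> norm b \<le> C"
    "\<And>B b v. onb B UNIV \<Longrightarrow> b \<in> B \<Longrightarrow> \<bar>ip v b\<bar> \<le> C * norm v"
    "\<And>B w c. onb B UNIV \<Longrightarrow> (\<And>b. b \<in> B \<Longrightarrow> \<bar>ip w b\<bar> \<le> c) \<Longrightarrow> c \<ge> 0 \<Longrightarrow> norm w \<le> C * c"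
    using onb_norm_bound by blast
  obtain L where L: "L > 0" "\<And>x y. norm (A x y) \<le> norm x * norm y * L"
    using bounded_bilinear.pos_bounded[OF A] by blast
  \<comment> \<open>The factor \<open>C * C\<close> suffices for the empty word, and
    \<open>C * C * L\<close> for one more direction.\<close>
  define K where "K = C * C * (1 + L)"
  have K0: "K \<ge> 0" and KC: "C * C \<le> K" "C * C * L \<le> K"
    using C(1) L(1) by (auto simp: K_def algebra_simps)
  have "norm (pword A x p hs v) \<le> K ^ Suc (length hs) * prod_list (map norm hs) * M * norm v"
    if sa: "self_adjoint (A x)" and sb: "spectrum_bound (A x) R"
      and M: "\<And>t. \<bar>t\<bar> \<le> R \<Longrightarrow> \<bar>poly ((pderiv ^^ length hs) p) t\<bar> \<le> M" "M \<ge> 0"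
    for x R p v M hs
    using M
  proof (induction hs arbitrary: p M)
    case Nil
    obtain B where B: "eigenbasis (A x) B" using eigenbasis_exists[OF sa] by blast
    then have o: "onb B UNIV" by (simp add: eigenbasis_def)
    have "norm (pword A x p [] v) \<le> C * (M * (C * norm v))"
    proof (rule C(4)[OF o])
      fix b assume b: "b \<in> B"
      define l where "l = ip (A x b) b"
      have e: "A x b = l *\<^sub>R b" using B b by (simp add: eigenbasis_def l_def)
      have "b \<noteq> 0" using onb_unit[OF o b] by (auto simp: ip_simps)
      then have "\<bar>l\<bar> \<le> R" using sb e by (auto simp: spectrum_bound_def)
      then have "\<bar>poly p l\<bar> \<le> M" using Nil(1)[of l] by simp
      then have "\<bar>poly p l\<bar> * \<bar>ip v b\<bar> \<le> M * (C * norm v)"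
        using C(3)[OF o b] Nil(2) by (intro mult_mono) auto
      then show "\<bar>ip (pword A x p [] v) b\<bar> \<le> M * (C * norm v)"
        by (simp add: pword_Nil_eigen[OF A sa e] abs_mult)
    qed (use Nil(2) C(1) in auto)
    also have "\<dots> = C * C * (M * norm v)" by simp
    also have "\<dots> \<le> K * (M * norm v)" using KC Nil(2) by (intro mult_right_mono) auto
    finally show ?case by (simp add: mult.assoc)
  next
    case (Cons h hs)
    obtain B where B: "eigenbasis (A x) B" using eigenbasis_exists[OF sa] by blast
    then have o: "onb B UNIV" by (simp add: eigenbasis_def)
    let ?T = "K ^ Suc (length hs) * prod_list (map norm hs) * M * norm v"
    have pn: "prod_list (map norm hs) \<ge> 0" by (induction hs) auto
    have T0: "?T \<ge> 0" using K0 pn Cons.prems(2) by simp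
    have "norm (pword A x p (h # hs) v) \<le> C * (C * (norm h * ?T * L))"
    proof (rule C(4)[OF o])
      fix b assume b: "b \<in> B"
      define l where "l = ip (A x b) b"
      have e: "A x b = l *\<^sub>R b" using B b by (simp add: eigenbasis_def l_def)
      have "b \<noteq> 0" using onb_unit[OF o b] by (auto simp: ip_simps)
      then have l: "\<bar>l\<bar> \<le> R" using sb e by (auto simp: spectrum_bound_def)
      have IH: "norm (pword A x (synthetic_div p l) hs v) \<le> ?T"
        by (rule Cons.IH[OF synthetic_div_deriv_bound[OF l]]) (use Cons.prems in auto)
      have "\<bar>ip (pword A x p (h # hs) v) b\<bar> = \<bar>ip (A h (pword A x (synthetic_div p l) hs v)) b\<bar>"
        by (simp add: pword_Cons_eigen[OF A sa e])
      also have "\<dots> \<le> C * norm (A h (pword A x (synthetic_div p l) hs v))" by (rule C(3)[OF o b])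
      also have "\<dots> \<le> C * (norm h * ?T * L)"
        using L IH C(1) by (intro mult_left_mono order_trans[OF L(2)] mult_right_mono) auto
      finally show "\<bar>ip (pword A x p (h # hs) v) b\<bar> \<le> C * (norm h * ?T * L)" .
    qed (use T0 C(1) L(1) in auto)
    also have "\<dots> = C * C * L * (norm h * ?T)" by simp
    also have "\<dots> \<le> K * (norm h * ?T)"
      using KC T0 by (intro mult_right_mono) auto
    finally show ?case by (simp add: mult_ac)
  qed
  then show ?thesis using K0 by blast
qed

text \<open>Take polynomials approximating \<open>D 0\<close> in C^k on [-R, R]. By
  \<open>pword_bound\<close> their words with at most \<open>k\<close> directions are uniformly
  Cauchy on \<open>U\<close>, and limits of words with one direction more are derivatives of limits
  of words.\<close>

theorem times_differentiable_fun_calc: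
  fixes A :: "'a::euclidean_space \<Rightarrow> 'g \<Rightarrow> 'g"
  assumes A: "bounded_bilinear A" and U: "open U" and R: "R > 0"
    and sa: "\<And>x. x \<in> U \<Longrightarrow> self_adjoint (A x)" and sb: "\<And>x. x \<in> U \<Longrightarrow> spectrum_bound (A x) R"
    and D: "\<And>j t. j < k \<Longrightarrow> \<bar>t\<bar> \<le> R \<Longrightarrow> (D j has_real_derivative D (Suc j) t) (at t)"
    and c: "continuous_on {-R..R} (D k)"
  shows "times_differentiable_on k U (\<lambda>x. fun_calc (D 0) (A x) v)"
proof -
  have "\<exists>p. \<forall>j\<le>k. \<forall>t. \<bar>t\<bar> \<le> R \<longrightarrow> \<bar>poly ((pderiv ^^ j) p) t - D j t\<bar> \<le> 1 / (1 + real m)" for m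
    by (rule smooth_polynomial_approximation[OF R _ D c]) auto
  then obtain P where P: "\<And>m j t. j \<le> k \<Longrightarrow> \<bar>t\<bar> \<le> R \<Longrightarrow> \<bar>poly ((pderiv ^^ j) (P m)) t - D j t\<bar> \<le> 1 / (1 + real m)"
    by metis
  obtain K where K: "K \<ge> 0" "\<And>hs x R p v M. self_adjoint (A x) \<Longrightarrow> spectrum_bound (A x) R \<Longrightarrow>
    (\<And>t. \<bar>t\<bar> \<le> R \<Longrightarrow> \<bar>poly ((pderiv ^^ length hs) p) t\<bar> \<le> M) \<Longrightarrow> M \<ge> 0 \<Longrightarrow>
    norm (pword A x p hs v) \<le> K ^ Suc (length hs) * prod_list (map norm hs) * M * norm v"
    using pword_bound[OF A] by metis
  define G where "G m hs x = pword A x (P m) hs v" for m hs x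
  define c where "c hs = K ^ Suc (length hs) * prod_list (map norm hs) * norm v" for hs :: "'a list"
  have dist: "norm (G m hs x - G n hs x) \<le> c hs * (1 / (1 + real m) + 1 / (1 + real n))"
    if "x \<in> U" "length hs \<le> k" for m n hs x
  proof -
    have hd: "(pderiv ^^ i) (p - q) = (pderiv ^^ i) p - (pderiv ^^ i) q" for i and p q :: "real poly"
      by (induction i) (auto simp: pderiv_diff)
    have "norm (pword A x (P m - P n) hs v) \<le>
       K ^ Suc (length hs) * prod_list (map norm hs) * (1 / (1 + real m) + 1 / (1 + real n)) * norm v"
    proof (rule K(2)[OF sa sb])
      fix t assume "\<bar>t\<bar> \<le> R"
      then have "\<bar>poly ((pderiv ^^ length hs) (P m)) t - D (length hs) t\<bar> \<le> 1 / (1 + real m)"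
         "\<bar>poly ((pderiv ^^ length hs) (P n)) t - D (length hs) t\<bar> \<le> 1 / (1 + real n)"
        using P that by blast+
      then show "\<bar>poly ((pderiv ^^ length hs) (P m - P n)) t\<bar> \<le> 1 / (1 + real m) + 1 / (1 + real n)"
        unfolding hd poly_diff by linarith
    qed (use that in auto)
    then show ?thesis unfolding G_def pword_diff c_def by (simp only: mult_ac)
  qed
  have inv0: "(\<lambda>m. 1 / (1 + real m)) \<longlonglongrightarrow> 0"
    using LIMSEQ_inverse_real_of_nat by (simp add: divide_inverse add.commute)
  have small: "\<forall>\<^sub>F m in sequentially. d * (1 / (1 + real m)) < e" if "e > 0" for d e
  proof -
    have "(\<lambda>m. d * (1 / (1 + real m))) \<longlonglongrightarrow> d * 0" by (intro tendsto_intros inv0)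
    from order_tendstoD(2)[OF this, of e] show ?thesis using that by simp
  qed
  \<comment> \<open>\<open>H hs\<close> is the term with directions \<open>hs\<close> of an iterated
    derivative of the limit; \<open>H []\<close> turns out to be the functional calculus
    itself.\<close>
  define H where "H hs x = lim (\<lambda>m. G m hs x)" for hs x
  have conv: "(\<lambda>m. G m hs x) \<longlonglongrightarrow> H hs x" if x: "x \<in> U" and l: "length hs \<le> k" for hs x
  proof -
    have "Cauchy (\<lambda>m. G m hs x)"
      unfolding Cauchy_def dist_norm
    proof (intro allI impI)
      fix e :: real assume e: "e > 0"
      have "\<forall>\<^sub>F m in sequentially. c hs * (1 / (1 + real m)) < e / 2"
        by (rule small) (use e in simp)
      then obtain M where M: "\<And>m. m \<ge> M \<Longrightarrow> c hs * (1 / (1 + real m)) < e / 2"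
        unfolding eventually_sequentially by blast
      show "\<exists>M. \<forall>m\<ge>M. \<forall>n\<ge>M. norm (G m hs x - G n hs x) < e"
      proof (intro exI[of _ M] allI impI)
        fix m n assume "M \<le> m" "M \<le> n"
        then have "c hs * (1 / (1 + real m)) < e / 2" "c hs * (1 / (1 + real n)) < e / 2"
          using M by blast+
        then show "norm (G m hs x - G n hs x) < e"
          using dist[OF x l, of m n] unfolding distrib_left by linarith
      qed
    qed
    then show ?thesis unfolding H_def by (simp add: Cauchy_convergent convergent_LIMSEQ_iff[symmetric])
  qed
  have distH: "norm (G m hs x - H hs x) \<le> c hs * (1 / (1 + real m))"
    if x: "x \<in> U" and l: "length hs \<le> k" for m hs x
  proof (rule LIMSEQ_le)
    show "(\<lambda>n. norm (G m hs x - G n hs x)) \<longlonglongrightarrow> norm (G m hs x - H hs x)"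
      by (intro tendsto_intros conv x l)
    have "(\<lambda>n. c hs * (1 / (1 + real m) + 1 / (1 + real n))) \<longlonglongrightarrow> c hs * (1 / (1 + real m) + 0)"
      by (intro tendsto_intros inv0)
    then show "(\<lambda>n. c hs * (1 / (1 + real m) + 1 / (1 + real n))) \<longlonglongrightarrow> c hs * (1 / (1 + real m))"
      by simp
    show "\<exists>N. \<forall>n\<ge>N. norm (G m hs x - G n hs x) \<le> c hs * (1 / (1 + real m) + 1 / (1 + real n))"
      using dist[OF x l] by blast
  qed
  have H_fc: "H [] x = fun_calc (D 0) (A x) v" if x: "x \<in> U" for x
  proof -
    obtain B where B: "eigenbasis (A x) B" using eigenbasis_exists[OF sa[OF x]] by blast
    then have o: "onb B UNIV" by (simp add: eigenbasis_def)
    have e: "b \<in> B \<Longrightarrow> A x b = ip (A x b) b *\<^sub>R b" for b using B by (simp add: eigenbasis_def)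
    have "(\<lambda>m. poly (P m) (ip (A x b) b)) \<longlonglongrightarrow> D 0 (ip (A x b) b)" if b: "b \<in> B" for b
    proof -
      have "b \<noteq> 0" using onb_unit[OF o b] by (auto simp: ip_simps)
      then have l: "\<bar>ip (A x b) b\<bar> \<le> R" using sb[OF x] e[OF b] \<open>b \<noteq> 0\<close> unfolding spectrum_bound_def by blast
      have "(\<lambda>m. poly (P m) (ip (A x b) b) - D 0 (ip (A x b) b)) \<longlonglongrightarrow> 0"
      proof (rule Lim_null_comparison[OF always_eventually inv0], rule allI)
        show "norm (poly (P m) (ip (A x b) b) - D 0 (ip (A x b) b)) \<le> 1 / (1 + real m)" for m
          using P[OF le0 l, of m] by simp
      qed
      then show ?thesis by (rule LIM_zero_cancel)
    qed
    then have "(\<lambda>m. \<Sum>b\<in>B. (poly (P m) (ip (A x b) b) * ip v b) *\<^sub>R b) \<longlonglongrightarrow>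
        (\<Sum>b\<in>B. (D 0 (ip (A x b) b) * ip v b) *\<^sub>R b)"
      by (intro tendsto_sum tendsto_scaleR tendsto_mult tendsto_const)
    moreover have "(\<lambda>m. \<Sum>b\<in>B. (poly (P m) (ip (A x b) b) * ip v b) *\<^sub>R b) = (\<lambda>m. G m [] x)"
      unfolding G_def fun_calc_poly[where A=A, OF A sa[OF x], symmetric]
      by (intro ext fun_calc_onb[OF sa[OF x] o e, symmetric])
    moreover have "(\<Sum>b\<in>B. (D 0 (ip (A x b) b) * ip v b) *\<^sub>R b) = fun_calc (D 0) (A x) v"
      by (rule fun_calc_onb[OF sa[OF x] o e, symmetric])
    ultimately have "(\<lambda>m. G m [] x) \<longlonglongrightarrow> fun_calc (D 0) (A x) v" by (simp only:)
    moreover have "(\<lambda>m. G m [] x) \<longlonglongrightarrow> H [] x" by (rule conv[OF x]) simp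
    ultimately show ?thesis using LIMSEQ_unique by blast
  qed
  have main: "times_differentiable_on j U (H hs)" if "length hs + j \<le> k" for j hs
    using that
  proof (induction j arbitrary: hs)
    case 0
    have "continuous_on U (H hs)"
    proof (rule uniform_limit_theorem)
      show "\<forall>\<^sub>F m in sequentially. continuous_on U (G m hs)"
      proof (rule always_eventually, rule allI)
        show "continuous_on U (G m hs)" for m
          unfolding G_def[abs_def]
          by (rule has_derivative_continuous_on[OF has_derivative_at_withinI[OF pword_has_derivative[OF A]]])
      qed
      show "uniform_limit U (\<lambda>m. G m hs) (H hs) sequentially"
      proof (rule uniform_limitI)
        fix e :: real assume e: "e > 0"
        have "\<forall>\<^sub>F m in sequentially. c hs * (1 / (1 + real m)) < e"
          by (rule small[OF e])
        then show "\<forall>\<^sub>F m in sequentially. \<forall>x\<in>U. dist (G m hs x) (H hs x) < e"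
        proof eventually_elim
          case (elim m)
          show ?case
          proof
            fix x assume "x \<in> U"
            then have "norm (G m hs x - H hs x) \<le> c hs * (1 / (1 + real m))"
              by (rule distH) (use 0 in simp)
            then show "dist (G m hs x) (H hs x) < e" using elim by (simp add: dist_norm)
          qed
        qed
      qed
    qed simp
    then show ?case by simp
  next
    case (Suc j)
    have deriv: "(H hs has_derivative (\<lambda>h. \<Sum>l\<leftarrow>inserts h hs. H l x)) (at x)" if x: "x \<in> U" for x
    proof -
      obtain r where r: "r > 0" "ball x r \<subseteq> U" using U x openE by blast
      have "\<exists>g. \<forall>y\<in>ball x r. (\<lambda>m. G m hs y) \<longlonglongrightarrow> g y \<and>
          (g has_derivative (\<lambda>h. \<Sum>l\<leftarrow>inserts h hs. H l y)) (at y within ball x r)"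
      proof (rule has_derivative_sequence[where f'="\<lambda>m y h. \<Sum>l\<leftarrow>inserts h hs. G m l y"])
        show "(G m hs has_derivative (\<lambda>h. \<Sum>l\<leftarrow>inserts h hs. G m l y)) (at y within ball x r)" for m y
          unfolding G_def[abs_def] by (rule has_derivative_at_withinI[OF pword_has_derivative[OF A]])
        show "(\<lambda>m. G m hs x) \<longlonglongrightarrow> H hs x" by (rule conv[OF x]) (use Suc.prems in simp)
        fix e :: real assume e: "e > 0"
        \<comment> \<open>There are \<open>Suc (length hs)\<close> insertions, and by
          \<open>prod_norm_inserts\<close> each contributes the factor \<open>norm h\<close>. The
          error thus gets the form \<open>e * norm h\<close> that differentiating a limit of
          functions requires.\<close>
        define c' where "c' = real (Suc (length hs)) * (K ^ Suc (Suc (length hs)) * prod_list (map norm hs) * norm v)"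
        have "\<forall>\<^sub>F m in sequentially. c' * (1 / (1 + real m)) < e"
          by (rule small[OF e])
        then show "\<forall>\<^sub>F m in sequentially. \<forall>y\<in>ball x r. \<forall>h.
            norm ((\<Sum>l\<leftarrow>inserts h hs. G m l y) - (\<Sum>l\<leftarrow>inserts h hs. H l y)) \<le> e * norm h"
        proof eventually_elim
          case (elim m)
          show ?case
          proof (intro ballI allI)
            fix y h assume "y \<in> ball x r"
            then have y: "y \<in> U" using r by blast
            have sl: "norm ((\<Sum>l\<leftarrow>L. G m l y) - (\<Sum>l\<leftarrow>L. H l y)) \<le> real (length L) * d"
              if "\<And>l. l \<in> set L \<Longrightarrow> norm (G m l y - H l y) \<le> d" for L d
              using that
            proof (induction L)
              case (Cons l L)
              have "norm ((G m l y - H l y) + ((\<Sum>l\<leftarrow>L. G m l y) - (\<Sum>l\<leftarrow>L. H l y))) \<le> d + real (length L) * d"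
                using Cons by (intro norm_triangle_mono) auto
              then show ?case by (simp add: algebra_simps)
            qed simp
            have "norm ((\<Sum>l\<leftarrow>inserts h hs. G m l y) - (\<Sum>l\<leftarrow>inserts h hs. H l y)) \<le>
               real (length (inserts h hs)) * (K ^ Suc (Suc (length hs)) * (norm h * prod_list (map norm hs)) * norm v * (1 / (1 + real m)))"
            proof (rule sl)
              fix l assume l: "l \<in> set (inserts h hs)"
              then show "norm (G m l y - H l y) \<le> K ^ Suc (Suc (length hs)) * (norm h * prod_list (map norm hs)) * norm v * (1 / (1 + real m))"
                using distH[OF y, of l m] length_inserts[OF l] prod_norm_inserts[OF l] Suc.prems
                by (simp add: c_def)
            qed
            also have "\<dots> = c' * (1 / (1 + real m)) * norm h"
              by (simp add: c'_def length_inserts_list mult_ac)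
            also have "\<dots> \<le> e * norm h" using elim by (intro mult_right_mono) auto
            finally show "norm ((\<Sum>l\<leftarrow>inserts h hs. G m l y) - (\<Sum>l\<leftarrow>inserts h hs. H l y)) \<le> e * norm h" .
          qed
        qed
      qed (use r in auto)
      then obtain g where g: "\<And>y. y \<in> ball x r \<Longrightarrow> (\<lambda>m. G m hs y) \<longlonglongrightarrow> g y"
        "\<And>y. y \<in> ball x r \<Longrightarrow> (g has_derivative (\<lambda>h. \<Sum>l\<leftarrow>inserts h hs. H l y)) (at y within ball x r)"
        by blast
      have gH: "g y = H hs y" if "y \<in> ball x r" for y
        using LIMSEQ_unique[OF g(1)[OF that] conv] that r(2) Suc.prems by auto
      have "(g has_derivative (\<lambda>h. \<Sum>l\<leftarrow>inserts h hs. H l x)) (at x)"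
        using g(2)[of x] r(1) by (simp add: at_within_open[OF _ open_ball])
      then show ?thesis
        by (rule has_derivative_transform_within_open[OF _ open_ball[of x r]]) (use gH r in auto)
    qed
    have "times_differentiable_on j U (\<lambda>x. \<Sum>l\<leftarrow>inserts h hs. H l x)" for h
      by (intro times_differentiable_on_sum_list Suc.IH) (use length_inserts Suc.prems in fastforce)
    with deriv show ?case
      unfolding times_differentiable_on.simps
      by (intro exI[of _ "\<lambda>x h. \<Sum>l\<leftarrow>inserts h hs. H l x"] conjI ballI allI)
  qed
  show ?thesis
    by (rule times_differentiable_on_cong[OF U H_fc main]) simp_all
qed

end

section \<open>Lie algebras with a Cartan involution\<close>

definition trace_of :: "('g::euclidean_space \<Rightarrow> 'g) \<Rightarrow> real" where
  "trace_of A = (\<Sum>b\<in>Basis. A b \<bullet> b)"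

lemma trace_of_commute:
  fixes A B :: "'g::euclidean_space \<Rightarrow> 'g"
  assumes "linear A" "linear B"
  shows "trace_of (\<lambda>x. A (B x)) = trace_of (\<lambda>x. B (A x))"
proof -
  have e: "A' (B' b) \<bullet> b = (\<Sum>c\<in>Basis. (B' b \<bullet> c) * (A' c \<bullet> b))" if "linear A'" for A' B' :: "'g \<Rightarrow> 'g" and b
  proof -
    have "A' (B' b) = A' (\<Sum>c\<in>Basis. (B' b \<bullet> c) *\<^sub>R c)" by (simp only: euclidean_representation)
    also have "\<dots> = (\<Sum>c\<in>Basis. (B' b \<bullet> c) *\<^sub>R A' c)"
      by (simp add: linear_sum[OF that] linear_scale[OF that])
    finally show ?thesis by (simp add: inner_sum_left)
  qed
  have "trace_of (\<lambda>x. A (B x)) = (\<Sum>b\<in>Basis. \<Sum>c\<in>Basis. (B b \<bullet> c) * (A c \<bullet> b))"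
    unfolding trace_of_def by (intro sum.cong refl) (rule e[OF assms(1)])
  also have "\<dots> = (\<Sum>c\<in>Basis. \<Sum>b\<in>Basis. (A c \<bullet> b) * (B b \<bullet> c))"
    by (subst sum.swap) (simp only: mult.commute)
  also have "\<dots> = trace_of (\<lambda>x. B (A x))"
    unfolding trace_of_def by (intro sum.cong refl) (rule e[OF assms(2), symmetric])
  finally show ?thesis .
qed

lemma trace_of_diff: "trace_of (\<lambda>x. A x - B x) = trace_of A - trace_of B"
  by (simp add: trace_of_def inner_diff_left sum_subtractf)

lemma killing_eq_trace: "killing br X Y = trace_of (\<lambda>Z. br X (br Y Z))"
  by (simp add: killing_def trace_of_def)

locale cartan_lie =
  fixes br :: "'g::euclidean_space \<Rightarrow> 'g \<Rightarrow> 'g" and \<theta> :: "'g \<Rightarrow> 'g"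
  assumes lie: "lie_algebra br" and cartan: "cartan_involution br \<theta>"
begin

lemma br_bilinear: "bilinear br"
  using lie by (simp add: lie_algebra_def)

lemma br_bounded: "bounded_bilinear br"
  using br_bilinear by (simp add: bilinear_conv_bounded_bilinear)

lemma ad_linear: "linear (br X)" and ad_linear_left: "linear (\<lambda>X. br X Y)"
  using br_bilinear by (auto simp: bilinear_def)

lemma ad_bounded_linear: "bounded_linear (br X)"
  using ad_linear linear_conv_bounded_linear by blast

lemma br_scaleR [simp]: "br (c *\<^sub>R X) Y = c *\<^sub>R br X Y" "br X (c *\<^sub>R Y) = c *\<^sub>R br X Y"
  using bilinear_lmul[OF br_bilinear] bilinear_rmul[OF br_bilinear] by auto

lemmas br_simps = br_scaleR bilinear_ladd[OF br_bilinear] bilinear_radd[OF br_bilinear]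
  bilinear_lneg[OF br_bilinear] bilinear_rneg[OF br_bilinear]
  bilinear_lzero[OF br_bilinear] bilinear_rzero[OF br_bilinear]
  bilinear_lsub[OF br_bilinear] bilinear_rsub[OF br_bilinear]

lemma br_sum_right: "br X (\<Sum>i\<in>I. f i) = (\<Sum>i\<in>I. br X (f i))"
  using linear_sum[OF ad_linear] by blast

lemma br_self [simp]: "br X X = 0"
  using lie by (simp add: lie_algebra_def)

lemma br_anti: "br X Y = - br Y X"
proof -
  have "br (X + Y) (X + Y) = 0" by (rule br_self)
  then have "br X Y + br Y X = 0" by (simp add: br_simps del: br_self) (simp add: add.commute)
  then show ?thesis by (rule eq_neg_iff_add_eq_0[THEN iffD2])
qed

lemma jacobi: "br X (br Y Z) = br (br X Y) Z + br Y (br X Z)"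
proof -
  have "br X (br Y Z) + br Y (br Z X) + br Z (br X Y) = 0"
    using lie by (simp add: lie_algebra_def)
  moreover have "br Y (br Z X) = - br Y (br X Z)"
    by (subst br_anti[of Z X]) (rule bilinear_rneg[OF br_bilinear])
  moreover have "br Z (br X Y) = - br (br X Y) Z" by (rule br_anti)
  ultimately show ?thesis by (simp add: algebra_simps eq_neg_iff_add_eq_0)
qed

lemma jacobi_left: "br (br X Y) Z = br X (br Y Z) - br Y (br X Z)"
  using jacobi[of X Y Z] by simp

definition B :: "'g \<Rightarrow> 'g \<Rightarrow> real" where "B = killing br"

lemma B_bilinear: "bilinear B"
  unfolding bilinear_def B_def killing_def
  by (intro conjI allI linearI)
     (simp_all add: br_simps inner_add_left sum.distrib scaleR_sum_right sum_distrib_left)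

lemma B_sym: "B X Y = B Y X"
  unfolding B_def killing_eq_trace by (rule trace_of_commute[OF ad_linear ad_linear])

lemma B_invariant: "B (br X Y) Z = B X (br Y Z)"
proof -
  have "trace_of (\<lambda>W. br Y (br X (br Z W))) = trace_of (\<lambda>W. br X (br Z (br Y W)))"
    by (rule trace_of_commute[OF ad_linear, where B="\<lambda>W. br X (br Z W)"])
       (intro linear_compose[OF ad_linear ad_linear, unfolded o_def])
  then show ?thesis
    by (simp add: B_def killing_eq_trace jacobi_left trace_of_diff br_simps)
qed

section \<open>Automorphisms, the Cartan involution and its inner product\<close>

definition automorphism :: "('g \<Rightarrow> 'g) \<Rightarrow> bool" where
  "automorphism g \<longleftrightarrow> linear g \<and> bij g \<and> (\<forall>X Y. g (br X Y) = br (g X) (g Y))"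

lemma automorphism_linear: "automorphism g \<Longrightarrow> linear g"
  and automorphism_br: "automorphism g \<Longrightarrow> g (br X Y) = br (g X) (g Y)"
  and automorphism_inv1: "automorphism g \<Longrightarrow> inv g (g X) = X"
  and automorphism_inv2: "automorphism g \<Longrightarrow> g (inv g X) = X"
  by (auto simp: automorphism_def bij_is_inj bij_is_surj surj_f_inv_f)

lemma automorphism_inv: "automorphism g \<Longrightarrow> automorphism (inv g)"
  unfolding automorphism_def
  by (auto simp: bij_imp_bij_inv bij_is_inj inj_linear_imp_inv_linear bij_is_surj surj_f_inv_f
      intro!: inv_f_eq)

lemma automorphism_comp: "automorphism g \<Longrightarrow> automorphism h \<Longrightarrow> automorphism (g \<circ> h)"
  unfolding automorphism_def using bij_comp linear_compose by auto

lemma B_automorphism: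
  assumes g: "automorphism g"
  shows "B (g X) (g Y) = B X Y"
proof -
  have "B (g X) (g Y) = trace_of (\<lambda>W. br (g X) (br (g Y) (g (inv g W))))"
    using automorphism_inv2[OF g] by (simp add: B_def killing_eq_trace)
  also have "\<dots> = trace_of (\<lambda>W. g (br X (br Y (inv g W))))"
    by (simp add: automorphism_br[OF g])
  also have "\<dots> = trace_of (\<lambda>W. br X (br Y (inv g (g W))))"
    by (rule trace_of_commute[OF automorphism_linear[OF g], where B="\<lambda>W. br X (br Y (inv g W))"])
       (intro linear_compose[OF automorphism_linear[OF automorphism_inv[OF g]]
          linear_compose[OF ad_linear ad_linear], unfolded o_def])
  also have "\<dots> = B X Y"
    using automorphism_inv1[OF g] by (simp add: B_def killing_eq_trace)
  finally show ?thesis .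
qed

lemma \<theta>_linear: "linear \<theta>" and \<theta>_\<theta> [simp]: "\<theta> (\<theta> X) = X" and \<theta>_br: "\<theta> (br X Y) = br (\<theta> X) (\<theta> Y)"
  using cartan by (auto simp: cartan_involution_def)

lemma \<theta>_automorphism: "automorphism \<theta>"
  unfolding automorphism_def using \<theta>_linear \<theta>_br by (metis \<theta>_\<theta> involuntory_imp_bij)

abbreviation ip :: "'g \<Rightarrow> 'g \<Rightarrow> real" where "ip \<equiv> cartan_ip br \<theta>"

lemma ip_eq: "ip X Y = - B X (\<theta> Y)"
  by (simp add: cartan_ip_def B_def)

sublocale inner_form ip
proof
  show "bilinear ip"
    unfolding bilinear_def ip_eq
    by (intro conjI allI linearI)
       (simp_all add: linear_add[OF \<theta>_linear] linear_scale[OF \<theta>_linear]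
         bilinear_ladd[OF B_bilinear] bilinear_radd[OF B_bilinear]
         bilinear_lmul[OF B_bilinear] bilinear_rmul[OF B_bilinear])
  show "ip x y = ip y x" for x y
  proof -
    have "B x (\<theta> y) = B (\<theta> x) (\<theta> (\<theta> y))" by (rule B_automorphism[OF \<theta>_automorphism, symmetric])
    then show ?thesis by (simp add: ip_eq B_sym)
  qed
  show "x \<noteq> 0 \<Longrightarrow> 0 < ip x x" for x
    using cartan by (simp add: cartan_involution_def)
qed

lemma ip_\<theta>: "ip (\<theta> X) (\<theta> Y) = ip X Y"
  unfolding ip_eq B_automorphism[OF \<theta>_automorphism] ..

lemma ad_adjoint: "ip (br X Y) Z = - ip Y (br (\<theta> X) Z)"
proof -
  have "B (br X Y) (\<theta> Z) = - B (br Y X) (\<theta> Z)"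
    by (subst br_anti) (rule bilinear_lneg[OF B_bilinear])
  also have "\<dots> = - B Y (br X (\<theta> Z))" by (simp add: B_invariant)
  also have "br X (\<theta> Z) = \<theta> (br (\<theta> X) Z)" by (simp add: \<theta>_br)
  finally show ?thesis by (simp add: ip_eq)
qed

lemma center_zero: "(\<And>Y. br X Y = 0) \<Longrightarrow> X = 0"
proof -
  assume "\<And>Y. br X Y = 0"
  then have "ip X X = 0" by (simp add: ip_eq B_def killing_def)
  then show "X = 0" by (simp add: ip_eq_0_iff)
qed

abbreviation "\<kk> \<equiv> k_part \<theta>"
abbreviation "\<pp> \<equiv> p_part \<theta>"

lemma k_iff: "X \<in> \<kk> \<longleftrightarrow> \<theta> X = X" and p_iff: "X \<in> \<pp> \<longleftrightarrow> \<theta> X = - X"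
  by (auto simp: k_part_def p_part_def)

lemma subspace_k: "subspace \<kk>" and subspace_p: "subspace \<pp>"
  by (auto simp: subspace_def k_iff p_iff linear_0[OF \<theta>_linear] linear_add[OF \<theta>_linear] linear_scale[OF \<theta>_linear])

lemma br_kp: "X \<in> \<kk> \<Longrightarrow> Y \<in> \<pp> \<Longrightarrow> br X Y \<in> \<pp>"
  and br_pp: "X \<in> \<pp> \<Longrightarrow> Y \<in> \<pp> \<Longrightarrow> br X Y \<in> \<kk>"
  by (auto simp: k_iff p_iff \<theta>_br br_simps)

lemma self_adjoint_p: "X \<in> \<pp> \<Longrightarrow> self_adjoint (br X)"
  using ad_adjoint[of X] by (simp add: self_adjoint_def ad_linear p_iff br_simps ip_simps)

lemma \<theta>_diff_p: "X - \<theta> X \<in> \<pp>" and \<theta>_add_k: "X + \<theta> X \<in> \<kk>"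
  by (auto simp: k_iff p_iff linear_diff[OF \<theta>_linear] linear_add[OF \<theta>_linear])

lemma ip_tendsto:
  "(f \<longlongrightarrow> l) F \<Longrightarrow> (g \<longlongrightarrow> m) F \<Longrightarrow> ((\<lambda>x. ip (f x) (g x)) \<longlongrightarrow> ip l m) F"
  by (rule bounded_bilinear.tendsto[OF ip_bounded])

section \<open>The exponential of the adjoint representation\<close>

abbreviation E :: "'g \<Rightarrow> 'g \<Rightarrow> 'g" where "E \<equiv> exp_ad br"

definition br_const :: real where
  "br_const = (SOME K. K > 0 \<and> (\<forall>X Y. norm (br X Y) \<le> norm X * norm Y * K))"

lemma br_const: "br_const > 0" "norm (br X Y) \<le> br_const * norm X * norm Y"
proof -
  have "\<exists>K. K > 0 \<and> (\<forall>X Y. norm (br X Y) \<le> norm X * norm Y * K)"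
    using bounded_bilinear.pos_bounded[OF br_bounded] by blast
  from someI_ex[OF this] show "br_const > 0" "norm (br X Y) \<le> br_const * norm X * norm Y"
    by (auto simp: br_const_def mult_ac)
qed

lemma norm_ad_pow: "norm ((br X ^^ n) Y) \<le> (br_const * norm X) ^ n * norm Y"
proof (induction n)
  case (Suc n)
  have "norm ((br X ^^ Suc n) Y) \<le> br_const * norm X * norm ((br X ^^ n) Y)"
    using br_const(2) by simp
  also have "\<dots> \<le> br_const * norm X * ((br_const * norm X) ^ n * norm Y)"
    using Suc br_const(1) by (intro mult_left_mono) auto
  finally show ?case by (simp add: mult_ac)
qed simp

lemma exp_term_bound:
  "norm ((1 / fact n) *\<^sub>R (br X ^^ n) Y) \<le> (br_const * norm X) ^ n /\<^sub>R fact n * norm Y"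
  using norm_ad_pow[of n X Y] by (simp add: divide_inverse mult.assoc mult_left_mono)

lemma exp_ad_sums: "(\<lambda>n. (1 / fact n) *\<^sub>R (br X ^^ n) Y) sums E X Y"
proof -
  have "summable (\<lambda>n. (br_const * norm X) ^ n /\<^sub>R fact n * norm Y)"
    by (intro summable_mult2 summable_exp_generic)
  then have "summable (\<lambda>n. (1 / fact n) *\<^sub>R (br X ^^ n) Y)"
    by (rule summable_comparison_test'[where N=0]) (rule exp_term_bound)
  then show ?thesis unfolding exp_ad_def by (rule summable_sums)
qed

lemma ad_pow_linear: "linear (br X ^^ n)"
proof (induction n)
  case 0
  show ?case by (simp only: funpow.simps) (rule linear_id)
next
  case (Suc n)
  show ?case by (simp only: funpow.simps) (rule linear_compose[OF Suc ad_linear])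
qed

lemma exp_ad_linear: "linear (E X)"
proof (rule linearI)
  fix Y Z :: 'g and c :: real
  have "(\<lambda>n. (1 / fact n) *\<^sub>R (br X ^^ n) Y + (1 / fact n) *\<^sub>R (br X ^^ n) Z) sums (E X Y + E X Z)"
    by (intro sums_add exp_ad_sums)
  then show "E X (Y + Z) = E X Y + E X Z"
    using exp_ad_sums[of X "Y + Z"] sums_unique2
    by (simp add: linear_add[OF ad_pow_linear] scaleR_add_right)
  have "(\<lambda>n. c *\<^sub>R ((1 / fact n) *\<^sub>R (br X ^^ n) Y)) sums (c *\<^sub>R E X Y)"
    by (intro sums_scaleR_right exp_ad_sums)
  then show "E X (c *\<^sub>R Y) = c *\<^sub>R E X Y"
    using exp_ad_sums[of X "c *\<^sub>R Y"] sums_unique2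
    by (simp add: linear_scale[OF ad_pow_linear] mult.commute)
qed

lemma exp_ad_0 [simp]: "E 0 Y = Y"
proof -
  have "(\<lambda>n. (1 / fact n) *\<^sub>R (br 0 ^^ n) Y) sums (\<Sum>n\<in>{0}. (1 / fact n) *\<^sub>R (br 0 ^^ n) Y)"
  proof (rule sums_finite)
    fix n :: nat assume "n \<notin> {0}"
    then obtain m where "n = Suc m" by (cases n) auto
    then show "(1 / fact n) *\<^sub>R (br 0 ^^ n) Y = 0" by (simp add: br_simps)
  qed simp
  then show ?thesis using exp_ad_sums[of 0 Y] sums_unique2 by fastforce
qed

lemma exp_ad_eigen:
  assumes "br X Y = l *\<^sub>R Y"
  shows "E X Y = exp l *\<^sub>R Y"
proof -
  have p: "(br X ^^ n) Y = l ^ n *\<^sub>R Y" for n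
    by (induction n) (auto simp: br_simps assms)
  have "(\<lambda>n. (l ^ n /\<^sub>R fact n) *\<^sub>R Y) sums (exp l *\<^sub>R Y)"
    by (intro sums_scaleR_left exp_converges)
  then have "(\<lambda>n. (1 / fact n) *\<^sub>R (br X ^^ n) Y) sums (exp l *\<^sub>R Y)"
    by (simp add: p divide_inverse)
  then show ?thesis using exp_ad_sums sums_unique2 by blast
qed

lemma exp_ad_equivariant:
  assumes "linear g" "\<And>X Y. g (br X Y) = br (g X) (g Y)"
  shows "g (E X Y) = E (g X) (g Y)"
proof -
  have p: "g ((br X ^^ n) Y) = (br (g X) ^^ n) (g Y)" for n
    by (induction n) (auto simp: assms(2))
  have "bounded_linear g" using assms(1) linear_conv_bounded_linear by blast
  then have "(\<lambda>n. g ((1 / fact n) *\<^sub>R (br X ^^ n) Y)) sums g (E X Y)"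
    by (rule bounded_linear.sums) (rule exp_ad_sums)
  then have "(\<lambda>n. (1 / fact n) *\<^sub>R (br (g X) ^^ n) (g Y)) sums g (E X Y)"
    by (simp add: linear_scale[OF assms(1)] p)
  then show ?thesis using exp_ad_sums sums_unique2 by blast
qed

lemma exp_ad_\<theta>: "\<theta> (E X Y) = E (\<theta> X) (\<theta> Y)"
  by (rule exp_ad_equivariant[OF \<theta>_linear \<theta>_br])

lemma exp_ad_commute: "E X (br X Y) = br X (E X Y)"
proof -
  have "(\<lambda>n. br X ((1 / fact n) *\<^sub>R (br X ^^ n) Y)) sums br X (E X Y)"
    by (rule bounded_linear.sums[OF ad_bounded_linear]) (rule exp_ad_sums)
  then have "(\<lambda>n. (1 / fact n) *\<^sub>R (br X ^^ n) (br X Y)) sums br X (E X Y)"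
    by (simp add: funpow_swap1)
  then show ?thesis using exp_ad_sums sums_unique2 by blast
qed

text \<open>Each coordinate is an everywhere convergent power series in \<open>t\<close> and is
  differentiated termwise.\<close>

lemma exp_ad_has_vector_derivative:
  "((\<lambda>t. E (t *\<^sub>R X) Y) has_vector_derivative br X (E (t *\<^sub>R X) Y)) (at t)"
proof -
  have pw: "(br (t *\<^sub>R X) ^^ n) Y = t ^ n *\<^sub>R (br X ^^ n) Y" for t n
    by (induction n) (auto simp: br_simps)
  have "((\<lambda>s. E (s *\<^sub>R X) Y \<bullet> b) has_real_derivative br X (E (t *\<^sub>R X) Y) \<bullet> b) (at t)" if b: "b \<in> Basis" for b
  proof -
    define c where "c n = ((br X ^^ n) Y \<bullet> b) / fact n" for n
    have s: "(\<lambda>n. c n * s ^ n) sums (E (s *\<^sub>R X) Y \<bullet> b)" for s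
    proof -
      have "(\<lambda>n. ((1 / fact n) *\<^sub>R (br (s *\<^sub>R X) ^^ n) Y) \<bullet> b) sums (E (s *\<^sub>R X) Y \<bullet> b)"
        by (rule bounded_linear.sums[OF bounded_linear_inner_left exp_ad_sums])
      then show ?thesis by (simp add: pw c_def mult_ac)
    qed
    have "(\<lambda>n. diffs c n * t ^ n) sums (br X (E (t *\<^sub>R X) Y) \<bullet> b)"
    proof -
      have "bounded_linear (\<lambda>Z. br X Z \<bullet> b)"
        by (rule bounded_linear_compose[OF bounded_linear_inner_left ad_bounded_linear])
      then have "(\<lambda>n. br X ((1 / fact n) *\<^sub>R (br (t *\<^sub>R X) ^^ n) Y) \<bullet> b) sums (br X (E (t *\<^sub>R X) Y) \<bullet> b)"
        by (rule bounded_linear.sums[OF _ exp_ad_sums])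
      then show ?thesis
        by (simp add: pw c_def diffs_def br_simps field_simps del: of_nat_Suc)
    qed
    then have "br X (E (t *\<^sub>R X) Y) \<bullet> b = (\<Sum>n. diffs c n * t ^ n)" by (rule sums_unique)
    moreover have "(\<lambda>s. E (s *\<^sub>R X) Y \<bullet> b) = (\<lambda>s. \<Sum>n. c n * s ^ n)"
      using s sums_unique by blast
    moreover have "((\<lambda>s. \<Sum>n. c n * s ^ n) has_field_derivative (\<Sum>n. diffs c n * t ^ n)) (at t)"
      by (rule termdiffs_strong_converges_everywhere) (use s sums_summable in blast)
    ultimately show ?thesis by simp
  qed
  then show ?thesis
    unfolding has_vector_derivative_def
    by (subst has_derivative_componentwise_within)
       (simp add: has_field_derivative_def mult_commute_abs)
qed

lemma exp_ad_product_derivative: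
  assumes w: "(w has_vector_derivative w') (at t)"
  shows "((\<lambda>t. E (t *\<^sub>R X) (w t)) has_vector_derivative br X (E (t *\<^sub>R X) (w t)) + E (t *\<^sub>R X) w') (at t)"
proof -
  have exp_sum: "E Z v = (\<Sum>b\<in>Basis. (v \<bullet> b) *\<^sub>R E Z b)" for Z v
  proof -
    have "E Z v = E Z (\<Sum>b\<in>Basis. (v \<bullet> b) *\<^sub>R b)" by (simp only: euclidean_representation)
    then show ?thesis by (simp add: linear_sum[OF exp_ad_linear] linear_scale[OF exp_ad_linear])
  qed
  have "((\<lambda>t. w t \<bullet> b) has_real_derivative (w' \<bullet> b)) (at t)" for b
    using bounded_linear.has_vector_derivative[OF bounded_linear_inner_left w, of b]
    by (simp add: has_real_derivative_iff_has_vector_derivative)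
  then have "((\<lambda>t. \<Sum>b\<in>Basis. (w t \<bullet> b) *\<^sub>R E (t *\<^sub>R X) b) has_vector_derivative
      (\<Sum>b\<in>Basis. (w t \<bullet> b) *\<^sub>R br X (E (t *\<^sub>R X) b) + (w' \<bullet> b) *\<^sub>R E (t *\<^sub>R X) b)) (at t)"
    by (intro has_vector_derivative_sum has_vector_derivative_scaleR exp_ad_has_vector_derivative)
  moreover have "(\<Sum>b\<in>Basis. (w t \<bullet> b) *\<^sub>R br X (E (t *\<^sub>R X) b) + (w' \<bullet> b) *\<^sub>R E (t *\<^sub>R X) b) =
      br X (E (t *\<^sub>R X) (w t)) + E (t *\<^sub>R X) w'"
    by (simp add: exp_sum[of _ "w t"] exp_sum[of _ w'] sum.distrib br_sum_right br_simps)
  ultimately show ?thesis by (simp add: exp_sum[of _ "w _"])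
qed

lemma has_vector_derivative_zero_const:
  fixes f :: "real \<Rightarrow> 'g"
  assumes "\<And>t. (f has_vector_derivative 0) (at t)"
  shows "f s = f t"
proof -
  have "\<exists>c. \<forall>x\<in>UNIV. f x = c"
    by (rule has_vector_derivative_zero_constant[of UNIV]) (use assms in auto)
  then show ?thesis by auto
qed

text \<open>The curve E(-tX) E(tX) Y has derivative zero. The addition law and the compatibility
  with the bracket below follow the same pattern.\<close>

lemma exp_ad_minus [simp]: "E (- X) (E X Y) = Y"
proof -
  define f where "f t = E (t *\<^sub>R - X) (E (t *\<^sub>R X) Y)" for t
  have "(f has_vector_derivative br (- X) (E (t *\<^sub>R - X) (E (t *\<^sub>R X) Y)) + E (t *\<^sub>R - X) (br X (E (t *\<^sub>R X) Y))) (at t)" for t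
    unfolding f_def[abs_def] by (intro exp_ad_product_derivative exp_ad_has_vector_derivative)
  moreover have "br (- X) (E (t *\<^sub>R - X) Z) + E (t *\<^sub>R - X) (br X Z) = 0" for t Z
  proof (cases "t = 0")
    case False
    \<comment> \<open>\<open>exp_ad_commute\<close> concerns the operator \<open>ad (- t X)\<close>
      itself, so the factor \<open>t\<close> is put in and cancelled at the end.\<close>
    have "t *\<^sub>R E (t *\<^sub>R - X) (br X Z) = - E (t *\<^sub>R - X) (br (t *\<^sub>R - X) Z)"
      by (simp add: br_simps linear_scale[OF exp_ad_linear] linear_neg[OF exp_ad_linear])
    also have "\<dots> = - br (t *\<^sub>R - X) (E (t *\<^sub>R - X) Z)" by (simp only: exp_ad_commute)
    also have "\<dots> = t *\<^sub>R (- br (- X) (E (t *\<^sub>R - X) Z))" by (simp add: br_simps)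
    finally show ?thesis using False by (simp only: real_vector.scale_cancel_left) simp
  qed (simp add: br_simps)
  ultimately have "(f has_vector_derivative 0) (at t)" for t by simp
  from has_vector_derivative_zero_const[OF this, of 1 0] show ?thesis by (simp add: f_def)
qed

lemma exp_ad_minus' [simp]: "E X (E (- X) Y) = Y"
  using exp_ad_minus[of "- X"] by simp

lemma exp_ad_commute_scaled: "E (t *\<^sub>R X) (br X Y) = br X (E (t *\<^sub>R X) Y)"
proof (cases "t = 0")
  case False
  have "t *\<^sub>R E (t *\<^sub>R X) (br X Y) = t *\<^sub>R br X (E (t *\<^sub>R X) Y)"
    using exp_ad_commute[of "t *\<^sub>R X" Y] by (simp add: linear_scale[OF exp_ad_linear])
  then show ?thesis using False by simp
qed simp

lemma exp_ad_add: "E ((s + t) *\<^sub>R X) Y = E (s *\<^sub>R X) (E (t *\<^sub>R X) Y)"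
proof -
  define f where "f u = E (u *\<^sub>R - X) (E ((u + t) *\<^sub>R X) Y)" for u
  have "((\<lambda>u. E ((u + t) *\<^sub>R X) Y) has_vector_derivative br X (E ((u + t) *\<^sub>R X) Y)) (at u)" for u
    using vector_diff_chain_at[of "\<lambda>u. u + t" 1 u "\<lambda>v. E (v *\<^sub>R X) Y", OF _ exp_ad_has_vector_derivative]
    by (simp add: o_def has_vector_derivative_add_const has_vector_derivative_id)
  then have "(f has_vector_derivative br (- X) (E (u *\<^sub>R - X) (E ((u + t) *\<^sub>R X) Y)) +
      E (u *\<^sub>R - X) (br X (E ((u + t) *\<^sub>R X) Y))) (at u)" for u
    unfolding f_def[abs_def] by (intro exp_ad_product_derivative)
  moreover have "E (u *\<^sub>R - X) (br X Z) = - br (- X) (E (u *\<^sub>R - X) Z)" for u Z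
    using exp_ad_commute_scaled[of u "- X" Z] by (simp add: br_simps linear_neg[OF exp_ad_linear])
  ultimately have "(f has_vector_derivative 0) (at u)" for u by simp
  from has_vector_derivative_zero_const[OF this, of s 0]
  have "E (- (s *\<^sub>R X)) (E ((s + t) *\<^sub>R X) Y) = E (t *\<^sub>R X) Y" by (simp add: f_def)
  then show ?thesis by (metis exp_ad_minus')
qed

text \<open>By the Jacobi identity \<open>ad X\<close> is a derivation, so E(-tX) [E(tX) Y, E(tX) Z]
  is constant in t.\<close>

lemma exp_ad_br: "E X (br Y Z) = br (E X Y) (E X Z)"
proof -
  define f where "f t = E (t *\<^sub>R - X) (br (E (t *\<^sub>R X) Y) (E (t *\<^sub>R X) Z))" for t
  have "((\<lambda>t. br (E (t *\<^sub>R X) Y) (E (t *\<^sub>R X) Z)) has_vector_derivative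
      br (E (t *\<^sub>R X) Y) (br X (E (t *\<^sub>R X) Z)) + br (br X (E (t *\<^sub>R X) Y)) (E (t *\<^sub>R X) Z)) (at t)" for t
    by (intro bounded_bilinear.has_vector_derivative[OF br_bounded] exp_ad_has_vector_derivative)
  then have "(f has_vector_derivative br (- X) (f t) + E (t *\<^sub>R - X)
      (br (E (t *\<^sub>R X) Y) (br X (E (t *\<^sub>R X) Z)) + br (br X (E (t *\<^sub>R X) Y)) (E (t *\<^sub>R X) Z))) (at t)" for t
    unfolding f_def[abs_def] by (intro exp_ad_product_derivative)
  moreover have "br (E (t *\<^sub>R X) Y) (br X (E (t *\<^sub>R X) Z)) + br (br X (E (t *\<^sub>R X) Y)) (E (t *\<^sub>R X) Z) =
      br X (br (E (t *\<^sub>R X) Y) (E (t *\<^sub>R X) Z))" for t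
    by (simp only: jacobi[of X "E (t *\<^sub>R X) Y" "E (t *\<^sub>R X) Z"] add.commute)
  moreover have "E (u *\<^sub>R - X) (br X W) = - br (- X) (E (u *\<^sub>R - X) W)" for u W
    using exp_ad_commute_scaled[of u "- X" W] by (simp add: br_simps linear_neg[OF exp_ad_linear])
  ultimately have "(f has_vector_derivative 0) (at t)" for t by (simp add: f_def)
  from has_vector_derivative_zero_const[OF this, of 1 0]
  have "E (- X) (br (E X Y) (E X Z)) = br Y Z" by (simp add: f_def)
  then show ?thesis by (metis exp_ad_minus')
qed

lemma exp_ad_automorphism: "automorphism (E X)"
  unfolding automorphism_def
  using exp_ad_linear exp_ad_br by (metis bijI' exp_ad_minus exp_ad_minus')

text \<open>Joint continuity, since both the exponent and the vector move in the limits taken later.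
  The series converges uniformly on every ball.\<close>

lemma exp_ad_continuous: "continuous_on UNIV (\<lambda>p. E (fst p) (snd p))"
proof -
  have "continuous_on (cball 0 R) (\<lambda>p::'g \<times> 'g. E (fst p) (snd p))" if R: "R > 0" for R
  proof -
    have u: "uniform_limit (cball 0 R) (\<lambda>n p::'g \<times> 'g. \<Sum>i<n. (1 / fact i) *\<^sub>R (br (fst p) ^^ i) (snd p))
        (\<lambda>p. \<Sum>i. (1 / fact i) *\<^sub>R (br (fst p) ^^ i) (snd p)) sequentially"
    proof (rule Weierstrass_m_test)
      fix n and p :: "'g \<times> 'g" assume p: "p \<in> cball 0 R"
      have a: "norm (fst p) \<le> R" "norm (snd p) \<le> R"
        using p norm_fst_le[of "fst p" "snd p"] norm_snd_le[of "snd p" "fst p"] by auto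
      have "norm ((1 / fact n) *\<^sub>R (br (fst p) ^^ n) (snd p)) \<le>
          (br_const * norm (fst p)) ^ n /\<^sub>R fact n * norm (snd p)" by (rule exp_term_bound)
      also have "\<dots> \<le> (br_const * R) ^ n /\<^sub>R fact n * R"
        using a R br_const(1) by (intro mult_mono scaleR_left_mono power_mono) auto
      finally show "norm ((1 / fact n) *\<^sub>R (br (fst p) ^^ n) (snd p)) \<le> (br_const * R) ^ n /\<^sub>R fact n * R" .
    next
      show "summable (\<lambda>n. (br_const * R) ^ n /\<^sub>R fact n * R)"
        by (intro summable_mult2 summable_exp_generic)
    qed
    have pc: "continuous_on UNIV (\<lambda>p::'g \<times> 'g. (br (fst p) ^^ i) (snd p))" for i
    proof (induction i)
      case (Suc i)
      then show ?case
        by (simp add: bounded_bilinear.continuous_on[OF br_bounded] continuous_on_fst continuous_on_id)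
    qed (simp add: continuous_on_snd continuous_on_id)
    have "continuous_on (cball 0 R) (\<lambda>p::'g \<times> 'g. \<Sum>i. (1 / fact i) *\<^sub>R (br (fst p) ^^ i) (snd p))"
    proof (rule uniform_limit_theorem[OF always_eventually u], rule allI)
      show "continuous_on (cball 0 R) (\<lambda>p::'g \<times> 'g. \<Sum>i<n. (1 / fact i) *\<^sub>R (br (fst p) ^^ i) (snd p))" for n
        by (intro continuous_on_sum continuous_on_scaleR continuous_on_const continuous_on_subset[OF pc]) simp
    qed simp
    then show ?thesis by (simp add: exp_ad_def)
  qed
  note c = this
  show ?thesis
    unfolding continuous_on_eq_continuous_at[OF open_UNIV]
  proof
    fix p :: "'g \<times> 'g"
    have "continuous_on (ball 0 (norm p + 1)) (\<lambda>p::'g \<times> 'g. E (fst p) (snd p))"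
      by (rule continuous_on_subset[OF c[of "norm p + 1"]]) (auto intro: add_nonneg_pos)
    then show "isCont (\<lambda>p. E (fst p) (snd p)) p"
      by (rule continuous_on_interior) (simp add: interior_open)
  qed
qed

lemma exp_ad_tendsto:
  assumes "(f \<longlongrightarrow> X) F" "(g \<longlongrightarrow> Y) F"
  shows "((\<lambda>x. E (f x) (g x)) \<longlongrightarrow> E X Y) F"
proof -
  have "isCont (\<lambda>p. E (fst p) (snd p)) (X, Y)"
    using exp_ad_continuous continuous_on_eq_continuous_at[OF open_UNIV] by blast
  from isCont_tendsto_compose[OF this tendsto_Pair[OF assms]] show ?thesis by simp
qed

text \<open>With a = \<open>br_const * norm X\<close>, dropping the first two terms of the series
  leaves a^2 times a series dominated by that of exp a.\<close>

lemma exp_ad_first_order: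
  "norm (E X Y - Y - br X Y) \<le> (br_const * norm X)^2 * exp (br_const * norm X) * norm Y"
proof -
  define a where "a = br_const * norm X"
  have a: "a \<ge> 0" using br_const(1) by (simp add: a_def)
  define f where "f n = (1 / fact n) *\<^sub>R (br X ^^ n) Y" for n
  have f: "f sums E X Y" unfolding f_def by (rule exp_ad_sums)
  then have "(\<lambda>n. f (n + 2)) sums (E X Y - (\<Sum>i<2. f i))" by (rule sums_split_initial_segment)
  moreover have "(\<Sum>i<2. f i) = Y + br X Y" by (simp add: f_def numeral_2_eq_2)
  ultimately have s: "(\<lambda>n. f (n + 2)) sums (E X Y - Y - br X Y)" by (simp add: diff_diff_eq)
  have le: "norm (f (n + 2)) \<le> a ^ 2 * (a ^ n /\<^sub>R fact n * norm Y)" for n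
  proof -
    have "norm (f (n + 2)) \<le> a ^ (n + 2) /\<^sub>R fact (n + 2) * norm Y"
      unfolding f_def a_def by (rule exp_term_bound)
    also have "\<dots> \<le> a ^ (n + 2) /\<^sub>R fact n * norm Y"
    proof -
      have "(fact n :: real) \<le> fact (n + 2)" by (rule fact_mono) simp
      then have "inverse (fact (n + 2)) \<le> (inverse (fact n) :: real)" by (intro le_imp_inverse_le) auto
      then show ?thesis using a by (intro mult_right_mono scaleR_right_mono) auto
    qed
    finally show ?thesis by (simp add: power_add mult_ac power2_eq_square)
  qed
  have sm: "(\<lambda>n. a ^ 2 * (a ^ n /\<^sub>R fact n * norm Y)) sums (a ^ 2 * (exp a * norm Y))"
    by (intro sums_mult sums_mult2 exp_converges)
  have "norm (suminf (\<lambda>n. f (n + 2))) \<le> (\<Sum>n. a ^ 2 * (a ^ n /\<^sub>R fact n * norm Y))"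
    by (rule norm_suminf_le[OF le]) (use sm sums_summable in blast)
  then show ?thesis
    using sums_unique[OF s] sums_unique[OF sm] by (simp add: a_def mult_ac)
qed

end

context cartan_lie
begin

section \<open>The Cartan decomposition of the adjoint group\<close>

definition derivation :: "('g \<Rightarrow> 'g) \<Rightarrow> bool" where
  "derivation D \<longleftrightarrow> linear D \<and> (\<forall>X Y. D (br X Y) = br (D X) Y + br X (D Y))"

text \<open>Nondegeneracy of the Killing form yields \<open>X\<close> with B(X, Y) = tr(D ad Y). The
  difference D' of D and ad X has tr(D' ad Y) = 0 for all Y, while B(D' Y, Z) = tr(D' ad [Y, Z]).
  Hence D' = 0.\<close>

lemma derivation_inner:
  assumes D: "derivation D"
  shows "\<exists>X. \<forall>Y. D Y = br X Y"
proof -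
  have lD: "linear D" and dD: "\<And>X Y. D (br X Y) = br (D X) Y + br X (D Y)"
    using D by (auto simp: derivation_def)
  define \<phi> where "\<phi> Y = trace_of (\<lambda>W. D (br Y W))" for Y
  have l\<phi>: "linear \<phi>"
    unfolding \<phi>_def trace_of_def
    by (rule linearI)
       (simp_all add: br_simps linear_add[OF lD] linear_scale[OF lD] inner_add_left sum.distrib sum_distrib_left)
  obtain Bs where Bs: "onb Bs UNIV" using onb_exists[OF subspace_UNIV] by blast
  \<comment> \<open>\<open>X0\<close> represents \<open>\<phi>\<close> for \<open>ip\<close>. As
    \<open>ip\<close> is minus the Killing form twisted by \<open>\<theta>\<close>, the vector
    \<open>- \<theta> X0\<close> represents it for \<open>B\<close>.\<close>
  define X0 where "X0 = (\<Sum>b\<in>Bs. \<phi> b *\<^sub>R b)"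
  define X where "X = - \<theta> X0"
  have X0: "ip X0 Y = \<phi> Y" for Y
  proof -
    have "\<phi> Y = \<phi> (\<Sum>b\<in>Bs. ip Y b *\<^sub>R b)" by (simp only: onb_expand[OF Bs])
    also have "\<dots> = (\<Sum>b\<in>Bs. ip Y b * \<phi> b)"
      by (simp add: linear_sum[OF l\<phi>] linear_scale[OF l\<phi>])
    also have "\<dots> = ip X0 Y" by (simp add: X0_def ip_sum_left ip_sym[of Y] mult.commute)
    finally show ?thesis by simp
  qed
  have BX: "B X Y = \<phi> Y" for Y
  proof -
    have "\<phi> Y = - B X0 (\<theta> Y)" using X0[of Y] by (simp add: ip_eq)
    also have "B X0 (\<theta> Y) = B (\<theta> X0) (\<theta> (\<theta> Y))"
      by (rule B_automorphism[OF \<theta>_automorphism, symmetric])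
    finally show ?thesis by (simp add: X_def bilinear_lneg[OF B_bilinear])
  qed
  define D' where "D' Y = D Y - br X Y" for Y
  have lD': "linear D'"
    unfolding D'_def by (intro linear_compose_sub lD ad_linear)
  have dD': "br (D' Y) W = D' (br Y W) - br Y (D' W)" for Y W
    by (simp add: D'_def dD br_simps jacobi[of X Y W])
  have tr0: "trace_of (\<lambda>W. D' (br Y W)) = 0" for Y
    unfolding D'_def trace_of_diff using BX[of Y] by (simp add: \<phi>_def B_def killing_eq_trace)
  have "D' Y = 0" for Y
  proof -
    have "B (D' Y) Z = 0" for Z
    proof -
      have "B (D' Y) Z = trace_of (\<lambda>W. D' (br Y (br Z W))) - trace_of (\<lambda>W. br Y (D' (br Z W)))"
        by (simp add: B_def killing_eq_trace dD' trace_of_diff)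
      also have "trace_of (\<lambda>W. br Y (D' (br Z W))) = trace_of (\<lambda>W. D' (br Z (br Y W)))"
        by (rule trace_of_commute[OF ad_linear, where B="\<lambda>W. D' (br Z W)"])
           (rule linear_compose[OF ad_linear lD', unfolded o_def])
      also have "trace_of (\<lambda>W. D' (br Y (br Z W))) - \<dots> = trace_of (\<lambda>W. D' (br (br Y Z) W))"
        by (simp add: trace_of_diff[symmetric] jacobi_left linear_diff[OF lD'])
      finally show ?thesis using tr0 by simp
    qed
    then have "ip (D' Y) (D' Y) = 0" by (simp add: ip_eq)
    then show ?thesis by (simp add: ip_eq_0_iff)
  qed
  then show ?thesis by (auto simp: D'_def)
qed

section \<open>The groups G and K\<close>

abbreviation G :: "('g \<Rightarrow> 'g) set" where "G \<equiv> isometry_group br"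
abbreviation K :: "('g \<Rightarrow> 'g) set" where "K \<equiv> isotropy_group br \<theta>"

lemma adjoint_group_automorphism: "g \<in> adjoint_group br S \<Longrightarrow> automorphism g"
proof (induction rule: adjoint_group.induct)
  case 1
  show ?case unfolding automorphism_def id_def[symmetric] by (simp add: linear_id)
next
  case (2 X g)
  then show ?case using automorphism_comp exp_ad_automorphism by blast
qed

lemma adjoint_group_comp:
  "g \<in> adjoint_group br S \<Longrightarrow> h \<in> adjoint_group br S \<Longrightarrow> g \<circ> h \<in> adjoint_group br S"
  by (induction rule: adjoint_group.induct) (auto simp: comp_assoc intro: adjoint_group.intros)

lemma adjoint_group_mono: "S \<subseteq> T \<Longrightarrow> g \<in> adjoint_group br S \<Longrightarrow> g \<in> adjoint_group br T"
proof -
  assume S: "S \<subseteq> T" and "g \<in> adjoint_group br S"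
  from this(2) show "g \<in> adjoint_group br T"
  proof (induction rule: adjoint_group.induct)
    case 1
    show ?case by (rule adjoint_group.intros(1))
  next
    case (2 X g)
    show ?case by (rule adjoint_group.intros(2)[OF subsetD[OF S 2(1)] 2(3)])
  qed
qed

lemma exp_in_adjoint_group: "X \<in> S \<Longrightarrow> E X \<in> adjoint_group br S"
  using adjoint_group.intros(2)[OF _ adjoint_group.intros(1)] by fastforce

lemma inv_exp_ad: "inv (E X) = E (- X)"
  by (rule inv_equality) auto

lemma adjoint_group_inv:
  assumes "\<And>X. X \<in> S \<Longrightarrow> - X \<in> S"
  shows "g \<in> adjoint_group br S \<Longrightarrow> inv g \<in> adjoint_group br S"
proof (induction rule: adjoint_group.induct)
  case 1
  show ?case by (metis adjoint_group.intros(1) inv_id)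
next
  case (2 X g)
  have "inv (E X \<circ> g) = inv g \<circ> E (- X)"
    using adjoint_group_automorphism[OF 2(2)] exp_ad_automorphism[of X]
    by (simp add: o_inv_distrib inv_exp_ad automorphism_def)
  moreover have "inv g \<circ> E (- X) \<in> adjoint_group br S"
    by (rule adjoint_group_comp[OF 2(3) exp_in_adjoint_group[OF assms[OF 2(1)]]])
  ultimately show ?case by (simp only:)
qed

lemma G_automorphism: "g \<in> G \<Longrightarrow> automorphism g"
  and G_comp: "g \<in> G \<Longrightarrow> h \<in> G \<Longrightarrow> g \<circ> h \<in> G"
  and G_inv: "g \<in> G \<Longrightarrow> inv g \<in> G"
  and exp_in_G: "E X \<in> G"
  and id_in_G: "id \<in> G"
  using adjoint_group_automorphism adjoint_group_comp adjoint_group_inv[of UNIV]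
    exp_in_adjoint_group adjoint_group.intros(1)
  by (auto simp: isometry_group_def)

lemma adjoint_group_sub_G: "g \<in> adjoint_group br S \<Longrightarrow> g \<in> G"
  unfolding isometry_group_def using adjoint_group_mono by blast

lemma K_iff: "g \<in> K \<longleftrightarrow> g \<in> G \<and> (\<forall>X. g (\<theta> X) = \<theta> (g X))"
  by (auto simp: isotropy_group_def fun_eq_iff)

lemma K_comp: "g \<in> K \<Longrightarrow> h \<in> K \<Longrightarrow> g \<circ> h \<in> K"
  using G_comp by (auto simp: K_iff)

lemma K_inv: assumes "g \<in> K" shows "inv g \<in> K"
proof -
  have a: "automorphism g" using assms G_automorphism K_iff by blast
  have "inv g (\<theta> X) = \<theta> (inv g X)" for X
  proof -
    have "g (\<theta> (inv g X)) = \<theta> X" using assms a by (simp add: K_iff automorphism_inv2)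
    then show ?thesis using automorphism_inv1[OF a] by metis
  qed
  then show ?thesis using assms G_inv by (simp add: K_iff)
qed

lemma K_automorphism: "k \<in> K \<Longrightarrow> automorphism k"
  using G_automorphism K_iff by blast

lemma id_in_K: "id \<in> K"
  using id_in_G by (simp add: K_iff)

lemma K_\<theta>: "k \<in> K \<Longrightarrow> k (\<theta> X) = \<theta> (k X)"
  by (simp add: K_iff)

lemma K_p: "k \<in> K \<Longrightarrow> X \<in> \<pp> \<Longrightarrow> k X \<in> \<pp>"
  and K_k: "k \<in> K \<Longrightarrow> X \<in> \<kk> \<Longrightarrow> k X \<in> \<kk>"
  by (auto simp: p_iff k_iff K_\<theta>[symmetric] linear_neg[OF automorphism_linear[OF K_automorphism]])

lemma K_ip: "k \<in> K \<Longrightarrow> ip (k X) (k Y) = ip X Y"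
  using B_automorphism[OF K_automorphism] by (simp add: ip_eq K_\<theta>[symmetric])

lemma adjoint_group_k: "S \<subseteq> \<kk> \<Longrightarrow> g \<in> adjoint_group br S \<Longrightarrow> g \<in> K"
proof -
  assume S: "S \<subseteq> \<kk>" and g: "g \<in> adjoint_group br S"
  have "g (\<theta> X) = \<theta> (g X)" for X
    using g
  proof (induction arbitrary: X rule: adjoint_group.induct)
    case (2 Y g)
    then have "\<theta> Y = Y" using S by (auto simp: k_iff)
    then show ?case using 2 exp_ad_\<theta>[of Y] by simp
  qed simp
  then show "g \<in> K" using g adjoint_group_sub_G by (simp add: K_iff)
qed

lemma ip_adjoint:
  assumes "automorphism g"
  shows "ip (g X) Y = ip X (\<theta> (inv g (\<theta> Y)))"
proof -
  have "B (g X) (\<theta> Y) = B (g X) (g (inv g (\<theta> Y)))" by (simp only: automorphism_inv2[OF assms])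
  then show ?thesis by (simp add: ip_eq B_automorphism[OF assms])
qed

lemma exp_ad_p_adjoint: "X \<in> \<pp> \<Longrightarrow> ip (E X Y) Z = ip Y (E X Z)"
  using ip_adjoint[OF exp_ad_automorphism, of X] by (simp add: inv_exp_ad exp_ad_\<theta> p_iff linear_neg[OF \<theta>_linear])

lemma exp_ad_double: "E (2 *\<^sub>R X) Y = E X (E X Y)"
  using exp_ad_add[of 1 1 X Y] by (simp add: scaleR_2)

text \<open>An eigenvector of \<open>ad X\<close> for l is expanded in an eigenbasis of
  \<open>ad Y\<close>. Both exponentials scale it by exp l, and exp is injective, so only components
  with eigenvalue l occur. Thus ad X = ad Y, and the center is zero.\<close>

lemma exp_ad_p_injective:
  assumes X: "X \<in> \<pp>" and Y: "Y \<in> \<pp>" and eq: "\<And>v. E X v = E Y v"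
  shows "X = Y"
proof -
  obtain Bx where Bx: "eigenbasis (br X) Bx" using eigenbasis_exists[OF self_adjoint_p[OF X]] by blast
  obtain By where By: "eigenbasis (br Y) By" using eigenbasis_exists[OF self_adjoint_p[OF Y]] by blast
  have ox: "onb Bx UNIV" and oy: "onb By UNIV" using Bx By by (auto simp: eigenbasis_def)
  have "br X b = br Y b" if b: "b \<in> Bx" for b
  proof -
    define l where "l = ip (br X b) b"
    have l: "br X b = l *\<^sub>R b" using Bx b by (simp add: eigenbasis_def l_def)
    have Eb: "E Y b = exp l *\<^sub>R b" using exp_ad_eigen[OF l] eq by simp
    have "br Y b = br Y (\<Sum>c\<in>By. ip b c *\<^sub>R c)" by (simp only: onb_expand[OF oy])
    also have "\<dots> = (\<Sum>c\<in>By. ip b c *\<^sub>R br Y c)" by (simp add: br_sum_right br_simps)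
    also have "\<dots> = (\<Sum>c\<in>By. l *\<^sub>R (ip b c *\<^sub>R c))"
    proof (rule sum.cong)
      fix c assume c: "c \<in> By"
      define m where "m = ip (br Y c) c"
      have m: "br Y c = m *\<^sub>R c" using By c by (simp add: eigenbasis_def m_def)
      have "ip (E Y b) c = ip b (E Y c)" by (rule exp_ad_p_adjoint[OF Y])
      then have "exp l * ip b c = exp m * ip b c" by (simp add: Eb exp_ad_eigen[OF m])
      then have "ip b c = 0 \<or> l = m" by auto
      then show "ip b c *\<^sub>R br Y c = l *\<^sub>R (ip b c *\<^sub>R c)" by (auto simp: m)
    qed simp
    also have "\<dots> = l *\<^sub>R (\<Sum>c\<in>By. ip b c *\<^sub>R c)" by (simp add: scaleR_sum_right)
    also have "\<dots> = br X b" by (simp only: onb_expand[OF oy] l)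
    finally show ?thesis by simp
  qed
  then have "br X v = br Y v" for v by (rule linear_eq_on_onb[OF ox ad_linear ad_linear])
  then have "br (X - Y) v = 0" for v by (simp add: br_simps)
  then have "X - Y = 0" by (rule center_zero)
  then show ?thesis by simp
qed

text \<open>Eigenvalues of an automorphism multiply under the bracket, so those of its logarithm
  add: the logarithm is a derivation, hence of the form ad Z. Self-adjointness means ad(\<theta> Z)
  = - ad Z, which puts Z into the p-part.\<close>

lemma positive_automorphism_log:
  assumes P: "automorphism P" and sa: "self_adjoint P" and pos: "\<And>X. X \<noteq> 0 \<Longrightarrow> ip (P X) X > 0"
  shows "\<exists>Z\<in>\<pp>. \<forall>X. P X = E Z X"
proof -
  obtain Bs where Bs: "eigenbasis P Bs" using eigenbasis_exists[OF sa] by blast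
  have o: "onb Bs UNIV" using Bs by (simp add: eigenbasis_def)
  define l where "l b = ip (P b) b" for b
  have Pb: "P b = l b *\<^sub>R b" if "b \<in> Bs" for b using Bs that by (simp add: eigenbasis_def l_def)
  have lpos: "l b > 0" if "b \<in> Bs" for b
  proof -
    have "b \<noteq> 0" using onb_unit[OF o that] by (auto simp: ip_simps)
    then show ?thesis using pos by (simp add: l_def)
  qed
  define D where "D = fun_calc ln P"
  have lD: "linear D" by (simp add: D_def fun_calc_linear)
  have Db: "D u = ln m *\<^sub>R u" if "P u = m *\<^sub>R u" for u m
    unfolding D_def by (rule fun_calc_eigenvector[OF sa that])
  have lP: "linear P" using sa by (simp add: self_adjoint_def)
  have "D (br X Y) = br (D X) Y + br X (D Y)" for X Y
  proof -
    have bb: "D (br b c) = br (D b) c + br b (D c)" if b: "b \<in> Bs" and c: "c \<in> Bs" for b c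
    proof -
      have "P (br b c) = (l b * l c) *\<^sub>R br b c"
        by (simp add: automorphism_br[OF P] Pb[OF b] Pb[OF c])
      then have "D (br b c) = ln (l b * l c) *\<^sub>R br b c" by (rule Db)
      also have "ln (l b * l c) = ln (l b) + ln (l c)" using lpos[OF b] lpos[OF c] by (rule ln_mult_pos)
      finally show ?thesis by (simp add: Db[OF Pb[OF b]] Db[OF Pb[OF c]] algebra_simps)
    qed
    have l1: "linear (\<lambda>X. D (br X Y))" for Y using linear_compose[OF ad_linear_left lD] by (simp add: o_def)
    have l2: "linear (\<lambda>Y. D (br X Y))" for X using linear_compose[OF ad_linear lD] by (simp add: o_def)
    have l3: "linear (\<lambda>X. br (D X) Y + br X (D Y))" for Y
      using linear_compose[OF lD ad_linear_left] by (intro linear_compose_add ad_linear_left) (simp add: o_def)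
    have l4: "linear (\<lambda>Y. br (D X) Y + br X (D Y))" for X
      using linear_compose[OF lD ad_linear] by (intro linear_compose_add ad_linear) (simp add: o_def)
    have "D (br X c) = br (D X) c + br X (D c)" if "c \<in> Bs" for c
      by (rule linear_eq_on_onb[OF o l1 l3 bb[OF _ that]])
    then show ?thesis by (rule linear_eq_on_onb[OF o l2 l4])
  qed
  then have "derivation D" using lD by (simp add: derivation_def)
  then obtain Z where Z: "\<And>Y. D Y = br Z Y" using derivation_inner by blast
  have D_sa: "ip (D X) Y = ip X (D Y)" for X Y
  proof -
    have e: "D X = (\<Sum>b\<in>Bs. (ln (l b) * ip X b) *\<^sub>R b)" for X
      unfolding D_def by (rule fun_calc_onb[OF sa o Pb])
    show ?thesis by (simp add: e ip_sum_left ip_sum_right ip_sym[of _ Y] mult_ac)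
  qed
  have Zp: "Z \<in> \<pp>"
  proof -
    have "br (Z + \<theta> Z) Y = 0" for Y
    proof (rule ip_eqI)
      fix W
      have "ip (br (\<theta> Z) Y) W = - ip Y (br Z W)" using ad_adjoint[of "\<theta> Z" Y W] by simp
      also have "\<dots> = - ip (br Z Y) W" using D_sa[of Y W] by (simp add: Z)
      finally show "ip (br (Z + \<theta> Z) Y) W = ip 0 W" by (simp add: br_simps ip_simps)
    qed
    then have "Z + \<theta> Z = 0" by (rule center_zero)
    then show ?thesis by (simp add: p_iff add_eq_0_iff)
  qed
  have "P X = E Z X" for X
  proof (rule linear_eq_on_onb[OF o lP exp_ad_linear])
    fix b assume b: "b \<in> Bs"
    have "br Z b = ln (l b) *\<^sub>R b" using Db[OF Pb[OF b]] by (simp add: Z)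
    then have "E Z b = exp (ln (l b)) *\<^sub>R b" by (rule exp_ad_eigen)
    then show "P b = E Z b" using lpos[OF b] Pb[OF b] by simp
  qed
  then show ?thesis using Zp by blast
qed

text \<open>Polar decomposition. \<open>T\<close> is the \<open>ip\<close>-adjoint of
  \<open>g\<close>, and \<open>g \<circ> T\<close> is a positive automorphism, so it is
  \<open>E Z\<close> for some \<open>Z\<close> in the p-part. Its square root E(Z/2) is the positive
  factor of \<open>g\<close>, and the remaining factor commutes with
  \<open>\<theta>\<close>.\<close>

lemma cartan_decomposition:
  assumes g: "g \<in> G"
  shows "\<exists>X\<in>\<pp>. \<exists>k\<in>K. g = E X \<circ> k"
proof -
  have a: "automorphism g" by (rule G_automorphism[OF g])
  have ai: "automorphism (inv g)" by (rule automorphism_inv[OF a])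
  define T where "T X = \<theta> (inv g (\<theta> X))" for X
  have aT: "automorphism T"
    using automorphism_comp[OF automorphism_comp[OF \<theta>_automorphism ai] \<theta>_automorphism]
    by (simp add: T_def[abs_def] comp_def)
  have ipT: "ip (g X) Y = ip X (T Y)" for X Y unfolding T_def by (rule ip_adjoint[OF a])
  have aP: "automorphism (g \<circ> T)" by (rule automorphism_comp[OF a aT])
  have "self_adjoint (g \<circ> T)"
    unfolding self_adjoint_def
  proof (intro conjI allI)
    show "linear (g \<circ> T)" by (rule automorphism_linear[OF aP])
    show "ip ((g \<circ> T) X) Y = ip X ((g \<circ> T) Y)" for X Y
      using ipT[of "T X" Y] ipT[of "T Y" X] ip_sym[of "T X" "T Y"] ip_sym[of X "g (T Y)"] by simp
  qed
  moreover have "ip ((g \<circ> T) X) X > 0" if "X \<noteq> 0" for X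
  proof -
    have "T X \<noteq> 0"
      using that automorphism_inv1[OF aT, of X] automorphism_linear[OF automorphism_inv[OF aT]] linear_0 by metis
    then show ?thesis using ip_pos by (simp add: ipT)
  qed
  ultimately obtain Z where Z: "Z \<in> \<pp>" "\<And>X. g (T X) = E Z X"
    using positive_automorphism_log[OF aP] by auto
  define X where "X = (1/2) *\<^sub>R Z"
  have X: "X \<in> \<pp>" using Z(1) subspace_p by (simp add: X_def subspace_scale)
  have gT: "g (T Y) = E X (E X Y)" for Y
    using Z(2)[of Y] exp_ad_double[of X Y] by (simp add: X_def)
  have \<theta>X: "\<theta> X = - X" using X by (simp add: p_iff)
  define k where "k = E (- X) \<circ> g"
  have "k (\<theta> Y) = \<theta> (k Y)" for Y
  proof -
    have "T (\<theta> (g Y)) = \<theta> Y" by (simp add: T_def automorphism_inv1[OF a])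
    then have "g (\<theta> Y) = E X (E X (\<theta> (g Y)))" using gT by metis
    then show ?thesis by (simp add: k_def exp_ad_\<theta> linear_neg[OF \<theta>_linear] \<theta>X)
  qed
  moreover have "k \<in> G" unfolding k_def using G_comp exp_in_G g by blast
  ultimately have "k \<in> K" by (simp add: K_iff)
  moreover have "g = E X \<circ> k" by (auto simp: k_def)
  ultimately show ?thesis using X by blast
qed

section \<open>The exponential map of the symmetric space\<close>

abbreviation Exp :: "'g \<Rightarrow> ('g \<Rightarrow> 'g) set" where "Exp \<equiv> Exp_o br \<theta>"

lemma act_comp: "act (g \<circ> h) p = act g (act h p)"
  by (auto simp: act_def image_image comp_assoc)

lemma act_id [simp]: "act id p = p"
  by (simp add: act_def)

lemma act_K: "k \<in> K \<Longrightarrow> act k K = K"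
proof
  assume k: "k \<in> K"
  show "act k K \<subseteq> K" using k K_comp by (auto simp: act_def)
  show "K \<subseteq> act k K"
  proof
    fix h assume "h \<in> K"
    then have "inv k \<circ> h \<in> K" using K_comp[OF K_inv[OF k]] by blast
    moreover have "h = k \<circ> (inv k \<circ> h)"
      by (auto simp: automorphism_inv2[OF K_automorphism[OF k]])
    ultimately show "h \<in> act k K" unfolding act_def by blast
  qed
qed

lemma act_K_imp: "act g K = K \<Longrightarrow> g \<in> K"
  unfolding act_def using id_in_K by (metis comp_id image_eqI)

lemma Exp_eq: "Exp X = act (E X) K"
  by (simp add: Exp_o_def origin_def)

lemma Exp_0: "Exp 0 = K"
  unfolding Exp_eq by (auto simp: act_def o_def)

lemma act_inverse: "automorphism g \<Longrightarrow> act (inv g) (act g p) = p" "automorphism g \<Longrightarrow> act g (act (inv g) p) = p"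
proof -
  assume g: "automorphism g"
  have "inv g \<circ> g = id" "g \<circ> inv g = id"
    using automorphism_inv1[OF g] automorphism_inv2[OF g] by auto
  then show "act (inv g) (act g p) = p" "act g (act (inv g) p) = p"
    by (metis act_comp act_id)+
qed

lemma act_exp_inverse [simp]: "act (E (- X)) (act (E X) p) = p" "act (E X) (act (E (- X)) p) = p"
  using act_inverse[OF exp_ad_automorphism, of X p] by (simp_all add: inv_exp_ad)

lemma act_K_Exp: "k \<in> K \<Longrightarrow> act k (Exp X) = Exp (k X)"
proof -
  assume k: "k \<in> K"
  have "k \<circ> E X = E (k X) \<circ> k"
    using exp_ad_equivariant[of k X] automorphism_linear[OF K_automorphism[OF k]] automorphism_br[OF K_automorphism[OF k]]
    by auto
  then show ?thesis by (metis Exp_eq act_comp act_K[OF k])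
qed

text \<open>The hypothesis means g E(Y) = E(W) k with an unknown k in K. Multiplying by the adjoint
  removes k, which is orthogonal for \<open>ip\<close>: E(2W) = g E(2Y) g*, where g* = \<theta> g^-1
  \<theta>.\<close>

lemma Exp_transition:
  assumes g: "g \<in> G" and Y: "Y \<in> \<pp>" and W: "W \<in> \<pp>" and eq: "act g (Exp Y) = Exp W"
  shows "E (2 *\<^sub>R W) v = g (E (2 *\<^sub>R Y) (\<theta> (inv g (\<theta> v))))"
proof -
  define k where "k = E (- W) \<circ> (g \<circ> E Y)"
  have "act k K = act (E (- W)) (act g (Exp Y))" by (simp add: k_def act_comp Exp_eq)
  also have "\<dots> = act (E (- W)) (act (E W) K)" by (simp only: eq Exp_eq[of W])
  also have "\<dots> = K" by (rule act_exp_inverse)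
  finally have k: "k \<in> K" by (rule act_K_imp)
  have gE: "g (E Y u) = E W (k u)" for u by (simp add: k_def)
  have ag: "automorphism g" by (rule G_automorphism[OF g])
  have "\<theta> (k u) = E W (\<theta> (g (E Y u)))" for u
    using W by (simp add: k_def exp_ad_\<theta> p_iff linear_neg[OF \<theta>_linear])
  then have kt: "k (\<theta> u) = E W (\<theta> (g (E Y u)))" for u by (simp add: K_\<theta>[OF k])
  define u where "u = E (- Y) (inv g (\<theta> v))"
  have "\<theta> u = E Y (\<theta> (inv g (\<theta> v)))"
    using Y by (simp add: u_def exp_ad_\<theta> p_iff linear_neg[OF \<theta>_linear])
  then have "g (E (2 *\<^sub>R Y) (\<theta> (inv g (\<theta> v)))) = g (E Y (\<theta> u))" by (simp add: exp_ad_double)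
  also have "\<dots> = E W (k (\<theta> u))" by (rule gE)
  also have "\<dots> = E W (E W (\<theta> (g (E Y u))))" by (simp only: kt)
  also have "g (E Y u) = \<theta> v" by (simp add: u_def automorphism_inv2[OF ag])
  finally show ?thesis by (simp add: exp_ad_double)
qed

lemma Exp_inj: "X \<in> \<pp> \<Longrightarrow> Y \<in> \<pp> \<Longrightarrow> Exp X = Exp Y \<Longrightarrow> X = Y"
proof -
  assume X: "X \<in> \<pp>" and Y: "Y \<in> \<pp>" and eq: "Exp X = Exp Y"
  have "E (2 *\<^sub>R Y) v = E (2 *\<^sub>R X) v" for v
    using Exp_transition[OF id_in_G X Y, of v] eq by (simp add: inv_id[unfolded id_def])
  with subspace_scale[OF subspace_p Y] subspace_scale[OF subspace_p X]
  have "2 *\<^sub>R Y = 2 *\<^sub>R X" by (rule exp_ad_p_injective)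
  then show "X = Y" by simp
qed

lemma sym_space_eq: "sym_space br \<theta> = Exp ` \<pp>"
proof
  show "sym_space br \<theta> \<subseteq> Exp ` \<pp>"
  proof
    fix p assume "p \<in> sym_space br \<theta>"
    then obtain g where g: "g \<in> G" "p = act g K" by (auto simp: sym_space_def origin_def)
    obtain X k where "X \<in> \<pp>" "k \<in> K" "g = E X \<circ> k" using cartan_decomposition[OF g(1)] by blast
    then show "p \<in> Exp ` \<pp>" using g(2) by (auto simp: act_comp act_K Exp_eq)
  qed
  show "Exp ` \<pp> \<subseteq> sym_space br \<theta>"
    using exp_in_G by (auto simp: sym_space_def origin_def Exp_eq)
qed

lemma act_sym_space: "g \<in> G \<Longrightarrow> p \<in> sym_space br \<theta> \<Longrightarrow> act g p \<in> sym_space br \<theta>"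
  unfolding sym_space_def using G_comp by (auto simp: act_comp[symmetric])

lemma transition_exists: "g \<in> G \<Longrightarrow> Y \<in> \<pp> \<Longrightarrow> \<exists>W\<in>\<pp>. act g (Exp Y) = Exp W"
  using act_sym_space[of g "Exp Y"] sym_space_eq by auto

section \<open>Recovering a limit of X from limits of ad X or exp(ad X)\<close>

lemma ad_tendsto_imp:
  assumes "\<And>v. ((\<lambda>s. br (f s) v) \<longlongrightarrow> br X v) F"
  shows "(f \<longlongrightarrow> X) F"
proof -
  obtain Bs where Bs: "onb Bs UNIV" using onb_exists[OF subspace_UNIV] by blast
  have B: "((\<lambda>s. B (f s) Z) \<longlongrightarrow> B X Z) F" for Z
    unfolding B_def killing_def by (intro tendsto_sum tendsto_inner assms tendsto_const)
  have "((\<lambda>s. \<Sum>b\<in>Bs. ip (f s) b *\<^sub>R b) \<longlongrightarrow> (\<Sum>b\<in>Bs. ip X b *\<^sub>R b)) F"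
    unfolding ip_eq by (intro tendsto_sum tendsto_scaleR tendsto_minus B tendsto_const)
  then show ?thesis by (simp only: onb_expand[OF Bs])
qed

lemma p_spectrum_bound:
  assumes X: "X \<in> \<pp>" and b: "\<And>l u. u \<noteq> 0 \<Longrightarrow> br X u = l *\<^sub>R u \<Longrightarrow> \<bar>l\<bar> \<le> c"
  shows "ip (br X v) (br X v) \<le> c^2 * ip v v"
proof -
  obtain Bx where Bx: "eigenbasis (br X) Bx" using eigenbasis_exists[OF self_adjoint_p[OF X]] by blast
  have o: "onb Bx UNIV" using Bx by (simp add: eigenbasis_def)
  have "ip (br X v) (br X v) = (\<Sum>b\<in>Bx. ip (br X v) b * ip (br X v) b)" by (rule onb_ip_sum[OF o])
  also have "\<dots> \<le> (\<Sum>b\<in>Bx. c^2 * (ip v b * ip v b))"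
  proof (rule sum_mono)
    fix b assume bB: "b \<in> Bx"
    define l where "l = ip (br X b) b"
    have l: "br X b = l *\<^sub>R b" using Bx bB by (simp add: eigenbasis_def l_def)
    have "b \<noteq> 0" using onb_unit[OF o bB] by (auto simp: ip_simps)
    then have "\<bar>l\<bar> \<le> c" using b l by blast
    then have l2: "l^2 \<le> c^2" by (rule abs_le_square_iff[THEN iffD1, OF order_trans[OF _ abs_ge_self]])
    have "ip (br X v) b = ip v (br X b)" using self_adjoint_p[OF X] by (simp add: self_adjoint_def)
    then have "ip (br X v) b = l * ip v b" by (simp add: l)
    then have "ip (br X v) b * ip (br X v) b = l^2 * (ip v b * ip v b)" by (simp add: power2_eq_square)
    also have "\<dots> \<le> c^2 * (ip v b * ip v b)" using l2 by (intro mult_right_mono) auto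
    finally show "ip (br X v) b * ip (br X v) b \<le> c^2 * (ip v b * ip v b)" .
  qed
  also have "\<dots> = c^2 * ip v v" by (simp add: onb_ip_sum[OF o, of v v] sum_distrib_left)
  finally show ?thesis .
qed

text \<open>Convergence of the operators \<open>exp (ad X\<^sub>n)\<close> forces the sequence \<open>X\<^sub>n\<close> to be bounded: an
  eigenvalue \<open>l\<close> of \<open>ad X\<^sub>n\<close> contributes the eigenvalues \<open>exp l\<close> and, after applying \<open>\<theta>\<close>,
  \<open>exp (- l)\<close>.\<close>

lemma exp_ad_p_bounded:
  assumes X: "\<And>n. X n \<in> \<pp>" and bd: "\<And>v. bounded (range (\<lambda>n. E (X n) v))"
  shows "bounded (range X)"
proof -
  have "\<exists>c. \<forall>b\<in>Basis. \<forall>n. norm (E (X n) b) \<le> c"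
  proof -
    have "\<forall>b. \<exists>c. \<forall>n. norm (E (X n) b) \<le> c" using bd by (auto simp: bounded_iff)
    then obtain c where c: "\<And>b n. norm (E (X n) b) \<le> c b" by metis
    have "norm (E (X n) b) \<le> (\<Sum>b\<in>Basis. c b)" if "b \<in> Basis" for b n
    proof -
      have "c b \<ge> 0" for b using order_trans[OF norm_ge_zero c] .
      then have "c b \<le> (\<Sum>b\<in>Basis. c b)" using that by (intro member_le_sum) auto
      then show ?thesis using c order_trans by blast
    qed
    then show ?thesis by blast
  qed
  then obtain c where c: "\<And>b n. b \<in> Basis \<Longrightarrow> norm (E (X n) b) \<le> c" by blast
  have Ev: "norm (E (X n) v) \<le> real DIM('g) * c * norm v" for n v
  proof -
    have "E (X n) v = E (X n) (\<Sum>b\<in>Basis. (v \<bullet> b) *\<^sub>R b)" by (simp only: euclidean_representation)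
    also have "\<dots> = (\<Sum>b\<in>Basis. (v \<bullet> b) *\<^sub>R E (X n) b)"
      by (simp add: linear_sum[OF exp_ad_linear] linear_scale[OF exp_ad_linear])
    finally have "norm (E (X n) v) \<le> (\<Sum>b\<in>Basis. norm ((v \<bullet> b) *\<^sub>R E (X n) b))"
      by (simp only: norm_sum)
    also have "\<dots> \<le> (\<Sum>b\<in>(Basis::'g set). norm v * c)"
      unfolding norm_scaleR
    proof (rule sum_mono)
      fix b :: 'g assume b: "b \<in> Basis"
      show "\<bar>v \<bullet> b\<bar> * norm (E (X n) b) \<le> norm v * c"
        by (rule mult_mono[OF Basis_le_norm[OF b] c[OF b]]) auto
    qed
    finally show ?thesis by (simp add: mult_ac)
  qed
  define C where "C = real DIM('g) * c"
  define L where "L = \<bar>ln C\<bar>"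
  have eig: "l \<le> L" if "u \<noteq> 0" "br (X n) u = l *\<^sub>R u" for n l u
  proof -
    have "exp l * norm u \<le> C * norm u"
      using Ev[of n u] exp_ad_eigen[OF that(2)] by (simp add: C_def)
    then have "exp l \<le> C" using that(1) by simp
    then have "l \<le> ln C" using exp_gt_zero[of l] by (metis ln_exp ln_le_cancel_iff order_less_le_trans)
    then show ?thesis by (simp add: L_def)
  qed
  have abs_eig: "\<bar>l\<bar> \<le> L" if u: "u \<noteq> 0" "br (X n) u = l *\<^sub>R u" for n l u
  proof -
    have "br (X n) (\<theta> u) = (- l) *\<^sub>R \<theta> u"
    proof -
      have "br (X n) (\<theta> u) = \<theta> (br (\<theta> (X n)) u)" by (simp add: \<theta>_br)
      also have "\<dots> = \<theta> (- (l *\<^sub>R u))" using X[of n] u(2) by (simp add: p_iff br_simps)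
      finally show ?thesis by (simp add: linear_neg[OF \<theta>_linear] linear_scale[OF \<theta>_linear])
    qed
    moreover have "\<theta> u \<noteq> 0" using u(1) by (metis \<theta>_\<theta> linear_0[OF \<theta>_linear])
    ultimately have "- l \<le> L" using eig by blast
    then show ?thesis using eig[OF u] by linarith
  qed
  obtain C' where C': "C' > 0" "\<And>x. norm x ^ 2 \<le> C' * ip x x" using ip_norm_bound by blast
  obtain Bs where Bs: "onb Bs UNIV" using onb_exists[OF subspace_UNIV] by blast
  define d where "d v = L * sqrt (C' * ip v v)" for v
  have brd: "norm (br (X n) v) \<le> d v" for n v
  proof -
    have L0: "L \<ge> 0" by (simp add: L_def)
    have "ip (br (X n) v) (br (X n) v) \<le> L^2 * ip v v"
      by (rule p_spectrum_bound[OF X]) (rule abs_eig)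
    then have "C' * ip (br (X n) v) (br (X n) v) \<le> C' * (L^2 * ip v v)"
      using C'(1) by simp
    then have "norm (br (X n) v) ^ 2 \<le> C' * (L^2 * ip v v)"
      using C'(2)[of "br (X n) v"] by linarith
    also have "\<dots> = d v ^ 2" using C'(1) ip_ge_0 by (simp add: d_def power_mult_distrib)
    finally show ?thesis by (rule power2_le_imp_le) (use C'(1) ip_ge_0 L0 in \<open>simp add: d_def\<close>)
  qed
  define M where "M Z = (\<Sum>b\<in>Basis. d (br (\<theta> Z) b))" for Z
  have ipM: "\<bar>ip (X n) Z\<bar> \<le> M Z" for n Z
  proof -
    have "ip (X n) Z = - (\<Sum>b\<in>Basis. br (X n) (br (\<theta> Z) b) \<bullet> b)" by (simp add: ip_eq B_def killing_def)
    then have "\<bar>ip (X n) Z\<bar> \<le> (\<Sum>b\<in>Basis. \<bar>br (X n) (br (\<theta> Z) b) \<bullet> b\<bar>)" by (simp add: sum_abs)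
    also have "\<dots> \<le> (\<Sum>b\<in>Basis. d (br (\<theta> Z) b))"
      by (rule sum_mono) (rule order_trans[OF Basis_le_norm brd])
    finally show ?thesis by (simp add: M_def)
  qed
  have "norm (X n) \<le> (\<Sum>b\<in>Bs. M b * norm b)" for n
  proof -
    have "norm (X n) = norm (\<Sum>b\<in>Bs. ip (X n) b *\<^sub>R b)" by (simp only: onb_expand[OF Bs])
    also have "\<dots> \<le> (\<Sum>b\<in>Bs. norm (ip (X n) b *\<^sub>R b))" by (rule norm_sum)
    also have "\<dots> \<le> (\<Sum>b\<in>Bs. M b * norm b)"
      unfolding norm_scaleR using ipM by (intro sum_mono mult_right_mono) auto
    finally show ?thesis .
  qed
  then show ?thesis by (auto simp: bounded_iff)
qed

text \<open>The sequence is bounded by \<open>exp_ad_p_bounded\<close>. The limit of any convergent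
  subsequence has the same exponential as \<open>Y\<close>, hence equals \<open>Y\<close>; a
  subsequence staying away from \<open>Y\<close> is therefore impossible.\<close>

lemma exp_ad_p_tendsto_imp:
  assumes X: "\<And>n. X n \<in> \<pp>" and Y: "Y \<in> \<pp>" and lim: "\<And>v. (\<lambda>n. E (X n) v) \<longlonglongrightarrow> E Y v"
  shows "X \<longlonglongrightarrow> Y"
proof (rule ccontr)
  assume "\<not> X \<longlonglongrightarrow> Y"
  then obtain e where e: "e > 0" "\<And>N. \<exists>n\<ge>N. dist (X n) Y \<ge> e"
    unfolding lim_sequentially by (meson not_le)
  define I where "I = {n. dist (X n) Y \<ge> e}"
  have inf: "infinite I"
    unfolding infinite_nat_iff_unbounded_le I_def using e(2) by auto
  define s where "s = enumerate I"
  have s: "strict_mono s" "\<And>n. dist (X (s n)) Y \<ge> e"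
    using inf enumerate_in_set[OF inf] strict_mono_enumerate[OF inf] by (auto simp: s_def I_def)
  have "bounded (range X)"
    by (rule exp_ad_p_bounded[OF X]) (use lim convergent_imp_bounded in blast)
  then have "bounded (range (X \<circ> s))" by (rule bounded_subset) auto
  then obtain L t where t: "strict_mono t" "(X \<circ> s \<circ> t) \<longlonglongrightarrow> L"
    using bounded_imp_convergent_subsequence by blast
  have Lp: "L \<in> \<pp>"
    by (rule closed_sequentially[OF closed_subspace[OF subspace_p] _ t(2)]) (use X in auto)
  have "E L v = E Y v" for v
  proof -
    have "(\<lambda>n. E ((X \<circ> s \<circ> t) n) v) \<longlonglongrightarrow> E L v" by (intro exp_ad_tendsto t tendsto_const)
    moreover have "(\<lambda>n. E ((X \<circ> s \<circ> t) n) v) \<longlonglongrightarrow> E Y v"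
      using LIMSEQ_subseq_LIMSEQ[OF lim[of v] strict_mono_o[OF s(1) t(1)]] by (simp add: o_def)
    ultimately show ?thesis by (rule LIMSEQ_unique)
  qed
  then have "L = Y" by (rule exp_ad_p_injective[OF Lp Y])
  then have "\<forall>\<^sub>F n in sequentially. dist ((X \<circ> s \<circ> t) n) Y < e"
    using t(2) e(1) by (simp add: tendsto_iff)
  then show False using s(2) by (auto simp: eventually_sequentially not_less[symmetric])
qed

end

section \<open>Conjugacy of maximal abelian subspaces\<close>

context inner_form
begin

definition proj :: "'g set \<Rightarrow> 'g \<Rightarrow> 'g" where
  "proj S v = (let B = (SOME B. onb B S) in \<Sum>b\<in>B. ip v b *\<^sub>R b)"

lemma proj_linear: "linear (proj S)"
  unfolding proj_def Let_def
  by (rule linearI) (auto simp: ip_simps algebra_simps sum.distrib scaleR_sum_right)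

lemma
  assumes S: "subspace S"
  shows proj_mem: "proj S v \<in> S"
    and proj_id: "v \<in> S \<Longrightarrow> proj S v = v"
    and proj_orth: "(\<And>w. w \<in> S \<Longrightarrow> ip v w = 0) \<Longrightarrow> proj S v = 0"
    and proj_diff_orth: "w \<in> S \<Longrightarrow> ip (v - proj S v) w = 0"
proof -
  define B where "B = (SOME B. onb B S)"
  have B: "onb B S" using someI_ex[OF onb_exists[OF S]] by (simp add: B_def)
  have p: "proj S v = (\<Sum>b\<in>B. ip v b *\<^sub>R b)" for v by (simp add: proj_def B_def)
  have BS: "B \<subseteq> S" using B by (simp add: onb_def)
  show "proj S v \<in> S"
    unfolding p by (rule subspace_sum[OF S]) (use BS S in \<open>auto simp: subspace_scale\<close>)
  show "v \<in> S \<Longrightarrow> proj S v = v" unfolding p using B by (auto simp: onb_def)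
  show "(\<And>w. w \<in> S \<Longrightarrow> ip v w = 0) \<Longrightarrow> proj S v = 0"
    unfolding p using BS by (intro sum.neutral) auto
  assume w: "w \<in> S"
  have wB: "w = (\<Sum>b\<in>B. ip w b *\<^sub>R b)" using B w by (simp add: onb_def)
  have "ip (v - proj S v) b = 0" if "b \<in> B" for b
    unfolding p using onb_coeff[OF B that, of "ip v"] by (simp add: ip_simps)
  then have "ip (v - proj S v) (\<Sum>b\<in>B. ip w b *\<^sub>R b) = 0"
    unfolding ip_sum_right by (intro sum.neutral) simp
  then show "ip (v - proj S v) w = 0" using wB by metis
qed

end

context cartan_lie
begin

section \<open>Lie triple systems and slices for their isotropy orbits\<close>

definition lts_k :: "'g set \<Rightarrow> 'g set" where
  "lts_k q = span {br U V |U V. U \<in> q \<and> V \<in> q}"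

definition lts :: "'g set \<Rightarrow> bool" where
  "lts q \<longleftrightarrow> lie_triple_system br q \<and> q \<subseteq> \<pp>"

lemma lts_p: "lts \<pp>"
  using subspace_p br_pp br_kp by (simp add: lts_def lie_triple_system_def)

lemma lts_subspace: "lts q \<Longrightarrow> subspace q" and lts_sub_p: "lts q \<Longrightarrow> q \<subseteq> \<pp>"
  by (auto simp: lts_def lie_triple_system_def)

lemma lts_k_subspace: "subspace (lts_k q)"
  by (simp add: lts_k_def)

lemma br_in_lts_k: "X \<in> q \<Longrightarrow> Y \<in> q \<Longrightarrow> br X Y \<in> lts_k q"
  unfolding lts_k_def by (intro span_base) auto

lemma lts_k_induct:
  assumes "Z \<in> lts_k q" "subspace {Z. P Z}" "\<And>U V. U \<in> q \<Longrightarrow> V \<in> q \<Longrightarrow> P (br U V)"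
  shows "P Z"
proof -
  have "lts_k q \<subseteq> {Z. P Z}"
    unfolding lts_k_def by (rule span_minimal[OF _ assms(2)]) (use assms(3) in auto)
  then show ?thesis using assms(1) by auto
qed

lemma lts_k_sub_k: "q \<subseteq> \<pp> \<Longrightarrow> lts_k q \<subseteq> \<kk>"
  unfolding lts_k_def using br_pp by (intro span_minimal subspace_k) auto

lemma lts_k_mono: "q \<subseteq> q' \<Longrightarrow> lts_k q \<subseteq> lts_k q'"
  unfolding lts_k_def by (intro span_mono) auto

lemma br_lts_k:
  assumes q: "lts q" and Z: "Z \<in> lts_k q" and X: "X \<in> q"
  shows "br Z X \<in> q"
  using Z
proof (rule lts_k_induct)
  show "subspace {Z. br Z X \<in> q}"
    using lts_subspace[OF q] by (auto simp: subspace_def br_simps)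
  show "br (br U V) X \<in> q" if "U \<in> q" "V \<in> q" for U V
    using q X that by (simp add: lts_def lie_triple_system_def)
qed

lemma exp_ad_invariant_subspace:
  assumes S: "subspace S" "\<And>Y. Y \<in> S \<Longrightarrow> br X Y \<in> S" and Y: "Y \<in> S"
  shows "E X Y \<in> S"
proof -
  have p: "(br X ^^ n) Y \<in> S" for n by (induction n) (use Y S(2) in auto)
  have "(\<lambda>n. \<Sum>i<n. (1 / fact i) *\<^sub>R (br X ^^ i) Y) \<longlonglongrightarrow> E X Y"
    using exp_ad_sums[of X Y] by (simp add: sums_def)
  then show ?thesis
    by (rule closed_sequentially[OF closed_subspace[OF S(1)], rotated])
       (intro subspace_sum[OF S(1)] subspace_scale[OF S(1)] p)
qed

lemma adjoint_group_invariant: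
  assumes S: "subspace S" "\<And>X Y. X \<in> L \<Longrightarrow> Y \<in> S \<Longrightarrow> br X Y \<in> S"
  shows "g \<in> adjoint_group br L \<Longrightarrow> Y \<in> S \<Longrightarrow> g Y \<in> S"
proof (induction rule: adjoint_group.induct)
  case (2 X g)
  have "E X (g Y) \<in> S"
    by (rule exp_ad_invariant_subspace[OF S(1) S(2)[OF 2(1)] 2(3)[OF 2(4)]])
  then show ?case by simp
qed simp

lemma exp_ad_fixed: "br X Y = 0 \<Longrightarrow> E X Y = Y"
  using exp_ad_eigen[of X Y 0] by simp

lemma adjoint_group_fixed:
  assumes "\<And>X. X \<in> L \<Longrightarrow> br X Y = 0"
  shows "g \<in> adjoint_group br L \<Longrightarrow> g Y = Y"
  by (induction rule: adjoint_group.induct) (use assms exp_ad_fixed in auto)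

lemma exp_ad_has_derivative_0:
  "((\<lambda>p. E (fst p) (snd p)) has_derivative (\<lambda>p. br (fst p) V + snd p)) (at (0, V))"
  unfolding has_derivative_at
proof
  have "linear (\<lambda>p::'g \<times> 'g. br (fst p) V + snd p)"
    by (rule linearI) (simp_all add: br_simps algebra_simps)
  then show "bounded_linear (\<lambda>p::'g \<times> 'g. br (fst p) V + snd p)"
    by (simp add: linear_conv_bounded_linear)
  define c where "c = br_const"
  define C where "C = c^2 * exp c * (norm V + 1) + c"
  have c: "c > 0" using br_const by (simp add: c_def)
  have bound: "norm (E (fst ((0, V) + h)) (snd ((0, V) + h)) - E (fst (0, V)) (snd (0, V)) - (br (fst h) V + snd h)) / norm h
      \<le> C * norm h" if h: "norm h \<le> 1" for h :: "'g \<times> 'g"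
  proof -
    define A W where "A = fst h" and "W = snd h"
    have nA: "norm A \<le> norm h" and nW: "norm W \<le> norm h"
      using norm_fst_le[of A W] norm_snd_le[of W A] by (auto simp: A_def W_def)
    have e: "E A (V + W) - V - (br A V + W) = (E A (V + W) - (V + W) - br A (V + W)) + br A W"
      by (simp add: br_simps)
    have "norm (E A (V + W) - (V + W) - br A (V + W)) \<le> (c * norm A)^2 * exp (c * norm A) * norm (V + W)"
      unfolding c_def by (rule exp_ad_first_order)
    also have "\<dots> \<le> (c * norm h)^2 * exp (c * 1) * (norm V + 1)"
    proof (intro mult_mono power_mono)
      show "exp (c * norm A) \<le> exp (c * 1)" using nA h c by simp
      show "norm (V + W) \<le> norm V + 1" using norm_triangle_ineq[of V W] nW h by linarith
    qed (use nA c in auto)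
    finally have 1: "norm (E A (V + W) - (V + W) - br A (V + W)) \<le> c^2 * exp c * (norm V + 1) * (norm h)^2"
      by (simp add: power_mult_distrib mult_ac)
    have "norm (br A W) \<le> c * norm A * norm W" unfolding c_def by (rule br_const)
    also have "\<dots> \<le> c * norm h * norm h" using nA nW c by (intro mult_mono) auto
    finally have 2: "norm (br A W) \<le> c * (norm h)^2" by (simp add: power2_eq_square)
    have "norm (E A (V + W) - V - (br A V + W)) \<le> C * (norm h)^2"
      unfolding e C_def distrib_right by (intro norm_triangle_mono 1 2)
    then have "norm (E A (V + W) - V - (br A V + W)) / norm h \<le> C * norm h"
      by (cases "h = 0") (simp_all add: power2_eq_square divide_le_eq mult.assoc)
    then show ?thesis by (simp add: A_def W_def)
  qed
  have lim: "((\<lambda>h. C * norm h) \<longlongrightarrow> 0) (at (0::'g \<times> 'g))"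
    by (intro tendsto_eq_intros) auto
  have ev: "\<forall>\<^sub>F h in at (0::'g \<times> 'g). norm h \<le> 1"
    unfolding eventually_at by (intro exI[of _ 1]) (auto simp: dist_norm)
  show "(\<lambda>h. norm (E (fst ((0, V) + h)) (snd ((0, V) + h)) - E (fst (0, V)) (snd (0, V)) - (br (fst h) V + snd h)) / norm h)
      \<midarrow>0\<rightarrow> 0"
    by (rule tendsto_sandwich[OF _ _ tendsto_const lim])
       (use ev bound in \<open>auto elim!: eventually_mono\<close>)
qed

definition centralizer :: "'g set \<Rightarrow> 'g \<Rightarrow> 'g set" where
  "centralizer q H = {W \<in> q. br H W = 0}"

lemma lts_centralizer:
  assumes q: "lts q"
  shows "lts (centralizer q H)"
proof -
  have "subspace (centralizer q H)"
    using lts_subspace[OF q] by (auto simp: centralizer_def subspace_def br_simps)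
  moreover have "br H (br (br X Y) Z) = 0" if "br H X = 0" "br H Y = 0" "br H Z = 0" for X Y Z
    by (simp add: jacobi[of H] that br_simps)
  ultimately show ?thesis
    using q by (auto simp: lts_def lie_triple_system_def centralizer_def)
qed

text \<open>The tangent space [[q, q], Y] of the orbit and the centralizer of \<open>Y\<close>
  together span \<open>q\<close>. So the map (Z, W) to E(Z)(Y + W) has a surjective differential
  onto \<open>q\<close>, and its image contains a neighbourhood of \<open>Y\<close> in
  \<open>q\<close>.\<close>

lemma slice:
  assumes q: "lts q" and Y: "Y \<in> q"
  shows "\<exists>e>0. \<forall>y\<in>q. dist y Y < e \<longrightarrow> (\<exists>Z\<in>lts_k q. E Z y \<in> centralizer q Y)"
proof -
  let ?l = "lts_k q" and ?c = "centralizer q Y"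
  have sq: "subspace q" by (rule lts_subspace[OF q])
  have sl: "subspace ?l" by (rule lts_k_subspace)
  have sc: "subspace ?c" by (rule lts_subspace[OF lts_centralizer[OF q]])
  have cq: "?c \<subseteq> q" by (auto simp: centralizer_def)
  have Yp: "Y \<in> \<pp>" using Y lts_sub_p[OF q] by blast
  define R where "R = {br Z Y |Z. Z \<in> ?l}"
  have sR: "subspace R"
  proof -
    have "R = (\<lambda>Z. br Z Y) ` ?l" by (auto simp: R_def)
    then show ?thesis using linear_subspace_image[OF ad_linear_left sl] by simp
  qed
  have Rq: "R \<subseteq> q" using br_lts_k[OF q _ Y] by (auto simp: R_def)
  \<comment> \<open>For W in q orthogonal to [[q, q], Y], pairing with [[Y, W], Y] gives minus the
    squared norm of [Y, W], so W centralizes Y.\<close>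
  have decomp: "\<exists>Z\<in>?l. \<exists>W\<in>?c. y = br Z Y + W" if y: "y \<in> q" for y
  proof -
    define W where "W = y - proj R y"
    have Wq: "W \<in> q" unfolding W_def using proj_mem[OF sR] Rq y sq subspace_diff by blast
    have "br Y W \<in> ?l" by (rule br_in_lts_k[OF Y Wq])
    then have "br (br Y W) Y \<in> R" by (auto simp: R_def)
    then have "ip W (br (br Y W) Y) = 0" unfolding W_def by (rule proj_diff_orth[OF sR])
    moreover have "ip W (br (br Y W) Y) = - ip (br Y W) (br Y W)"
      using self_adjoint_p[OF Yp] by (subst br_anti) (simp add: ip_simps self_adjoint_def)
    ultimately have "br Y W = 0" by (simp add: ip_eq_0_iff)
    then have "W \<in> ?c" using Wq by (simp add: centralizer_def)
    moreover obtain Z where "Z \<in> ?l" "proj R y = br Z Y"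
      using proj_mem[OF sR, of y] by (auto simp: R_def)
    moreover have "y = proj R y + W" by (simp add: W_def)
    ultimately show ?thesis by metis
  qed
  \<comment> \<open>The projections extend the map to the whole space, and the last summand adds the
    directions orthogonal to \<open>q\<close>. This makes the differential surjective on the full
    type, as the open mapping theorem for a differentiable point demands.\<close>
  define \<Phi> where "\<Phi> p = E (proj ?l (fst p)) (Y + proj ?c (snd p)) + (snd p - proj q (snd p))" for p
  define \<Phi>' where "\<Phi>' p = br (proj ?l (fst p)) Y + proj ?c (snd p) + (snd p - proj q (snd p))" for p
  have bl: "bounded_linear (proj S)" for S using proj_linear linear_conv_bounded_linear by blast
  have 0: "proj S 0 = 0" for S by (rule linear_0[OF proj_linear])
  have lin: "linear (\<lambda>p::'g \<times> 'g. (proj ?l (fst p), proj ?c (snd p)))"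
    by (rule linearI) (simp_all add: linear_add[OF proj_linear] linear_scale[OF proj_linear])
  have d1: "((\<lambda>p::'g \<times> 'g. (0, Y) + (proj ?l (fst p), proj ?c (snd p))) has_derivative
      (\<lambda>p. (proj ?l (fst p), proj ?c (snd p)))) (at (0, 0))"
  proof -
    have "((\<lambda>p::'g \<times> 'g. (0, Y) + (proj ?l (fst p), proj ?c (snd p))) has_derivative
      (\<lambda>p. 0 + (proj ?l (fst p), proj ?c (snd p)))) (at (0, 0))"
      by (intro has_derivative_add has_derivative_const bounded_linear_imp_has_derivative
          lin[unfolded linear_conv_bounded_linear])
    then show ?thesis by simp
  qed
  have d2: "((\<lambda>p. E (fst p) (snd p)) has_derivative (\<lambda>p. br (fst p) Y + snd p))
      (at ((0, Y) + (proj ?l (fst (0::'g, 0::'g)), proj ?c (snd (0::'g, 0::'g)))))"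
    using exp_ad_has_derivative_0[of Y] by (simp add: 0)
  have d3: "((\<lambda>p::'g \<times> 'g. snd p - proj q (snd p)) has_derivative (\<lambda>p. snd p - proj q (snd p))) (at (0, 0))"
    by (intro bounded_linear_imp_has_derivative bounded_linear_sub bounded_linear_snd
        bounded_linear_compose[OF bl bounded_linear_snd])
  have der: "(\<Phi> has_derivative \<Phi>') (at (0, 0))"
    using has_derivative_add[OF has_derivative_compose[OF d1 d2] d3]
    by (simp add: \<Phi>_def[abs_def] \<Phi>'_def[abs_def])
  have cont: "continuous_on UNIV \<Phi>"
  proof -
    have c1: "continuous_on UNIV (\<lambda>p::'g \<times> 'g. (proj ?l (fst p), Y + proj ?c (snd p)))"
      by (intro continuous_on_Pair continuous_on_add continuous_on_const
          linear_continuous_on_compose[OF continuous_on_fst[OF continuous_on_id] proj_linear]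
          linear_continuous_on_compose[OF continuous_on_snd[OF continuous_on_id] proj_linear])
    have c2: "continuous_on UNIV (\<lambda>p::'g \<times> 'g. snd p - proj q (snd p))"
      by (intro continuous_on_diff continuous_on_snd continuous_on_id
          linear_continuous_on_compose[OF continuous_on_snd[OF continuous_on_id] proj_linear])
    have "continuous_on UNIV (\<lambda>p::'g \<times> 'g. E (proj ?l (fst p)) (Y + proj ?c (snd p)))"
      using continuous_on_compose2[OF exp_ad_continuous c1] by simp
    then show ?thesis unfolding \<Phi>_def[abs_def] by (intro continuous_on_add c2)
  qed
  have lin': "linear \<Phi>'"
    unfolding \<Phi>'_def
    by (rule linearI)
       (simp_all add: linear_add[OF proj_linear] linear_scale[OF proj_linear] br_simps algebra_simps)
  have surj': "surj \<Phi>'"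
  proof -
    have "\<exists>p. v = \<Phi>' p" for v
    proof -
      define u where "u = v - proj q v"
      obtain Z W where ZW: "Z \<in> ?l" "W \<in> ?c" "proj q v = br Z Y + W"
        using decomp[OF proj_mem[OF sq]] by blast
      have uq: "ip u w = 0" if "w \<in> q" for w unfolding u_def by (rule proj_diff_orth[OF sq that])
      have "proj ?c u = 0" by (rule proj_orth[OF sc]) (use uq cq in auto)
      moreover have "proj q u = 0" by (rule proj_orth[OF sq]) (use uq in auto)
      moreover have "proj q W = W" by (rule proj_id[OF sq]) (use ZW cq in auto)
      ultimately have "\<Phi>' (Z, W + u) = br Z Y + W + u"
        by (simp add: \<Phi>'_def linear_add[OF proj_linear] proj_id[OF sl ZW(1)] proj_id[OF sc ZW(2)])
      also have "\<dots> = v" by (simp add: u_def ZW(3)[symmetric])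
      finally show ?thesis by metis
    qed
    then show ?thesis by (simp add: surj_def)
  qed
  obtain g where g: "linear g" "\<Phi>' \<circ> g = id"
    using linear_surjective_right_inverse[OF lin' surj'] by blast
  have "\<Phi> (0, 0) \<in> interior (\<Phi> ` UNIV)"
    by (rule sussmann_open_mapping[OF open_UNIV cont _ der _ g(2)])
       (use g(1) in \<open>auto simp: linear_conv_bounded_linear\<close>)
  then obtain e where e: "e > 0" "ball (\<Phi> (0, 0)) e \<subseteq> range \<Phi>" by (auto simp: mem_interior)
  have "\<Phi> (0, 0) = Y" by (simp add: \<Phi>_def 0)
  with e have e': "ball Y e \<subseteq> range \<Phi>" by simp
  have "\<exists>Z\<in>?l. E Z y \<in> ?c" if y: "y \<in> q" "dist y Y < e" for y
  proof -
    have "y \<in> ball Y e" using y(2) by (simp add: dist_commute)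
    then obtain p where p: "y = \<Phi> p" using e' by blast
    define Z W u where "Z = proj ?l (fst p)" and "W = proj ?c (snd p)" and "u = snd p - proj q (snd p)"
    have Z: "Z \<in> ?l" and W: "W \<in> ?c" unfolding Z_def W_def by (intro proj_mem sl sc)+
    have Yc: "Y \<in> ?c" using Y by (simp add: centralizer_def)
    have YW: "Y + W \<in> ?c" by (rule subspace_add[OF sc Yc W])
    have "E Z (Y + W) \<in> q"
      by (rule exp_ad_invariant_subspace[OF sq br_lts_k[OF q Z]]) (use YW cq in auto)
    moreover have yu: "y = E Z (Y + W) + u" by (simp add: p \<Phi>_def Z_def W_def u_def)
    \<comment> \<open>The auxiliary component \<open>u\<close> is orthogonal to \<open>q\<close>, so
      once it lies in \<open>q\<close> it vanishes.\<close>
    ultimately have "u \<in> q" using subspace_diff[OF sq y(1), of "E Z (Y + W)"] by simp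
    then have "ip u u = 0" unfolding u_def by (rule proj_diff_orth[OF sq])
    then have "u = 0" by (simp add: ip_eq_0_iff)
    then have "E (- Z) y = Y + W" using yu by simp
    then show ?thesis using YW subspace_neg[OF sl Z] by metis
  qed
  then show ?thesis using e(1) by blast
qed

lemma maximal_abelian_mem:
  assumes b: "maximal_abelian br q b" and X: "X \<in> q" "\<And>H. H \<in> b \<Longrightarrow> br H X = 0" and q: "subspace q"
  shows "X \<in> b"
proof -
  let ?b = "span (insert X b)"
  have sb: "subspace b" "b \<subseteq> q" "\<And>U V. U \<in> b \<Longrightarrow> V \<in> b \<Longrightarrow> br U V = 0"
    using b by (auto simp: maximal_abelian_def)
  have el: "\<exists>t. U - t *\<^sub>R X \<in> b" if "U \<in> ?b" for U
    using that span_eq_iff[THEN iffD2, OF sb(1)] by (simp add: span_insert)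
  have "br U V = 0" if UV: "U \<in> ?b" "V \<in> ?b" for U V
  proof -
    obtain s t where st: "U - s *\<^sub>R X \<in> b" "V - t *\<^sub>R X \<in> b" using el[OF UV(1)] el[OF UV(2)] by blast
    define U0 V0 where "U0 = U - s *\<^sub>R X" and "V0 = V - t *\<^sub>R X"
    have "U = U0 + s *\<^sub>R X" "V = V0 + t *\<^sub>R X" by (auto simp: U0_def V0_def)
    moreover have "br U0 V0 = 0" "br U0 X = 0" "br V0 X = 0"
      using st sb(3) X(2) by (auto simp: U0_def V0_def)
    moreover have "br X V0 = 0" using br_anti[of X V0] \<open>br V0 X = 0\<close> by simp
    ultimately show ?thesis by (simp add: br_simps)
  qed
  moreover have "?b \<subseteq> q" using X(1) sb(2) q by (intro span_minimal) auto
  moreover have "b \<subseteq> ?b" using span_superset by blast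
  ultimately have "?b = b" using b unfolding maximal_abelian_def by (metis subspace_span)
  then show ?thesis using span_base[of X "insert X b"] by simp
qed

lemma maximal_abelian_centralizer:
  assumes b: "maximal_abelian br q b" and H: "H \<in> b"
  shows "maximal_abelian br (centralizer q H) b"
  using b H unfolding maximal_abelian_def centralizer_def by auto

text \<open>Maximizing \<open>ip H\<close> over the closure of the orbit of \<open>X\<close>, with \<open>H \<in> b\<close> not central in \<open>q\<close>, yields a limit
  point \<open>Y\<close> commuting with \<open>H\<close>, which by induction may be taken in \<open>b\<close>.  The orbit itself meets the slice
  \<open>centralizer q Y\<close>, a smaller Lie triple system unless \<open>Y\<close> is central; in that case \<open>X = Y\<close>, the distance to
  \<open>Y\<close> being constant on the orbit.\<close>

theorem lts_conjugate:
  assumes "lts q" "maximal_abelian br q b" "X \<in> q"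
  shows "\<exists>k\<in>adjoint_group br (lts_k q). k X \<in> b"
  using assms
proof (induction "dim q" arbitrary: q X rule: less_induct)
  case (less q X)
  note q = less.prems(1) and b = less.prems(2) and X = less.prems(3)
  let ?L = "adjoint_group br (lts_k q)"
  have sq: "subspace q" by (rule lts_subspace[OF q])
  have bq: "b \<subseteq> q" using b by (simp add: maximal_abelian_def)
  have id: "id \<in> ?L" by (rule adjoint_group.intros(1))
  have LK: "k \<in> K" if "k \<in> ?L" for k
    by (rule adjoint_group_k[OF lts_k_sub_k[OF lts_sub_p[OF q]] that])
  have Lq: "k Y \<in> q" if "k \<in> ?L" "Y \<in> q" for k Y
    by (rule adjoint_group_invariant[OF sq br_lts_k[OF q] that])
  have reduce: "\<exists>k\<in>?L. k Y \<in> b" if H: "H \<in> b" "centralizer q H \<noteq> q" and Y: "Y \<in> centralizer q H" for H Y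
  proof -
    have "centralizer q H \<subset> q" using H(2) by (auto simp: centralizer_def)
    then have "dim (centralizer q H) < dim q"
      using lts_subspace[OF lts_centralizer[OF q]] sq by (metis dim_psubset span_eq_iff)
    from less.hyps[OF this lts_centralizer[OF q] maximal_abelian_centralizer[OF b H(1)] Y]
    obtain k where k: "k \<in> adjoint_group br (lts_k (centralizer q H))" "k Y \<in> b" by blast
    have "k \<in> ?L" by (rule adjoint_group_mono[OF lts_k_mono k(1)]) (auto simp: centralizer_def)
    then show ?thesis using k(2) by blast
  qed
  show ?case
  proof (cases "\<forall>H\<in>b. centralizer q H = q")
    case True
    then have "br H X = 0" if "H \<in> b" for H using X that by (auto simp: centralizer_def)
    then have "X \<in> b" by (rule maximal_abelian_mem[OF b X _ sq])
    then show ?thesis using id by (intro bexI[of _ id]) auto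
  next
    case False
    then obtain H where H: "H \<in> b" "centralizer q H \<noteq> q" by blast
    \<comment> \<open>The orbit has not been shown to be closed, so the maximum is sought on its
      closure; \<open>slice\<close> later leads back to a genuine orbit point.\<close>
    define Orb where "Orb = (\<lambda>k. k X) ` ?L"
    have Oq: "closure Orb \<subseteq> q"
      by (rule closure_minimal[OF _ closed_subspace[OF sq]]) (use Lq X in \<open>auto simp: Orb_def\<close>)
    obtain C where C: "C > 0" "\<And>x. norm x ^ 2 \<le> C * ip x x" using ip_norm_bound by blast
    have "bounded Orb"
    proof (rule boundedI)
      fix y assume "y \<in> Orb"
      then obtain k where k: "k \<in> ?L" "y = k X" by (auto simp: Orb_def)
      have "norm y ^ 2 \<le> C * ip X X" using C(2)[of y] K_ip[OF LK[OF k(1)], of X X] k(2) by simp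
      then show "norm y \<le> sqrt (C * ip X X)" by (simp add: real_le_rsqrt)
    qed
    then have "compact (closure Orb)" by (simp add: compact_closure)
    moreover have "closure Orb \<noteq> {}" using id by (auto simp: Orb_def)
    moreover have "continuous_on (closure Orb) (\<lambda>y. ip y H)"
      by (intro ip_continuous_on continuous_on_id continuous_on_const)
    ultimately obtain Y where Y: "Y \<in> closure Orb" "\<And>y. y \<in> closure Orb \<Longrightarrow> ip y H \<le> ip Y H"
      using continuous_attains_sup by metis
    have Orb_inv: "k y \<in> closure Orb" if k: "k \<in> ?L" and y: "y \<in> closure Orb" for k y
    proof -
      obtain s where s: "\<And>n. s n \<in> Orb" "s \<longlonglongrightarrow> y" using y by (auto simp: closure_sequential)
      have "bounded_linear k"
        using automorphism_linear[OF K_automorphism[OF LK[OF k]]] linear_conv_bounded_linear by blast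
      then have "(\<lambda>n. k (s n)) \<longlonglongrightarrow> k y" using s(2) by (rule bounded_linear.tendsto)
      moreover have "k (s n) \<in> Orb" for n
      proof -
        obtain h where "h \<in> ?L" "s n = h X" using s(1)[of n] by (auto simp: Orb_def)
        then have "k (s n) = (k \<circ> h) X" "k \<circ> h \<in> ?L" using adjoint_group_comp k by auto
        then show ?thesis unfolding Orb_def by blast
      qed
      ultimately show ?thesis
        unfolding closure_sequential by (intro exI[of _ "\<lambda>n. k (s n)"] conjI allI)
    qed
    have Yq: "Y \<in> q" and Hq: "H \<in> q" using Y(1) Oq H(1) bq by auto
    have Yp: "Y \<in> \<pp>" using Yq lts_sub_p[OF q] by blast
    have crit: "ip (br Z Y) H = 0" if Z: "Z \<in> lts_k q" for Z
    proof -
      define f where "f t = ip (E (t *\<^sub>R Z) Y) H" for t :: real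
      have "((\<lambda>t. ip (E (t *\<^sub>R Z) Y) H) has_vector_derivative ip (br Z (E (0 *\<^sub>R Z) Y)) H) (at 0)"
        using bounded_linear.has_vector_derivative[OF bounded_bilinear.bounded_linear_left[OF ip_bounded]
            exp_ad_has_vector_derivative[of Z Y 0], of H] .
      then have "(f has_real_derivative ip (br Z Y) H) (at 0)"
        by (simp add: f_def[abs_def] has_real_derivative_iff_has_vector_derivative)
      moreover have "f t \<le> f 0" for t
      proof -
        have "E (t *\<^sub>R Z) \<in> ?L"
          by (intro exp_in_adjoint_group subspace_scale[OF lts_k_subspace] Z)
        then show ?thesis using Y(2)[OF Orb_inv[OF _ Y(1)]] by (simp add: f_def)
      qed
      ultimately show ?thesis using DERIV_local_max[of f _ 0 1] by simp
    qed
    \<comment> \<open>Criticality in the direction Z = [Y, H] says that minus the squared norm of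
      [Y, H] is zero.\<close>
    have "br Y H = 0"
    proof -
      have "ip (br (br Y H) Y) H = - ip (br Y H) (br Y H)"
        using self_adjoint_p[OF Yp] by (subst br_anti) (simp add: ip_simps self_adjoint_def)
      then show ?thesis using crit[OF br_in_lts_k[OF Yq Hq]] by (simp add: ip_eq_0_iff)
    qed
    then have "Y \<in> centralizer q H" using Yq br_anti[of H Y] by (simp add: centralizer_def)
    from reduce[OF H this] obtain k1 where k1: "k1 \<in> ?L" "k1 Y \<in> b" by blast
    define Y1 where "Y1 = k1 Y"
    have Y1: "Y1 \<in> closure Orb" "Y1 \<in> b" "Y1 \<in> q"
      using Orb_inv[OF k1(1) Y(1)] k1(2) Lq[OF k1(1) Yq] by (auto simp: Y1_def)
    show ?thesis
    proof (cases "centralizer q Y1 = q")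
      case True
      then have c: "br W Y1 = 0" if "W \<in> q" for W
        using that br_anti[of W Y1] by (auto simp: centralizer_def)
      have "br Z Y1 = 0" if "Z \<in> lts_k q" for Z
        using that
      proof (rule lts_k_induct)
        show "subspace {Z. br Z Y1 = 0}" by (auto simp: subspace_def br_simps)
        show "br (br U V) Y1 = 0" if "U \<in> q" "V \<in> q" for U V
          by (simp add: jacobi_left c[OF that(1)] c[OF that(2)] br_simps)
      qed
      then have fix1: "k Y1 = Y1" if "k \<in> ?L" for k by (rule adjoint_group_fixed[OF _ that])
      obtain s where s: "\<And>n. s n \<in> Orb" "s \<longlonglongrightarrow> Y1" using Y1(1) by (auto simp: closure_sequential)
      have "ip (s n - Y1) (s n - Y1) = ip (X - Y1) (X - Y1)" for n
      proof -
        obtain k where k: "k \<in> ?L" "s n = k X" using s(1)[of n] by (auto simp: Orb_def)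
        have "s n - Y1 = k (X - Y1)"
          using k fix1[OF k(1)] linear_diff[OF automorphism_linear[OF K_automorphism[OF LK[OF k(1)]]]]
          by simp
        then show ?thesis using K_ip[OF LK[OF k(1)]] by simp
      qed
      moreover have "(\<lambda>n. ip (s n - Y1) (s n - Y1)) \<longlonglongrightarrow> ip (Y1 - Y1) (Y1 - Y1)"
        by (intro ip_tendsto tendsto_diff s tendsto_const)
      ultimately have "(\<lambda>n::nat. ip (X - Y1) (X - Y1)) \<longlonglongrightarrow> ip (Y1 - Y1) (Y1 - Y1)" by (simp only:)
      then have "ip (X - Y1) (X - Y1) = ip (Y1 - Y1) (Y1 - Y1)" by (simp only: LIMSEQ_const_iff)
      then have "ip (X - Y1) (X - Y1) = 0" by (simp add: bilinear_lzero[OF ip_bilinear])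
      then have "X = Y1" by (simp add: ip_eq_0_iff)
      then show ?thesis using Y1(2) id by (intro bexI[of _ id]) auto
    next
      case False
      obtain e where e: "e > 0" "\<And>y. y \<in> q \<Longrightarrow> dist y Y1 < e \<Longrightarrow> \<exists>Z\<in>lts_k q. E Z y \<in> centralizer q Y1"
        using slice[OF q Y1(3)] by blast
      obtain y where "y \<in> Orb" "dist y Y1 < e" using Y1(1) e(1) by (meson closure_approachable)
      then obtain k2 where k2: "k2 \<in> ?L" "dist (k2 X) Y1 < e" by (auto simp: Orb_def)
      obtain Z where Z: "Z \<in> lts_k q" "E Z (k2 X) \<in> centralizer q Y1"
        using e(2)[OF Lq[OF k2(1) X] k2(2)] by blast
      obtain k3 where k3: "k3 \<in> ?L" "k3 (E Z (k2 X)) \<in> b"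
        using reduce[OF Y1(2) False Z(2)] by blast
      have "k3 \<circ> (E Z \<circ> k2) \<in> ?L"
        by (intro adjoint_group_comp k3 k2 exp_in_adjoint_group Z)
      then show ?thesis using k3(2) by (intro bexI[of _ "k3 \<circ> (E Z \<circ> k2)"]) auto
    qed
  qed
qed

end

section \<open>Smooth maps and submanifolds\<close>

lemma times_differentiable_on_subset:
  "times_differentiable_on k U f \<Longrightarrow> V \<subseteq> U \<Longrightarrow> times_differentiable_on k V f"
proof (induction k arbitrary: f)
  case 0
  then show ?case by (auto intro: continuous_on_subset)
next
  case (Suc k)
  then obtain f' where "\<forall>x\<in>U. (f has_derivative f' x) (at x)" "\<forall>v. times_differentiable_on k U (\<lambda>x. f' x v)"
    by auto
  then show ?case
    unfolding times_differentiable_on.simps using Suc.IH Suc.prems(2)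
    by (intro exI[of _ f'] conjI ballI allI) blast+
qed

lemma smooth_map_on_continuous:
  assumes "smooth_map_on S f"
  shows "continuous_on S f"
  unfolding continuous_on_eq_continuous_within
proof
  fix x assume x: "x \<in> S"
  obtain U F where U: "open U" "x \<in> U" "\<forall>k. times_differentiable_on k U F" "\<forall>y\<in>S \<inter> U. F y = f y"
    using assms x unfolding smooth_map_on_def by blast
  have "continuous_on U F" using U(3)[rule_format, of 0] by simp
  then have "continuous_on (S \<inter> U) F" by (rule continuous_on_subset) simp
  then have "continuous_on (S \<inter> U) f" using continuous_on_cong[OF refl, of "S \<inter> U" F f] U(4) by blast
  then have "continuous (at x within S \<inter> U) f" using x U(2) by (simp add: continuous_on_eq_continuous_within)
  moreover have "at x within S \<inter> U = at x within S" by (rule at_within_nhd[OF U(2) U(1)]) auto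
  ultimately show "continuous (at x within S) f" by (simp add: continuous_within)
qed

lemma smooth_map_on_open_differentiable:
  assumes "smooth_map_on S f" "open S" "x \<in> S"
  shows "\<exists>f'. (f has_derivative f') (at x)"
proof -
  obtain U F where U: "open U" "x \<in> U" "\<forall>k. times_differentiable_on k U F" "\<forall>y\<in>S \<inter> U. F y = f y"
    using assms unfolding smooth_map_on_def by blast
  obtain F' where "(F has_derivative F') (at x)" using U(3)[rule_format, of "Suc 0"] U(2) by auto
  then have "(f has_derivative F') (at x)"
    by (rule has_derivative_transform_within_open[where s="S \<inter> U"]) (use U assms in auto)
  then show ?thesis by blast
qed

lemma diffeomorphism_homeomorphism:
  assumes "diffeomorphism S T f"
  shows "homeomorphism S T f (the_inv_into S f)"
proof -
  have b: "bij_betw f S T" and s: "smooth_map_on S f" "smooth_map_on T (the_inv_into S f)"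
    using assms by (auto simp: diffeomorphism_def)
  have i: "inj_on f S" and im: "f ` S = T" using b by (auto simp: bij_betw_def)
  show ?thesis
    unfolding homeomorphism_def
  proof (intro conjI ballI)
    show "the_inv_into S f ` T = S" using bij_betw_the_inv_into[OF b] by (simp add: bij_betw_def)
    show "the_inv_into S f (f x) = x" if "x \<in> S" for x using the_inv_into_f_f[OF i that] .
    show "f (the_inv_into S f y) = y" if "y \<in> T" for y using f_the_inv_into_f[OF i] that im by blast
  qed (use s smooth_map_on_continuous im in auto)
qed

section \<open>Dimension and tangent space of a submanifold through its charts\<close>

definition slice_chart :: "'a::euclidean_space set \<Rightarrow> 'a \<Rightarrow> nat \<Rightarrow> 'a set \<Rightarrow> 'a set \<Rightarrow> ('a \<Rightarrow> 'a) \<Rightarrow> 'a set \<Rightarrow> bool" where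
  "slice_chart S x n U V \<phi> L \<longleftrightarrow> open U \<and> x \<in> U \<and> open V \<and> subspace L \<and> dim L = n \<and>
     diffeomorphism U V \<phi> \<and> \<phi> ` (S \<inter> U) = V \<inter> L"

lemma embedded_submanifold_slice_chart:
  assumes "embedded_submanifold S" "x \<in> S"
  shows "\<exists>n U V \<phi> L. slice_chart S x n U V \<phi> L"
proof -
  obtain U V \<phi> L where "open U \<and> x \<in> U \<and> open V \<and> subspace (L :: 'a set) \<and>
        diffeomorphism U V \<phi> \<and> \<phi> ` (S \<inter> U) = V \<inter> L"
    using assms unfolding embedded_submanifold_def by metis
  then have "slice_chart S x (dim L) U V \<phi> L" unfolding slice_chart_def by simp
  then show ?thesis by (intro exI)
qed

text \<open>The transition between two charts is a continuous injection of an open subset of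
  \<open>L1\<close> into \<open>L2\<close>, so invariance of dimension applies. By symmetry the
  dimension at a point is well defined, although \<open>embedded_submanifold\<close> lets
  \<open>L\<close> vary.\<close>

lemma slice_chart_dim_le:
  assumes c1: "slice_chart S x n U1 V1 \<phi>1 L1" and c2: "slice_chart S x m U2 V2 \<phi>2 L2" and x: "x \<in> S"
  shows "n \<le> m"
proof -
  define \<psi> where "\<psi> = the_inv_into U1 \<phi>1"
  have h1: "homeomorphism U1 V1 \<phi>1 \<psi>" and h2: "homeomorphism U2 V2 \<phi>2 (the_inv_into U2 \<phi>2)"
    using c1 c2 diffeomorphism_homeomorphism unfolding slice_chart_def \<psi>_def by blast+
  let ?W = "S \<inter> (U1 \<inter> U2)"
  have "openin (top_of_set V1) (\<phi>1 ` (U1 \<inter> U2))"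
    by (rule homeomorphism_imp_open_map[OF h1]) (use c1 c2 in \<open>auto simp: slice_chart_def intro!: openin_open_Int\<close>)
  then have op': "open (\<phi>1 ` (U1 \<inter> U2))" using c1 openin_open_trans by (auto simp: slice_chart_def)
  have inj: "inj_on \<phi>1 U1" by (metis h1 homeomorphism_apply1 inj_on_inverseI)
  have eq: "\<phi>1 ` ?W = L1 \<inter> \<phi>1 ` (U1 \<inter> U2)"
  proof
    show "\<phi>1 ` ?W \<subseteq> L1 \<inter> \<phi>1 ` (U1 \<inter> U2)" using c1 by (auto simp: slice_chart_def)
    show "L1 \<inter> \<phi>1 ` (U1 \<inter> U2) \<subseteq> \<phi>1 ` ?W"
    proof
      fix y assume y: "y \<in> L1 \<inter> \<phi>1 ` (U1 \<inter> U2)"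
      then obtain u where u: "u \<in> U1" "u \<in> U2" "y = \<phi>1 u" by auto
      have "y \<in> V1 \<inter> L1" using y u h1 by (auto simp: homeomorphism_def)
      then obtain s where s: "s \<in> S" "s \<in> U1" "y = \<phi>1 s" using c1 by (auto simp: slice_chart_def)
      then have "s = u" using inj u by (auto simp: inj_on_def)
      then show "y \<in> \<phi>1 ` ?W" using s u by auto
    qed
  qed
  have "dim L1 \<le> dim L2"
  proof (rule invariance_of_dimension_subspaces[where S="\<phi>1 ` ?W" and f="\<phi>2 \<circ> \<psi>"])
    show "openin (top_of_set L1) (\<phi>1 ` ?W)" unfolding eq using op' by (rule openin_open_Int)
    show "subspace L1" "subspace L2" using c1 c2 by (auto simp: slice_chart_def)
    have bck: "\<psi> (\<phi>1 w) = w" if "w \<in> U1" for w using h1 that by (simp add: homeomorphism_def)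
    have im: "\<psi> ` \<phi>1 ` ?W \<subseteq> U2" using bck by auto
    show "continuous_on (\<phi>1 ` ?W) (\<phi>2 \<circ> \<psi>)"
    proof (rule continuous_on_compose)
      show "continuous_on (\<phi>1 ` ?W) \<psi>"
        using h1 by (rule continuous_on_subset[OF homeomorphism_cont2]) (use h1 in \<open>auto simp: homeomorphism_def\<close>)
      show "continuous_on (\<psi> ` \<phi>1 ` ?W) \<phi>2"
        by (rule continuous_on_subset[OF homeomorphism_cont1[OF h2] im])
    qed
    show "\<phi>2 \<circ> \<psi> \<in> \<phi>1 ` ?W \<rightarrow> L2" using c2 bck by (auto simp: slice_chart_def)
    have "inj_on \<phi>2 U2" by (metis h2 homeomorphism_apply1 inj_on_inverseI)
    then show "inj_on (\<phi>2 \<circ> \<psi>) (\<phi>1 ` ?W)" using bck by (auto simp: inj_on_def)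
    show "\<phi>1 ` ?W \<noteq> {}" using x c1 c2 by (auto simp: slice_chart_def)
  qed
  then show ?thesis using c1 c2 by (simp add: slice_chart_def)
qed

text \<open>The dimension is locally constant, so on the connected \<open>S\<close> it is
  \<open>dim P\<close> throughout. Invariance of domain then makes \<open>P\<close> open in
  \<open>S\<close>; it is also closed and nonempty.\<close>

lemma submanifold_eq_subspace:
  assumes S: "embedded_submanifold S" "connected S" and P: "subspace P" "P \<subseteq> S"
    and c: "slice_chart S 0 (dim P) U0 V0 \<phi>0 L0"
  shows "S = P"
proof -
  have zero: "0 \<in> P" by (rule subspace_0[OF P(1)])
  define ch where "ch x n \<longleftrightarrow> (\<exists>U V \<phi> L. slice_chart S x n U V \<phi> L)" for x n
  have ex: "\<exists>n. ch x n" if x: "x \<in> S" for x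
    using embedded_submanifold_slice_chart[OF S(1) x] unfolding ch_def by metis
  have uniq: "n = m" if "x \<in> S" "ch x n" "ch x m" for x n m
  proof -
    obtain U V \<phi> L where c1: "slice_chart S x n U V \<phi> L" using \<open>ch x n\<close> unfolding ch_def by blast
    obtain U' V' \<phi>' L' where c2: "slice_chart S x m U' V' \<phi>' L'" using \<open>ch x m\<close> unfolding ch_def by blast
    show ?thesis
      by (rule order_antisym[OF slice_chart_dim_le[OF c1 c2] slice_chart_dim_le[OF c2 c1]]) fact+
  qed
  have op: "openin (top_of_set S) {x \<in> S. ch x n}" for n
    unfolding openin_subopen[of _ "{x \<in> S. ch x n}"]
  proof
    fix x assume "x \<in> {x \<in> S. ch x n}"
    then obtain U V \<phi> L where x: "x \<in> S" and s: "slice_chart S x n U V \<phi> L" by (auto simp: ch_def)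
    have "ch y n" if "y \<in> U" for y using s that unfolding ch_def slice_chart_def by blast
    then have "S \<inter> U \<subseteq> {x \<in> S. ch x n}" by auto
    moreover have "openin (top_of_set S) (S \<inter> U)" using s by (auto simp: slice_chart_def)
    moreover have "x \<in> S \<inter> U" using x s by (auto simp: slice_chart_def)
    ultimately show "\<exists>T. openin (top_of_set S) T \<and> x \<in> T \<and> T \<subseteq> {x \<in> S. ch x n}" by blast
  qed
  define d where "d = dim P"
  define Sd where "Sd = {x \<in> S. ch x d}"
  have "S - Sd = (\<Union>n\<in>{n. n \<noteq> d}. {x \<in> S. ch x n})"
  proof
    show "S - Sd \<subseteq> (\<Union>n\<in>{n. n \<noteq> d}. {x \<in> S. ch x n})"
      using ex by (fastforce simp: Sd_def)
    show "(\<Union>n\<in>{n. n \<noteq> d}. {x \<in> S. ch x n}) \<subseteq> S - Sd"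
      using uniq by (auto simp: Sd_def)
  qed
  moreover have "openin (top_of_set S) (\<Union>n\<in>{n. n \<noteq> d}. {x \<in> S. ch x n})"
    by (rule openin_Union) (use op in blast)
  ultimately have "openin (top_of_set S) (S - Sd)" by simp
  then have "closedin (top_of_set S) Sd" by (simp add: closedin_def Sd_def)
  then have "Sd = {} \<or> Sd = S"
    using S(2)[unfolded connected_clopen] op[of d] unfolding Sd_def[symmetric] by metis
  moreover have "0 \<in> Sd" using c zero P(2) unfolding Sd_def ch_def d_def by auto
  ultimately have all: "ch x d" if "x \<in> S" for x using that unfolding Sd_def by blast
  have "openin (top_of_set S) P"
    unfolding openin_subopen[of _ P]
  proof
    fix x assume xP: "x \<in> P"
    have "ch x d" using all xP P(2) by blast
    then obtain U V \<phi> L where s: "slice_chart S x d U V \<phi> L" unfolding ch_def by blast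
    have h: "homeomorphism U V \<phi> (the_inv_into U \<phi>)"
      using s diffeomorphism_homeomorphism unfolding slice_chart_def by blast
    have inj: "inj_on \<phi> U" by (metis h homeomorphism_apply1 inj_on_inverseI)
    have oU: "open U" "x \<in> U" using s by (auto simp: slice_chart_def)
    have "openin (top_of_set L) (\<phi> ` (P \<inter> U))"
    proof (rule invariance_of_domain_subspaces)
      show "openin (top_of_set P) (P \<inter> U)" using oU by (simp add: openin_open_Int)
      show "dim L \<le> dim P" "subspace L" using s by (auto simp: slice_chart_def d_def)
      show "continuous_on (P \<inter> U) \<phi>" using homeomorphism_cont1[OF h] by (rule continuous_on_subset) auto
      show "\<phi> \<in> P \<inter> U \<rightarrow> L" using s P(2) by (auto simp: slice_chart_def)
      show "inj_on \<phi> (P \<inter> U)" using inj by (rule inj_on_subset) auto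
    qed (rule P)
    then obtain T where T: "open T" "\<phi> ` (P \<inter> U) = L \<inter> T" by (auto simp: openin_open)
    have "open (U \<inter> \<phi> -` T)"
      using continuous_open_preimage[OF homeomorphism_cont1[OF h] oU(1) T(1)] .
    then have "openin (top_of_set S) (S \<inter> (U \<inter> \<phi> -` T))" by (rule openin_open_Int)
    moreover have "S \<inter> (U \<inter> \<phi> -` T) \<subseteq> P"
    proof
      fix y assume y: "y \<in> S \<inter> (U \<inter> \<phi> -` T)"
      then have "\<phi> y \<in> L" using s by (auto simp: slice_chart_def)
      then have "\<phi> y \<in> \<phi> ` (P \<inter> U)" using T(2) y by auto
      then show "y \<in> P" using inj y by (auto simp: inj_on_def)
    qed
    moreover have "x \<in> S \<inter> (U \<inter> \<phi> -` T)" using xP P(2) oU T(2) by auto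
    ultimately show "\<exists>T. openin (top_of_set S) T \<and> x \<in> T \<and> T \<subseteq> P" by blast
  qed
  moreover have "closedin (top_of_set S) P"
    by (rule closed_subset[OF P(2) closed_subspace[OF P(1)]])
  ultimately show ?thesis using S(2) zero unfolding connected_clopen by blast
qed

lemma has_vector_derivative_in_subspace:
  fixes c :: "real \<Rightarrow> 'a::euclidean_space"
  assumes c: "(c has_vector_derivative X) (at 0)" and L: "subspace L" and ev: "\<forall>\<^sub>F t in nhds 0. c t \<in> L"
  shows "X \<in> L"
proof (rule Lim_in_closed_set[OF closed_subspace[OF L]])
  show "((\<lambda>t. (1 / t) *\<^sub>R (c t - c 0)) \<longlongrightarrow> X) (at 0)"
  proof -
    have "((\<lambda>h. norm (c (0 + h) - c 0 - h *\<^sub>R X) / norm h) \<longlongrightarrow> 0) (at 0)"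
      using c unfolding has_vector_derivative_def has_derivative_at by simp
    then have "((\<lambda>h. norm ((1 / h) *\<^sub>R (c h - c 0) - X)) \<longlongrightarrow> 0) (at 0)"
    proof (rule Lim_transform_eventually)
      show "\<forall>\<^sub>F h in at 0. norm (c (0 + h) - c 0 - h *\<^sub>R X) / norm h = norm ((1 / h) *\<^sub>R (c h - c 0) - X)"
        unfolding eventually_at_filter
      proof (intro always_eventually allI impI)
        fix h :: real assume "h \<noteq> 0"
        then have "(1 / h) *\<^sub>R (c h - c 0) - X = (1 / h) *\<^sub>R (c h - c 0 - h *\<^sub>R X)"
          by (simp add: scaleR_diff_right)
        then show "norm (c (0 + h) - c 0 - h *\<^sub>R X) / norm h = norm ((1 / h) *\<^sub>R (c h - c 0) - X)"
          by simp
      qed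
    qed
    then show ?thesis using Lim_null tendsto_norm_zero_iff by blast
  qed
  have "c 0 \<in> L" using ev eventually_nhds_x_imp_x by blast
  then show "\<forall>\<^sub>F t in at 0. (1 / t) *\<^sub>R (c t - c 0) \<in> L"
    using ev L unfolding eventually_at_filter
    by (auto elim!: eventually_mono intro!: subspace_scale subspace_diff)
qed simp

text \<open>\<open>T\<close> is the image of \<open>L\<close> under the differential of the inverse
  chart: the chart carries curves in \<open>S\<close> to curves in \<open>L\<close>, and straight
  lines in \<open>L\<close> are pulled back.\<close>

lemma tangent_space_of_slice_chart:
  assumes ch: "slice_chart S 0 n U V \<phi> L" and zero: "0 \<in> S" and P: "subspace P" "S \<subseteq> P"
  defines "T \<equiv> {X \<in> P. \<exists>c :: real \<Rightarrow> 'a::euclidean_space. c 0 = 0 \<and> (c has_vector_derivative X) (at 0) \<and> (\<forall>t. c t \<in> S)}"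
  shows "subspace T" "dim T = n"
proof -
  define \<psi> where "\<psi> = the_inv_into U \<phi>"
  have U: "open U" "0 \<in> U" and V: "open V" and L: "subspace L" "dim L = n"
    and d: "diffeomorphism U V \<phi>" and im: "\<phi> ` (S \<inter> U) = V \<inter> L"
    using ch by (auto simp: slice_chart_def)
  have h: "homeomorphism U V \<phi> \<psi>" using diffeomorphism_homeomorphism[OF d] by (simp add: \<psi>_def)
  have \<phi>0V: "\<phi> 0 \<in> V" and \<phi>0: "\<phi> 0 \<in> L" using im zero U by blast+
  obtain f where f: "(\<phi> has_derivative f) (at 0)"
    using smooth_map_on_open_differentiable d U unfolding diffeomorphism_def by blast
  obtain g where g: "(\<psi> has_derivative g) (at (\<phi> 0))"
    using smooth_map_on_open_differentiable d V \<phi>0V unfolding diffeomorphism_def \<psi>_def by blast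
  have lf: "linear f" and lg: "linear g" using f g has_derivative_linear by blast+
  have \<psi>\<phi>: "\<psi> (\<phi> x) = x" if "x \<in> U" for x using h that by (simp add: homeomorphism_def)
  have \<phi>\<psi>: "\<phi> (\<psi> y) = y" if "y \<in> V" for y using h that by (simp add: homeomorphism_def)
  have gf: "g (f X) = X" for X
  proof -
    have "((\<lambda>x. \<psi> (\<phi> x)) has_derivative (\<lambda>x. g (f x))) (at 0)" by (rule has_derivative_compose[OF f g])
    then have "((\<lambda>x. x) has_derivative (\<lambda>x. g (f x))) (at 0)"
      by (rule has_derivative_transform_within_open[OF _ U]) (rule \<psi>\<phi>)
    then have "(\<lambda>x. g (f x)) = (\<lambda>x. x)" using has_derivative_unique has_derivative_ident by blast
    then show ?thesis by metis
  qed
  have fg: "f (g Y) = Y" for Y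
  proof -
    have f': "(\<phi> has_derivative f) (at (\<psi> (\<phi> 0)))" using f \<psi>\<phi>[OF U(2)] by simp
    have "((\<lambda>y. \<phi> (\<psi> y)) has_derivative (\<lambda>y. f (g y))) (at (\<phi> 0))" by (rule has_derivative_compose[OF g f'])
    then have "((\<lambda>y. y) has_derivative (\<lambda>y. f (g y))) (at (\<phi> 0))"
      by (rule has_derivative_transform_within_open[OF _ V \<phi>0V]) (rule \<phi>\<psi>)
    then have "(\<lambda>y. f (g y)) = (\<lambda>y. y)" using has_derivative_unique has_derivative_ident by blast
    then show ?thesis by metis
  qed
  have T_eq: "T = g ` L"
  proof
    show "T \<subseteq> g ` L"
    proof
      fix X assume "X \<in> T"
      then obtain c where c: "c 0 = 0" "(c has_vector_derivative X) (at 0)" "\<And>t. c t \<in> S" by (auto simp: T_def)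
      have "((\<lambda>t. \<phi> (c t)) has_vector_derivative f X) (at 0)"
      proof -
        have "(c has_derivative (\<lambda>t. t *\<^sub>R X)) (at 0)" using c(2) by (simp add: has_vector_derivative_def)
        moreover have "(\<phi> has_derivative f) (at (c 0))" using f c(1) by simp
        ultimately have "((\<lambda>t. \<phi> (c t)) has_derivative (\<lambda>t. f (t *\<^sub>R X))) (at 0)" by (rule has_derivative_compose)
        then show ?thesis by (simp add: has_vector_derivative_def linear_scale[OF lf])
      qed
      moreover have "\<forall>\<^sub>F t in nhds 0. \<phi> (c t) \<in> L"
      proof -
        have "isCont c 0" using has_vector_derivative_continuous[OF c(2)] by simp
        then have "filterlim c (nhds (c 0)) (nhds 0)" by (simp add: isCont_def tendsto_at_iff_tendsto_nhds)
        then have "\<forall>\<^sub>F t in nhds 0. c t \<in> U"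
          by (rule topological_tendstoD) (use U c(1) in auto)
        then show ?thesis by (rule eventually_mono) (use c(3) im in blast)
      qed
      ultimately have "f X \<in> L" by (rule has_vector_derivative_in_subspace[OF _ L(1)])
      then have "g (f X) \<in> g ` L" by (rule imageI)
      then show "X \<in> g ` L" by (simp only: gf)
    qed
    show "g ` L \<subseteq> T"
    proof clarify
      fix Y assume Y: "Y \<in> L"
      \<comment> \<open>A curve in the definition of \<open>T\<close> has to stay in
        \<open>S\<close> for all times; the default value 0, a point of \<open>S\<close>, takes over
        once the line has left \<open>V\<close>.\<close>
      define c where "c t = (if \<phi> 0 + t *\<^sub>R Y \<in> V then \<psi> (\<phi> 0 + t *\<^sub>R Y) else 0)" for t :: real
      have c0: "c 0 = 0" using \<phi>0V \<psi>\<phi>[OF U(2)] by (simp add: c_def)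
      have cS: "c t \<in> S" for t
      proof (cases "\<phi> 0 + t *\<^sub>R Y \<in> V")
        case True
        then have "\<phi> 0 + t *\<^sub>R Y \<in> V \<inter> L" using L(1) \<phi>0 Y by (simp add: subspace_add subspace_scale)
        then obtain s where s: "s \<in> S" "s \<in> U" "\<phi> 0 + t *\<^sub>R Y = \<phi> s" unfolding im[symmetric] by auto
        then have "c t = s" using True \<psi>\<phi> by (simp add: c_def)
        then show ?thesis using s by simp
      qed (simp add: c_def zero)
      have der: "(c has_vector_derivative g Y) (at 0)"
      proof -
        have "((\<lambda>t::real. \<phi> 0 + t *\<^sub>R Y) has_derivative (\<lambda>t. t *\<^sub>R Y)) (at 0)"
          by (auto intro!: derivative_eq_intros)
        moreover have "(\<psi> has_derivative g) (at (\<phi> 0 + (0::real) *\<^sub>R Y))" using g by simp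
        ultimately have "((\<lambda>t. \<psi> (\<phi> 0 + t *\<^sub>R Y)) has_derivative (\<lambda>t. g (t *\<^sub>R Y))) (at 0)"
          by (rule has_derivative_compose)
        moreover have "open ((\<lambda>t::real. \<phi> 0 + t *\<^sub>R Y) -` V)"
          by (intro open_vimage V continuous_intros)
        ultimately have "(c has_derivative (\<lambda>t. g (t *\<^sub>R Y))) (at 0)"
          by (rule has_derivative_transform_within_open) (use \<phi>0V in \<open>auto simp: c_def\<close>)
        then show ?thesis by (simp add: has_vector_derivative_def linear_scale[OF lg])
      qed
      have "g Y \<in> P"
        by (rule has_vector_derivative_in_subspace[OF der P(1) always_eventually[OF allI]]) (use cS P(2) in auto)
      then show "g Y \<in> T" using c0 der cS by (auto simp: T_def)
    qed
  qed
  show "subspace T" unfolding T_eq by (rule linear_subspace_image[OF lg L(1)])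
  have "inj_on g (span L)" by (rule inj_on_inverseI[where g=f]) (rule fg)
  then show "dim T = n" unfolding T_eq using dim_image_eq[OF lg] L(2) by blast
qed

section \<open>The differential of the exponential map\<close>

definition sinhc :: "real \<Rightarrow> real" where
  "sinhc x = (if x = 0 then 1 else sinh x / x)"

lemma sinhc_pos: "sinhc x > 0"
  by (cases "x > 0"; cases "x = 0") (auto simp: sinhc_def divide_neg_neg)

text \<open>The value 1/6 is the coefficient of x^3 in sinh x. Continuity of \<open>g\<close> at 0
  is what allows the second-order term of sinhc(t ad X) to be read off as t tends to 0.\<close>

lemma sinhc_expansion: "\<exists>g. isCont g 0 \<and> g 0 = 1 / 6 \<and> (\<forall>x. sinhc x = 1 + x\<^sup>2 * g x)"
proof -
  \<comment> \<open>The coefficients are those of sinh shifted by three, so that sinh x - x = x^3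
    g(x); the shift exchanges odd and even indices.\<close>
  define c :: "nat \<Rightarrow> real" where "c n = (if even n then 1 / fact (n + 3) else 0)" for n
  define g where "g x = (\<Sum>n. c n * x ^ n)" for x
  have sm: "summable (\<lambda>n. c n * x ^ n)" for x
  proof (rule summable_comparison_test'[where N=0])
    show "summable (\<lambda>n. \<bar>x\<bar> ^ n /\<^sub>R fact n)" by (rule summable_exp_generic)
    show "norm (c n * x ^ n) \<le> \<bar>x\<bar> ^ n /\<^sub>R fact n" for n
    proof -
      have "\<bar>c n\<bar> \<le> 1 / fact n"
        using fact_mono[of n "n + 3", where 'a=real] by (auto simp: c_def intro!: divide_left_mono)
      then have "\<bar>c n\<bar> * \<bar>x\<bar> ^ n \<le> 1 / fact n * \<bar>x\<bar> ^ n" by (intro mult_right_mono) auto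
      then show ?thesis by (simp add: abs_mult power_abs divide_inverse)
    qed
  qed
  have "isCont g x" for x unfolding g_def[abs_def] by (rule isCont_powser_converges_everywhere[OF sm])
  moreover have "g 0 = 1 / 6" by (simp add: g_def powser_zero c_def fact_numeral)
  moreover have "sinhc x = 1 + x\<^sup>2 * g x" for x
  proof (cases "x = 0")
    case False
    let ?f = "\<lambda>n. if even n then 0 else x ^ n /\<^sub>R fact n"
    have "(\<lambda>n. ?f (n + 3)) sums (sinh x - (\<Sum>i<3. ?f i))"
      by (rule sums_split_initial_segment[OF sinh_converges])
    moreover have "(\<Sum>i<3. ?f i) = x" by (simp add: eval_nat_numeral)
    ultimately have "(\<lambda>n. ?f (n + 3)) sums (sinh x - x)" by simp
    moreover have "?f (n + 3) = x ^ 3 * (c n * x ^ n)" for n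
      by (simp add: c_def power_add divide_inverse)
    ultimately have "(\<lambda>n. x ^ 3 * (c n * x ^ n)) sums (sinh x - x)" by simp
    moreover have "(\<lambda>n. x ^ 3 * (c n * x ^ n)) sums (x ^ 3 * g x)"
      unfolding g_def by (intro sums_mult summable_sums sm)
    ultimately have "sinh x - x = x ^ 3 * g x" by (rule sums_unique2)
    then have "sinh x = x * (1 + x\<^sup>2 * g x)" by (simp add: power3_eq_cube power2_eq_square algebra_simps)
    then show ?thesis using False by (simp add: sinhc_def)
  qed (simp add: sinhc_def)
  ultimately show ?thesis by blast
qed

context cartan_lie
begin

definition \<psi> :: "'g \<Rightarrow> 'g \<Rightarrow> 'g" where
  "\<psi> X = fun_calc sinhc (br X)"

lemma \<psi>_linear: "linear (\<psi> X)"
  by (simp add: \<psi>_def fun_calc_linear)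

lemma \<psi>_injective:
  assumes X: "X \<in> \<pp>"
  shows "inj (\<psi> X)"
proof -
  obtain Bx where Bx: "eigenbasis (br X) Bx" using eigenbasis_exists[OF self_adjoint_p[OF X]] by blast
  have o: "onb Bx UNIV" using Bx by (simp add: eigenbasis_def)
  have e: "br X b = ip (br X b) b *\<^sub>R b" if "b \<in> Bx" for b using Bx that by (simp add: eigenbasis_def)
  have f: "\<psi> X v = (\<Sum>b\<in>Bx. (sinhc (ip (br X b) b) * ip v b) *\<^sub>R b)" for v
    unfolding \<psi>_def by (rule fun_calc_onb[OF self_adjoint_p[OF X] o e])
  have "v = 0" if v: "\<psi> X v = 0" for v
  proof -
    have "ip v b = 0" if b: "b \<in> Bx" for b
    proof -
      have "ip (\<psi> X v) b = sinhc (ip (br X b) b) * ip v b"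
        unfolding f by (rule onb_coeff[OF o b])
      then show ?thesis using v sinhc_pos[of "ip (br X b) b"] by (simp add: ip_simps)
    qed
    then have "(\<Sum>b\<in>Bx. ip v b *\<^sub>R b) = 0" by simp
    then show ?thesis by (simp only: onb_expand[OF o])
  qed
  then show ?thesis using linear_injective_0[OF \<psi>_linear] by blast
qed

text \<open>Duhamel: \<open>exp (- ad A) exp (ad (A + s H)) v = v + s [\<integral>\<^sub>0\<^sup>1 exp (- u ad A) H du, v] + O(s\<^sup>2)\<close>;
  here \<open>\<Phi>\<close> is the integral up to \<open>t\<close>.\<close>

lemma exp_ad_perturbation:
  assumes \<Phi>: "\<And>t. (\<Phi> has_vector_derivative E (- (t *\<^sub>R A)) H) (at t)" and \<Phi>0: "\<Phi> 0 = 0"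
  shows "((\<lambda>s. (1 / s) *\<^sub>R (E (- A) (E (A + s *\<^sub>R H) v) - v)) \<longlongrightarrow> br (\<Phi> 1) v) (at 0)"
proof -
  define u where "u s t = E (- (t *\<^sub>R A)) (E (t *\<^sub>R (A + s *\<^sub>R H)) v)" for s t :: real
  define h where "h t = E (- (t *\<^sub>R A)) H" for t :: real
  have du: "(u s has_vector_derivative s *\<^sub>R br (h t) (u s t)) (at t)" for s t
  proof -
    let ?w = "E (t *\<^sub>R (A + s *\<^sub>R H)) v"
    have "((\<lambda>t. E (t *\<^sub>R (- A)) (E (t *\<^sub>R (A + s *\<^sub>R H)) v)) has_vector_derivative
       br (- A) (E (t *\<^sub>R (- A)) ?w) + E (t *\<^sub>R (- A)) (br (A + s *\<^sub>R H) ?w)) (at t)"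
      by (rule exp_ad_product_derivative[OF exp_ad_has_vector_derivative])
    moreover have "br (- A) (E (t *\<^sub>R (- A)) ?w) = - E (t *\<^sub>R (- A)) (br A ?w)"
      using exp_ad_commute_scaled[of t "- A" ?w] by (simp add: br_simps linear_neg[OF exp_ad_linear])
    moreover have "E (t *\<^sub>R (- A)) (br (A + s *\<^sub>R H) ?w) =
       E (t *\<^sub>R (- A)) (br A ?w) + s *\<^sub>R br (E (t *\<^sub>R (- A)) H) (E (t *\<^sub>R (- A)) ?w)"
      by (simp add: br_simps linear_add[OF exp_ad_linear] linear_scale[OF exp_ad_linear] exp_ad_br)
    ultimately show ?thesis by (simp add: u_def[abs_def] h_def)
  qed
  have cu: "continuous_on ({-1..1} \<times> {0..1}) (\<lambda>p. u (fst p) (snd p))"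
  proof -
    have "continuous_on UNIV (\<lambda>p::real \<times> real. (snd p *\<^sub>R (A + fst p *\<^sub>R H), v))"
      by (intro continuous_intros)
    from continuous_on_compose2[OF exp_ad_continuous this]
    have "continuous_on UNIV (\<lambda>p::real \<times> real. E (snd p *\<^sub>R (A + fst p *\<^sub>R H)) v)" by simp
    then have "continuous_on UNIV (\<lambda>p::real \<times> real. (- (snd p *\<^sub>R A), E (snd p *\<^sub>R (A + fst p *\<^sub>R H)) v))"
      by (intro continuous_intros)
    from continuous_on_compose2[OF exp_ad_continuous this]
    have "continuous_on UNIV (\<lambda>p. u (fst p) (snd p))" by (simp add: u_def)
    then show ?thesis by (rule continuous_on_subset) simp
  qed
  have ch: "continuous_on {0..1} h"
  proof -
    have "continuous_on UNIV (\<lambda>t::real. (- (t *\<^sub>R A), H))" by (intro continuous_intros)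
    from continuous_on_compose2[OF exp_ad_continuous this]
    have "continuous_on UNIV h" by (simp add: h_def[abs_def])
    then show ?thesis by (rule continuous_on_subset) simp
  qed
  have "bounded ((\<lambda>p. u (fst p) (snd p)) ` ({-1..1} \<times> {0..1}))"
    by (intro compact_imp_bounded compact_continuous_image[OF cu] compact_Times compact_Icc)
  then obtain R where R': "\<And>y. y \<in> (\<lambda>p. u (fst p) (snd p)) ` ({-1..1} \<times> {0..1}) \<Longrightarrow> norm y \<le> R"
    unfolding bounded_iff by blast
  have R: "norm (u s t) \<le> R" if "\<bar>s\<bar> \<le> 1" "t \<in> {0..1}" for s t
    by (rule R', rule image_eqI[of _ _ "(s, t)"]) (use that in \<open>auto simp: abs_le_iff\<close>)
  have "bounded (h ` {0..1})" by (intro compact_imp_bounded compact_continuous_image[OF ch] compact_Icc)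
  then obtain M where M: "\<And>t. t \<in> {0..1} \<Longrightarrow> norm (h t) \<le> M" unfolding bounded_iff by blast
  define c where "c = br_const * M"
  have M0: "M \<ge> 0" by (rule order_trans[OF norm_ge_zero M[of 0]]) simp
  have c0: "c \<ge> 0" using M0 br_const(1) by (simp add: c_def)
  have brh: "norm (br (h t) w) \<le> c * norm w" if "t \<in> {0..1}" for t w
  proof -
    have "norm (br (h t) w) \<le> br_const * norm (h t) * norm w" by (rule br_const)
    also have "\<dots> \<le> br_const * M * norm w"
      using M[OF that] br_const(1) by (intro mult_right_mono mult_left_mono) auto
    finally show ?thesis by (simp add: c_def)
  qed
  have u0: "u s 0 = v" for s by (simp add: u_def)
  have mvt: "norm (f t - f 0) \<le> B" if f: "\<And>t. t \<in> {0..1} \<Longrightarrow> (f has_vector_derivative f' t) (at t)"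
    and B: "\<And>t. t \<in> {0..1} \<Longrightarrow> norm (f' t) \<le> B" and t: "t \<in> {0..1}" for f f' :: "real \<Rightarrow> 'g" and B t
  proof -
    have B0: "B \<ge> 0" by (rule order_trans[OF norm_ge_zero B[OF t]])
    have "norm (f t - f 0) \<le> B * norm (t - 0)"
    proof (rule differentiable_bound[where S="{0..1}" and f'="\<lambda>t h. h *\<^sub>R f' t"])
      show "(f has_derivative (\<lambda>h. h *\<^sub>R f' x)) (at x within {0..1})" if "x \<in> {0..1}" for x
        using f[OF that] unfolding has_vector_derivative_def by (rule has_derivative_at_withinI)
      show "onorm (\<lambda>h. h *\<^sub>R f' x) \<le> B" if "x \<in> {0..1}" for x
      proof (rule onorm_bound[OF B0])
        show "norm (h *\<^sub>R f' x) \<le> B * norm h" for h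
          using mult_right_mono[OF B[OF that], of "norm h"] by (simp add: mult.commute)
      qed
    qed (use t in auto)
    also have "\<dots> \<le> B * 1" using t B0 by (intro mult_left_mono) auto
    finally show ?thesis by simp
  qed
  have b1: "norm (u s t - v) \<le> \<bar>s\<bar> * (c * R)" if s: "\<bar>s\<bar> \<le> 1" and t: "t \<in> {0..1}" for s t
  proof -
    have "norm (u s t - u s 0) \<le> \<bar>s\<bar> * (c * R)"
    proof (rule mvt[OF du _ t])
      fix t :: real assume t: "t \<in> {0..1}"
      have "norm (br (h t) (u s t)) \<le> c * norm (u s t)" by (rule brh[OF t])
      also have "\<dots> \<le> c * R" by (rule mult_left_mono[OF R[OF s t] c0])
      finally show "norm (s *\<^sub>R br (h t) (u s t)) \<le> \<bar>s\<bar> * (c * R)" by (simp add: mult_left_mono)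
    qed
    then show ?thesis by (simp add: u0)
  qed
  \<comment> \<open>The bound \<open>b1\<close> says that \<open>u s t\<close> is \<open>v\<close>
    up to order s. Fed back into the differential equation \<open>du\<close>, it improves the
    comparison with \<open>v + s *\<^sub>R br (\<Phi> t) v\<close> to order s^2.\<close>
  have b2: "norm (u s 1 - v - s *\<^sub>R br (\<Phi> 1) v) \<le> \<bar>s\<bar> * (c * (\<bar>s\<bar> * (c * R)))" if s: "\<bar>s\<bar> \<le> 1" for s
  proof -
    define f where "f t = u s t - v - s *\<^sub>R br (\<Phi> t) v" for t
    have "norm (f 1 - f 0) \<le> \<bar>s\<bar> * (c * (\<bar>s\<bar> * (c * R)))"
    proof (rule mvt)
      fix t :: real assume t: "t \<in> {0..1}"
      have "((\<lambda>t. br (\<Phi> t) v) has_vector_derivative br (h t) v) (at t)"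
        using bounded_linear.has_vector_derivative[OF bounded_bilinear.bounded_linear_left[OF br_bounded] \<Phi>]
        by (simp add: h_def)
      then have "((\<lambda>t. s *\<^sub>R br (\<Phi> t) v) has_vector_derivative s *\<^sub>R br (h t) v) (at t)"
        by (rule bounded_linear.has_vector_derivative[OF bounded_linear_scaleR_right])
      from has_vector_derivative_diff[OF has_vector_derivative_diff[OF du has_vector_derivative_const] this]
      show "(f has_vector_derivative s *\<^sub>R br (h t) (u s t - v)) (at t)"
        by (simp add: f_def[abs_def] br_simps scaleR_diff_right)
      have "norm (br (h t) (u s t - v)) \<le> c * norm (u s t - v)" by (rule brh[OF t])
      also have "\<dots> \<le> c * (\<bar>s\<bar> * (c * R))" by (rule mult_left_mono[OF b1[OF s t] c0])
      finally show "norm (s *\<^sub>R br (h t) (u s t - v)) \<le> \<bar>s\<bar> * (c * (\<bar>s\<bar> * (c * R)))"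
        by (simp add: mult_left_mono)
    qed simp
    then show ?thesis by (simp add: f_def u0 \<Phi>0 br_simps)
  qed
  have "((\<lambda>s. (1 / s) *\<^sub>R (u s 1 - v) - br (\<Phi> 1) v) \<longlongrightarrow> 0) (at 0)"
  proof (rule Lim_null_comparison)
    show "((\<lambda>s. \<bar>s\<bar> * (c * (c * R))) \<longlongrightarrow> 0) (at 0)" by (auto intro!: tendsto_eq_intros)
    have "\<forall>\<^sub>F s in at (0::real). \<bar>s\<bar> \<le> 1 \<and> s \<noteq> 0"
      unfolding eventually_at by (intro exI[of _ 1]) auto
    then show "\<forall>\<^sub>F s in at 0. norm ((1 / s) *\<^sub>R (u s 1 - v) - br (\<Phi> 1) v) \<le> \<bar>s\<bar> * (c * (c * R))"
    proof eventually_elim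
      case (elim s)
      have "(1 / s) *\<^sub>R (u s 1 - v) - br (\<Phi> 1) v = (1 / s) *\<^sub>R (u s 1 - v - s *\<^sub>R br (\<Phi> 1) v)"
        using elim by (simp add: scaleR_diff_right)
      also have "norm \<dots> = norm (u s 1 - v - s *\<^sub>R br (\<Phi> 1) v) / \<bar>s\<bar>" by simp
      also have "\<dots> \<le> \<bar>s\<bar> * (c * (\<bar>s\<bar> * (c * R))) / \<bar>s\<bar>" by (rule divide_right_mono) (use b2 elim in auto)
      also have "\<dots> = \<bar>s\<bar> * (c * (c * R))" using elim by simp
      finally show ?case .
    qed
  qed
  then have "((\<lambda>s. (1 / s) *\<^sub>R (u s 1 - v)) \<longlongrightarrow> br (\<Phi> 1) v) (at 0)" by (rule LIM_zero_cancel)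
  then show ?thesis by (simp add: u_def)
qed

text \<open>This differentiates the inverse of exp at the identity without presupposing
  differentiability. Properness (\<open>exp_ad_p_tendsto_imp\<close>) gives c(s) to 0; then the
  quotients c(s)/s stay bounded because ad is injective and the Taylor remainder is small relative
  to them; then ad(c(s)/s) tends to ad W.\<close>

lemma exp_ad_p_inverse_derivative:
  assumes c: "\<And>s. c s \<in> \<pp>" and lim: "\<And>v. ((\<lambda>s. (1 / s) *\<^sub>R (E (c s) v - v)) \<longlongrightarrow> br W v) (at 0)"
  shows "((\<lambda>s. (1 / s) *\<^sub>R c s) \<longlongrightarrow> W) (at (0::real))"
proof -
  have Ev: "((\<lambda>s. E (c s) v) \<longlongrightarrow> v) (at 0)" for v
  proof -
    have "((\<lambda>s. v + s *\<^sub>R ((1 / s) *\<^sub>R (E (c s) v - v))) \<longlongrightarrow> v + 0 *\<^sub>R br W v) (at 0)"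
      by (intro tendsto_intros lim)
    then have "((\<lambda>s. v + s *\<^sub>R ((1 / s) *\<^sub>R (E (c s) v - v))) \<longlongrightarrow> v) (at 0)" by simp
    then show ?thesis
      by (rule Lim_transform_eventually) (auto simp: eventually_at_filter)
  qed
  have c0: "(c \<longlongrightarrow> 0) (at 0)"
    unfolding tendsto_at_iff_sequentially
  proof (intro allI impI)
    fix X :: "nat \<Rightarrow> real" assume X: "\<forall>i. X i \<in> UNIV - {0}" "X \<longlonglongrightarrow> 0"
    have "(\<lambda>n. E ((c \<circ> X) n) v) \<longlonglongrightarrow> E 0 v" for v
      using Ev[of v, unfolded tendsto_at_iff_sequentially] X by (simp add: o_def)
    then show "(c \<circ> X) \<longlonglongrightarrow> 0"
      by (rule exp_ad_p_tendsto_imp[rotated 2]) (use c subspace_0[OF subspace_p] in auto)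
  qed
  define k where "k = br_const"
  have k: "k > 0" using br_const by (simp add: k_def)
  define n where "n D = (\<Sum>b\<in>Basis. norm (br D b))" for D
  \<comment> \<open>Injectivity of ad together with compactness of the sphere bounds D by the values
    of ad D on the basis.\<close>
  obtain \<mu> where \<mu>: "\<mu> > 0" "\<And>D. \<mu> * norm D \<le> n D"
  proof -
    have "continuous_on UNIV n"
      unfolding n_def[abs_def]
      by (intro continuous_on_sum continuous_on_norm bounded_bilinear.continuous_on[OF br_bounded]
          continuous_on_id continuous_on_const)
    then have cn: "continuous_on (sphere 0 1) n" by (rule continuous_on_subset) simp
    have ne: "sphere (0::'g) 1 \<noteq> {}" by simp
    obtain D0 where D0: "D0 \<in> sphere 0 1" "\<And>D. D \<in> sphere 0 1 \<Longrightarrow> n D0 \<le> n D"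
      using continuous_attains_inf[OF compact_sphere ne cn] by blast
    have n_ge: "n D \<ge> 0" for D by (simp add: n_def sum_nonneg)
    have "n D0 \<noteq> 0"
    proof
      assume "n D0 = 0"
      then have z: "br D0 b = 0" if "b \<in> Basis" for b using that by (simp add: n_def sum_nonneg_eq_0_iff)
      have "br D0 v = 0" for v
      proof -
        have "br D0 (\<Sum>b\<in>Basis. (v \<bullet> b) *\<^sub>R b) = 0" using z by (simp add: br_sum_right)
        then show ?thesis by (simp only: euclidean_representation)
      qed
      then have "D0 = 0" by (rule center_zero)
      then show False using D0(1) by simp
    qed
    then have pos: "n D0 > 0" using n_ge[of D0] by simp
    have "n D0 * norm D \<le> n D" for D
    proof (cases "D = 0")
      case False
      have "n (D /\<^sub>R norm D) = n D / norm D"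
        by (simp add: n_def sum_distrib_left divide_inverse mult.commute)
      moreover have "n D0 \<le> n (D /\<^sub>R norm D)" using False by (intro D0(2)) simp
      ultimately have "n D0 \<le> n D / norm D" by (simp only:)
      then show ?thesis using False by (simp add: pos_le_divide_eq)
    qed (simp add: n_ge)
    then show ?thesis using that pos by blast
  qed
  define D where "D s = (1 / s) *\<^sub>R c s" for s
  define Q where "Q v s = (1 / s) *\<^sub>R (E (c s) v - v)" for v s
  define \<epsilon> where "\<epsilon> s = k^2 * norm (c s) * exp (k * norm (c s))" for s
  have \<epsilon>0: "(\<epsilon> \<longlongrightarrow> 0) (at 0)"
  proof -
    have "((\<lambda>s. k^2 * norm (c s) * exp (k * norm (c s))) \<longlongrightarrow> k^2 * norm (0::'g) * exp (k * norm (0::'g))) (at 0)"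
      by (intro tendsto_intros c0)
    then show ?thesis by (simp add: \<epsilon>_def[abs_def])
  qed
  have \<epsilon>_ge: "\<epsilon> s \<ge> 0" for s by (simp add: \<epsilon>_def)
  have rem: "norm (Q v s - br (D s) v) \<le> \<epsilon> s * norm (D s) * norm v" if "s \<noteq> 0" for s v
  proof -
    have "Q v s - br (D s) v = (1 / s) *\<^sub>R (E (c s) v - v - br (c s) v)"
      by (simp add: Q_def D_def br_simps scaleR_diff_right)
    then have "norm (Q v s - br (D s) v) = norm (E (c s) v - v - br (c s) v) / \<bar>s\<bar>" by simp
    also have "\<dots> \<le> ((k * norm (c s))^2 * exp (k * norm (c s)) * norm v) / \<bar>s\<bar>"
      unfolding k_def by (intro divide_right_mono exp_ad_first_order) simp
    also have "\<dots> = \<epsilon> s * norm (D s) * norm v"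
      by (simp add: \<epsilon>_def D_def power_mult_distrib power2_eq_square)
    finally show ?thesis .
  qed
  define S where "S s = (\<Sum>b\<in>Basis. norm (Q b s))" for s
  define d where "d = real DIM('g)"
  define S0 where "S0 = (\<Sum>b\<in>Basis. norm (br W b))"
  have S0: "(S \<longlongrightarrow> S0) (at 0)"
    unfolding S_def[abs_def] S0_def Q_def by (intro tendsto_sum tendsto_norm lim)
  have nD: "n (D s) \<le> S s + \<epsilon> s * norm (D s) * d" if s: "s \<noteq> 0" for s
  proof -
    have "n (D s) \<le> (\<Sum>b\<in>(Basis::'g set). norm (Q b s) + \<epsilon> s * norm (D s))"
      unfolding n_def
    proof (rule sum_mono)
      fix b :: 'g assume b: "b \<in> Basis"
      have "norm (br (D s) b) \<le> norm (Q b s) + norm (Q b s - br (D s) b)"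
        using norm_triangle_ineq4[of "Q b s" "Q b s - br (D s) b"] by simp
      then show "norm (br (D s) b) \<le> norm (Q b s) + \<epsilon> s * norm (D s)"
        using rem[OF s, of b] b by simp
    qed
    then show ?thesis by (simp add: S_def d_def sum.distrib mult.commute)
  qed
  have d: "d > 0" by (simp add: d_def)
  \<comment> \<open>Once \<open>\<epsilon> s * d\<close> is below \<open>\<mu> / 2\<close>, half of
    \<open>\<mu> * norm (D s)\<close> absorbs the remainder, and the other half is at most
    \<open>S0 + 1\<close>.\<close>
  define C where "C = 2 * (S0 + 1) / \<mu>"
  have evs: "\<forall>\<^sub>F s in at 0. s \<noteq> 0 \<and> norm (D s) \<le> C"
  proof -
    have "\<forall>\<^sub>F s in at 0. \<epsilon> s < \<mu> / (2 * d)" by (rule order_tendstoD(2)[OF \<epsilon>0]) (use \<mu>(1) d in simp)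
    moreover have "\<forall>\<^sub>F s in at 0. S s < S0 + 1" by (rule order_tendstoD(2)[OF S0]) simp
    moreover have "\<forall>\<^sub>F s in at (0::real). s \<noteq> 0" by (simp add: eventually_at_filter)
    ultimately show ?thesis
    proof eventually_elim
      case (elim s)
      have "\<epsilon> s * d \<le> \<mu> / 2" using elim(1) d by (simp add: field_simps)
      then have "\<epsilon> s * d * norm (D s) \<le> \<mu> / 2 * norm (D s)" by (rule mult_right_mono) simp
      moreover have "\<mu> * norm (D s) \<le> S s + \<epsilon> s * norm (D s) * d"
        using \<mu>(2)[of "D s"] nD[OF elim(3)] by linarith
      ultimately have "\<mu> / 2 * norm (D s) \<le> S0 + 1" using elim(2) by (simp add: mult_ac)
      then show ?case using \<mu>(1) elim(3) by (simp add: C_def field_simps)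
    qed
  qed
  have "((\<lambda>s. br (D s) v) \<longlongrightarrow> br W v) (at 0)" for v
  proof -
    have "((\<lambda>s. Q v s - br (D s) v) \<longlongrightarrow> 0) (at 0)"
    proof (rule Lim_null_comparison)
      have "((\<lambda>s. \<epsilon> s * C * norm v) \<longlongrightarrow> 0 * C * norm v) (at 0)" by (intro tendsto_intros \<epsilon>0)
      then show "((\<lambda>s. \<epsilon> s * C * norm v) \<longlongrightarrow> 0) (at 0)" by simp
      show "\<forall>\<^sub>F s in at 0. norm (Q v s - br (D s) v) \<le> \<epsilon> s * C * norm v"
        using evs
      proof eventually_elim
        case (elim s)
        have "\<epsilon> s * norm (D s) * norm v \<le> \<epsilon> s * C * norm v"
          using elim \<epsilon>_ge by (intro mult_right_mono mult_left_mono) auto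
        then show ?case using rem[of s v] elim by linarith
      qed
    qed
    from tendsto_diff[OF lim[of v, folded Q_def] this] show ?thesis by simp
  qed
  then show ?thesis unfolding D_def[symmetric] by (rule ad_tendsto_imp)
qed

lemma has_vector_derivative_iff_limit:
  fixes c :: "real \<Rightarrow> 'g"
  assumes "c 0 = 0" "((\<lambda>t. (1 / t) *\<^sub>R c t) \<longlongrightarrow> X) (at 0)"
  shows "(c has_vector_derivative X) (at 0)"
proof -
  have "((\<lambda>t. norm ((1 / t) *\<^sub>R c t - X)) \<longlongrightarrow> 0) (at 0)"
    by (rule tendsto_norm_zero[OF LIM_zero[OF assms(2)]])
  then have "((\<lambda>h. norm (c (0 + h) - c 0 - h *\<^sub>R X) / norm h) \<longlongrightarrow> 0) (at 0)"
  proof (rule Lim_transform_eventually)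
    show "\<forall>\<^sub>F t in at 0. norm ((1 / t) *\<^sub>R c t - X) = norm (c (0 + t) - c 0 - t *\<^sub>R X) / norm t"
      unfolding eventually_at_filter
    proof (intro always_eventually allI impI)
      fix t :: real assume "t \<noteq> 0"
      then have "(1 / t) *\<^sub>R c t - X = (1 / t) *\<^sub>R (c t - t *\<^sub>R X)" by (simp add: scaleR_diff_right)
      then show "norm ((1 / t) *\<^sub>R c t - X) = norm (c (0 + t) - c 0 - t *\<^sub>R X) / norm t"
        by (simp add: assms(1))
    qed
  qed
  then show ?thesis
    unfolding has_vector_derivative_def has_derivative_at by (simp add: bounded_linear_scaleR_left)
qed

lemma exp_ad_onb:
  assumes o: "onb Bs UNIV" and e: "\<And>b. b \<in> Bs \<Longrightarrow> br X b = l b *\<^sub>R b"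
  shows "E (t *\<^sub>R X) v = (\<Sum>b\<in>Bs. (exp (t * l b) * ip v b) *\<^sub>R b)"
proof -
  have "E (t *\<^sub>R X) v = E (t *\<^sub>R X) (\<Sum>b\<in>Bs. ip v b *\<^sub>R b)" by (simp only: onb_expand[OF o])
  also have "\<dots> = (\<Sum>b\<in>Bs. ip v b *\<^sub>R E (t *\<^sub>R X) b)"
    by (simp add: linear_sum[OF exp_ad_linear] linear_scale[OF exp_ad_linear])
  also have "\<dots> = (\<Sum>b\<in>Bs. (exp (t * l b) * ip v b) *\<^sub>R b)"
  proof (rule sum.cong)
    fix b assume "b \<in> Bs"
    then have "br (t *\<^sub>R X) b = (t * l b) *\<^sub>R b" using e by (simp add: br_simps)
    then have "E (t *\<^sub>R X) b = exp (t * l b) *\<^sub>R b" by (rule exp_ad_eigen)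
    then show "ip v b *\<^sub>R E (t *\<^sub>R X) b = (exp (t * l b) * ip v b) *\<^sub>R b" by (simp add: mult.commute)
  qed simp
  finally show ?thesis .
qed

text \<open>The differential at \<open>X\<close> of \<open>Exp\<^sub>o\<close>, translated back to the origin by \<open>exp (- X)\<close>, is \<open>\<psi> X\<close>.\<close>

lemma Exp_curve:
  assumes X: "X \<in> \<pp>" and Z: "Z \<in> \<pp>"
  obtains c where "c 0 = 0" "\<And>s::real. c s \<in> \<pp>" "\<And>s. act (E X) (Exp (c s)) = Exp (X + s *\<^sub>R Z)"
    "(c has_vector_derivative \<psi> X Z) (at 0)"
proof -
  have XZ: "X + s *\<^sub>R Z \<in> \<pp>" for s using X Z subspace_p by (simp add: subspace_add subspace_scale)
  have "\<forall>s. \<exists>W. W \<in> \<pp> \<and> act (E (- X)) (Exp (X + s *\<^sub>R Z)) = Exp W"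
    using transition_exists[OF exp_in_G XZ] by blast
  then obtain c where c: "\<And>s. c s \<in> \<pp>" "\<And>s. act (E (- X)) (Exp (X + s *\<^sub>R Z)) = Exp (c s)" by metis
  have act_c: "act (E X) (Exp (c s)) = Exp (X + s *\<^sub>R Z)" for s by (simp add: c(2)[symmetric])
  have "Exp (c 0) = Exp 0" unfolding c(2)[symmetric] by (simp add: Exp_eq[of X] Exp_0)
  then have c0: "c 0 = 0" by (rule Exp_inj[OF c(1) subspace_0[OF subspace_p]])
  obtain Bx where Bx: "eigenbasis (br X) Bx" using eigenbasis_exists[OF self_adjoint_p[OF X]] by blast
  have o: "onb Bx UNIV" using Bx by (simp add: eigenbasis_def)
  define l where "l b = ip (br X b) b" for b
  have e: "br X b = l b *\<^sub>R b" if "b \<in> Bx" for b using Bx that by (simp add: eigenbasis_def l_def)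
  \<comment> \<open>\<open>\<phi> m t\<close> is the integral of exp(-2um) over u in [0, t]. The
    factor 2 arises because \<open>Exp_transition\<close> involves E(2X), so the perturbation
    formula is used with 2X and 2Z.\<close>
  define \<phi> where "\<phi> m t = (if m = 0 then t else (1 - exp (- (2 * t * m))) / (2 * m))" for m t :: real
  define \<Phi> where "\<Phi> t = (\<Sum>b\<in>Bx. (\<phi> (l b) t * ip (2 *\<^sub>R Z) b) *\<^sub>R b)" for t
  have d\<phi>: "(\<phi> m has_real_derivative exp (- (2 * t * m))) (at t)" for m t
    unfolding \<phi>_def by (cases "m = 0") (auto intro!: derivative_eq_intros)
  have "(\<Phi> has_vector_derivative (\<Sum>b\<in>Bx. (exp (- (2 * t * l b)) * ip (2 *\<^sub>R Z) b) *\<^sub>R b)) (at t)" for t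
    unfolding \<Phi>_def[abs_def]
  proof (rule has_vector_derivative_sum)
    fix b
    have "((\<lambda>t. \<phi> (l b) t * ip (2 *\<^sub>R Z) b) has_real_derivative exp (- (2 * t * l b)) * ip (2 *\<^sub>R Z) b) (at t)"
      by (rule DERIV_cmult_right[OF d\<phi>])
    then show "((\<lambda>t. (\<phi> (l b) t * ip (2 *\<^sub>R Z) b) *\<^sub>R b) has_vector_derivative
       (exp (- (2 * t * l b)) * ip (2 *\<^sub>R Z) b) *\<^sub>R b) (at t)"
      using has_vector_derivative_scaleR[OF _ has_vector_derivative_const, of _ _ t UNIV b] by fastforce
  qed
  moreover have "(\<Sum>b\<in>Bx. (exp (- (2 * t * l b)) * ip (2 *\<^sub>R Z) b) *\<^sub>R b) = E (- (t *\<^sub>R (2 *\<^sub>R X))) (2 *\<^sub>R Z)" for t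
    using exp_ad_onb[OF o e, of "- (2 * t)" "2 *\<^sub>R Z"] by (simp add: mult.commute)
  ultimately have d\<Phi>: "(\<Phi> has_vector_derivative E (- (t *\<^sub>R (2 *\<^sub>R X))) (2 *\<^sub>R Z)) (at t)" for t by simp
  have "\<phi> m 0 = 0" for m by (simp add: \<phi>_def)
  then have \<Phi>0: "\<Phi> 0 = 0" by (simp add: \<Phi>_def)
  \<comment> \<open>On an eigenvector for m this is the identity exp(m) (1 - exp(-2m)) / (2m) =
    sinh(m) / m.\<close>
  have E\<Phi>: "E X (\<Phi> 1) = 2 *\<^sub>R \<psi> X Z"
  proof -
    have "exp m * \<phi> m 1 = sinhc m" for m :: real
    proof (cases "m = 0")
      case False
      have "exp m * (1 - exp (- (2 * m))) = exp m - exp (- m)"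
        by (simp add: algebra_simps flip: exp_add)
      then show ?thesis using False by (simp add: \<phi>_def sinhc_def sinh_def field_simps)
    qed (simp add: \<phi>_def sinhc_def)
    then have s: "exp m * (\<phi> m 1 * y) = sinhc m * y" for m y by (simp flip: mult.assoc)
    have "E X (\<Phi> 1) = (\<Sum>b\<in>Bx. (exp (l b) * ip (\<Phi> 1) b) *\<^sub>R b)" using exp_ad_onb[OF o e, of 1 "\<Phi> 1"] by simp
    also have "\<dots> = (\<Sum>b\<in>Bx. (sinhc (l b) * ip (2 *\<^sub>R Z) b) *\<^sub>R b)"
    proof (rule sum.cong)
      fix b assume b: "b \<in> Bx"
      have "ip (\<Phi> 1) b = \<phi> (l b) 1 * ip (2 *\<^sub>R Z) b" unfolding \<Phi>_def by (rule onb_coeff[OF o b])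
      then show "(exp (l b) * ip (\<Phi> 1) b) *\<^sub>R b = (sinhc (l b) * ip (2 *\<^sub>R Z) b) *\<^sub>R b" by (simp only: s)
    qed simp
    also have "\<dots> = \<psi> X (2 *\<^sub>R Z)" unfolding \<psi>_def by (rule fun_calc_onb[OF self_adjoint_p[OF X] o e, symmetric])
    finally show ?thesis by (simp add: linear_scale[OF \<psi>_linear])
  qed
  have "((\<lambda>s. (1 / s) *\<^sub>R (E (2 *\<^sub>R c s) v - v)) \<longlongrightarrow> br (2 *\<^sub>R \<psi> X Z) v) (at 0)" for v
  proof -
    define w where "w = E (- X) v"
    have "E (2 *\<^sub>R c s) v = E X (E (- (2 *\<^sub>R X)) (E (2 *\<^sub>R X + s *\<^sub>R (2 *\<^sub>R Z)) w))" for s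
    proof -
      have "E (2 *\<^sub>R c s) v = E (- X) (E (2 *\<^sub>R (X + s *\<^sub>R Z)) (\<theta> (inv (E (- X)) (\<theta> v))))"
        by (rule Exp_transition[OF exp_in_G XZ c(1) c(2)])
      also have "\<theta> (inv (E (- X)) (\<theta> v)) = w"
        using X by (simp add: inv_exp_ad exp_ad_\<theta> w_def p_iff)
      also have "2 *\<^sub>R (X + s *\<^sub>R Z) = 2 *\<^sub>R X + s *\<^sub>R (2 *\<^sub>R Z)" by (simp add: scaleR_add_right)
      also have "E (- X) u = E X (E (- (2 *\<^sub>R X)) u)" for u
        using exp_ad_double[of "- X" u] by simp
      finally show ?thesis .
    qed
    then have eq: "(1 / s) *\<^sub>R (E (2 *\<^sub>R c s) v - v) =
        E X ((1 / s) *\<^sub>R (E (- (2 *\<^sub>R X)) (E (2 *\<^sub>R X + s *\<^sub>R (2 *\<^sub>R Z)) w) - w))" for s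
      by (simp add: linear_scale[OF exp_ad_linear] linear_diff[OF exp_ad_linear]) (simp add: w_def)
    have "((\<lambda>s. E X ((1 / s) *\<^sub>R (E (- (2 *\<^sub>R X)) (E (2 *\<^sub>R X + s *\<^sub>R (2 *\<^sub>R Z)) w) - w))) \<longlongrightarrow> E X (br (\<Phi> 1) w)) (at 0)"
      by (intro exp_ad_tendsto tendsto_const exp_ad_perturbation d\<Phi> \<Phi>0)
    moreover have "E X (br (\<Phi> 1) w) = br (2 *\<^sub>R \<psi> X Z) v" by (simp add: exp_ad_br E\<Phi> w_def)
    ultimately show ?thesis by (simp only: eq)
  qed
  then have "((\<lambda>s. (1 / s) *\<^sub>R (2 *\<^sub>R c s)) \<longlongrightarrow> 2 *\<^sub>R \<psi> X Z) (at 0)"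
    by (rule exp_ad_p_inverse_derivative[rotated]) (use c(1) subspace_scale[OF subspace_p] in blast)
  then have "((\<lambda>s. (1 / 2) *\<^sub>R ((1 / s) *\<^sub>R (2 *\<^sub>R c s))) \<longlongrightarrow> (1 / 2) *\<^sub>R (2 *\<^sub>R \<psi> X Z)) (at 0)"
    by (rule tendsto_scaleR[OF tendsto_const])
  then have "(c has_vector_derivative \<psi> X Z) (at 0)"
    by (intro has_vector_derivative_iff_limit c0) simp
  then show ?thesis using that c0 c(1) act_c by blast
qed

end

section \<open>Totally geodesic submanifolds\<close>

locale totally_geodesic = cartan_lie br \<theta> for br :: "'g::euclidean_space \<Rightarrow> 'g \<Rightarrow> 'g" and \<theta> :: "'g \<Rightarrow> 'g" +
  fixes N :: "('g \<Rightarrow> 'g) set set"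
  assumes N_geodesic: "complete_totally_geodesic br \<theta> N"
    and N_connected: "connected_in_M br \<theta> N" and N_origin: "origin br \<theta> \<in> N"
begin

abbreviation "q \<equiv> p_sub br \<theta> N"

text \<open>Every tangent vector at the origin generates a geodesic inside N, so \<open>q\<close> is
  contained in the chart image of N. It is a subspace of the dimension of the chart at 0, and
  \<open>submanifold_eq_subspace\<close> gives equality.\<close>

lemma
  shows q_subspace: "subspace q" and N_chart: "chart_image br \<theta> N = q"
proof -
  define S where "S = chart_image br \<theta> N"
  have emb: "embedded_submanifold S" using N_geodesic by (simp add: complete_totally_geodesic_def S_def)
  have con: "connected S" using N_connected by (simp add: connected_in_M_def S_def)
  have Sp: "S \<subseteq> \<pp>" by (auto simp: S_def chart_image_def)
  have zero: "0 \<in> S"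
    using N_origin subspace_0[OF subspace_p] by (simp add: S_def chart_image_def Exp_0 origin_def)
  have q_eq: "q = {X \<in> \<pp>. \<exists>c :: real \<Rightarrow> 'g. c 0 = 0 \<and> (c has_vector_derivative X) (at 0) \<and> (\<forall>t. c t \<in> S)}"
    by (simp add: p_sub_def tangent_vectors_def S_def chart_image_def act_def)
  obtain n U V \<phi> L where ch: "slice_chart S 0 n U V \<phi> L"
    using embedded_submanifold_slice_chart[OF emb zero] by blast
  have sq: "subspace q" and dq: "dim q = n"
    unfolding q_eq by (rule tangent_space_of_slice_chart[OF ch zero subspace_p Sp])+
  have "q \<subseteq> S"
  proof
    fix X assume X: "X \<in> q"
    then have Xp: "X \<in> \<pp>" by (simp add: q_eq)
    have "act id (origin br \<theta>) \<in> N" using N_origin by simp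
    then have "act id (Exp (1 *\<^sub>R X)) \<in> N"
      using N_geodesic id_in_G X unfolding complete_totally_geodesic_def p_sub_def by blast
    then show "X \<in> S" using Xp by (simp add: S_def chart_image_def)
  qed
  then have "S = q" by (rule submanifold_eq_subspace[OF emb con sq _ ch[folded dq]])
  then show "subspace q" "chart_image br \<theta> N = q" using sq by (auto simp: S_def)
qed

lemma q_sub_p: "q \<subseteq> \<pp>"
  by (auto simp: p_sub_def tangent_vectors_def)

lemma N_eq: "N = Exp ` q"
proof
  show "N \<subseteq> Exp ` q"
  proof
    fix p assume p: "p \<in> N"
    then have "p \<in> sym_space br \<theta>" using N_geodesic by (auto simp: complete_totally_geodesic_def)
    then obtain X where X: "X \<in> \<pp>" "p = Exp X" by (auto simp: sym_space_eq)
    then have "X \<in> q" using p N_chart by (auto simp: chart_image_def)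
    then show "p \<in> Exp ` q" using X by blast
  qed
  show "Exp ` q \<subseteq> N" using N_chart by (auto simp: chart_image_def)
qed

lemma N_D: "p \<in> N \<Longrightarrow> \<exists>W\<in>q. p = Exp W"
  by (metis N_eq imageE)

lemma N_I: "W \<in> q \<Longrightarrow> Exp W \<in> N"
  by (metis N_eq imageI)

text \<open>The line \<open>X + s *\<^sub>R Z\<close> lies in \<open>q\<close>, so its image under
  Exp is a curve in N. By \<open>Exp_curve\<close> its velocity, translated to the origin, is
  \<open>\<psi> X Z\<close>, hence tangent to N at Exp X.\<close>

lemma N_geodesics:
  assumes X: "X \<in> q" and Z: "Z \<in> q"
  shows "act (E X) (Exp (\<psi> X Z)) \<in> N"
proof -
  have Xp: "X \<in> \<pp>" and Zp: "Z \<in> \<pp>" using X Z q_sub_p by auto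
  obtain c where c: "c 0 = 0" "\<And>s::real. c s \<in> \<pp>" "\<And>s. act (E X) (Exp (c s)) = Exp (X + s *\<^sub>R Z)"
    "(c has_vector_derivative \<psi> X Z) (at 0)"
    using Exp_curve[OF Xp Zp] by blast
  have "X + s *\<^sub>R Z \<in> q" for s using X Z q_subspace by (simp add: subspace_add subspace_scale)
  then have cN: "act (E X) (Exp (c s)) \<in> N" for s unfolding c(3) by (rule N_I)
  have "\<psi> X Z \<in> \<pp>"
    by (rule has_vector_derivative_in_subspace[OF c(4) subspace_p always_eventually[OF allI]]) (rule c(2))
  then have "\<psi> X Z \<in> tangent_vectors br \<theta> (E X) N"
    unfolding tangent_vectors_def using c(1,2,4) cN by blast
  moreover have "act (E X) (origin br \<theta>) \<in> N" using N_I[OF X] by (simp add: origin_def Exp_eq)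
  ultimately have "act (E X) (Exp (1 *\<^sub>R \<psi> X Z)) \<in> N"
    using N_geodesic exp_in_G unfolding complete_totally_geodesic_def by blast
  then show ?thesis by simp
qed

lemma \<psi>_image_subspace: "subspace (\<psi> X ` q)"
  by (rule linear_subspace_image[OF \<psi>_linear q_subspace])

lemma dim_\<psi>_image: "X \<in> \<pp> \<Longrightarrow> dim (\<psi> X ` q) = dim q"
  by (rule dim_image_eq[OF \<psi>_linear inj_on_subset[OF \<psi>_injective]]) auto

lemma \<psi>_in_p: "X \<in> q \<Longrightarrow> \<psi> X ` q \<subseteq> \<pp>"
proof clarify
  fix Z assume X: "X \<in> q" and Z: "Z \<in> q"
  have Xp: "X \<in> \<pp>" and Zp: "Z \<in> \<pp>" using X Z q_sub_p by auto
  obtain c where "c 0 = 0" and c: "\<And>s::real. c s \<in> \<pp>" "\<And>s. act (E X) (Exp (c s)) = Exp (X + s *\<^sub>R Z)"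
    "(c has_vector_derivative \<psi> X Z) (at 0)"
    using Exp_curve[OF Xp Zp] by blast
  show "\<psi> X Z \<in> \<pp>"
    by (rule has_vector_derivative_in_subspace[OF c(3) subspace_p always_eventually[OF allI]]) (rule c(1))
qed

text \<open>The identity in \<open>Exp_transition\<close> carries convergence of \<open>Y n\<close>
  over to the operators E(2 W_n), and \<open>exp_ad_p_tendsto_imp\<close> returns from these to
  \<open>W n\<close>.\<close>

lemma transition_continuous:
  assumes g: "g \<in> G" and Y: "\<And>n::nat. Y n \<in> \<pp>" "Y0 \<in> \<pp>" "Y \<longlonglongrightarrow> Y0"
    and W: "\<And>n. W n \<in> \<pp>" "W0 \<in> \<pp>" and eq: "\<And>n. act g (Exp (Y n)) = Exp (W n)" "act g (Exp Y0) = Exp W0"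
  shows "W \<longlonglongrightarrow> W0"
proof -
  have bl: "bounded_linear g"
    using automorphism_linear[OF G_automorphism[OF g]] linear_conv_bounded_linear by blast
  have "(\<lambda>n. 2 *\<^sub>R W n) \<longlonglongrightarrow> 2 *\<^sub>R W0"
  proof (rule exp_ad_p_tendsto_imp)
    fix v
    have "(\<lambda>n. g (E (2 *\<^sub>R Y n) (\<theta> (inv g (\<theta> v))))) \<longlonglongrightarrow> g (E (2 *\<^sub>R Y0) (\<theta> (inv g (\<theta> v))))"
      by (rule bounded_linear.tendsto[OF bl exp_ad_tendsto[OF tendsto_scaleR[OF tendsto_const Y(3)] tendsto_const]])
    then show "(\<lambda>n. E (2 *\<^sub>R W n) v) \<longlonglongrightarrow> E (2 *\<^sub>R W0) v"
      by (simp only: Exp_transition[OF g Y(1) W(1) eq(1)] Exp_transition[OF g Y(2) W(2) eq(2)])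
  qed (use W subspace_p in \<open>auto simp: subspace_scale\<close>)
  then have "(\<lambda>n. (1 / 2) *\<^sub>R (2 *\<^sub>R W n)) \<longlonglongrightarrow> (1 / 2) *\<^sub>R (2 *\<^sub>R W0)" by (rule tendsto_scaleR[OF tendsto_const])
  then show ?thesis by simp
qed

text \<open>The geodesics issuing from \<open>Exp X\<close> tangent to \<open>N\<close> cover an open (invariance of domain) and closed
  subset of \<open>N\<close>.\<close>

lemma geodesics_cover_N:
  assumes X: "X \<in> q"
  shows "\<forall>W\<in>q. \<exists>Y\<in>\<psi> X ` q. act (E X) (Exp Y) = Exp W"
proof -
  let ?Q = "\<psi> X ` q"
  have Xp: "X \<in> \<pp>" using X q_sub_p by auto
  have sQ: "subspace ?Q" by (rule \<psi>_image_subspace)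
  have Qp: "Y \<in> \<pp>" if "Y \<in> ?Q" for Y using \<psi>_in_p[OF X] that by blast
  have qp: "W \<in> \<pp>" if "W \<in> q" for W using q_sub_p that by blast
  have "\<forall>Y\<in>?Q. \<exists>W\<in>q. act (E X) (Exp Y) = Exp W"
  proof clarify
    fix Z assume "Z \<in> q"
    from N_D[OF N_geodesics[OF X this]] show "\<exists>W\<in>q. act (E X) (Exp (\<psi> X Z)) = Exp W" .
  qed
  then obtain \<tau> where \<tau>: "\<And>Y. Y \<in> ?Q \<Longrightarrow> \<tau> Y \<in> q" "\<And>Y. Y \<in> ?Q \<Longrightarrow> act (E X) (Exp Y) = Exp (\<tau> Y)"
    by metis
  have cont: "continuous_on ?Q \<tau>"
    unfolding continuous_on_sequentially
  proof (intro allI ballI impI)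
    fix s Y0 assume Y0: "Y0 \<in> ?Q" and s: "(\<forall>n. s n \<in> ?Q) \<and> s \<longlonglongrightarrow> Y0"
    show "(\<tau> \<circ> s) \<longlonglongrightarrow> \<tau> Y0"
      by (rule transition_continuous[OF exp_in_G[of X], of s Y0]) (use s Y0 Qp qp \<tau> in auto)
  qed
  have inj: "inj_on \<tau> ?Q"
  proof (rule inj_onI)
    fix Y Y' assume Y: "Y \<in> ?Q" "Y' \<in> ?Q" "\<tau> Y = \<tau> Y'"
    then have "act (E X) (Exp Y) = act (E X) (Exp Y')" using \<tau>(2) by simp
    then have "Exp Y = Exp Y'" by (metis act_exp_inverse(1))
    then show "Y = Y'" using Exp_inj Qp Y by blast
  qed
  have "openin (top_of_set q) (\<tau> ` ?Q)"
    by (rule invariance_of_domain_subspaces[OF _ sQ q_subspace _ cont _ inj])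
       (use \<tau>(1) dim_\<psi>_image[OF Xp] in auto)
  moreover have "closed (\<tau> ` ?Q)"
    unfolding closed_sequential_limits
  proof (intro allI impI)
    fix s W assume s: "(\<forall>n. s n \<in> \<tau> ` ?Q) \<and> s \<longlonglongrightarrow> W"
    then have "\<forall>n. \<exists>Y. Y \<in> ?Q \<and> s n = \<tau> Y" by blast
    then obtain Y where Y: "\<And>n. Y n \<in> ?Q" "\<And>n. s n = \<tau> (Y n)" by metis
    have sq: "s n \<in> q" for n using Y \<tau>(1) by simp
    have Wq: "W \<in> q"
      by (rule closed_sequentially[OF closed_subspace[OF q_subspace], of s W]) (use sq s in auto)
    obtain Y0 where Y0: "Y0 \<in> \<pp>" "act (E (- X)) (Exp W) = Exp Y0"
      using transition_exists[OF exp_in_G qp[OF Wq]] by blast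
    have sY: "act (E (- X)) (Exp (s n)) = Exp (Y n)" for n
      unfolding Y(2) \<tau>(2)[OF Y(1), symmetric] by simp
    have "Y \<longlonglongrightarrow> Y0"
      by (rule transition_continuous[OF exp_in_G qp[OF sq] qp[OF Wq] conjunct2[OF s] Qp[OF Y(1)] Y0(1) sY Y0(2)])
    then have Y0Q: "Y0 \<in> ?Q" by (rule closed_sequentially[OF closed_subspace[OF sQ] Y(1)])
    have "act (E X) (Exp Y0) = Exp W" unfolding Y0(2)[symmetric] by simp
    then have "Exp (\<tau> Y0) = Exp W" using \<tau>(2)[OF Y0Q] by simp
    then have "\<tau> Y0 = W" using Exp_inj qp \<tau>(1)[OF Y0Q] Wq by blast
    then show "W \<in> \<tau> ` ?Q" using Y0Q by blast
  qed
  then have "closedin (top_of_set q) (\<tau> ` ?Q)" using \<tau>(1) by (intro closed_subset) auto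
  moreover have "connected q" by (rule convex_connected[OF subspace_imp_convex[OF q_subspace]])
  moreover have "\<tau> ` ?Q \<noteq> {}" using subspace_0[OF sQ] by blast
  ultimately have "\<tau> ` ?Q = q" unfolding connected_clopen by blast
  then show ?thesis using \<tau>(2) by (metis imageE)
qed

text \<open>The geodesic symmetry at \<open>Exp X\<close>, written in two ways.\<close>

lemma reflection:
  assumes X: "X \<in> \<pp>" and Y: "Y \<in> \<pp>" and Z: "Z \<in> \<pp>" and eq: "act (E X) (Exp Y) = Exp Z"
  shows "act (E X) (Exp (- Y)) = act (E (2 *\<^sub>R X)) (Exp (- Z))"
proof -
  define k where "k = E (- Z) \<circ> (E X \<circ> E Y)"
  have "act k K = act (E (- Z)) (act (E X) (Exp Y))" by (simp add: k_def act_comp Exp_eq)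
  also have "\<dots> = act (E (- Z)) (act (E Z) K)" by (simp only: eq Exp_eq[of Z])
  also have "\<dots> = K" by (rule act_exp_inverse)
  finally have k: "k \<in> K" by (rule act_K_imp)
  have \<theta>X: "\<theta> X = - X" "\<theta> Y = - Y" "\<theta> Z = - Z" using X Y Z by (auto simp: p_iff)
  \<comment> \<open>Since \<open>k\<close> commutes with \<open>\<theta>\<close>, which inverts all
    three exponentials, it has this second expression.\<close>
  have k': "k v = E Z (E (- X) (E (- Y) v))" for v
  proof -
    have "k v = \<theta> (k (\<theta> v))" by (simp add: K_\<theta>[OF k])
    also have "\<dots> = E Z (E (- X) (E (- Y) v))"
      by (simp add: k_def exp_ad_\<theta> linear_neg[OF \<theta>_linear] \<theta>X)
    finally show ?thesis .
  qed
  have "E X \<circ> E (- Y) = (E (2 *\<^sub>R X) \<circ> E (- Z)) \<circ> k"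
    by (rule ext) (simp add: k' exp_ad_double)
  then have "act (E X \<circ> E (- Y)) K = act (E (2 *\<^sub>R X) \<circ> E (- Z)) K"
    by (simp only: act_comp act_K[OF k])
  then show ?thesis by (simp add: act_comp Exp_eq)
qed

text \<open>The symmetry at the midpoint Exp(X/2) preserves N, because N consists of geodesics
  issuing from that point. By \<open>reflection\<close> it sends Exp Z to E(X) Exp(-Z), which is
  therefore in N and is reached from Exp X along a geodesic tangent to N. So -Z lies in \<psi>(X) q;
  equality of dimensions turns q \<subseteq> \<psi>(X) q into equality.\<close>

lemma \<psi>_preserves_q:
  assumes X: "X \<in> q" and Z: "Z \<in> q"
  shows "\<psi> X Z \<in> q"
proof -
  define X2 where "X2 = (1 / 2) *\<^sub>R X"
  have X2: "X2 \<in> q" "2 *\<^sub>R X2 = X" using X q_subspace by (auto simp: X2_def subspace_scale)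
  have Xp: "X \<in> \<pp>" and X2p: "X2 \<in> \<pp>" using X X2 q_sub_p by auto
  let ?Q = "\<psi> X ` q"
  have "q \<subseteq> ?Q"
  proof
    fix Z assume Z: "Z \<in> q"
    have Zp: "Z \<in> \<pp>" using Z q_sub_p by auto
    obtain Y where Y: "Y \<in> \<psi> X2 ` q" "act (E X2) (Exp Y) = Exp Z" using geodesics_cover_N[OF X2(1)] Z by blast
    have Yp: "Y \<in> \<pp>" using Y(1) \<psi>_in_p[OF X2(1)] by blast
    have "- Y \<in> \<psi> X2 ` q" by (rule subspace_neg[OF \<psi>_image_subspace Y(1)])
    then have "act (E X2) (Exp (- Y)) \<in> N" using N_geodesics[OF X2(1)] by auto
    then have "act (E X) (Exp (- Z)) \<in> N" using reflection[OF X2p Yp Zp Y(2)] X2(2) by simp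
    then obtain W where W: "W \<in> q" "act (E X) (Exp (- Z)) = Exp W" using N_D by blast
    obtain Y' where Y': "Y' \<in> ?Q" "act (E X) (Exp Y') = Exp W" using geodesics_cover_N[OF X] W(1) by blast
    have "Exp Y' = Exp (- Z)" using Y'(2) W(2) by (metis act_exp_inverse(1))
    moreover have "Y' \<in> \<pp>" using Y'(1) \<psi>_in_p[OF X] by blast
    ultimately have "Y' = - Z" using Exp_inj subspace_neg[OF subspace_p Zp] by blast
    then have "- Y' \<in> ?Q \<longrightarrow> Z \<in> ?Q" by simp
    then show "Z \<in> ?Q" using subspace_neg[OF \<psi>_image_subspace Y'(1)] by blast
  qed
  then have "q = ?Q"
    using subspace_dim_equal[OF q_subspace \<psi>_image_subspace] dim_\<psi>_image[OF Xp] by simp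
  then show ?thesis using Z by blast
qed

text \<open>\<psi>(tX) Z = Z + t^2 F(t) stays in \<open>q\<close> for all t, hence so does F(t) for
  t \<noteq> 0, and the limit F(0) = [X, [X, Z]] / 6 as well.\<close>

lemma q_square:
  assumes X: "X \<in> q" and Z: "Z \<in> q"
  shows "br X (br X Z) \<in> q"
proof -
  have Xp: "X \<in> \<pp>" using X q_sub_p by auto
  obtain Bx where Bx: "eigenbasis (br X) Bx" using eigenbasis_exists[OF self_adjoint_p[OF Xp]] by blast
  have o: "onb Bx UNIV" using Bx by (simp add: eigenbasis_def)
  define l where "l b = ip (br X b) b" for b
  have e: "br X b = l b *\<^sub>R b" if "b \<in> Bx" for b using Bx that by (simp add: eigenbasis_def l_def)
  obtain g where g: "isCont g 0" "g 0 = 1 / 6" "\<And>x. sinhc x = 1 + x\<^sup>2 * g x" using sinhc_expansion by blast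
  have tXp: "t *\<^sub>R X \<in> \<pp>" for t using Xp subspace_p by (simp add: subspace_scale)
  have \<psi>t: "\<psi> (t *\<^sub>R X) Z = (\<Sum>b\<in>Bx. (sinhc (t * l b) * ip Z b) *\<^sub>R b)" for t
    unfolding \<psi>_def by (rule fun_calc_onb[OF self_adjoint_p[OF tXp] o]) (simp add: br_simps e)
  define F where "F t = (\<Sum>b\<in>Bx. ((l b)\<^sup>2 * g (t * l b) * ip Z b) *\<^sub>R b)" for t
  have "\<psi> (t *\<^sub>R X) Z = Z + t\<^sup>2 *\<^sub>R F t" for t
  proof -
    have "\<psi> (t *\<^sub>R X) Z = (\<Sum>b\<in>Bx. ip Z b *\<^sub>R b + t\<^sup>2 *\<^sub>R (((l b)\<^sup>2 * g (t * l b) * ip Z b) *\<^sub>R b))"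
      unfolding \<psi>t by (intro sum.cong) (simp_all add: g(3) power_mult_distrib algebra_simps)
    also have "\<dots> = (\<Sum>b\<in>Bx. ip Z b *\<^sub>R b) + t\<^sup>2 *\<^sub>R F t"
      by (simp add: sum.distrib F_def scaleR_sum_right)
    finally show ?thesis by (simp only: onb_expand[OF o])
  qed
  moreover have "\<psi> (t *\<^sub>R X) Z \<in> q" for t
    by (intro \<psi>_preserves_q Z subspace_scale[OF q_subspace X])
  ultimately have "t\<^sup>2 *\<^sub>R F t \<in> q" for t
    using subspace_diff[OF q_subspace _ Z] by (metis add_diff_cancel_left')
  then have Fq: "F t \<in> q" if "t \<noteq> 0" for t
    using subspace_scale[OF q_subspace, of "t\<^sup>2 *\<^sub>R F t" "1 / t\<^sup>2"] that by simp
  have "(F \<longlongrightarrow> F 0) (at 0)"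
    unfolding F_def
  proof (intro tendsto_sum tendsto_scaleR tendsto_mult tendsto_const)
    fix b
    have "((\<lambda>t. t * l b) \<longlongrightarrow> 0 * l b) (at 0)" by (intro tendsto_intros)
    then show "((\<lambda>t. g (t * l b)) \<longlongrightarrow> g (0 * l b)) (at 0)"
      by (rule isCont_tendsto_compose[rotated]) (use g(1) in simp)
  qed
  then have "F 0 \<in> q"
    by (rule Lim_in_closed_set[OF closed_subspace[OF q_subspace], rotated 2])
       (auto simp: eventually_at_filter Fq)
  moreover have "br X (br X Z) = 6 *\<^sub>R F 0"
  proof -
    have "br X (br X Z) = br X (br X (\<Sum>b\<in>Bx. ip Z b *\<^sub>R b))" by (simp only: onb_expand[OF o])
    also have "\<dots> = (\<Sum>b\<in>Bx. ((l b)\<^sup>2 * ip Z b) *\<^sub>R b)"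
      by (simp add: br_sum_right br_simps e power2_eq_square mult_ac)
    also have "\<dots> = 6 *\<^sub>R F 0" by (simp add: F_def g(2) scaleR_sum_right)
    finally show ?thesis .
  qed
  ultimately show ?thesis by (simp add: subspace_scale[OF q_subspace])
qed

text \<open>Modulo \<open>q\<close> the trilinear map \<open>[X, [Y, Z]]\<close> is alternating by polarization, so the Jacobi
  identity forces three times it to vanish.\<close>

lemma lts_q: "lts q"
proof -
  have pol: "br X (br Y Z) + br Y (br X Z) \<in> q" if "X \<in> q" "Y \<in> q" "Z \<in> q" for X Y Z
  proof -
    have "br (X + Y) (br (X + Y) Z) \<in> q" "br X (br X Z) \<in> q" "br Y (br Y Z) \<in> q"
      using that q_subspace by (auto intro!: q_square subspace_add)
    then have "br (X + Y) (br (X + Y) Z) - br X (br X Z) - br Y (br Y Z) \<in> q"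
      by (intro subspace_diff[OF q_subspace])
    then show ?thesis by (simp add: br_simps algebra_simps)
  qed
  have "br (br X Y) Z \<in> q" if X: "X \<in> q" and Y: "Y \<in> q" and Z: "Z \<in> q" for X Y Z
  proof -
    define t where "t X Y Z = br X (br Y Z)" for X Y Z
    have 1: "t X Y Z + t Y X Z \<in> q" "t Y Z X + t Z Y X \<in> q" "t X Z Y + t Z X Y \<in> q"
      using pol X Y Z by (auto simp: t_def)
    have 2: "t U V W = - t U W V" for U V W
      unfolding t_def using br_anti[of V W] by (simp add: br_simps)
    have 3: "t X Y Z + t Y Z X + t Z X Y = 0"
      using lie by (simp add: lie_algebra_def t_def)
    define a b c where "a = t X Y Z" and "b = t Y Z X" and "c = t Z X Y"
    have "a - b \<in> q" "b - c \<in> q" "c - a \<in> q"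
      using 1 2[of Y X Z] 2[of Z Y X] 2[of X Z Y] by (simp_all add: a_def b_def c_def)
    moreover have "a + b + c = 0" using 3 by (simp add: a_def b_def c_def)
    ultimately have "3 *\<^sub>R c \<in> q"
    proof -
      assume d: "a - b \<in> q" "b - c \<in> q" "c - a \<in> q" and s: "a + b + c = 0"
      have "(c - a) - (b - c) \<in> q" by (rule subspace_diff[OF q_subspace d(3) d(2)])
      moreover have "(c - a) - (b - c) = 3 *\<^sub>R c - (a + b + c)"
        using scaleR_add_left[of 1 2 c] by (simp add: algebra_simps scaleR_2)
      ultimately show ?thesis using s by simp
    qed
    then have "(1 / 3) *\<^sub>R (3 *\<^sub>R c) \<in> q" by (rule subspace_scale[OF q_subspace])
    then have "- c \<in> q" using subspace_neg[OF q_subspace] by simp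
    moreover have "br (br X Y) Z = - c" unfolding c_def t_def by (rule br_anti)
    ultimately show ?thesis by simp
  qed
  then show ?thesis using q_subspace q_sub_p by (simp add: lts_def lie_triple_system_def)
qed

end

section \<open>Restricted roots and the complex structure\<close>

locale hermitian = cartan_lie br \<theta> for br :: "'g::euclidean_space \<Rightarrow> 'g \<Rightarrow> 'g" and \<theta> :: "'g \<Rightarrow> 'g" +
  fixes \<zeta> :: 'g
  assumes hermitian: "irreducible_hermitian_noncompact br \<theta> \<zeta>"
begin

lemma \<zeta>_k: "\<zeta> \<in> \<kk>" and br_\<zeta>_k: "X \<in> \<kk> \<Longrightarrow> br \<zeta> X = 0"
  and br_\<zeta>_\<zeta>: "X \<in> \<pp> \<Longrightarrow> br \<zeta> (br \<zeta> X) = - X"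
  using hermitian by (auto simp: irreducible_hermitian_noncompact_def)

lemma kp_commute_zero:
  assumes "\<And>X. X \<in> \<kk> \<Longrightarrow> br Z X = 0" "\<And>X. X \<in> \<pp> \<Longrightarrow> br Z X = 0"
  shows "Z = 0"
proof (rule center_zero)
  fix Y
  have Y: "Y = (1 / 2) *\<^sub>R (Y + \<theta> Y) + (1 / 2) *\<^sub>R (Y - \<theta> Y)"
    by (simp add: algebra_simps flip: scaleR_add_left)
  have 0: "br Z (Y + \<theta> Y) = 0" "br Z (Y - \<theta> Y) = 0"
    using assms \<theta>_add_k \<theta>_diff_p by auto
  have "br Z Y = (1 / 2) *\<^sub>R br Z (Y + \<theta> Y) + (1 / 2) *\<^sub>R br Z (Y - \<theta> Y)"
    unfolding br_scaleR(2)[symmetric] bilinear_radd[OF br_bilinear, symmetric] by (rule arg_cong[OF Y])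
  then show "br Z Y = 0" using 0 by simp
qed

text \<open>Elements of \<open>K\<close> may a priori reverse the sign of \<open>\<zeta>\<close>; this suffices below, since \<open>\<zeta>\<close>
  enters the diagonal maps twice.\<close>

lemma K_\<zeta>:
  assumes k: "k \<in> K"
  shows "k \<zeta> = \<zeta> \<or> k \<zeta> = - \<zeta>"
proof -
  define \<zeta>' where "\<zeta>' = k \<zeta>"
  have a: "automorphism k" by (rule K_automorphism[OF k])
  have ki: "inv k \<in> K" by (rule K_inv[OF k])
  have br': "br \<zeta>' X = k (br \<zeta> (inv k X))" for X
    by (simp add: \<zeta>'_def automorphism_br[OF a] automorphism_inv2[OF a])
  have \<zeta>'k: "\<zeta>' \<in> \<kk>" unfolding \<zeta>'_def by (rule K_k[OF k \<zeta>_k])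
  have c: "br \<zeta>' X = 0" if "X \<in> \<kk>" for X
    unfolding br' using br_\<zeta>_k[OF K_k[OF ki that]] linear_0[OF automorphism_linear[OF a]] by simp
  have sq: "br \<zeta>' (br \<zeta>' X) = - X" if "X \<in> \<pp>" for X
    unfolding br' automorphism_inv1[OF a] br_\<zeta>_\<zeta>[OF K_p[OF ki that]]
    by (simp add: linear_neg[OF automorphism_linear[OF a]] automorphism_inv2[OF a])
  have comm: "br \<zeta>' (br \<zeta> X) = br \<zeta> (br \<zeta>' X)" for X
    using jacobi[of \<zeta>' \<zeta> X] c[OF \<zeta>_k] by (simp add: br_simps)
  \<comment> \<open>\<open>W\<close> is where k \<zeta> and \<zeta> induce the same complex
    structure. It is invariant under the k-part, so irreducibility leaves 0 or everything. If it is
    0, then (ad \<zeta>' - ad \<zeta>)(ad \<zeta>' + ad \<zeta>) = 0 on the p-part forces \<zeta>' =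
    -\<zeta>.\<close>
  define W where "W = {X \<in> \<pp>. br (\<zeta>' - \<zeta>) X = 0}"
  have "subspace W"
    using subspace_p by (auto simp: W_def subspace_def br_simps)
  moreover have "br Y X \<in> W" if Y: "Y \<in> \<kk>" and X: "X \<in> W" for X Y
  proof -
    have "br (\<zeta>' - \<zeta>) (br Y X) = br (br (\<zeta>' - \<zeta>) Y) X + br Y (br (\<zeta>' - \<zeta>) X)" by (rule jacobi)
    moreover have "br (\<zeta>' - \<zeta>) Y = 0" using c[OF Y] br_\<zeta>_k[OF Y] by (simp add: br_simps)
    ultimately show ?thesis using X br_kp[OF Y] by (simp add: W_def br_simps)
  qed
  moreover have "W \<subseteq> \<pp>" by (auto simp: W_def)
  ultimately have "W = {0} \<or> W = \<pp>"
    using hermitian unfolding irreducible_hermitian_noncompact_def by blast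
  then show ?thesis
  proof
    assume W: "W = {0}"
    have p0: "br (\<zeta>' + \<zeta>) X = 0" if X: "X \<in> \<pp>" for X
    proof -
      have "br (\<zeta>' - \<zeta>) (br (\<zeta>' + \<zeta>) X) = 0"
        using sq[OF X] br_\<zeta>_\<zeta>[OF X] comm[of X] by (simp add: br_simps)
      moreover have "br (\<zeta>' + \<zeta>) X \<in> \<pp>"
        by (rule br_kp[OF subspace_add[OF subspace_k \<zeta>'k \<zeta>_k] X])
      ultimately show ?thesis using W by (auto simp: W_def)
    qed
    have "br (\<zeta>' + \<zeta>) X = 0" if "X \<in> \<kk>" for X
      using c[OF that] br_\<zeta>_k[OF that] by (simp add: br_simps)
    then have "\<zeta>' + \<zeta> = 0" using p0 by (rule kp_commute_zero)
    then show ?thesis by (simp add: \<zeta>'_def eq_neg_iff_add_eq_0)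
  next
    assume W: "W = \<pp>"
    have "\<zeta>' - \<zeta> = 0"
    proof (rule kp_commute_zero)
      show "br (\<zeta>' - \<zeta>) X = 0" if "X \<in> \<pp>" for X using that W by (auto simp: W_def)
      show "br (\<zeta>' - \<zeta>) X = 0" if "X \<in> \<kk>" for X
        using c[OF that] br_\<zeta>_k[OF that] by (simp add: br_simps)
    qed
    then show ?thesis by (simp add: \<zeta>'_def)
  qed
qed

lemma fun_calc_equivariant:
  assumes k: "k \<in> K" and A: "A \<in> \<pp>"
  shows "fun_calc f (br (k A)) (k v) = k (fun_calc f (br A) v)"
proof -
  have lk: "linear k" by (rule automorphism_linear[OF K_automorphism[OF k]])
  obtain Bx where Bx: "eigenbasis (br A) Bx" using eigenbasis_exists[OF self_adjoint_p[OF A]] by blast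
  have o: "onb Bx UNIV" using Bx by (simp add: eigenbasis_def)
  have l1: "linear (\<lambda>v. fun_calc f (br (k A)) (k v))"
    using linear_compose[OF lk fun_calc_linear] by (simp add: o_def)
  have l2: "linear (\<lambda>v. k (fun_calc f (br A) v))"
    using linear_compose[OF fun_calc_linear lk] by (simp add: o_def)
  show ?thesis
  proof (rule linear_eq_on_onb[OF o l1 l2])
    fix b assume b: "b \<in> Bx"
    define l where "l = ip (br A b) b"
    have l: "br A b = l *\<^sub>R b" using Bx b by (simp add: eigenbasis_def l_def)
    have "br (k A) (k b) = l *\<^sub>R k b"
      by (simp add: automorphism_br[OF K_automorphism[OF k], symmetric] l linear_scale[OF lk])
    then have "fun_calc f (br (k A)) (k b) = f l *\<^sub>R k b"
      by (rule fun_calc_eigenvector[OF self_adjoint_p[OF K_p[OF k A]]])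
    also have "\<dots> = k (fun_calc f (br A) b)"
      by (simp add: fun_calc_eigenvector[OF self_adjoint_p[OF A] l] linear_scale[OF lk])
    finally show "fun_calc f (br (k A)) (k b) = k (fun_calc f (br A) b)" .
  qed
qed

text \<open>\<open>\<Omega> f\<close> is the diagonal realization in the chart \<open>Exp\<^sub>o\<close>, expressed by the functional calculus of
  the operator \<open>ad X / 2\<close>, which is linear in \<open>X\<close>.\<close>

definition \<Omega> :: "(real \<Rightarrow> real) \<Rightarrow> 'g \<Rightarrow> 'g" where
  "\<Omega> f X = 2 *\<^sub>R br \<zeta> (fun_calc f (br ((1 / 2) *\<^sub>R X)) \<zeta>)"

lemma \<Omega>_equivariant:
  assumes k: "k \<in> K" and X: "X \<in> \<pp>"
  shows "\<Omega> f (k X) = k (\<Omega> f X)"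
proof -
  have lk: "linear k" by (rule automorphism_linear[OF K_automorphism[OF k]])
  define A where "A = (1 / 2) *\<^sub>R X"
  have A: "A \<in> \<pp>" unfolding A_def by (rule subspace_scale[OF subspace_p X])
  obtain s :: real where s: "s * s = 1" "\<zeta> = s *\<^sub>R k \<zeta>"
  proof -
    from K_\<zeta>[OF k] consider "k \<zeta> = \<zeta>" | "k \<zeta> = - \<zeta>" by blast
    then show ?thesis
    proof cases
      case 1 then show ?thesis using that[of 1] by simp
    next
      case 2 then show ?thesis using that[of "-1"] by simp
    qed
  qed
  have "k (br \<zeta> (fun_calc f (br A) \<zeta>)) = br (k \<zeta>) (fun_calc f (br (k A)) (k \<zeta>))"
    by (simp add: automorphism_br[OF K_automorphism[OF k]] fun_calc_equivariant[OF k A])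
  also have "\<dots> = (s * s) *\<^sub>R br (k \<zeta>) (fun_calc f (br (k A)) (k \<zeta>))" by (simp add: s(1))
  also have "\<dots> = br (s *\<^sub>R k \<zeta>) (fun_calc f (br (k A)) (s *\<^sub>R k \<zeta>))"
    by (simp only: linear_scale[OF fun_calc_linear] br_scaleR scaleR_scaleR)
  also have "\<dots> = br \<zeta> (fun_calc f (br (k A)) \<zeta>)" by (simp only: s(2)[symmetric])
  finally show ?thesis
    by (simp add: \<Omega>_def A_def linear_scale[OF lk])
qed

end

locale framed = hermitian br \<theta> \<zeta> for br :: "'g::euclidean_space \<Rightarrow> 'g \<Rightarrow> 'g" and \<theta> :: "'g \<Rightarrow> 'g" and \<zeta> :: 'g +
  fixes a :: "'g set" and r :: nat and e :: "nat \<Rightarrow> 'g \<Rightarrow> real"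
  assumes a_max: "maximal_abelian br \<pp> a" and frame: "root_frame br a r e"
begin

lemma a_subspace: "subspace a" and a_p: "X \<in> a \<Longrightarrow> X \<in> \<pp>" and a_abelian: "X \<in> a \<Longrightarrow> Y \<in> a \<Longrightarrow> br X Y = 0"
  using a_max by (auto simp: maximal_abelian_def)

lemma a_mem: "X \<in> \<pp> \<Longrightarrow> (\<And>H. H \<in> a \<Longrightarrow> br H X = 0) \<Longrightarrow> X \<in> a"
  using maximal_abelian_mem[OF a_max] subspace_p by blast

lemma B_a: "Y \<in> a \<Longrightarrow> B X Y = ip X Y"
  using a_p[of Y] by (simp add: ip_eq p_iff bilinear_rneg[OF B_bilinear])

lemma r_dim: "r = dim a" and e_linear: "i \<in> {1..r} \<Longrightarrow> linear (e i)"
  and e_nonzero: "i \<in> {1..r} \<Longrightarrow> \<exists>H\<in>a. e i H \<noteq> 0"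
  and e_orth: "i \<in> {1..r} \<Longrightarrow> j \<in> {1..r} \<Longrightarrow> i \<noteq> j \<Longrightarrow> dual_ip br a (e i) (e j) = 0"
  and roots: "restricted_roots br a = roots_C a r e \<or> restricted_roots br a = roots_BC a r e"
  using frame by (auto simp: root_frame_def)

lemma dual_vector_unique:
  assumes "H \<in> a" "\<And>Y. Y \<in> a \<Longrightarrow> l Y = ip H Y"
  shows "dual_vector br a l = H"
  unfolding dual_vector_def
proof (rule the_equality)
  show "H \<in> a \<and> (\<forall>Y\<in>a. l Y = killing br H Y)" using assms B_a by (simp add: B_def)
  fix H' assume H': "H' \<in> a \<and> (\<forall>Y\<in>a. l Y = killing br H' Y)"
  then have "ip H' Y = ip H Y" if "Y \<in> a" for Y using assms(2)[OF that] B_a[OF that] that by (simp add: B_def)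
  then have "ip (H' - H) (H' - H) = 0"
    using subspace_diff[OF a_subspace, of H' H] H' assms(1) by (simp add: ip_simps)
  then show "H' = H" by (simp add: ip_eq_0_iff)
qed

lemma dual_vector_linear:
  assumes l: "linear l"
  shows "dual_vector br a l \<in> a" "Y \<in> a \<Longrightarrow> l Y = ip (dual_vector br a l) Y"
proof -
  obtain Ba where Ba: "onb Ba a" using onb_exists[OF a_subspace] by blast
  define H where "H = (\<Sum>b\<in>Ba. l b *\<^sub>R b)"
  have H: "H \<in> a"
    unfolding H_def by (rule subspace_sum[OF a_subspace]) (use Ba in \<open>auto simp: onb_def subspace_scale a_subspace\<close>)
  have lY: "l Y = ip H Y" if Y: "Y \<in> a" for Y
  proof -
    have "l (\<Sum>b\<in>Ba. ip Y b *\<^sub>R b) = ip H Y"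
      by (simp add: linear_sum[OF l] linear_scale[OF l] H_def ip_sum_left ip_sym[of Y] mult.commute)
    moreover have "Y = (\<Sum>b\<in>Ba. ip Y b *\<^sub>R b)" using Ba Y by (simp add: onb_def)
    ultimately show ?thesis by metis
  qed
  have "dual_vector br a l = H" by (rule dual_vector_unique[OF H lY])
  then show "dual_vector br a l \<in> a" "Y \<in> a \<Longrightarrow> l Y = ip (dual_vector br a l) Y" using H lY by auto
qed

section \<open>The frame of \<open>a\<close> dual to the forms \<open>e\<close>\<close>

definition d :: "nat \<Rightarrow> 'g" where "d i = dual_vector br a (e i)"

abbreviation h :: "nat \<Rightarrow> 'g" where "h \<equiv> Htilde br a e"

lemma d_a: "i \<in> {1..r} \<Longrightarrow> d i \<in> a" and e_eq: "i \<in> {1..r} \<Longrightarrow> Y \<in> a \<Longrightarrow> e i Y = ip (d i) Y"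
  using dual_vector_linear[OF e_linear] by (auto simp: d_def)

lemma d_orth: "i \<in> {1..r} \<Longrightarrow> j \<in> {1..r} \<Longrightarrow> i \<noteq> j \<Longrightarrow> ip (d i) (d j) = 0"
  using e_orth[of i j] B_a[OF d_a] by (simp add: dual_ip_def d_def B_def)

lemma d_pos: "i \<in> {1..r} \<Longrightarrow> ip (d i) (d i) > 0"
proof -
  assume i: "i \<in> {1..r}"
  obtain H where "H \<in> a" "e i H \<noteq> 0" using e_nonzero[OF i] by blast
  then have "d i \<noteq> 0" using e_eq[OF i] by (auto simp: ip_simps)
  then show "ip (d i) (d i) > 0" by (rule ip_pos)
qed

text \<open>H_i = 2 d_i has squared norm C = 4 |d_i|^2, so (2/C) H_i = d_i / |d_i|^2. With this
  normalization the vectors \<open>h i\<close> form the basis of \<open>a\<close> dual to the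
  \<open>e i\<close>, and the diagonal map acts on the coordinates \<open>e i X\<close>.\<close>

lemma h_eq:
  assumes i: "i \<in> {1..r}"
  shows "h i = (1 / ip (d i) (d i)) *\<^sub>R d i"
proof -
  have "Hvec br a e i = 2 *\<^sub>R d i"
    unfolding Hvec_def
    by (rule dual_vector_unique) (use i d_a e_eq a_subspace in \<open>auto simp: subspace_scale\<close>)
  moreover have "killing br (2 *\<^sub>R d i) (2 *\<^sub>R d i) = 4 * ip (d i) (d i)"
    using B_a[OF subspace_scale[OF a_subspace d_a[OF i]], of "2 *\<^sub>R d i" 2] by (simp add: B_def)
  ultimately show ?thesis by (simp add: Htilde_def)
qed

lemma h_a: "i \<in> {1..r} \<Longrightarrow> h i \<in> a"
  by (simp add: h_eq subspace_scale[OF a_subspace d_a])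

lemma d_h: "i \<in> {1..r} \<Longrightarrow> d i = ip (d i) (d i) *\<^sub>R h i"
  using d_pos[of i] by (simp add: h_eq)

lemma e_h: "i \<in> {1..r} \<Longrightarrow> j \<in> {1..r} \<Longrightarrow> e i (h j) = (if i = j then 1 else 0)"
proof -
  assume i: "i \<in> {1..r}" and j: "j \<in> {1..r}"
  have "e i (h j) = ip (d i) (h j)" by (rule e_eq[OF i h_a[OF j]])
  also have "\<dots> = ip (d i) (d j) / ip (d j) (d j)" unfolding h_eq[OF j] by simp
  also have "\<dots> = (if i = j then 1 else 0)" using d_pos[OF j] d_orth[OF i j] by simp
  finally show "e i (h j) = (if i = j then 1 else 0)" .
qed

lemma h_expand:
  assumes X: "X \<in> a"
  shows "(\<Sum>i\<in>{1..r}. e i X *\<^sub>R h i) = X"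
proof -
  let ?D = "h ` {1..r}"
  have inj: "inj_on h {1..r}"
  proof (rule inj_onI)
    fix i j assume ij: "i \<in> {1..r}" "j \<in> {1..r}" "h i = h j"
    have "e i (h i) = 1" using e_h[OF ij(1) ij(1)] by simp
    then show "i = j" using e_h[OF ij(1) ij(2)] ij(3) by (metis zero_neq_one)
  qed
  have "independent ?D"
    unfolding dependent_def
  proof clarify
    fix i assume i: "i \<in> {1..r}" and s: "h i \<in> span (?D - {h i})"
    have "span (?D - {h i}) \<subseteq> {x. e i x = 0}"
    proof (rule span_minimal)
      show "?D - {h i} \<subseteq> {x. e i x = 0}" using e_h[OF i] by auto
      show "subspace {x. e i x = 0}"
        using linear_0[OF e_linear[OF i]] linear_add[OF e_linear[OF i]] linear_scale[OF e_linear[OF i]]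
        by (simp add: subspace_def)
    qed
    then show False using s e_h[OF i i] by auto
  qed
  moreover have "?D \<subseteq> a" using h_a by auto
  moreover have "dim a \<le> card ?D" using r_dim card_image[OF inj] by simp
  ultimately have "a \<subseteq> span ?D" by (intro card_ge_dim_independent)
  then have Xs: "X \<in> span ?D" using X by blast
  have lin: "linear (\<lambda>X. \<Sum>i\<in>{1..r}. e i X *\<^sub>R h i)"
    by (rule linearI)
       (simp_all add: linear_add[OF e_linear] linear_scale[OF e_linear] scaleR_add_left sum.distrib scaleR_sum_right)
  have "(\<Sum>i\<in>{1..r}. e i Y *\<^sub>R h i) = id Y" if "Y \<in> ?D" for Y
  proof -
    obtain j where j: "j \<in> {1..r}" "Y = h j" using \<open>Y \<in> ?D\<close> by blast
    have "(\<Sum>i\<in>{1..r}. e i Y *\<^sub>R h i) = (\<Sum>i\<in>{1..r}. if i = j then h i else 0)"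
      unfolding j(2) using e_h[OF _ j(1)] by (intro sum.cong) auto
    then show ?thesis using j by simp
  qed
  from linear_eq_on_span[OF lin linear_id this Xs] show ?thesis by simp
qed

lemma e_sum: "i \<in> {1..r} \<Longrightarrow> e i (\<Sum>j\<in>{1..r}. x j *\<^sub>R h j) = x i"
proof -
  assume i: "i \<in> {1..r}"
  have "e i (\<Sum>j\<in>{1..r}. x j *\<^sub>R h j) = (\<Sum>j\<in>{1..r}. x j * e i (h j))"
    by (simp add: linear_sum[OF e_linear[OF i]] linear_scale[OF e_linear[OF i]])
  also have "\<dots> = (\<Sum>j\<in>{1..r}. if j = i then x j else 0)"
    by (rule sum.cong) (use i e_h in auto)
  finally show ?thesis using i by simp
qed

lemma sum_h_a: "(\<Sum>j\<in>{1..r}. x j *\<^sub>R h j) \<in> a"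
  by (rule subspace_sum[OF a_subspace]) (simp add: subspace_scale[OF a_subspace h_a])

section \<open>Weights of ad a and the weight components of \<zeta>\<close>

lemma root_cases:
  assumes l: "linear l" and u: "u \<noteq> 0" "\<forall>H\<in>a. br H u = l H *\<^sub>R u"
  obtains (zero) "\<forall>H\<in>a. l H = 0"
  | (short) i j s t where "i \<in> {1..r}" "j \<in> {1..r}" "i \<noteq> j" "s \<in> {-1, 1}" "t \<in> {-1, 1::real}" "\<forall>H\<in>a. l H = s * e i H + t * e j H"
  | (long) i s where "i \<in> {1..r}" "s \<in> {-1, 1::real}" "\<forall>H\<in>a. l H = s * (2 * e i H)"
  | (half) i s where "i \<in> {1..r}" "s \<in> {-1, 1::real}" "\<forall>H\<in>a. l H = s * e i H"
proof (cases "\<forall>H\<in>a. l H = 0")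
  case True
  then show ?thesis using zero by blast
next
  case False
  have ext: "\<forall>H\<in>a. l H = m H" if "restrict l a = restrict m a" for m using that by (metis restrict_apply')
  have "restrict l a \<in> restricted_roots br a"
    unfolding restricted_roots_def using False l u by blast
  then have "restrict l a \<in> roots_BC a r e" using roots by (auto simp: roots_BC_def)
  then show ?thesis
    unfolding roots_BC_def roots_C_def
  proof (elim UnE CollectE exE conjE)
    fix s t :: real and i j
    assume *: "restrict l a = restrict (\<lambda>H. s * e i H + t * e j H) a" "s \<in> {-1, 1}" "t \<in> {-1, 1}" "1 \<le> i" "i < j" "j \<le> r"
    show ?thesis by (rule short[OF _ _ _ *(2,3) ext[OF *(1)]]) (use * in auto)
  next
    fix s :: real and i
    assume *: "restrict l a = restrict (\<lambda>H. s * (2 * e i H)) a" "s \<in> {-1, 1}" "i \<in> {1..r}"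
    show ?thesis by (rule long[OF *(3,2) ext[OF *(1)]])
  next
    fix s :: real and i
    assume *: "restrict l a = restrict (\<lambda>H. s * e i H) a" "s \<in> {-1, 1}" "i \<in> {1..r}"
    show ?thesis by (rule half[OF *(3,2) ext[OF *(1)]])
  qed
qed

text \<open>No root of type C or BC has a coordinate beyond 2; a vector whose weight would take the
  value 3 or -3 on \<open>h k\<close> must therefore vanish.\<close>

lemma weight_le_2:
  assumes l: "linear l" and u: "u \<noteq> 0" "\<And>H. H \<in> a \<Longrightarrow> br H u = l H *\<^sub>R u" and k: "k \<in> {1..r}"
  shows "\<bar>l (h k)\<bar> \<le> 2"
proof -
  have u': "\<forall>H\<in>a. br H u = l H *\<^sub>R u" using u(2) by blast
  from l u(1) u' show ?thesis
  proof (cases rule: root_cases)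
  case zero
  then show ?thesis using h_a[OF k] by simp
next
  case (short i j s t)
  then show ?thesis using h_a[OF k] k by (auto simp: e_h)
next
  case (long i s)
  then show ?thesis using h_a[OF k] k by (auto simp: e_h)
next
  case (half i s)
  then show ?thesis using h_a[OF k] k by (auto simp: e_h)
qed
qed

lemma long_root_vector:
  assumes i: "i \<in> {1..r}" and s: "s \<in> {-1, 1::real}"
  shows "\<exists>E. E \<noteq> 0 \<and> (\<forall>H\<in>a. br H E = (2 * s * e i H) *\<^sub>R E)"
proof -
  have "restrict (\<lambda>H. s * (2 * e i H)) a \<in> roots_C a r e"
    unfolding roots_C_def using i s by blast
  then have "restrict (\<lambda>H. s * (2 * e i H)) a \<in> restricted_roots br a"
    using roots by (auto simp: roots_BC_def)
  then obtain l X where l: "restrict (\<lambda>H. s * (2 * e i H)) a = restrict l a" "X \<noteq> 0" "\<forall>H\<in>a. br H X = l H *\<^sub>R X"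
    unfolding restricted_roots_def by blast
  have "l H = 2 * s * e i H" if "H \<in> a" for H
    using fun_cong[OF l(1), of H] that by simp
  then show ?thesis using l(2,3) by (intro exI[of _ X]) simp
qed

text \<open>An orthonormal basis adapted to the restricted root space decomposition;
  \<open>wt b\<close> below is the root, or zero, to which \<open>b\<close> belongs.\<close>

definition Bs :: "'g set" where
  "Bs = (SOME B. onb B UNIV \<and> (\<forall>b\<in>B. \<forall>A\<in>br ` a. \<exists>l. A b = l *\<^sub>R b))"

definition wt :: "'g \<Rightarrow> 'g \<Rightarrow> real" where "wt b H = ip (br H b) b"

lemma Bs: "onb Bs UNIV" and br_Bs: "b \<in> Bs \<Longrightarrow> H \<in> a \<Longrightarrow> br H b = wt b H *\<^sub>R b"
proof -
  have "\<exists>B. onb B UNIV \<and> (\<forall>b\<in>B. \<forall>A\<in>br ` a. \<exists>l. A b = l *\<^sub>R b)"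
  proof (rule common_eigenbasis[OF subspace_UNIV])
    show "linear A" if "A \<in> br ` a" for A using that ad_linear by auto
    show "ip (A x) y = ip x (A y)" if "A \<in> br ` a" for A x y
      using that self_adjoint_p[OF a_p] by (auto simp: self_adjoint_def)
    show "A (C x) = C (A x)" if "A \<in> br ` a" "C \<in> br ` a" for A C x
    proof -
      obtain X where X: "X \<in> a" "A = br X" using \<open>A \<in> br ` a\<close> by blast
      obtain Y where Y: "Y \<in> a" "C = br Y" using \<open>C \<in> br ` a\<close> by blast
      then show ?thesis using jacobi[of X Y x] a_abelian[OF X(1) Y(1)] X Y by (simp add: br_simps)
    qed
  qed simp
  from someI_ex[OF this] have *: "onb Bs UNIV" "\<forall>b\<in>Bs. \<forall>A\<in>br ` a. \<exists>l. A b = l *\<^sub>R b"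
    by (auto simp: Bs_def)
  then show "onb Bs UNIV" by simp
  assume b: "b \<in> Bs" and H: "H \<in> a"
  then obtain l where l: "br H b = l *\<^sub>R b" using * by blast
  then show "br H b = wt b H *\<^sub>R b" using onb_unit[OF *(1) b] by (simp add: wt_def)
qed

lemma wt_linear: "linear (wt b)"
  unfolding wt_def by (rule linearI) (simp_all add: br_simps ip_simps)

lemma Bs_nonzero: "b \<in> Bs \<Longrightarrow> b \<noteq> 0"
  using onb_unit[OF Bs, of b] by (auto simp: ip_simps)

lemma br_onb: "H \<in> a \<Longrightarrow> br H v = (\<Sum>b\<in>Bs. (wt b H * ip v b) *\<^sub>R b)"
proof -
  assume H: "H \<in> a"
  have "br H v = br H (\<Sum>b\<in>Bs. ip v b *\<^sub>R b)" by (simp only: onb_expand[OF Bs])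
  also have "\<dots> = (\<Sum>b\<in>Bs. (wt b H * ip v b) *\<^sub>R b)"
    unfolding br_sum_right by (rule sum.cong) (simp_all add: br_Bs[OF _ H] mult.commute)
  finally show ?thesis .
qed

text \<open>Let \<open>F\<close> be the component of \<open>\<zeta>\<close> of the same weight as \<open>b0\<close>, and \<open>E\<close> a root vector for \<open>2e\<^sub>j\<close> or
  \<open>- 2e\<^sub>j\<close>, with sign opposite to that of \<open>wt b0 (h j)\<close>.  As \<open>E + \<theta> E\<close> commutes with \<open>\<zeta>\<close>, pairing
  \<open>[E, [E, F]]\<close>, which vanishes because its weight is not a root, with \<open>\<zeta>\<close> gives \<open>[E, F] = 0\<close>.  Then
  \<open>[E, [\<theta> E, F]]\<close> is a positive multiple of \<open>F\<close>, which forces \<open>F = 0\<close>.\<close>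

lemma \<zeta>_support:
  assumes b0: "b0 \<in> Bs" and j: "j \<in> {1..r}" and t: "wt b0 (h j) \<in> {-1, 1}"
  shows "ip \<zeta> b0 = 0"
proof -
  define t where "t = wt b0 (h j)"
  define C where "C = {b \<in> Bs. \<forall>H\<in>a. wt b H = wt b0 H}"
  define F where "F = (\<Sum>b\<in>C. ip \<zeta> b *\<^sub>R b)"
  have tt: "t * t = 1" and nt: "- t \<in> {-1, 1}" using t by (auto simp: t_def)
  obtain E where E: "E \<noteq> 0" "\<And>H. H \<in> a \<Longrightarrow> br H E = (2 * (- t) * e j H) *\<^sub>R E"
    using long_root_vector[OF j nt] by blast
  have fin: "finite Bs" "C \<subseteq> Bs" using Bs by (auto simp: onb_def C_def)
  have FH: "br H F = wt b0 H *\<^sub>R F" if H: "H \<in> a" for H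
    unfolding F_def br_sum_right scaleR_sum_right
    by (rule sum.cong) (use H in \<open>auto simp: C_def br_Bs\<close>)
  have rest: "\<zeta> - F = (\<Sum>b\<in>Bs - C. ip \<zeta> b *\<^sub>R b)"
  proof -
    have "(\<Sum>b\<in>Bs. ip \<zeta> b *\<^sub>R b) = (\<Sum>b\<in>Bs - C. ip \<zeta> b *\<^sub>R b) + F"
      unfolding F_def by (rule sum.subset_diff[OF fin(2,1)])
    then have "\<zeta> = (\<Sum>b\<in>Bs - C. ip \<zeta> b *\<^sub>R b) + F" by (simp only: onb_expand[OF Bs])
    then show ?thesis by (rule diff_eq_eq[THEN iffD2])
  qed
  have wtE: "br H (br E v) = (2 * (- t) * e j H + m) *\<^sub>R br E v" if "H \<in> a" "br H v = m *\<^sub>R v" for H v m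
    by (simp add: jacobi[of H] E(2)[OF that(1)] that(2) br_simps algebra_simps)
  \<comment> \<open>\<open>E\<close> shifts all weights by the same form, so [E, F] and [E, b] still
    have different weights and are orthogonal.\<close>
  have orth: "ip (br E F) (br E b) = 0" if b: "b \<in> Bs - C" for b
  proof -
    obtain H where H: "H \<in> a" "wt b H \<noteq> wt b0 H" using b by (auto simp: C_def)
    have 1: "br H (br E F) = (2 * (- t) * e j H + wt b0 H) *\<^sub>R br E F" by (rule wtE[OF H(1) FH[OF H(1)]])
    have 2: "br H (br E b) = (2 * (- t) * e j H + wt b H) *\<^sub>R br E b"
      by (rule wtE[OF H(1) br_Bs[OF _ H(1)]]) (use b in simp)
    have "ip (br H (br E F)) (br E b) = ip (br E F) (br H (br E b))"
      using self_adjoint_p[OF a_p[OF H(1)]] by (simp add: self_adjoint_def)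
    then have "(2 * (- t) * e j H + wt b0 H) * ip (br E F) (br E b) = (2 * (- t) * e j H + wt b H) * ip (br E F) (br E b)"
      unfolding 1 2 by (simp only: ip_scaleR)
    then show ?thesis using H(2) by auto
  qed
  have s1: "ip (br E F) (br E \<zeta>) = ip (br E F) (br E F)"
  proof -
    have "ip (br E F) (br E (\<zeta> - F)) = 0"
      unfolding rest br_sum_right ip_sum_right by (rule sum.neutral) (use orth in simp)
    then show ?thesis by (simp add: br_simps ip_simps)
  qed
  have "br \<zeta> (E + \<theta> E) = 0" by (rule br_\<zeta>_k[OF \<theta>_add_k])
  then have "br (E + \<theta> E) \<zeta> = 0" using br_anti[of "E + \<theta> E" \<zeta>] by simp
  then have "br E \<zeta> = - br (\<theta> E) \<zeta>" by (simp add: br_simps add_eq_0_iff2)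
  then have s2: "ip (br E F) (br E \<zeta>) = ip (br E (br E F)) \<zeta>"
    using ad_adjoint[of E "br E F" \<zeta>] by (simp add: ip_simps)
  have s3: "br E (br E F) = 0"
  proof (rule ccontr)
    assume nz: "br E (br E F) \<noteq> 0"
    define l where "l H = 2 * (- t) * e j H + (2 * (- t) * e j H + wt b0 H)" for H
    have ll: "linear l"
      unfolding l_def
      by (rule linearI) (simp_all add: linear_add[OF e_linear[OF j]] linear_scale[OF e_linear[OF j]]
          linear_add[OF wt_linear] linear_scale[OF wt_linear] algebra_simps)
    have "br H (br E (br E F)) = l H *\<^sub>R br E (br E F)" if "H \<in> a" for H
      unfolding l_def by (rule wtE[OF that wtE[OF that FH[OF that]]])
    from weight_le_2[OF ll nz this j] have "\<bar>l (h j)\<bar> \<le> 2" .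
    \<comment> \<open>Each \<open>E\<close> contributes -2t and \<open>F\<close> contributes
      t.\<close>
    moreover have "l (h j) = - 3 * t" using e_h[OF j j] by (simp add: l_def t_def)
    ultimately show False using t by (auto simp: t_def)
  qed
  have EF: "br E F = 0" using s1 s2 s3 by (simp add: ip_simps ip_eq_0_iff)
  define A where "A = br E (\<theta> E)"
  have \<theta>E: "br H (\<theta> E) = - ((2 * (- t) * e j H) *\<^sub>R \<theta> E)" if H: "H \<in> a" for H
  proof -
    have "br H (\<theta> E) = \<theta> (br (\<theta> H) E)" by (simp add: \<theta>_br)
    also have "\<theta> H = - H" using a_p[OF H] by (simp add: p_iff)
    finally show ?thesis
      by (simp add: br_simps E(2)[OF H] linear_neg[OF \<theta>_linear] linear_scale[OF \<theta>_linear])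
  qed
  \<comment> \<open>The weights of \<open>E\<close> and \<open>\<theta> E\<close> cancel, so their
    bracket commutes with \<open>a\<close>; it lies in the p-part, and \<open>a\<close> is maximal
    abelian.\<close>
  have Aa: "A \<in> a"
  proof (rule a_mem)
    show "A \<in> \<pp>" using br_anti[of "\<theta> E" E] by (simp add: A_def p_iff \<theta>_br)
    show "br H A = 0" if H: "H \<in> a" for H
      by (simp add: A_def jacobi[of H] E(2)[OF H] \<theta>E[OF H] br_simps)
  qed
  have "A = (2 * t * ip E E) *\<^sub>R d j"
  proof -
    have "ip (A - (2 * t * ip E E) *\<^sub>R d j) H = 0" if H: "H \<in> a" for H
    proof -
      have "ip A H = - ip (\<theta> E) (br (\<theta> E) H)" unfolding A_def by (rule ad_adjoint)
      also have "br (\<theta> E) H = - br H (\<theta> E)" by (rule br_anti)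
      finally have "ip A H = 2 * t * e j H * ip E E" by (simp add: \<theta>E[OF H] ip_simps ip_\<theta>)
      then show ?thesis using e_eq[OF j H] by (simp add: ip_simps)
    qed
    moreover have "A - (2 * t * ip E E) *\<^sub>R d j \<in> a"
      by (intro subspace_diff[OF a_subspace] Aa subspace_scale[OF a_subspace] d_a[OF j])
    ultimately have "ip (A - (2 * t * ip E E) *\<^sub>R d j) (A - (2 * t * ip E E) *\<^sub>R d j) = 0" by blast
    then show ?thesis by (simp add: ip_eq_0_iff)
  qed
  also have "d j = ip (d j) (d j) *\<^sub>R h j" by (rule d_h[OF j])
  \<comment> \<open>Because the sign of the root of \<open>E\<close> is opposite to that of
    \<open>t\<close>, the factor t enters twice and the value is positive.\<close>
  finally have "wt b0 A = 2 * (t * t) * ip E E * ip (d j) (d j)"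
    by (simp add: linear_scale[OF wt_linear] t_def)
  then have pos: "wt b0 A > 0" using tt ip_pos[OF E(1)] d_pos[OF j] by simp
  have "ip (br (\<theta> E) F) (br (\<theta> E) F) = - ip F (br E (br (\<theta> E) F))"
    using ad_adjoint[of "\<theta> E" F "br (\<theta> E) F"] by simp
  also have "br E (br (\<theta> E) F) = br A F" by (simp add: jacobi[of E] EF br_simps A_def)
  also have "\<dots> = wt b0 A *\<^sub>R F" by (rule FH[OF Aa])
  finally have "wt b0 A * ip F F \<le> 0" using ip_ge_0[of "br (\<theta> E) F"] by simp
  then have "ip F F = 0" using pos ip_ge_0[of F] by (simp add: mult_le_0_iff order_antisym)
  then have "F = 0" by (simp add: ip_eq_0_iff)
  have "b0 \<in> C" using b0 by (simp add: C_def)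
  have "ip F b0 = ip \<zeta> b0"
  proof -
    have "ip F b0 = (\<Sum>b\<in>C. if b = b0 then ip \<zeta> b else 0)"
      unfolding F_def ip_sum_left by (rule sum.cong) (use Bs fin(2) b0 in \<open>auto simp: onb_def\<close>)
    then show ?thesis using \<open>b0 \<in> C\<close> finite_subset[OF fin(2,1)] by simp
  qed
  then show ?thesis using \<open>F = 0\<close> by (simp add: ip_simps)
qed

text \<open>A root of the form \<plusminus>e_i \<plusminus> e_j or \<plusminus>e_i takes the value 1
  or -1 on \<open>h i\<close>, which \<open>\<zeta>_support\<close> excludes.\<close>

lemma \<zeta>_weights:
  assumes b: "b \<in> Bs" "ip \<zeta> b \<noteq> 0"
  obtains (zero) "\<forall>H\<in>a. wt b H = 0"
  | (long) i s where "i \<in> {1..r}" "s \<in> {-1, 1::real}" "\<forall>H\<in>a. wt b H = s * (2 * e i H)"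
proof -
  have u': "\<forall>H\<in>a. br H b = wt b H *\<^sub>R b" using br_Bs[OF b(1)] by blast
  from wt_linear Bs_nonzero[OF b(1)] u' show ?thesis
  proof (cases rule: root_cases)
  case zero
  then show ?thesis using that(1) by blast
next
  case (short i j s t)
  then have "wt b (h i) = s" using h_a by (simp add: e_h)
  then show ?thesis using \<zeta>_support[OF b(1) short(1)] short(4) b(2) by simp
next
  case (long i s)
  then show ?thesis using that(2) by blast
next
  case (half i s)
  then have "wt b (h i) = s" using h_a by (simp add: e_h)
  then show ?thesis using \<zeta>_support[OF b(1) half(1)] half(2) b(2) by simp
qed
qed

text \<open>On the components of \<zeta>, ad(X/2) has only the eigenvalues 0 and
  \<plusminus>\<open>e i X\<close>: halving X cancels the 2 in the roots \<plusminus>2e_i. An odd f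
  vanishes at 0 and passes through the sign, so f acts on each coordinate separately.\<close>

lemma fun_calc_\<zeta>:
  assumes f: "\<And>x. f (- x) = - f x" and X: "X \<in> a"
  shows "fun_calc f (br ((1 / 2) *\<^sub>R X)) \<zeta> = (1 / 2) *\<^sub>R br (\<Sum>i\<in>{1..r}. f (e i X) *\<^sub>R h i) \<zeta>"
proof -
  let ?Y = "\<Sum>i\<in>{1..r}. f (e i X) *\<^sub>R h i"
  have Xh: "(1 / 2) *\<^sub>R X \<in> a" by (rule subspace_scale[OF a_subspace X])
  have f0: "f 0 = 0" using f[of 0] by simp
  have "fun_calc f (br ((1 / 2) *\<^sub>R X)) \<zeta> = (\<Sum>b\<in>Bs. (f (wt b ((1 / 2) *\<^sub>R X)) * ip \<zeta> b) *\<^sub>R b)"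
    by (rule fun_calc_onb[OF self_adjoint_p[OF a_p[OF Xh]] Bs br_Bs[OF _ Xh]])
  also have "\<dots> = (\<Sum>b\<in>Bs. (1 / 2) *\<^sub>R ((wt b ?Y * ip \<zeta> b) *\<^sub>R b))"
  proof (rule sum.cong)
    fix b assume b: "b \<in> Bs"
    show "(f (wt b ((1 / 2) *\<^sub>R X)) * ip \<zeta> b) *\<^sub>R b = (1 / 2) *\<^sub>R ((wt b ?Y * ip \<zeta> b) *\<^sub>R b)"
    proof (cases "ip \<zeta> b = 0")
      case False
      from b False show ?thesis
      proof (cases rule: \<zeta>_weights)
        case zero
        then show ?thesis using bspec[OF zero Xh] bspec[OF zero sum_h_a] f0 by simp
      next
        case (long i s)
        have "wt b ((1 / 2) *\<^sub>R X) = s * e i X" using bspec[OF long(3) Xh] linear_scale[OF e_linear[OF long(1)]] by simp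
        moreover have "wt b ?Y = s * (2 * f (e i X))" using bspec[OF long(3) sum_h_a] e_sum[OF long(1)] by simp
        moreover have "f (s * e i X) = s * f (e i X)" using long(2) f by auto
        ultimately show ?thesis by simp
      qed
    qed simp
  qed simp
  also have "\<dots> = (1 / 2) *\<^sub>R br ?Y \<zeta>" by (simp only: br_onb[OF sum_h_a] scaleR_sum_right)
  finally show ?thesis .
qed

lemma \<Omega>_diagonal:
  assumes f: "\<And>x. f (- x) = - f x" and X: "X \<in> a"
  shows "\<Omega> f X = (\<Sum>i\<in>{1..r}. f (e i X) *\<^sub>R h i)"
proof -
  let ?Y = "\<Sum>i\<in>{1..r}. f (e i X) *\<^sub>R h i"
  have "\<Omega> f X = br \<zeta> (br ?Y \<zeta>)" by (simp add: \<Omega>_def fun_calc_\<zeta>[where f=f, OF f X])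
  also have "br ?Y \<zeta> = - br \<zeta> ?Y" by (rule br_anti)
  also have "br \<zeta> (- br \<zeta> ?Y) = ?Y" using br_\<zeta>_\<zeta>[OF a_p[OF sum_h_a]] by (simp add: br_simps)
  finally show ?thesis .
qed

text \<open>On a component of weight 2 s e_i with s = \<plusminus>1, three brackets multiply by 8 s
  times the product of the coordinates, whereas one bracket with the coordinatewise product gives 2
  s times it. The quotient is the constant 4.\<close>

lemma triple_product:
  assumes X: "X \<in> a" and Y: "Y \<in> a" and Z: "Z \<in> a"
  shows "br (br (br \<zeta> X) Y) Z = 4 *\<^sub>R br \<zeta> (\<Sum>i\<in>{1..r}. (e i X * e i Y * e i Z) *\<^sub>R h i)"
proof -
  let ?P = "\<Sum>i\<in>{1..r}. (e i X * e i Y * e i Z) *\<^sub>R h i"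
  have "br (br (br \<zeta> X) Y) Z = - br Z (br Y (br X \<zeta>))"
  proof -
    have "br (br \<zeta> X) Y = br Y (br X \<zeta>)"
      unfolding br_anti[of \<zeta> X] bilinear_lneg[OF br_bilinear] br_anti[of "br X \<zeta>" Y] by simp
    then show ?thesis by (simp only: br_anti[of _ Z])
  qed
  also have "br Z (br Y (br X \<zeta>)) = (\<Sum>b\<in>Bs. (wt b X * wt b Y * wt b Z * ip \<zeta> b) *\<^sub>R b)"
  proof -
    have "br Z (br Y (br X \<zeta>)) = (\<Sum>b\<in>Bs. (wt b X * ip \<zeta> b) *\<^sub>R br Z (br Y b))"
      by (simp add: br_onb[OF X, of \<zeta>] br_sum_right)
    also have "\<dots> = (\<Sum>b\<in>Bs. (wt b X * wt b Y * wt b Z * ip \<zeta> b) *\<^sub>R b)"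
      by (rule sum.cong) (simp_all add: br_Bs[OF _ Y] br_Bs[OF _ Z] mult_ac)
    finally show ?thesis .
  qed
  also have "\<dots> = (\<Sum>b\<in>Bs. 4 *\<^sub>R ((wt b ?P * ip \<zeta> b) *\<^sub>R b))"
  proof (rule sum.cong)
    fix b assume b: "b \<in> Bs"
    show "(wt b X * wt b Y * wt b Z * ip \<zeta> b) *\<^sub>R b = 4 *\<^sub>R ((wt b ?P * ip \<zeta> b) *\<^sub>R b)"
    proof (cases "ip \<zeta> b = 0")
      case False
      from b False show ?thesis
      proof (cases rule: \<zeta>_weights)
        case zero
        then show ?thesis using bspec[OF zero X] bspec[OF zero sum_h_a] by simp
      next
        case (long i s)
        have "wt b ?P = s * (2 * (e i X * e i Y * e i Z))" using bspec[OF long(3) sum_h_a] e_sum[OF long(1)] by simp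
        then have "wt b X * wt b Y * wt b Z = 4 * wt b ?P" using long(2,3) X Y Z by auto
        then show ?thesis by (simp add: mult.assoc)
      qed
    qed simp
  qed simp
  also have "\<dots> = 4 *\<^sub>R br ?P \<zeta>" by (simp only: br_onb[OF sum_h_a] scaleR_sum_right)
  also have "- (4 *\<^sub>R br ?P \<zeta>) = 4 *\<^sub>R br \<zeta> ?P" using br_anti[of \<zeta> ?P] by simp
  finally show ?thesis .
qed

lemma conjugate_to_a: "X \<in> \<pp> \<Longrightarrow> \<exists>k\<in>K. \<exists>Y\<in>a. X = k Y"
proof -
  assume X: "X \<in> \<pp>"
  obtain k where k: "k \<in> adjoint_group br (lts_k \<pp>)" "k X \<in> a"
    using lts_conjugate[OF lts_p a_max X] by blast
  have kK: "k \<in> K" by (rule adjoint_group_k[OF lts_k_sub_k k(1)]) simp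
  have "X = inv k (k X)" by (simp add: automorphism_inv1[OF K_automorphism[OF kK]])
  then show ?thesis using k(2) K_inv[OF kK] by blast
qed

end

section \<open>Odd injective functions\<close>

text \<open>The range is open (invariance of domain on the line), connected and symmetric about 0,
  hence the open interval bounded by the supremum and its negative, also when the supremum is
  infinite.\<close>

lemma
  assumes \<eta>: "continuous_injective_odd \<eta>"
  shows open_range: "open (range \<eta>)" and is_interval_range: "is_interval (range \<eta>)"
    and range_uminus: "y \<in> range \<eta> \<Longrightarrow> - y \<in> range \<eta>"
    and range_iff: "y \<in> range \<eta> \<longleftrightarrow> ereal \<bar>y\<bar> < (SUP x. ereal (\<eta> x))"
proof -
  have c: "continuous_on UNIV \<eta>" and i: "inj \<eta>" and o: "\<eta> (- x) = - \<eta> x" for x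
    using \<eta> by (auto simp: continuous_injective_odd_def)
  have om: "open (\<eta> ` T)" if "open T" for T
    using injective_eq_1d_open_map_UNIV[of UNIV \<eta>] c i that by auto
  show op: "open (range \<eta>)" by (rule om) simp
  have "connected (range \<eta>)" by (rule connected_continuous_image[OF c connected_UNIV])
  then show int: "is_interval (range \<eta>)" by (simp add: is_interval_connected_1)
  show um: "- y \<in> range \<eta>" if y: "y \<in> range \<eta>" for y
  proof -
    obtain x where "y = \<eta> x" using y by blast
    then have "- y = \<eta> (- x)" by (simp add: o)
    then show ?thesis by blast
  qed
  show "y \<in> range \<eta> \<longleftrightarrow> ereal \<bar>y\<bar> < (SUP x. ereal (\<eta> x))"
  proof
    assume "y \<in> range \<eta>"
    then have "\<bar>y\<bar> \<in> range \<eta>" using um by (auto simp: abs_if)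
    then obtain \<epsilon> where e: "\<epsilon> > 0" "ball \<bar>y\<bar> \<epsilon> \<subseteq> range \<eta>" using op open_contains_ball by blast
    have "\<bar>y\<bar> + \<epsilon> / 2 \<in> ball \<bar>y\<bar> \<epsilon>" using e(1) by (simp add: dist_real_def)
    then obtain x where x: "\<eta> x = \<bar>y\<bar> + \<epsilon> / 2" using e(2) by (metis imageE subsetD)
    have "ereal \<bar>y\<bar> < ereal (\<eta> x)" using x e(1) by simp
    also have "\<dots> \<le> (SUP x. ereal (\<eta> x))" by (rule SUP_upper) simp
    finally show "ereal \<bar>y\<bar> < (SUP x. ereal (\<eta> x))" .
  next
    assume "ereal \<bar>y\<bar> < (SUP x. ereal (\<eta> x))"
    then obtain x where x: "\<bar>y\<bar> < \<eta> x" unfolding less_SUP_iff by auto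
    have "\<eta> (- x) \<le> y" "y \<le> \<eta> x" using x by (auto simp: o)
    then show "y \<in> range \<eta>"
      using mem_is_interval_1_I[OF int rangeI rangeI] by blast
  qed
qed

text \<open>The default 0 outside the range keeps the function odd on the whole line, as
  \<open>\<Omega>_diagonal\<close> requires.\<close>

definition odd_inverse :: "(real \<Rightarrow> real) \<Rightarrow> real \<Rightarrow> real" where
  "odd_inverse \<eta> y = (if y \<in> range \<eta> then inv \<eta> y else 0)"

lemma odd_inverse:
  assumes \<eta>: "continuous_injective_odd \<eta>"
  shows odd_inverse_left: "odd_inverse \<eta> (\<eta> x) = x"
    and odd_inverse_odd: "odd_inverse \<eta> (- y) = - odd_inverse \<eta> y"
    and odd_inverse_continuous: "continuous_on (range \<eta>) (odd_inverse \<eta>)"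
proof -
  have c: "continuous_on UNIV \<eta>" and i: "inj \<eta>" and o: "\<eta> (- x) = - \<eta> x" for x
    using \<eta> by (auto simp: continuous_injective_odd_def)
  show l: "odd_inverse \<eta> (\<eta> x) = x" for x using i by (simp add: odd_inverse_def)
  show "odd_inverse \<eta> (- y) = - odd_inverse \<eta> y"
  proof (cases "y \<in> range \<eta>")
    case True
    then obtain x where "y = \<eta> x" by blast
    then show ?thesis using l[of x] l[of "- x"] by (simp add: o)
  next
    case False
    then have "- y \<notin> range \<eta>" using range_uminus[OF \<eta>, of "- y"] by auto
    then show ?thesis using False by (simp add: odd_inverse_def)
  qed
  show "continuous_on (range \<eta>) (odd_inverse \<eta>)"
    unfolding continuous_on_open_vimage[OF open_range[OF \<eta>]]
  proof (intro allI impI)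
    fix U :: "real set" assume U: "open U"
    have "odd_inverse \<eta> -` U \<inter> range \<eta> = \<eta> ` U" using l by auto
    then show "open (odd_inverse \<eta> -` U \<inter> range \<eta>)"
      using injective_eq_1d_open_map_UNIV[of UNIV \<eta>] c i U by auto
  qed
qed

text \<open>Two radii are needed: \<open>R'\<close> bounds the eigenvalues at a given point, and the
  gap up to \<open>R\<close> leaves room for those at nearby points.\<close>

lemma symmetric_interval_bound:
  fixes J :: "real set"
  assumes J: "open J" "is_interval J" "0 \<in> J" "\<And>y. y \<in> J \<Longrightarrow> - y \<in> J" and S: "finite S" "S \<subseteq> J"
  shows "\<exists>R' R. 0 \<le> R' \<and> R' < R \<and> (\<forall>y\<in>S. \<bar>y\<bar> \<le> R') \<and> {-R..R} \<subseteq> J"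
proof -
  define R' where "R' = Max (insert 0 (abs ` S))"
  have R': "R' \<ge> 0" "\<And>y. y \<in> S \<Longrightarrow> \<bar>y\<bar> \<le> R'" using S(1) by (auto simp: R'_def)
  have "R' \<in> insert 0 (abs ` S)" unfolding R'_def using S(1) by (intro Max_in) auto
  then have "R' \<in> J" using J(3,4) S(2) by (auto simp: abs_if)
  then obtain \<epsilon> where e: "\<epsilon> > 0" "ball R' \<epsilon> \<subseteq> J" using J(1) open_contains_ball by blast
  define R where "R = R' + \<epsilon> / 2"
  have "R \<in> ball R' \<epsilon>" using e(1) by (simp add: dist_real_def R_def)
  then have RJ: "R \<in> J" using e(2) by blast
  have "{-R..R} \<subseteq> J" using mem_is_interval_1_I[OF J(2) J(4)[OF RJ] RJ] by auto
  then show ?thesis using R' e(1) by (intro exI[of _ R'] exI[of _ R]) (auto simp: R_def)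
qed

section \<open>Smooth functions of one variable\<close>

text \<open>The successive derivatives of \<open>D 0\<close> as explicit functions, the form in
  which \<open>times_differentiable_fun_calc\<close> takes its function.\<close>

definition derivative_sequence :: "nat \<Rightarrow> real set \<Rightarrow> (nat \<Rightarrow> real \<Rightarrow> real) \<Rightarrow> bool" where
  "derivative_sequence k J D \<longleftrightarrow>
     (\<forall>j<k. \<forall>t\<in>J. (D j has_real_derivative D (Suc j) t) (at t)) \<and> continuous_on J (D k)"

lemma times_differentiable_on_derivative_sequence:
  "times_differentiable_on k J f \<Longrightarrow> \<exists>D. D 0 = f \<and> derivative_sequence k J D"
proof (induction k arbitrary: f)
  case 0
  then show ?case by (intro exI[of _ "\<lambda>_. f"]) (simp add: derivative_sequence_def)
next
  case (Suc k)
  then obtain f' where f': "\<forall>x\<in>J. (f has_derivative f' x) (at x)" "\<forall>v. times_differentiable_on k J (\<lambda>x. f' x v)"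
    by auto
  obtain D where D: "D 0 = (\<lambda>x. f' x 1)" "derivative_sequence k J D" using Suc.IH f'(2) by blast
  have d: "(f has_real_derivative D 0 x) (at x)" if "x \<in> J" for x
  proof -
    have fx: "(f has_derivative f' x) (at x)" using f'(1) that by blast
    have "f' x = (*) (D 0 x)"
    proof
      show "f' x h = D 0 x * h" for h
        using linear_scale[OF has_derivative_linear[OF fx], of h 1] by (simp add: D(1) mult.commute)
    qed
    then show ?thesis using fx unfolding has_field_derivative_def by (simp only:)
  qed
  show ?case
  proof (intro exI[of _ "\<lambda>n. case n of 0 \<Rightarrow> f | Suc m \<Rightarrow> D m"] conjI)
    show "derivative_sequence (Suc k) J (\<lambda>n. case n of 0 \<Rightarrow> f | Suc m \<Rightarrow> D m)"
      using D(2) d by (auto simp: derivative_sequence_def less_Suc_eq_0_disj)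
  qed simp
qed

lemma times_differentiable_on_local:
  assumes "open J" "\<And>x. x \<in> J \<Longrightarrow> \<exists>U. open U \<and> x \<in> U \<and> times_differentiable_on k U f"
  shows "times_differentiable_on k J f"
  using assms(2)
proof (induction k arbitrary: f)
  case 0
  have "isCont f x" if x: "x \<in> J" for x
  proof -
    obtain U where "open U" "x \<in> U" "times_differentiable_on 0 U f" using 0[OF x] by blast
    then show ?thesis by (simp add: continuous_on_eq_continuous_at)
  qed
  then show ?case by (simp add: continuous_at_imp_continuous_on)
next
  case (Suc k)
  \<comment> \<open>The local derivatives come without a common choice; uniqueness of the derivative
    makes any global selection agree with them.\<close>
  define f' where "f' x = (SOME F. (f has_derivative F) (at x))" for x
  have f': "(f has_derivative f' x) (at x)" if "(f has_derivative F) (at x)" for F x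
    unfolding f'_def using someI[of "\<lambda>F. (f has_derivative F) (at x)", OF that] .
  have "(f has_derivative f' x) (at x)" if x: "x \<in> J" for x
  proof -
    obtain U where U: "x \<in> U" "times_differentiable_on (Suc k) U f" using Suc.prems[OF x] by blast
    then obtain F where "(f has_derivative F x) (at x)" unfolding times_differentiable_on.simps by blast
    then show ?thesis by (rule f')
  qed
  moreover have "times_differentiable_on k J (\<lambda>x. f' x v)" for v
  proof (rule Suc.IH)
    fix x assume "x \<in> J"
    then obtain U where U: "open U" "x \<in> U" "times_differentiable_on (Suc k) U f" using Suc.prems by blast
    then obtain F where F: "\<forall>y\<in>U. (f has_derivative F y) (at y)" "\<forall>v. times_differentiable_on k U (\<lambda>y. F y v)"
      unfolding times_differentiable_on.simps by blast
    have "F y v = f' y v" if "y \<in> U" for y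
    proof -
      have d: "(f has_derivative F y) (at y)" using F(1) that by blast
      show ?thesis by (simp only: has_derivative_unique[OF d f'[OF d]])
    qed
    then have "times_differentiable_on k U (\<lambda>x. f' x v)"
      by (rule times_differentiable_on_cong[OF U(1) _ F(2)[rule_format]])
    then show "\<exists>U. open U \<and> x \<in> U \<and> times_differentiable_on k U (\<lambda>x. f' x v)" using U by blast
  qed
  ultimately show ?case unfolding times_differentiable_on.simps by (intro exI[of _ f'] conjI ballI allI)
qed

lemma smooth_map_on_open:
  assumes f: "smooth_map_on J f" and J: "open J"
  shows "times_differentiable_on k J f"
proof (rule times_differentiable_on_local[OF J])
  fix x assume x: "x \<in> J"
  obtain U F where U: "open U" "x \<in> U" "\<forall>k. times_differentiable_on k U F" "\<forall>y\<in>J \<inter> U. F y = f y"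
    using f x unfolding smooth_map_on_def by blast
  have o: "open (J \<inter> U)" using J U(1) by blast
  have "times_differentiable_on k (J \<inter> U) F"
    by (rule times_differentiable_on_subset[OF U(3)[rule_format]]) simp
  then have "times_differentiable_on k (J \<inter> U) f"
    by (rule times_differentiable_on_cong[OF o, rotated]) (use U(4) in blast)
  then show "\<exists>U. open U \<and> x \<in> U \<and> times_differentiable_on k U f" using o x U(2) by blast
qed

lemma times_differentiable_on_linear:
  assumes T: "bounded_linear T"
  shows "times_differentiable_on k U f \<Longrightarrow> times_differentiable_on k U (\<lambda>x. T (f x))"
proof (induction k arbitrary: f)
  case 0
  then show ?case using bounded_linear.continuous_on[OF T] by simp
next
  case (Suc k)
  then obtain f' where f': "\<forall>x\<in>U. (f has_derivative f' x) (at x)" "\<forall>v. times_differentiable_on k U (\<lambda>x. f' x v)"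
    by auto
  have "\<forall>x\<in>U. ((\<lambda>x. T (f x)) has_derivative (\<lambda>v. T (f' x v))) (at x)"
    using bounded_linear.has_derivative[OF T] f'(1) by blast
  moreover have "\<forall>v. times_differentiable_on k U (\<lambda>x. T (f' x v))"
    using Suc.IH f'(2) by blast
  ultimately show ?case unfolding times_differentiable_on.simps by (intro exI[of _ "\<lambda>x v. T (f' x v)"] conjI)
qed

section \<open>Regularity of the diagonal maps\<close>

context framed
begin

text \<open>The p-part is not open in the ambient space, while \<open>smooth_map_on\<close> asks for
  extensions to open sets. Precomposing with this projection provides one, and it makes the
  operators self-adjoint everywhere.\<close>

definition p_proj :: "'g \<Rightarrow> 'g" where "p_proj X = (1 / 2) *\<^sub>R (X - \<theta> X)"

lemma p_proj_linear: "linear p_proj" and p_proj_p: "p_proj X \<in> \<pp>" and p_proj_id: "X \<in> \<pp> \<Longrightarrow> p_proj X = X"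
proof -
  show "linear p_proj"
    unfolding p_proj_def
    by (rule linearI) (simp_all add: linear_add[OF \<theta>_linear] linear_scale[OF \<theta>_linear] algebra_simps)
  show "p_proj X \<in> \<pp>" unfolding p_proj_def by (rule subspace_scale[OF subspace_p \<theta>_diff_p])
  show "X \<in> \<pp> \<Longrightarrow> p_proj X = X" by (simp add: p_proj_def p_iff flip: scaleR_2)
qed

text \<open>The eigenvalues of \<open>ad X / 2\<close> are \<open>0\<close>, \<open>(\<plusminus>x\<^sub>i \<plusminus> x\<^sub>j) / 2\<close>, \<open>\<plusminus>x\<^sub>i\<close> and possibly \<open>\<plusminus>x\<^sub>i / 2\<close>.\<close>

lemma numerical_range_bound:
  assumes k: "k \<in> K" and X: "X \<in> a" and R: "R \<ge> 0" "\<And>i. i \<in> {1..r} \<Longrightarrow> \<bar>e i X\<bar> \<le> R"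
  shows "\<bar>ip (br ((1 / 2) *\<^sub>R k X) v) v\<bar> \<le> R * ip v v"
proof -
  have ak: "automorphism k" by (rule K_automorphism[OF k])
  have wtR: "\<bar>wt b X\<bar> \<le> 2 * R" if b: "b \<in> Bs" for b
  proof -
    have "\<forall>H\<in>a. br H b = wt b H *\<^sub>R b" using br_Bs[OF b] by blast
    with wt_linear Bs_nonzero[OF b] show ?thesis
    proof (cases rule: root_cases)
      case zero
      then show ?thesis using X R by simp
    next
      case (short i j s t)
      then have "\<bar>wt b X\<bar> \<le> \<bar>e i X\<bar> + \<bar>e j X\<bar>" using X by auto
      then show ?thesis using R(2)[OF short(1)] R(2)[OF short(2)] by simp
    next
      case (long i s)
      then have "\<bar>wt b X\<bar> = 2 * \<bar>e i X\<bar>" using X by (auto simp: abs_mult)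
      then show ?thesis using R(2)[OF long(1)] by simp
    next
      case (half i s)
      then have "\<bar>wt b X\<bar> = \<bar>e i X\<bar>" using X by auto
      then show ?thesis using R(2)[OF half(1)] R(1) by simp
    qed
  qed
  have *: "\<bar>ip (br X w) w\<bar> \<le> 2 * R * ip w w" for w
  proof -
    have "ip (br X w) w = (\<Sum>b\<in>Bs. wt b X * (ip w b * ip w b))"
      unfolding br_onb[OF X, of w] ip_sum_left
      by (rule sum.cong) (simp_all add: ip_sym[of _ w])
    then have "\<bar>ip (br X w) w\<bar> \<le> (\<Sum>b\<in>Bs. \<bar>wt b X * (ip w b * ip w b)\<bar>)" by (simp only: sum_abs)
    also have "\<dots> \<le> (\<Sum>b\<in>Bs. 2 * R * (ip w b * ip w b))"
      by (rule sum_mono) (simp add: abs_mult wtR mult_right_mono)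
    also have "\<dots> = 2 * R * ip w w" by (simp add: onb_ip_sum[OF Bs, of w w] sum_distrib_left)
    finally show ?thesis .
  qed
  define w where "w = inv k v"
  have v: "v = k w" by (simp add: w_def automorphism_inv2[OF ak])
  have "ip (br ((1 / 2) *\<^sub>R k X) v) v = (1 / 2) * ip (br X w) w"
    by (simp add: v automorphism_br[OF ak, symmetric] K_ip[OF k])
  moreover have "ip v v = ip w w" by (simp add: v K_ip[OF k])
  ultimately show ?thesis using *[of w] by (simp add: abs_mult)
qed

text \<open>For J = \<open>UNIV\<close> this is the whole p-part; for the range of a continuous
  injective odd \<eta> it is the domain D_\<eta>, on which the inverse realization lives.\<close>

definition spectral_domain :: "real set \<Rightarrow> 'g set" where
  "spectral_domain J = {k X |k X. k \<in> K \<and> X \<in> a \<and> (\<forall>i\<in>{1..r}. e i X \<in> J)}"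

text \<open>The bound on ip(A v, v) at \<open>Y\<close> changes by at most a multiple of
  \<open>norm (X - Y)\<close>, so near \<open>Y\<close> the spectrum stays in [-R, R] \<subseteq> J.
  The neighbourhood is fixed before the order k and the function, since smoothness asks for a single
  one serving all orders.\<close>

lemma \<Omega>_times_differentiable:
  assumes J: "open J" "is_interval J" "0 \<in> J" "\<And>y. y \<in> J \<Longrightarrow> - y \<in> J" and Y: "Y \<in> spectral_domain J"
  shows "\<exists>U. open U \<and> Y \<in> U \<and>
    (\<forall>k D. derivative_sequence k J D \<longrightarrow> times_differentiable_on k U (\<lambda>X. \<Omega> (D 0) (p_proj X)))"
proof -
  obtain k0 X0 where kX: "k0 \<in> K" "X0 \<in> a" "\<forall>i\<in>{1..r}. e i X0 \<in> J" "Y = k0 X0"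
    using Y by (auto simp: spectral_domain_def)
  have "finite ((\<lambda>i. e i X0) ` {1..r})" "(\<lambda>i. e i X0) ` {1..r} \<subseteq> J" using kX(3) by auto
  then obtain R' R where R: "0 \<le> R'" "R' < R" "\<forall>y\<in>(\<lambda>i. e i X0) ` {1..r}. \<bar>y\<bar> \<le> R'" "{-R..R} \<subseteq> J"
    using symmetric_interval_bound[OF J] by metis
  define A where "A X v = br ((1 / 2) *\<^sub>R p_proj X) v" for X v
  have lA: "linear (\<lambda>X. (1 / 2) *\<^sub>R p_proj X)"
    by (rule linear_compose_scale_right[OF p_proj_linear])
  have "bilinear A"
    unfolding bilinear_def A_def
    using ad_linear linear_compose[OF lA ad_linear_left] by (auto simp: o_def)
  then have A: "bounded_bilinear A" by (simp add: bilinear_conv_bounded_bilinear)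
  have Yp: "Y \<in> \<pp>" using kX a_p K_p by simp
  have AY: "\<bar>ip (A Y v) v\<bar> \<le> R' * ip v v" for v
    using numerical_range_bound[OF kX(1,2) R(1), of v] R(3)
    unfolding A_def p_proj_id[OF Yp] by (simp add: kX(4))
  obtain CA where CA: "CA > 0" "\<And>x y. norm (A x y) \<le> norm x * norm y * CA"
    using bounded_bilinear.pos_bounded[OF A] by blast
  obtain CI where CI: "CI > 0" "\<And>x y. norm (ip x y) \<le> norm x * norm y * CI"
    using bounded_bilinear.pos_bounded[OF ip_bounded] by blast
  obtain CN where CN: "CN > 0" "\<And>x. norm x ^ 2 \<le> CN * ip x x" using ip_norm_bound by blast
  define C where "C = CA * CI * CN"
  have C: "C > 0" using CA(1) CI(1) CN(1) by (simp add: C_def)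
  have AH: "\<bar>ip (A H v) v\<bar> \<le> C * norm H * ip v v" for H v
  proof -
    have "\<bar>ip (A H v) v\<bar> \<le> norm (A H v) * norm v * CI" using CI(2)[of "A H v" v] by simp
    also have "\<dots> \<le> (norm H * norm v * CA) * norm v * CI"
      using CA(2) CI(1) by (intro mult_right_mono) auto
    also have "\<dots> = (CA * CI * norm H) * norm v ^ 2" by (simp add: power2_eq_square)
    also have "\<dots> \<le> (CA * CI * norm H) * (CN * ip v v)"
      using CN(2) CA(1) CI(1) by (intro mult_left_mono) auto
    finally show ?thesis by (simp add: C_def mult_ac)
  qed
  \<comment> \<open>Within this radius the perturbation uses up no more than the gap between
    \<open>R'\<close> and \<open>R\<close>.\<close>
  define \<delta> where "\<delta> = (R - R') / C"
  have \<delta>: "\<delta> > 0" using R(2) C by (simp add: \<delta>_def)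
  have sb: "spectrum_bound (A X) R" if X: "X \<in> ball Y \<delta>" for X
    unfolding spectrum_bound_def
  proof (intro allI impI)
    fix u l assume u: "u \<noteq> 0" "A X u = l *\<^sub>R u"
    have "A X u = A Y u + A (X - Y) u" by (simp add: bounded_bilinear.diff_left[OF A])
    then have "ip (A X u) u = ip (A Y u) u + ip (A (X - Y) u) u" by (simp add: ip_simps)
    then have "\<bar>l * ip u u\<bar> \<le> R' * ip u u + C * norm (X - Y) * ip u u"
      using AY[of u] AH[of "X - Y" u] u(2) by (simp add: ip_simps)
    also have "C * norm (X - Y) * ip u u \<le> (R - R') * ip u u"
    proof (rule mult_right_mono[OF _ ip_ge_0])
      have "norm (X - Y) < \<delta>" using X by (simp add: dist_norm norm_minus_commute)
      then show "C * norm (X - Y) \<le> R - R'" using C by (simp add: \<delta>_def field_simps)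
    qed
    finally have "\<bar>l\<bar> * ip u u \<le> R * ip u u" using ip_ge_0[of u] by (simp add: abs_mult algebra_simps)
    then show "\<bar>l\<bar> \<le> R" using ip_pos[OF u(1)] by simp
  qed
  have sa: "self_adjoint (A X)" for X
    unfolding A_def by (rule self_adjoint_p[OF subspace_scale[OF subspace_p p_proj_p]])
  have AX: "A X = br ((1 / 2) *\<^sub>R p_proj X)" for X by (rule ext) (simp only: A_def)
  show ?thesis
  proof (intro exI[of _ "ball Y \<delta>"] conjI allI impI)
    fix k D assume D: "derivative_sequence k J D"
    have "times_differentiable_on k (ball Y \<delta>) (\<lambda>X. fun_calc (D 0) (A X) \<zeta>)"
    proof (rule times_differentiable_fun_calc[OF A open_ball])
      show "R > 0" using R by simp
      show "(D j has_real_derivative D (Suc j) t) (at t)" if "j < k" "\<bar>t\<bar> \<le> R" for j t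
      proof -
        have "t \<in> J" using R(4) that(2) by (auto simp: abs_le_iff)
        then show ?thesis using D that(1) unfolding derivative_sequence_def by blast
      qed
      show "continuous_on {-R..R} (D k)"
        using D R(4) unfolding derivative_sequence_def by (blast intro: continuous_on_subset)
    qed (use sa sb in auto)
    then have "times_differentiable_on k (ball Y \<delta>) (\<lambda>X. 2 *\<^sub>R br \<zeta> (fun_calc (D 0) (A X) \<zeta>))"
      by (rule times_differentiable_on_linear[rotated])
         (rule bounded_linear_compose[OF bounded_linear_scaleR_right ad_bounded_linear])
    then show "times_differentiable_on k (ball Y \<delta>) (\<lambda>X. \<Omega> (D 0) (p_proj X))"
      by (simp only: \<Omega>_def AX[symmetric])
  qed (use \<delta> in auto)
qed

lemma spectral_domain_p: "spectral_domain J \<subseteq> \<pp>"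
  using a_p K_p by (auto simp: spectral_domain_def)

lemma \<Omega>_continuous:
  assumes J: "open J" "is_interval J" "0 \<in> J" "\<And>y. y \<in> J \<Longrightarrow> - y \<in> J" and f: "continuous_on J f"
  shows "continuous_on (spectral_domain J) (\<Omega> f)"
  unfolding continuous_on_eq_continuous_within
proof
  fix Y assume Y: "Y \<in> spectral_domain J"
  obtain U where U: "open U" "Y \<in> U" "\<And>k D. derivative_sequence k J D \<Longrightarrow> times_differentiable_on k U (\<lambda>X. \<Omega> (D 0) (p_proj X))"
    using \<Omega>_times_differentiable[OF J Y] by blast
  have "times_differentiable_on 0 U (\<lambda>X. \<Omega> f (p_proj X))"
    using U(3)[of 0 "\<lambda>_. f"] f by (simp add: derivative_sequence_def)
  then have "continuous_on U (\<lambda>X. \<Omega> f (p_proj X))" by simp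
  then have "continuous_on (spectral_domain J \<inter> U) (\<lambda>X. \<Omega> f (p_proj X))" by (rule continuous_on_subset) simp
  moreover have "\<Omega> f (p_proj X) = \<Omega> f X" if "X \<in> spectral_domain J \<inter> U" for X
  proof -
    have "X \<in> \<pp>" using that spectral_domain_p by blast
    then show ?thesis by (simp only: p_proj_id)
  qed
  ultimately have "continuous_on (spectral_domain J \<inter> U) (\<Omega> f)"
    using continuous_on_cong[OF refl, of "spectral_domain J \<inter> U" "\<lambda>X. \<Omega> f (p_proj X)" "\<Omega> f"] by blast
  then have "continuous (at Y within spectral_domain J \<inter> U) (\<Omega> f)"
    using Y U(2) by (simp add: continuous_on_eq_continuous_within)
  moreover have "at Y within spectral_domain J \<inter> U = at Y within spectral_domain J"
    by (rule at_within_nhd[OF U(2,1)]) auto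
  ultimately show "continuous (at Y within spectral_domain J) (\<Omega> f)" by (simp add: continuous_within)
qed

lemma \<Omega>_smooth:
  assumes J: "open J" "is_interval J" "0 \<in> J" "\<And>y. y \<in> J \<Longrightarrow> - y \<in> J" and f: "smooth_map_on J f"
    and S: "S \<subseteq> spectral_domain J" and F: "\<And>X. X \<in> S \<Longrightarrow> F X = \<Omega> f X"
  shows "smooth_map_on S F"
  unfolding smooth_map_on_def
proof
  fix Y assume Y: "Y \<in> S"
  obtain U where U: "open U" "Y \<in> U" "\<And>k D. derivative_sequence k J D \<Longrightarrow> times_differentiable_on k U (\<lambda>X. \<Omega> (D 0) (p_proj X))"
    using \<Omega>_times_differentiable[OF J] Y S by blast
  have "times_differentiable_on k U (\<lambda>X. \<Omega> f (p_proj X))" for k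
  proof -
    obtain D where D: "D 0 = f" "derivative_sequence k J D"
      using times_differentiable_on_derivative_sequence[OF smooth_map_on_open[OF f J(1), of k]] by blast
    show ?thesis using U(3)[OF D(2)] D(1) by simp
  qed
  moreover have "\<Omega> f (p_proj X) = F X" if "X \<in> S \<inter> U" for X
  proof -
    have "X \<in> \<pp>" using that S spectral_domain_p by blast
    then show ?thesis using F that by (simp add: p_proj_id)
  qed
  ultimately show "\<exists>U F'. open U \<and> Y \<in> U \<and> (\<forall>k. times_differentiable_on k U F') \<and> (\<forall>y\<in>S \<inter> U. F' y = F y)"
    using U(1,2) by (intro exI[of _ U] exI[of _ "\<lambda>X. \<Omega> f (p_proj X)"]) blast
qed

end

section \<open>Diagonal realizations of \<open>M\<close>\<close>

context framed
begin

lemma cio_odd: "continuous_injective_odd \<eta> \<Longrightarrow> \<eta> (- x) = - \<eta> x"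
  and cio_continuous: "continuous_injective_odd \<eta> \<Longrightarrow> continuous_on UNIV \<eta>"
  by (simp_all add: continuous_injective_odd_def)

lemma cio_0: "continuous_injective_odd \<eta> \<Longrightarrow> \<eta> 0 = 0"
  using cio_odd[of \<eta> 0] by simp

lemma range_cio_0: "continuous_injective_odd \<eta> \<Longrightarrow> 0 \<in> range \<eta>"
  using cio_0 by (metis rangeI)

lemmas range_cio_domain = open_range is_interval_range range_cio_0 range_uminus

lemma \<Omega>_sum_h:
  assumes "\<And>x. f (- x) = - f x"
  shows "\<Omega> f (\<Sum>i\<in>{1..r}. x i *\<^sub>R h i) = (\<Sum>i\<in>{1..r}. f (x i) *\<^sub>R h i)"
  unfolding \<Omega>_diagonal[where f=f, OF assms sum_h_a] by (rule sum.cong) (simp_all only: e_sum)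

lemma \<Omega>_p:
  assumes f: "\<And>x. f (- x) = - f x" and X: "X \<in> \<pp>"
  shows "\<Omega> f X \<in> \<pp>"
proof -
  obtain k Y where k: "k \<in> K" "Y \<in> a" "X = k Y" using conjugate_to_a[OF X] by blast
  have "\<Omega> f Y \<in> a" unfolding \<Omega>_diagonal[where f=f, OF f k(2)] by (rule sum_h_a)
  then show ?thesis using \<Omega>_equivariant[OF k(1) a_p[OF k(2)]] K_p[OF k(1) a_p] k(3) by simp
qed

lemma \<Omega>_inverse:
  assumes \<eta>: "continuous_injective_odd \<eta>" and X: "X \<in> \<pp>"
  shows "\<Omega> (odd_inverse \<eta>) (\<Omega> \<eta> X) = X"
proof -
  obtain k Y where k: "k \<in> K" "Y \<in> a" "X = k Y" using conjugate_to_a[OF X] by blast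
  have "\<Omega> (odd_inverse \<eta>) (\<Omega> \<eta> Y) = (\<Sum>i\<in>{1..r}. odd_inverse \<eta> (\<eta> (e i Y)) *\<^sub>R h i)"
    unfolding \<Omega>_diagonal[where f=\<eta>, OF cio_odd[OF \<eta>] k(2)] by (rule \<Omega>_sum_h[where f="odd_inverse \<eta>", OF odd_inverse_odd[OF \<eta>]])
  also have "\<dots> = Y" by (simp only: odd_inverse_left[OF \<eta>] h_expand[OF k(2)])
  finally have "\<Omega> (odd_inverse \<eta>) (\<Omega> \<eta> Y) = Y" .
  moreover have "\<Omega> (odd_inverse \<eta>) (k (\<Omega> \<eta> Y)) = k (\<Omega> (odd_inverse \<eta>) (\<Omega> \<eta> Y))"
    by (rule \<Omega>_equivariant[OF k(1) \<Omega>_p[where f=\<eta>, OF cio_odd[OF \<eta>] a_p[OF k(2)]]])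
  ultimately show ?thesis by (simp add: k(3) \<Omega>_equivariant[OF k(1) a_p[OF k(2)]])
qed

lemma p_spectral_domain: "\<pp> \<subseteq> spectral_domain UNIV"
  using conjugate_to_a by (force simp: spectral_domain_def)

lemma \<Omega>_spectral_domain:
  assumes \<eta>: "continuous_injective_odd \<eta>" and X: "X \<in> \<pp>"
  shows "\<Omega> \<eta> X \<in> spectral_domain (range \<eta>)"
proof -
  obtain k Y where k: "k \<in> K" "Y \<in> a" "X = k Y" using conjugate_to_a[OF X] by blast
  let ?Z = "\<Sum>i\<in>{1..r}. \<eta> (e i Y) *\<^sub>R h i"
  have "\<Omega> \<eta> X = k ?Z"
    by (simp add: k(3) \<Omega>_equivariant[OF k(1) a_p[OF k(2)]] \<Omega>_diagonal[where f=\<eta>, OF cio_odd[OF \<eta>] k(2)])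
  moreover have "\<forall>i\<in>{1..r}. e i ?Z \<in> range \<eta>" by (intro ballI) (simp only: e_sum rangeI)
  moreover have "?Z \<in> a" by (rule sum_h_a)
  ultimately show ?thesis unfolding spectral_domain_def using k(1) by blast
qed

lemma \<Omega>_homeomorphism:
  assumes \<eta>: "continuous_injective_odd \<eta>" and C: "C \<subseteq> \<pp>" and F: "\<And>X. X \<in> C \<Longrightarrow> F X = \<Omega> \<eta> X"
  shows "homeomorphism C (\<Omega> \<eta> ` C) F (\<Omega> (odd_inverse \<eta>))"
proof -
  have 1: "continuous_on C (\<Omega> \<eta>)"
    by (rule continuous_on_subset[OF \<Omega>_continuous[of UNIV]])
       (use cio_continuous[OF \<eta>] C p_spectral_domain in auto)
  have 2: "continuous_on (\<Omega> \<eta> ` C) (\<Omega> (odd_inverse \<eta>))"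
    by (rule continuous_on_subset[OF \<Omega>_continuous[OF range_cio_domain[OF \<eta>] odd_inverse_continuous[OF \<eta>]]])
       (use \<Omega>_spectral_domain[OF \<eta>] C in auto)
  have inv: "\<Omega> (odd_inverse \<eta>) (\<Omega> \<eta> X) = X" if "X \<in> C" for X using \<Omega>_inverse[OF \<eta>] C that by blast
  show ?thesis
  proof (rule homeomorphismI)
    show "continuous_on C F" using 1 continuous_on_eq F by metis
    show "continuous_on (\<Omega> \<eta> ` C) (\<Omega> (odd_inverse \<eta>))" by (rule 2)
    show "F ` C \<subseteq> \<Omega> \<eta> ` C" by (rule image_subsetI) (simp only: F imageI)
    show "\<Omega> (odd_inverse \<eta>) ` \<Omega> \<eta> ` C \<subseteq> C" by (intro image_subsetI, erule imageE) (simp only: inv)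
    show "\<Omega> (odd_inverse \<eta>) (F X) = X" if "X \<in> C" for X by (simp only: F[OF that] inv[OF that])
    show "F (\<Omega> (odd_inverse \<eta>) Y) = Y" if "Y \<in> \<Omega> \<eta> ` C" for Y
    proof -
      obtain X where X: "X \<in> C" "Y = \<Omega> \<eta> X" using \<open>Y \<in> \<Omega> \<eta> ` C\<close> by blast
      show ?thesis unfolding X(2) inv[OF X(1)] by (rule F[OF X(1)])
    qed
  qed
qed

lemma \<Omega>_diffeomorphism:
  assumes \<eta>: "continuous_injective_odd \<eta>" and d: "diffeomorphism UNIV (range \<eta>) \<eta>"
    and C: "C \<subseteq> \<pp>" and F: "\<And>X. X \<in> C \<Longrightarrow> F X = \<Omega> \<eta> X"
  shows "diffeomorphism C (\<Omega> \<eta> ` C) F"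
proof -
  have h: "homeomorphism C (\<Omega> \<eta> ` C) F (\<Omega> (odd_inverse \<eta>))" by (rule \<Omega>_homeomorphism[OF \<eta> C F])
  have inv: "\<Omega> (odd_inverse \<eta>) (F X) = X" if "X \<in> C" for X by (rule homeomorphism_apply1[OF h that])
  have inj: "inj_on F C" by (rule inj_on_inverseI[where g="\<Omega> (odd_inverse \<eta>)"]) (rule inv)
  have im: "F ` C = \<Omega> \<eta> ` C" using h by (simp add: homeomorphism_def)
  have s1: "smooth_map_on UNIV \<eta>" and s2: "smooth_map_on (range \<eta>) (the_inv_into UNIV \<eta>)"
    using d by (auto simp: diffeomorphism_def)
  have sF: "smooth_map_on C F"
    by (rule \<Omega>_smooth[of UNIV \<eta>]) (use s1 C p_spectral_domain F in auto)
  have so: "smooth_map_on (range \<eta>) (odd_inverse \<eta>)"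
  proof -
    have i: "inj \<eta>" using \<eta> by (simp add: continuous_injective_odd_def)
    have "the_inv_into UNIV \<eta> y = odd_inverse \<eta> y" if "y \<in> range \<eta>" for y
    proof -
      obtain x where "y = \<eta> x" using \<open>y \<in> range \<eta>\<close> by blast
      then show ?thesis using odd_inverse_left[OF \<eta>] the_inv_f_f[OF i] by simp
    qed
    then show ?thesis using s2 unfolding smooth_map_on_def by (metis IntD1)
  qed
  have sI: "smooth_map_on (\<Omega> \<eta> ` C) (the_inv_into C F)"
  proof (rule \<Omega>_smooth[OF range_cio_domain[OF \<eta>] so])
    show "\<Omega> \<eta> ` C \<subseteq> spectral_domain (range \<eta>)" using \<Omega>_spectral_domain[OF \<eta>] C by blast
    show "the_inv_into C F Y = \<Omega> (odd_inverse \<eta>) Y" if Y: "Y \<in> \<Omega> \<eta> ` C" for Y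
    proof -
      obtain X where X: "X \<in> C" "Y = F X" using Y F by auto
      have "\<Omega> (odd_inverse \<eta>) Y = X" unfolding X(2) by (rule inv[OF X(1)])
      then show ?thesis using X the_inv_into_f_f[OF inj X(1)] by simp
    qed
  qed
  show ?thesis using sF sI inj im by (simp add: diffeomorphism_def bij_betw_def)
qed

text \<open>Well-definedness of the diagonal map: by injectivity of Exp every representation of the
  point describes the same \<open>X\<close>, and by equivariance each yields
  \<open>\<Omega> \<eta> X\<close>. The group \<open>L\<close> and the vectors \<open>W\<close> are
  left general so as to serve both M and N.\<close>

lemma diagonal_map_eq:
  assumes L: "L \<subseteq> K" and W: "\<And>x. (\<Sum>i\<in>{1..n}. x i *\<^sub>R W i) \<in> \<pp>"
    and f: "\<And>x. \<Omega> \<eta> (\<Sum>i\<in>{1..n}. x i *\<^sub>R W i) = (\<Sum>i\<in>{1..n}. \<eta> (x i) *\<^sub>R W i)"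
    and X: "k \<in> L" "X = k (\<Sum>i\<in>{1..n}. x i *\<^sub>R W i)"
  shows "diagonal_map br \<theta> L n W \<eta> (Exp X) = \<Omega> \<eta> X"
proof -
  have kX: "\<Omega> \<eta> (k (\<Sum>i\<in>{1..n}. x i *\<^sub>R W i)) = k (\<Sum>i\<in>{1..n}. \<eta> (x i) *\<^sub>R W i)" if "k \<in> L" for k x
    using \<Omega>_equivariant[OF _ W, of k \<eta> x] that L f by auto
  have act: "act k (Exp (\<Sum>i\<in>{1..n}. x i *\<^sub>R W i)) = Exp (k (\<Sum>i\<in>{1..n}. x i *\<^sub>R W i))" if "k \<in> L" for k x
    using act_K_Exp that L by blast
  have p: "k (\<Sum>i\<in>{1..n}. x i *\<^sub>R W i) \<in> \<pp>" if "k \<in> L" for k x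
    using K_p[OF _ W] that L by blast
  show ?thesis
    unfolding diagonal_map_def
  proof (rule the_equality)
    show "\<exists>k\<in>L. \<exists>x. Exp X = act k (Exp (\<Sum>i\<in>{1..n}. x i *\<^sub>R W i)) \<and> \<Omega> \<eta> X = k (\<Sum>i\<in>{1..n}. \<eta> (x i) *\<^sub>R W i)"
      unfolding X(2) by (intro bexI[of _ k] exI[of _ x] conjI kX[OF X(1)] act[OF X(1), symmetric] X(1))
    fix Y
    assume "\<exists>k\<in>L. \<exists>x. Exp X = act k (Exp (\<Sum>i\<in>{1..n}. x i *\<^sub>R W i)) \<and> Y = k (\<Sum>i\<in>{1..n}. \<eta> (x i) *\<^sub>R W i)"
    then obtain k' x' where k': "k' \<in> L" "Exp X = act k' (Exp (\<Sum>i\<in>{1..n}. x' i *\<^sub>R W i))"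
      "Y = k' (\<Sum>i\<in>{1..n}. \<eta> (x' i) *\<^sub>R W i)" by blast
    have "X = k' (\<Sum>i\<in>{1..n}. x' i *\<^sub>R W i)"
    proof (rule Exp_inj)
      show "X \<in> \<pp>" unfolding X(2) by (rule p[OF X(1)])
      show "k' (\<Sum>i\<in>{1..n}. x' i *\<^sub>R W i) \<in> \<pp>" by (rule p[OF k'(1)])
      show "Exp X = Exp (k' (\<Sum>i\<in>{1..n}. x' i *\<^sub>R W i))" by (simp only: k'(2) act[OF k'(1)])
    qed
    then show "Y = \<Omega> \<eta> X" by (simp only: kX[OF k'(1)] k'(3))
  qed
qed

lemma Omega_eq:
  assumes \<eta>: "continuous_injective_odd \<eta>" and X: "X \<in> \<pp>"
  shows "Omega br \<theta> a r e \<eta> (Exp X) = \<Omega> \<eta> X"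
proof -
  obtain k Y where k: "k \<in> K" "Y \<in> a" "X = k Y" using conjugate_to_a[OF X] by blast
  have "X = k (\<Sum>i\<in>{1..r}. e i Y *\<^sub>R h i)" by (simp only: h_expand[OF k(2)] k(3))
  then show ?thesis
    unfolding Omega_def
    by (rule diagonal_map_eq[OF order_refl a_p[OF sum_h_a] \<Omega>_sum_h[where f=\<eta>, OF cio_odd[OF \<eta>]] k(1)])
qed

lemma square_eq:
  assumes \<eta>: "continuous_injective_odd \<eta>"
  shows "square n W \<eta> = {\<Sum>i\<in>{1..n}. \<eta> (x i) *\<^sub>R W i |x. True}"
proof -
  have r: "ereal \<bar>y\<bar> < (SUP x. ereal (\<eta> x)) \<longleftrightarrow> y \<in> range \<eta>" for y using range_iff[OF \<eta>] by blast
  show ?thesis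
  proof
    show "square n W \<eta> \<subseteq> {\<Sum>i\<in>{1..n}. \<eta> (x i) *\<^sub>R W i |x. True}"
    proof
      fix Y assume "Y \<in> square n W \<eta>"
      then obtain y where y: "Y = (\<Sum>i\<in>{1..n}. y i *\<^sub>R W i)" "\<forall>i\<in>{1..n}. y i \<in> range \<eta>"
        unfolding square_def r by blast
      have "\<forall>i\<in>{1..n}. \<exists>x. y i = \<eta> x" using y(2) by blast
      then obtain x where "\<And>i. i \<in> {1..n} \<Longrightarrow> y i = \<eta> (x i)" by metis
      then have "Y = (\<Sum>i\<in>{1..n}. \<eta> (x i) *\<^sub>R W i)" unfolding y(1) by (intro sum.cong) auto
      then show "Y \<in> {\<Sum>i\<in>{1..n}. \<eta> (x i) *\<^sub>R W i |x. True}" by blast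
    qed
    show "{\<Sum>i\<in>{1..n}. \<eta> (x i) *\<^sub>R W i |x. True} \<subseteq> square n W \<eta>"
    proof
      fix Y assume "Y \<in> {\<Sum>i\<in>{1..n}. \<eta> (x i) *\<^sub>R W i |x. True}"
      then obtain x where x: "Y = (\<Sum>i\<in>{1..n}. \<eta> (x i) *\<^sub>R W i)" by blast
      show "Y \<in> square n W \<eta>"
        unfolding square_def r mem_Collect_eq by (intro exI[of _ "\<lambda>i. \<eta> (x i)"] conjI x ballI rangeI)
    qed
  qed
qed

lemma \<Omega>_image_a:
  assumes \<eta>: "continuous_injective_odd \<eta>"
  shows "\<Omega> \<eta> ` a = square r h \<eta>"
proof
  show "\<Omega> \<eta> ` a \<subseteq> square r h \<eta>"
  proof (rule image_subsetI)
    fix X assume X: "X \<in> a"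
    show "\<Omega> \<eta> X \<in> square r h \<eta>"
      unfolding square_eq[OF \<eta>] \<Omega>_diagonal[where f=\<eta>, OF cio_odd[OF \<eta>] X] mem_Collect_eq
      by (intro exI[of _ "\<lambda>i. e i X"] conjI refl TrueI)
  qed
  show "square r h \<eta> \<subseteq> \<Omega> \<eta> ` a"
  proof
    fix Y assume "Y \<in> square r h \<eta>"
    then obtain x where "Y = (\<Sum>i\<in>{1..r}. \<eta> (x i) *\<^sub>R h i)" unfolding square_eq[OF \<eta>] by blast
    then have "Y = \<Omega> \<eta> (\<Sum>i\<in>{1..r}. x i *\<^sub>R h i)" by (simp only: \<Omega>_sum_h[where f=\<eta>, OF cio_odd[OF \<eta>]])
    then show "Y \<in> \<Omega> \<eta> ` a" by (rule image_eqI[OF _ sum_h_a])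
  qed
qed

lemma \<Omega>_image_p:
  assumes \<eta>: "continuous_injective_odd \<eta>"
  shows "\<Omega> \<eta> ` \<pp> = D_domain br \<theta> a r e \<eta>"
  unfolding D_domain_def \<Omega>_image_a[OF \<eta>, symmetric]
proof (intro equalityI subsetI)
  fix Y assume "Y \<in> \<Omega> \<eta> ` \<pp>"
  then obtain X where X: "X \<in> \<pp>" "Y = \<Omega> \<eta> X" by blast
  obtain k Z where k: "k \<in> K" "Z \<in> a" "X = k Z" using conjugate_to_a[OF X(1)] by blast
  then have "Y = k (\<Omega> \<eta> Z)" using X(2) \<Omega>_equivariant[OF k(1) a_p[OF k(2)]] by simp
  then show "Y \<in> (\<Union>k\<in>K. k ` \<Omega> \<eta> ` a)" using k by blast
next
  fix Y assume "Y \<in> (\<Union>k\<in>K. k ` \<Omega> \<eta> ` a)"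
  then obtain k Z where k: "k \<in> K" "Z \<in> a" "Y = k (\<Omega> \<eta> Z)" by blast
  then have "Y = \<Omega> \<eta> (k Z)" using \<Omega>_equivariant[OF k(1) a_p[OF k(2)]] by simp
  then show "Y \<in> \<Omega> \<eta> ` \<pp>" using K_p[OF k(1) a_p[OF k(2)]] by blast
qed

lemma chart_image_Exp: "C \<subseteq> \<pp> \<Longrightarrow> chart_image br \<theta> (Exp ` C) = C"
  unfolding chart_image_def using Exp_inj by blast

lemma homeomorphic_map:
  assumes \<eta>: "continuous_injective_odd \<eta>" and C: "C \<subseteq> \<pp>" and F: "\<And>X. X \<in> C \<Longrightarrow> F (Exp X) = \<Omega> \<eta> X"
  shows "homeomorphic_map_from_M br \<theta> (Exp ` C) (\<Omega> \<eta> ` C) F"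
    and "diffeomorphism UNIV (range \<eta>) \<eta> \<Longrightarrow> diffeomorphic_map_from_M br \<theta> (Exp ` C) (\<Omega> \<eta> ` C) F"
proof -
  have F': "X \<in> C \<Longrightarrow> (F \<circ> Exp) X = \<Omega> \<eta> X" for X using F by simp
  show "homeomorphic_map_from_M br \<theta> (Exp ` C) (\<Omega> \<eta> ` C) F"
    unfolding homeomorphic_map_from_M_def chart_image_Exp[OF C]
    by (rule exI, rule \<Omega>_homeomorphism[OF \<eta> C F'])
  show "diffeomorphic_map_from_M br \<theta> (Exp ` C) (\<Omega> \<eta> ` C) F" if "diffeomorphism UNIV (range \<eta>) \<eta>"
    unfolding diffeomorphic_map_from_M_def chart_image_Exp[OF C]
    by (rule \<Omega>_diffeomorphism[OF \<eta> that C F'])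
qed

section \<open>Complexified flats and closure under triple products\<close>

lemma br_\<zeta>_a_orth: "X \<in> a \<Longrightarrow> Y \<in> a \<Longrightarrow> ip (br \<zeta> X) Y = 0"
proof -
  assume X: "X \<in> a" and Y: "Y \<in> a"
  have "ip (br X \<zeta>) Y = ip \<zeta> (br X Y)" using self_adjoint_p[OF a_p[OF X]] unfolding self_adjoint_def by blast
  also have "\<dots> = 0" by (simp only: a_abelian[OF X Y] ip_simps)
  finally show "ip (br \<zeta> X) Y = 0" by (simp only: br_anti[of \<zeta> X] ip_simps)
qed

definition triple :: "'g \<Rightarrow> 'g \<Rightarrow> 'g \<Rightarrow> 'g" where
  "triple X Y Z = (\<Sum>i\<in>{1..r}. (e i X * e i Y * e i Z) *\<^sub>R h i)"

text \<open>Write J for ad \<zeta>. In the converse direction, brackets of two elements of b + J b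
  are combinations of brackets [J X, Y] with X, Y in b. These lie in the k-part, whose adjoint
  action commutes with J, so every triple bracket reduces to \<open>triple_product\<close>.\<close>

lemma complexification_triple:
  assumes b: "subspace b" "b \<subseteq> a"
  shows "has_lts_complexification br \<zeta> b \<longleftrightarrow> (\<forall>X\<in>b. \<forall>Y\<in>b. \<forall>Z\<in>b. triple X Y Z \<in> b)"
proof
  let ?C = "complexification br \<zeta> b"
  have mem: "X + br \<zeta> Y \<in> ?C" if "X \<in> b" "Y \<in> b" for X Y using that unfolding complexification_def by blast
  have mem1: "X \<in> ?C" if "X \<in> b" for X
    using mem[OF that subspace_0[OF b(1)]] by (simp only: br_simps add_0_right)
  have mem2: "br \<zeta> X \<in> ?C" if "X \<in> b" for X
    using mem[OF subspace_0[OF b(1)] that] by (simp only: add_0_left)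
  assume lc: "has_lts_complexification br \<zeta> b"
  show "\<forall>X\<in>b. \<forall>Y\<in>b. \<forall>Z\<in>b. triple X Y Z \<in> b"
  proof (intro ballI)
    fix X Y Z assume XYZ: "X \<in> b" "Y \<in> b" "Z \<in> b"
    then have a: "X \<in> a" "Y \<in> a" "Z \<in> a" using b(2) by auto
    have "br (br (br \<zeta> X) Y) Z \<in> ?C"
      using lc mem2[OF XYZ(1)] mem1[OF XYZ(2)] mem1[OF XYZ(3)]
      unfolding has_lts_complexification_def lie_triple_system_def by blast
    then have "4 *\<^sub>R br \<zeta> (triple X Y Z) \<in> ?C"
      using triple_product[OF a] by (simp add: triple_def)
    then obtain U W where UW: "U \<in> b" "W \<in> b" "4 *\<^sub>R br \<zeta> (triple X Y Z) = U + br \<zeta> W"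
      by (auto simp: complexification_def)
    \<comment> \<open>The component \<open>U\<close> equals J P with P in \<open>a\<close>; since J
      a is orthogonal to \<open>a\<close>, it vanishes, and injectivity of J on the p-part
      identifies the triple product with W/4.\<close>
    define P where "P = 4 *\<^sub>R triple X Y Z - W"
    have Pa: "P \<in> a"
      unfolding P_def triple_def using UW(2) b(2)
      by (intro subspace_diff[OF a_subspace] subspace_scale[OF a_subspace] sum_h_a) auto
    have PU: "br \<zeta> P = U" using UW(3) by (simp add: P_def br_simps)
    have "ip U U = 0" using br_\<zeta>_a_orth[OF Pa, of U] UW(1) b(2) PU by auto
    then have "br \<zeta> P = 0" using PU by (simp add: ip_eq_0_iff)
    then have "P = 0" using br_\<zeta>_\<zeta>[OF a_p[OF Pa]] by (simp add: br_simps)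
    then have "(1 / 4) *\<^sub>R W = (1 / 4) *\<^sub>R (4 *\<^sub>R triple X Y Z)" by (simp add: P_def)
    then have "(1 / 4) *\<^sub>R W = triple X Y Z" by simp
    then show "triple X Y Z \<in> b" using subspace_scale[OF b(1) UW(2), of "1 / 4"] by simp
  qed
next
  let ?C = "complexification br \<zeta> b"
  assume t: "\<forall>X\<in>b. \<forall>Y\<in>b. \<forall>Z\<in>b. triple X Y Z \<in> b"
  have ba: "X \<in> a" if "X \<in> b" for X using that b(2) by blast
  have bp: "X \<in> \<pp>" if "X \<in> b" for X using a_p[OF ba[OF that]] .
  have "?C = (\<lambda>(X, Y). X + br \<zeta> Y) ` (b \<times> b)" by (auto simp: complexification_def)
  moreover have "linear (\<lambda>(X, Y). X + br \<zeta> Y)"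
    by (rule linearI) (auto simp: br_simps algebra_simps)
  ultimately have sC: "subspace ?C"
    using linear_subspace_image[OF _ subspace_Times[OF b(1) b(1)]] by metis
  have mem: "X + br \<zeta> Y \<in> ?C" if "X \<in> b" "Y \<in> b" for X Y using that unfolding complexification_def by blast
  have mem1: "X \<in> ?C" if "X \<in> b" for X
    using mem[OF that subspace_0[OF b(1)]] by (simp only: br_simps add_0_right)
  have mem2: "br \<zeta> X \<in> ?C" if "X \<in> b" for X
    using mem[OF subspace_0[OF b(1)] that] by (simp only: add_0_left)
  have J: "br \<zeta> U \<in> ?C" if "U \<in> ?C" for U
  proof -
    obtain X Y where XY: "X \<in> b" "Y \<in> b" "U = X + br \<zeta> Y" using \<open>U \<in> ?C\<close> by (auto simp: complexification_def)
    have "br \<zeta> U = (- Y) + br \<zeta> X" using br_\<zeta>_\<zeta>[OF bp[OF XY(2)]] XY(3) by (simp add: br_simps)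
    then show ?thesis using mem[OF subspace_neg[OF b(1) XY(2)] XY(1)] by simp
  qed
  have t4: "br (br (br \<zeta> X) Y) Z \<in> ?C" if "X \<in> b" "Y \<in> b" "Z \<in> b" for X Y Z
  proof -
    have "4 *\<^sub>R triple X Y Z \<in> b" using t that subspace_scale[OF b(1)] by blast
    then have "br \<zeta> (4 *\<^sub>R triple X Y Z) \<in> ?C" by (rule mem2)
    then show ?thesis using triple_product[OF ba[OF that(1)] ba[OF that(2)] ba[OF that(3)]] by (simp add: triple_def)
  qed
  have k1: "br (br \<zeta> X) Y \<in> \<kk>" if "X \<in> b" "Y \<in> b" for X Y
    by (rule br_pp[OF br_kp[OF \<zeta>_k bp[OF that(1)]] bp[OF that(2)]])
  have t5: "br (br (br \<zeta> X) Y) U \<in> ?C" if XY: "X \<in> b" "Y \<in> b" and U: "U \<in> ?C" for X Y U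
  proof -
    obtain Z Z' where Z: "Z \<in> b" "Z' \<in> b" "U = Z + br \<zeta> Z'" using U by (auto simp: complexification_def)
    let ?A = "br (br \<zeta> X) Y"
    have "br ?A (br \<zeta> Z') = br \<zeta> (br ?A Z')"
    proof -
      have "br \<zeta> (br ?A Z') = br (br \<zeta> ?A) Z' + br ?A (br \<zeta> Z')" by (rule jacobi)
      then show ?thesis using br_\<zeta>_k[OF k1[OF XY]] by (simp add: br_simps)
    qed
    then have "br ?A U = br ?A Z + br \<zeta> (br ?A Z')" by (simp add: Z(3) br_simps)
    then show ?thesis using subspace_add[OF sC t4[OF XY Z(1)] J[OF t4[OF XY Z(2)]]] by simp
  qed
  have bracket: "br (br U U') W \<in> ?C" if U: "U \<in> ?C" and U': "U' \<in> ?C" and W: "W \<in> ?C" for U U' W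
  proof -
    obtain X Y where X: "X \<in> b" "Y \<in> b" "U = X + br \<zeta> Y" using U by (auto simp: complexification_def)
    obtain X' Y' where X': "X' \<in> b" "Y' \<in> b" "U' = X' + br \<zeta> Y'" using U' by (auto simp: complexification_def)
    \<comment> \<open>J is an automorphism for brackets of the p-part, so [J Y, J Y'] = [Y, Y'] = 0;
      the equation comes from applying ad \<zeta> to [Y, J Y'], an element of the k-part.\<close>
    have JJ: "br (br \<zeta> Y) (br \<zeta> Y') = 0"
    proof -
      have "br \<zeta> (br Y (br \<zeta> Y')) = 0"
        by (rule br_\<zeta>_k[OF br_pp[OF bp[OF X(2)] br_kp[OF \<zeta>_k bp[OF X'(2)]]]])
      then have "br (br \<zeta> Y) (br \<zeta> Y') + br Y (br \<zeta> (br \<zeta> Y')) = 0" by (simp add: jacobi[of \<zeta> Y])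
      then show ?thesis
        using br_\<zeta>_\<zeta>[OF bp[OF X'(2)]] a_abelian[OF ba[OF X(2)] ba[OF X'(2)]] by (simp add: br_simps)
    qed
    have "br U U' = br (br \<zeta> Y) X' - br (br \<zeta> Y') X"
      using JJ a_abelian[OF ba[OF X(1)] ba[OF X'(1)]] br_anti[of X "br \<zeta> Y'"]
      by (simp add: X(3) X'(3) br_simps)
    then have "br (br U U') W = br (br (br \<zeta> Y) X') W - br (br (br \<zeta> Y') X) W" by (simp add: br_simps)
    then show ?thesis using subspace_diff[OF sC t5[OF X(2) X'(1) W] t5[OF X'(2) X(1) W]] by simp
  qed
  show "has_lts_complexification br \<zeta> b"
    unfolding has_lts_complexification_def lie_triple_system_def using sC bracket J by blast
qed

end

section \<open>Totally geodesic submanifolds with complexifiable flats\<close>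

locale framed_submanifold = framed br \<theta> \<zeta> a r e + totally_geodesic br \<theta> N
  for br :: "'g::euclidean_space \<Rightarrow> 'g \<Rightarrow> 'g" and \<theta> :: "'g \<Rightarrow> 'g" and \<zeta> :: 'g
    and a :: "'g set" and r :: nat and e :: "nat \<Rightarrow> 'g \<Rightarrow> real" and N :: "('g \<Rightarrow> 'g) set set" +
  fixes a\<^sub>N :: "'g set" and r\<^sub>N :: nat and idx :: "nat \<Rightarrow> nat" and V :: "nat \<Rightarrow> 'g"
  assumes aN_max: "maximal_abelian br q a\<^sub>N" and aN_a: "a\<^sub>N \<subseteq> a"
    and basis: "canonical_basis br a r e a\<^sub>N r\<^sub>N idx V"
begin

lemma aN_subspace: "subspace a\<^sub>N" and aN_q: "a\<^sub>N \<subseteq> q"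
  using aN_max by (auto simp: maximal_abelian_def)

abbreviation "IN \<equiv> {1..r\<^sub>N}"

lemma idx_inj: "m \<in> IN \<Longrightarrow> l \<in> IN \<Longrightarrow> idx m = idx l \<longleftrightarrow> m = l"
  using basis strict_mono_on_imp_inj_on[of IN idx] unfolding canonical_basis_def inj_on_def by blast

lemma idx_range: "m \<in> IN \<Longrightarrow> idx m \<in> {1..r}"
  using basis unfolding canonical_basis_def by blast

lemma span_V: "span (V ` IN) = a\<^sub>N"
  using basis unfolding canonical_basis_def by blast

lemma V_aN: "m \<in> IN \<Longrightarrow> V m \<in> a\<^sub>N"
  using span_base[of "V m" "V ` IN"] span_V by auto

text \<open>The correction sums of the canonical basis avoid the indices \<open>idx l\<close>, so
  the forms \<open>e (idx l)\<close> are the coordinates belonging to \<open>V\<close>.\<close>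

lemma e_V:
  assumes l: "l \<in> IN" and m: "m \<in> IN"
  shows "e (idx l) (V m) = (if l = m then 1 else 0)"
proof -
  obtain c :: "nat \<Rightarrow> nat \<Rightarrow> real" where c: "\<forall>m\<in>IN. V m = h (idx m) + (\<Sum>i\<in>{1..r} - idx ` IN. c m i *\<^sub>R h i)"
    using basis unfolding canonical_basis_def by blast
  have le: "linear (e (idx l))" by (rule e_linear[OF idx_range[OF l]])
  have "e (idx l) (\<Sum>i\<in>{1..r} - idx ` IN. c m i *\<^sub>R h i) = (\<Sum>i\<in>{1..r} - idx ` IN. c m i * e (idx l) (h i))"
    by (simp add: linear_sum[OF le] linear_scale[OF le])
  also have "\<dots> = 0"
  proof (rule sum.neutral, rule ballI)
    fix i assume i: "i \<in> {1..r} - idx ` IN"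
    then have "idx l \<noteq> i" using l by auto
    then show "c m i * e (idx l) (h i) = 0" using e_h[OF idx_range[OF l], of i] i by simp
  qed
  finally have "e (idx l) (V m) = e (idx l) (h (idx m))"
    using bspec[OF c m] by (simp add: linear_add[OF le])
  then show ?thesis using e_h[OF idx_range[OF l] idx_range[OF m]] idx_inj[OF l m] by simp
qed

lemma V_expand:
  assumes X: "X \<in> a\<^sub>N"
  shows "(\<Sum>m\<in>IN. e (idx m) X *\<^sub>R V m) = X"
proof -
  have lin: "linear (\<lambda>X. \<Sum>m\<in>IN. e (idx m) X *\<^sub>R V m)"
    by (rule linearI)
       (simp_all add: linear_add[OF e_linear[OF idx_range]] linear_scale[OF e_linear[OF idx_range]]
         scaleR_add_left sum.distrib scaleR_sum_right)
  have "(\<Sum>m\<in>IN. e (idx m) Y *\<^sub>R V m) = id Y" if "Y \<in> V ` IN" for Y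
  proof -
    obtain l where l: "l \<in> IN" "Y = V l" using \<open>Y \<in> V ` IN\<close> by blast
    have "(\<Sum>m\<in>IN. e (idx m) Y *\<^sub>R V m) = (\<Sum>m\<in>IN. if m = l then V m else 0)"
      unfolding l(2) using e_V[OF _ l(1)] by (intro sum.cong) auto
    then show ?thesis using l by simp
  qed
  moreover have "X \<in> span (V ` IN)" using X by (simp only: span_V)
  ultimately have "(\<Sum>m\<in>IN. e (idx m) X *\<^sub>R V m) = id X" by (rule linear_eq_on_span[OF lin linear_id])
  then show ?thesis by (simp only: id_apply)
qed

lemma sum_V_aN: "(\<Sum>m\<in>IN. x m *\<^sub>R V m) \<in> a\<^sub>N"
  by (rule subspace_sum[OF aN_subspace]) (simp add: subspace_scale[OF aN_subspace V_aN])

lemma e_sum_V: "i \<in> {1..r} \<Longrightarrow> e i (\<Sum>m\<in>IN. x m *\<^sub>R V m) = (\<Sum>m\<in>IN. x m * e i (V m))"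
  by (simp add: linear_sum[OF e_linear] linear_scale[OF e_linear])

lemma e_triple: "i \<in> {1..r} \<Longrightarrow> e i (triple X Y Z) = e i X * e i Y * e i Z"
  unfolding triple_def by (rule e_sum)


lemma \<Omega>_image_sub:
  assumes \<eta>: "continuous_injective_odd \<eta>" and f: "\<And>x. \<Omega> \<eta> (\<Sum>m\<in>IN. x m *\<^sub>R V m) = (\<Sum>m\<in>IN. \<eta> (x m) *\<^sub>R V m)"
  shows "\<Omega> \<eta> ` a\<^sub>N = square r\<^sub>N V \<eta>"
proof
  show "\<Omega> \<eta> ` a\<^sub>N \<subseteq> square r\<^sub>N V \<eta>"
  proof (rule image_subsetI)
    fix X assume X: "X \<in> a\<^sub>N"
    have "\<Omega> \<eta> X = (\<Sum>m\<in>IN. \<eta> (e (idx m) X) *\<^sub>R V m)"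
      using f[of "\<lambda>m. e (idx m) X"] by (simp only: V_expand[OF X])
    then show "\<Omega> \<eta> X \<in> square r\<^sub>N V \<eta>"
      unfolding square_eq[OF \<eta>] mem_Collect_eq by (intro exI[of _ "\<lambda>m. e (idx m) X"] conjI TrueI)
  qed
  show "square r\<^sub>N V \<eta> \<subseteq> \<Omega> \<eta> ` a\<^sub>N"
  proof
    fix Y assume "Y \<in> square r\<^sub>N V \<eta>"
    then obtain x where "Y = (\<Sum>m\<in>IN. \<eta> (x m) *\<^sub>R V m)" unfolding square_eq[OF \<eta>] by blast
    then have "Y = \<Omega> \<eta> (\<Sum>m\<in>IN. x m *\<^sub>R V m)" by (simp only: f)
    then show "Y \<in> \<Omega> \<eta> ` a\<^sub>N" by (rule image_eqI[OF _ sum_V_aN])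
  qed
qed

section \<open>The Lie algebra g_N and the isotropy group K_N\<close>

lemma g_sub_eq: "g_sub br \<theta> N = {A + U |A U. A \<in> lts_k q \<and> U \<in> q}"
  by (simp only: g_sub_def lts_k_def)

lemma lts_k_g_sub: "lts_k q \<subseteq> g_sub br \<theta> N" and q_g_sub: "q \<subseteq> g_sub br \<theta> N"
  unfolding g_sub_eq using subspace_0[OF lts_k_subspace[of q]] subspace_0[OF q_subspace] by force+

lemma subspace_g_sub: "subspace (g_sub br \<theta> N)"
proof -
  have "g_sub br \<theta> N = {x + y |x y. x \<in> lts_k q \<and> y \<in> q}" by (rule g_sub_eq)
  then show ?thesis using subspace_sums[OF lts_k_subspace q_subspace] by simp
qed

lemma br_lts_k_lts_k:
  assumes A: "A \<in> lts_k q" and D: "D \<in> lts_k q"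
  shows "br A D \<in> lts_k q"
  using D
proof (rule lts_k_induct)
  have "linear (br A)" by (rule ad_linear)
  then show "subspace {D. br A D \<in> lts_k q}"
    using linear_subspace_vimage[OF _ lts_k_subspace, of "br A" q] by (simp add: vimage_def)
  fix U W assume U: "U \<in> q" and W: "W \<in> q"
  have "br A (br U W) = br (br A U) W + br U (br A W)" by (rule jacobi)
  also have "\<dots> \<in> lts_k q"
    by (intro subspace_add[OF lts_k_subspace] br_in_lts_k br_lts_k[OF lts_q A] U W)
  finally show "br A (br U W) \<in> lts_k q" .
qed

lemma br_g_sub:
  assumes X: "X \<in> g_sub br \<theta> N" and Y: "Y \<in> g_sub br \<theta> N"
  shows "br X Y \<in> g_sub br \<theta> N"
proof -
  obtain A U where A: "A \<in> lts_k q" "U \<in> q" "X = A + U" using X unfolding g_sub_eq by blast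
  obtain D W where D: "D \<in> lts_k q" "W \<in> q" "Y = D + W" using Y unfolding g_sub_eq by blast
  have "br X Y = (br A D + br U W) + (br A W - br D U)"
    using br_anti[of U D] by (simp add: A(3) D(3) br_simps)
  moreover have "br A D + br U W \<in> lts_k q"
    by (intro subspace_add[OF lts_k_subspace] br_in_lts_k br_lts_k_lts_k A D)
  moreover have "br A W - br D U \<in> q"
    by (intro subspace_diff[OF q_subspace] br_lts_k[OF lts_q] A D)
  ultimately show ?thesis unfolding g_sub_eq by blast
qed

lemma g_sub_p: "X \<in> g_sub br \<theta> N \<Longrightarrow> X \<in> \<pp> \<Longrightarrow> X \<in> q"
proof -
  assume X: "X \<in> g_sub br \<theta> N" "X \<in> \<pp>"
  obtain A U where A: "A \<in> lts_k q" "U \<in> q" "X = A + U" using X(1) unfolding g_sub_eq by blast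
  have "A \<in> \<kk>" using A(1) lts_k_sub_k[OF q_sub_p] by blast
  moreover have "A = X - U" using A(3) by simp
  then have "A \<in> \<pp>" using subspace_diff[OF subspace_p X(2)] A(2) q_sub_p by blast
  ultimately have "A = - A" by (simp add: k_part_def p_part_def)
  then have "A = 0" by (simp add: eq_neg_iff_add_eq_0 flip: scaleR_2)
  then show "X \<in> q" using A by simp
qed

lemma K_sub_K: "K_sub br \<theta> N \<subseteq> K"
  using act_K_imp by (auto simp: K_sub_def origin_def)

text \<open>An element of K_N is a product of exponentials from all of g_N, not just from [q, q].
  Invariance of \<open>q\<close> therefore comes from that of g_N and of the p-part, whose
  intersection is \<open>q\<close>.\<close>

lemma K_sub_q: "k \<in> K_sub br \<theta> N \<Longrightarrow> X \<in> q \<Longrightarrow> k X \<in> q"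
proof -
  assume k: "k \<in> K_sub br \<theta> N" and X: "X \<in> q"
  have kg: "k \<in> adjoint_group br (g_sub br \<theta> N)" using k by (simp add: K_sub_def)
  have "k X \<in> g_sub br \<theta> N"
    by (rule adjoint_group_invariant[OF subspace_g_sub br_g_sub kg]) (use X q_g_sub in auto)
  moreover have "k X \<in> \<pp>" using K_p K_sub_K k X q_sub_p by blast
  ultimately show "k X \<in> q" by (rule g_sub_p)
qed

lemma adjoint_group_K_sub: "k \<in> adjoint_group br (lts_k q) \<Longrightarrow> k \<in> K_sub br \<theta> N"
  using adjoint_group_mono[OF lts_k_g_sub] act_K[OF adjoint_group_k[OF lts_k_sub_k[OF q_sub_p]]]
  by (simp add: K_sub_def origin_def)

lemma conjugate_to_aN:
  assumes X: "X \<in> q"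
  obtains k Y where "k \<in> K_sub br \<theta> N" "Y \<in> a\<^sub>N" "X = k Y"
proof -
  obtain g where g: "g \<in> adjoint_group br (lts_k q)" "g X \<in> a\<^sub>N"
    using lts_conjugate[OF lts_q aN_max X] by blast
  have "inv g \<in> adjoint_group br (lts_k q)"
    by (rule adjoint_group_inv[OF subspace_neg[OF lts_k_subspace] g(1)])
  then have "inv g \<in> K_sub br \<theta> N" by (rule adjoint_group_K_sub)
  moreover have "X = inv g (g X)" using automorphism_inv1[OF adjoint_group_automorphism[OF g(1)]] by simp
  ultimately show ?thesis using that g(2) by blast
qed

lemma \<Omega>_image_q:
  assumes "\<Omega> \<eta> ` a\<^sub>N = square r\<^sub>N V \<eta>"
  shows "\<Omega> \<eta> ` q = D_domain_sub br \<theta> N r\<^sub>N V \<eta>"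
  unfolding D_domain_sub_def assms[symmetric]
proof (intro equalityI subsetI)
  have eq: "\<Omega> \<eta> (k Z) = k (\<Omega> \<eta> Z)" if "k \<in> K_sub br \<theta> N" "Z \<in> a\<^sub>N" for k Z
    by (rule \<Omega>_equivariant) (use that K_sub_K aN_q q_sub_p in auto)
  {
    fix Y assume "Y \<in> \<Omega> \<eta> ` q"
    then obtain X where X: "X \<in> q" "Y = \<Omega> \<eta> X" by blast
    obtain k Z where k: "k \<in> K_sub br \<theta> N" "Z \<in> a\<^sub>N" "X = k Z" by (rule conjugate_to_aN[OF X(1)])
    then have "Y = k (\<Omega> \<eta> Z)" using X(2) eq by simp
    then show "Y \<in> (\<Union>k\<in>K_sub br \<theta> N. k ` \<Omega> \<eta> ` a\<^sub>N)" using k by blast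
  next
    fix Y assume "Y \<in> (\<Union>k\<in>K_sub br \<theta> N. k ` \<Omega> \<eta> ` a\<^sub>N)"
    then obtain k Z where k: "k \<in> K_sub br \<theta> N" "Z \<in> a\<^sub>N" "Y = k (\<Omega> \<eta> Z)" by blast
    then have "Y = \<Omega> \<eta> (k Z)" using eq by simp
    then show "Y \<in> \<Omega> \<eta> ` q" using K_sub_q[OF k(1)] k(2) aN_q by blast
  }
qed

lemma Omega_sub_eq:
  assumes \<eta>: "\<And>x. \<Omega> \<eta> (\<Sum>m\<in>IN. x m *\<^sub>R V m) = (\<Sum>m\<in>IN. \<eta> (x m) *\<^sub>R V m)" and X: "X \<in> q"
  shows "Omega_sub br \<theta> N r\<^sub>N V \<eta> (Exp X) = \<Omega> \<eta> X"
proof -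
  obtain k Y where k: "k \<in> K_sub br \<theta> N" "Y \<in> a\<^sub>N" "X = k Y" by (rule conjugate_to_aN[OF X])
  have "X = k (\<Sum>m\<in>IN. e (idx m) Y *\<^sub>R V m)" by (simp only: V_expand[OF k(2)] k(3))
  then show ?thesis
    unfolding Omega_sub_def by (rule diagonal_map_eq[OF K_sub_K a_p[OF subsetD[OF aN_a sum_V_aN]] \<eta> k(1)])
qed

text \<open>Closure under triple products forces the basis vectors \<open>V m\<close> to have coefficients in
  \<open>{-1, 0, 1}\<close> and pairwise disjoint supports: compare \<open>V m\<^sup>3\<close> and \<open>V m V l\<^sup>2\<close> with the canonical basis.\<close>

context
  assumes complexifiable: "has_lts_complexification br \<zeta> a\<^sub>N"
begin

lemma triple_aN: "X \<in> a\<^sub>N \<Longrightarrow> Y \<in> a\<^sub>N \<Longrightarrow> Z \<in> a\<^sub>N \<Longrightarrow> triple X Y Z \<in> a\<^sub>N"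
  using complexifiable complexification_triple[OF aN_subspace aN_a] by blast

lemma V_coefficients:
  assumes i: "i \<in> {1..r}" and m: "m \<in> IN"
  shows "e i (V m) \<in> {-1, 0, 1}"
proof -
  let ?T = "triple (V m) (V m) (V m)"
  have T: "?T \<in> a\<^sub>N" using triple_aN V_aN[OF m] by blast
  have "?T = (\<Sum>l\<in>IN. e (idx l) ?T *\<^sub>R V l)" by (rule V_expand[OF T, symmetric])
  also have "\<dots> = (\<Sum>l\<in>IN. if l = m then V l else 0)"
    by (rule sum.cong) (simp_all only: e_triple[OF idx_range] e_V[OF _ m], simp_all)
  also have "\<dots> = V m" using m by simp
  finally have "e i (V m) * e i (V m) * e i (V m) = e i (V m)" using e_triple[OF i] by metis
  then have "e i (V m) = 0 \<or> e i (V m) * e i (V m) = 1" by (cases "e i (V m) = 0") auto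
  then show ?thesis by (auto simp: square_eq_1_iff)
qed

lemma V_disjoint:
  assumes i: "i \<in> {1..r}" and m: "m \<in> IN" and l: "l \<in> IN" and ml: "m \<noteq> l"
  shows "e i (V m) = 0 \<or> e i (V l) = 0"
proof -
  let ?T = "triple (V m) (V l) (V l)"
  have T: "?T \<in> a\<^sub>N" using triple_aN V_aN[OF m] V_aN[OF l] by blast
  have "?T = (\<Sum>n\<in>IN. e (idx n) ?T *\<^sub>R V n)" by (rule V_expand[OF T, symmetric])
  also have "\<dots> = 0"
  proof (rule sum.neutral, rule ballI)
    fix n assume "n \<in> IN"
    then show "e (idx n) ?T *\<^sub>R V n = 0" using ml by (simp only: e_triple[OF idx_range] e_V[OF _ m] e_V[OF _ l]) simp
  qed
  finally have "e i (V m) * e i (V l) * e i (V l) = 0"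
    using e_triple[OF i] linear_0[OF e_linear[OF i]] by metis
  then show ?thesis by auto
qed

text \<open>At the coordinate \<open>i\<close> at most one basis vector is nonzero, with coefficient
  1 or -1, so both sums have at most one term and an odd function passes through the sign.\<close>

lemma odd_sum_V:
  assumes f: "\<And>x::real. f (- x) = - (f x :: real)" and i: "i \<in> {1..r}"
  shows "f (\<Sum>m\<in>IN. x m * e i (V m)) = (\<Sum>m\<in>IN. f (x m) * e i (V m))"
proof (cases "\<exists>l\<in>IN. e i (V l) \<noteq> 0")
  case True
  then obtain l where l: "l \<in> IN" "e i (V l) \<noteq> 0" by blast
  have only: "(\<Sum>m\<in>IN. y m * e i (V m)) = y l * e i (V l)" for y
  proof -
    have "(\<Sum>m\<in>IN. y m * e i (V m)) = (\<Sum>m\<in>IN. if m = l then y l * e i (V l) else 0)"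
    proof (rule sum.cong[OF refl])
      fix m assume m: "m \<in> IN"
      show "y m * e i (V m) = (if m = l then y l * e i (V l) else 0)"
      proof (cases "m = l")
        case False
        then have "e i (V m) = 0" using V_disjoint[OF i m l(1)] l(2) by blast
        then show ?thesis using False by (simp only: mult_zero_right if_False)
      qed simp
    qed
    also have "\<dots> = y l * e i (V l)" by (subst sum.delta) (use l(1) in \<open>simp_all del: atLeastAtMost_iff\<close>)
    finally show ?thesis .
  qed
  have "e i (V l) = 1 \<or> e i (V l) = - 1" using V_coefficients[OF i l(1)] l(2) by blast
  then have "f (x l * e i (V l)) = f (x l) * e i (V l)" by (elim disjE) (simp_all add: f)
  then show ?thesis by (simp only: only)
next
  case False
  then have z: "(\<Sum>m\<in>IN. y m * e i (V m)) = 0" for y by (intro sum.neutral) auto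
  have f0: "f 0 = 0" using f[of 0] by simp
  show ?thesis unfolding z[of x] z[of "\<lambda>m. f (x m)"] by (rule f0)
qed

lemma \<Omega>_sum_V:
  assumes f: "\<And>x. f (- x) = - f x"
  shows "\<Omega> f (\<Sum>m\<in>IN. x m *\<^sub>R V m) = (\<Sum>m\<in>IN. f (x m) *\<^sub>R V m)"
proof -
  let ?X = "\<Sum>m\<in>IN. x m *\<^sub>R V m" and ?Y = "\<Sum>m\<in>IN. f (x m) *\<^sub>R V m"
  have X: "?X \<in> a" and Y: "?Y \<in> a" by (rule subsetD[OF aN_a sum_V_aN])+
  have "\<Omega> f ?X = (\<Sum>i\<in>{1..r}. f (e i ?X) *\<^sub>R h i)" by (rule \<Omega>_diagonal[where f=f, OF f X])
  also have "\<dots> = (\<Sum>i\<in>{1..r}. e i ?Y *\<^sub>R h i)"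
    by (rule sum.cong[OF refl]) (simp only: e_sum_V odd_sum_V[where f=f, OF f])
  also have "\<dots> = ?Y" by (rule h_expand[OF Y])
  finally show ?thesis .
qed

lemma realization:
  assumes \<eta>: "continuous_injective_odd \<eta>"
  shows
    "(\<forall>p\<in>N. Omega br \<theta> a r e \<eta> p = Omega_sub br \<theta> N r\<^sub>N V \<eta> p) \<and>
     N \<subseteq> sym_space br \<theta> \<and> Exp ` a\<^sub>N \<subseteq> Exp ` a \<and> Exp ` a \<subseteq> sym_space br \<theta> \<and> Exp ` a\<^sub>N \<subseteq> N \<and>
     D_domain_sub br \<theta> N r\<^sub>N V \<eta> \<subseteq> D_domain br \<theta> a r e \<eta> \<and>
     square r\<^sub>N V \<eta> \<subseteq> square r h \<eta> \<and>
     square r h \<eta> \<subseteq> D_domain br \<theta> a r e \<eta> \<and>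
     square r\<^sub>N V \<eta> \<subseteq> D_domain_sub br \<theta> N r\<^sub>N V \<eta> \<and>
     homeomorphic_map_from_M br \<theta> (sym_space br \<theta>) (D_domain br \<theta> a r e \<eta>) (Omega br \<theta> a r e \<eta>) \<and>
     homeomorphic_map_from_M br \<theta> (Exp ` a) (square r h \<eta>) (Omega br \<theta> a r e \<eta>) \<and>
     homeomorphic_map_from_M br \<theta> N (D_domain_sub br \<theta> N r\<^sub>N V \<eta>) (Omega_sub br \<theta> N r\<^sub>N V \<eta>) \<and>
     homeomorphic_map_from_M br \<theta> (Exp ` a\<^sub>N) (square r\<^sub>N V \<eta>) (Omega_sub br \<theta> N r\<^sub>N V \<eta>) \<and>
     (diffeomorphism UNIV (range \<eta>) \<eta> \<longrightarrow>
        diffeomorphic_map_from_M br \<theta> (sym_space br \<theta>) (D_domain br \<theta> a r e \<eta>) (Omega br \<theta> a r e \<eta>) \<and>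
        diffeomorphic_map_from_M br \<theta> (Exp ` a) (square r h \<eta>) (Omega br \<theta> a r e \<eta>) \<and>
        diffeomorphic_map_from_M br \<theta> N (D_domain_sub br \<theta> N r\<^sub>N V \<eta>) (Omega_sub br \<theta> N r\<^sub>N V \<eta>) \<and>
        diffeomorphic_map_from_M br \<theta> (Exp ` a\<^sub>N) (square r\<^sub>N V \<eta>) (Omega_sub br \<theta> N r\<^sub>N V \<eta>))"
proof -
  note sV = \<Omega>_sum_V[where f=\<eta>, OF cio_odd[OF \<eta>]]
  have im: "\<Omega> \<eta> ` \<pp> = D_domain br \<theta> a r e \<eta>" "\<Omega> \<eta> ` a = square r h \<eta>"
    "\<Omega> \<eta> ` q = D_domain_sub br \<theta> N r\<^sub>N V \<eta>" "\<Omega> \<eta> ` a\<^sub>N = square r\<^sub>N V \<eta>"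
    using \<Omega>_image_p[OF \<eta>] \<Omega>_image_a[OF \<eta>] \<Omega>_image_q[OF \<Omega>_image_sub[OF \<eta> sV]] \<Omega>_image_sub[OF \<eta> sV] by simp_all
  have ap: "a \<subseteq> \<pp>" using a_p by blast
  have aNp: "a\<^sub>N \<subseteq> \<pp>" using aN_q q_sub_p by blast
  have Om: "X \<in> C \<Longrightarrow> Omega br \<theta> a r e \<eta> (Exp X) = \<Omega> \<eta> X" if "C \<subseteq> \<pp>" for X C using Omega_eq[OF \<eta>] that by blast
  have Om': "X \<in> C \<Longrightarrow> Omega_sub br \<theta> N r\<^sub>N V \<eta> (Exp X) = \<Omega> \<eta> X" if "C \<subseteq> q" for X C
    using Omega_sub_eq[where \<eta>=\<eta>, OF sV] that by blast
  note maps = homeomorphic_map[OF \<eta> order_refl Om[OF order_refl], unfolded im, folded sym_space_eq]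
    homeomorphic_map[OF \<eta> ap Om[OF ap], unfolded im]
    homeomorphic_map[OF \<eta> q_sub_p Om'[OF order_refl], unfolded im, folded N_eq]
    homeomorphic_map[OF \<eta> aNp Om'[OF aN_q], unfolded im]
  have "Omega br \<theta> a r e \<eta> p = Omega_sub br \<theta> N r\<^sub>N V \<eta> p" if p: "p \<in> N" for p
  proof -
    obtain X where X: "X \<in> q" "p = Exp X" using N_D[OF p] by blast
    show ?thesis unfolding X(2) Om[OF q_sub_p X(1)] Om'[OF order_refl X(1)] ..
  qed
  moreover have "N \<subseteq> sym_space br \<theta>" using N_geodesic by (simp add: complete_totally_geodesic_def)
  moreover have "Exp ` a \<subseteq> sym_space br \<theta>" unfolding sym_space_eq by (rule image_mono[OF ap])
  moreover have "Exp ` a\<^sub>N \<subseteq> N" using N_I aN_q by blast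
  moreover have "square r\<^sub>N V \<eta> \<subseteq> D_domain_sub br \<theta> N r\<^sub>N V \<eta>" "square r h \<eta> \<subseteq> D_domain br \<theta> a r e \<eta>"
    "square r\<^sub>N V \<eta> \<subseteq> square r h \<eta>" "D_domain_sub br \<theta> N r\<^sub>N V \<eta> \<subseteq> D_domain br \<theta> a r e \<eta>"
    unfolding im[symmetric] using aN_q ap aN_a q_sub_p by blast+
  ultimately show ?thesis using maps image_mono[OF aN_a, of Exp] by blast
qed

end

lemma complexification_of_images:
  assumes im: "\<forall>\<eta>. continuous_injective_odd \<eta> \<longrightarrow> Omega br \<theta> a r e \<eta> ` (Exp ` a\<^sub>N) = square r\<^sub>N V \<eta>"
  shows "has_lts_complexification br \<zeta> a\<^sub>N"
proof -
  let ?c = "\<lambda>x::real. x ^ 3"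
  have c: "continuous_injective_odd ?c"
    unfolding continuous_injective_odd_def
  proof (intro conjI allI)
    show "continuous_on UNIV ?c" by (intro continuous_intros)
    show "inj ?c" by (rule inj_on_inverseI[where g="root 3"]) (simp add: odd_real_root_power_cancel)
    show "(- x) ^ 3 = - (x ^ 3)" for x :: real by simp
  qed
  have cube: "(\<Sum>i\<in>{1..r}. (e i X ^ 3) *\<^sub>R h i) \<in> a\<^sub>N" if X: "X \<in> a\<^sub>N" for X
  proof -
    have Xa: "X \<in> a" using X aN_a by blast
    have "(\<Sum>i\<in>{1..r}. (e i X ^ 3) *\<^sub>R h i) = Omega br \<theta> a r e ?c (Exp X)"
      unfolding Omega_eq[OF c a_p[OF Xa]] by (rule \<Omega>_diagonal[where f="?c", OF cio_odd[OF c] Xa, symmetric])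
    also have "\<dots> \<in> square r\<^sub>N V ?c" using im c X by blast
    also have "\<dots> \<subseteq> a\<^sub>N" unfolding square_def using sum_V_aN by auto
    finally show ?thesis .
  qed
  have "triple X Y Z \<in> a\<^sub>N" if XYZ: "X \<in> a\<^sub>N" "Y \<in> a\<^sub>N" "Z \<in> a\<^sub>N" for X Y Z
  proof -
    define S where "S X = (\<Sum>i\<in>{1..r}. (e i X ^ 3) *\<^sub>R h i)" for X
    have S: "S X \<in> a\<^sub>N" if "X \<in> a\<^sub>N" for X unfolding S_def using cube[OF that] .
    \<comment> \<open>Flipping the signs of Y and Z, weighted by the product of the signs, leaves
      only the mixed term of the cube. It has coefficient 6 and occurs four times, hence 24.\<close>
    let ?P = "S (X + Y + Z) - S (X + Y - Z) - S (X - Y + Z) + S (X - Y - Z)"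
    have "?P = (\<Sum>i\<in>{1..r}. (24 * (e i X * e i Y * e i Z)) *\<^sub>R h i)"
      unfolding S_def sum_subtractf[symmetric] sum.distrib[symmetric]
    proof (rule sum.cong[OF refl])
      fix i assume i: "i \<in> {1..r}"
      have cub: "(x + y + z) ^ 3 - (x + y - z) ^ 3 - (x - y + z) ^ 3 + (x - y - z) ^ 3 = 24 * (x * y * z)"
        for x y z :: real by (simp add: power3_eq_cube algebra_simps)
      show "(e i (X + Y + Z) ^ 3) *\<^sub>R h i - (e i (X + Y - Z) ^ 3) *\<^sub>R h i - (e i (X - Y + Z) ^ 3) *\<^sub>R h i
          + (e i (X - Y - Z) ^ 3) *\<^sub>R h i = (24 * (e i X * e i Y * e i Z)) *\<^sub>R h i"
        by (simp only: linear_add[OF e_linear[OF i]] linear_diff[OF e_linear[OF i]] cub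
            scaleR_diff_left[symmetric] scaleR_add_left[symmetric])
    qed
    also have "\<dots> = 24 *\<^sub>R triple X Y Z" by (simp only: triple_def scaleR_sum_right scaleR_scaleR)
    finally have "triple X Y Z = (1 / 24) *\<^sub>R ?P" by simp
    moreover have "?P \<in> a\<^sub>N"
      by (intro subspace_add[OF aN_subspace] subspace_diff[OF aN_subspace] S XYZ)
    ultimately show ?thesis using subspace_scale[OF aN_subspace, of ?P "1 / 24"] by metis
  qed
  then show ?thesis using complexification_triple[OF aN_subspace aN_a] by blast
qed

end

theorem theorem1p5:
  fixes br :: "'g::euclidean_space \<Rightarrow> 'g \<Rightarrow> 'g"
    and \<theta> :: "'g \<Rightarrow> 'g" and \<zeta> :: 'g
    and N :: "('g \<Rightarrow> 'g) set set"
    and a a\<^sub>N :: "'g set"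
    and r r\<^sub>N :: nat
    and e :: "nat \<Rightarrow> 'g \<Rightarrow> real"
    and idx :: "nat \<Rightarrow> nat" and V :: "nat \<Rightarrow> 'g"
  assumes M: "irreducible_hermitian_noncompact br \<theta> \<zeta>"
    and N: "complete_totally_geodesic br \<theta> N" "connected_in_M br \<theta> N" "origin br \<theta> \<in> N"
    and aN: "maximal_abelian br (p_sub br \<theta> N) a\<^sub>N"
    and a: "maximal_abelian br (p_part \<theta>) a" "a\<^sub>N \<subseteq> a"
    and e: "root_frame br a r e"
    and V: "canonical_basis br a r e a\<^sub>N r\<^sub>N idx V"
  shows
    "(has_lts_complexification br \<zeta> a\<^sub>N \<longrightarrow>
       (\<forall>\<eta>. continuous_injective_odd \<eta> \<longrightarrow>
          (\<forall>p\<in>N. Omega br \<theta> a r e \<eta> p = Omega_sub br \<theta> N r\<^sub>N V \<eta> p) \<and>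
          N \<subseteq> sym_space br \<theta> \<and> Exp_o br \<theta> ` a\<^sub>N \<subseteq> Exp_o br \<theta> ` a \<and>
          Exp_o br \<theta> ` a \<subseteq> sym_space br \<theta> \<and> Exp_o br \<theta> ` a\<^sub>N \<subseteq> N \<and>
          D_domain_sub br \<theta> N r\<^sub>N V \<eta> \<subseteq> D_domain br \<theta> a r e \<eta> \<and>
          square r\<^sub>N V \<eta> \<subseteq> square r (Htilde br a e) \<eta> \<and>
          square r (Htilde br a e) \<eta> \<subseteq> D_domain br \<theta> a r e \<eta> \<and>
          square r\<^sub>N V \<eta> \<subseteq> D_domain_sub br \<theta> N r\<^sub>N V \<eta> \<and>
          homeomorphic_map_from_M br \<theta> (sym_space br \<theta>) (D_domain br \<theta> a r e \<eta>)
            (Omega br \<theta> a r e \<eta>) \<and>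
          homeomorphic_map_from_M br \<theta> (Exp_o br \<theta> ` a) (square r (Htilde br a e) \<eta>)
            (Omega br \<theta> a r e \<eta>) \<and>
          homeomorphic_map_from_M br \<theta> N (D_domain_sub br \<theta> N r\<^sub>N V \<eta>)
            (Omega_sub br \<theta> N r\<^sub>N V \<eta>) \<and>
          homeomorphic_map_from_M br \<theta> (Exp_o br \<theta> ` a\<^sub>N) (square r\<^sub>N V \<eta>)
            (Omega_sub br \<theta> N r\<^sub>N V \<eta>) \<and>
          (diffeomorphism UNIV (range \<eta>) \<eta> \<longrightarrow>
             diffeomorphic_map_from_M br \<theta> (sym_space br \<theta>) (D_domain br \<theta> a r e \<eta>)
               (Omega br \<theta> a r e \<eta>) \<and>
             diffeomorphic_map_from_M br \<theta> (Exp_o br \<theta> ` a) (square r (Htilde br a e) \<eta>)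
               (Omega br \<theta> a r e \<eta>) \<and>
             diffeomorphic_map_from_M br \<theta> N (D_domain_sub br \<theta> N r\<^sub>N V \<eta>)
               (Omega_sub br \<theta> N r\<^sub>N V \<eta>) \<and>
             diffeomorphic_map_from_M br \<theta> (Exp_o br \<theta> ` a\<^sub>N) (square r\<^sub>N V \<eta>)
               (Omega_sub br \<theta> N r\<^sub>N V \<eta>)))) \<and>
     ((\<forall>\<eta>. continuous_injective_odd \<eta> \<longrightarrow>
          Omega br \<theta> a r e \<eta> ` N = D_domain_sub br \<theta> N r\<^sub>N V \<eta> \<and>
          Omega br \<theta> a r e \<eta> ` (Exp_o br \<theta> ` a\<^sub>N) = square r\<^sub>N V \<eta>) \<longrightarrow>
        has_lts_complexification br \<zeta> a\<^sub>N)"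
proof -
  have "lie_algebra br" "cartan_involution br \<theta>" using M by (auto simp: irreducible_hermitian_noncompact_def)
  then interpret framed_submanifold br \<theta> \<zeta> a r e N a\<^sub>N r\<^sub>N idx V
    using M N aN a e V by unfold_locales
  show ?thesis
  proof (rule conjI; intro impI)
    show "has_lts_complexification br \<zeta> a\<^sub>N"
      if "\<forall>\<eta>. continuous_injective_odd \<eta> \<longrightarrow>
          Omega br \<theta> a r e \<eta> ` N = D_domain_sub br \<theta> N r\<^sub>N V \<eta> \<and>
          Omega br \<theta> a r e \<eta> ` (Exp_o br \<theta> ` a\<^sub>N) = square r\<^sub>N V \<eta>"
      by (rule complexification_of_images) (use that in blast)
  qed (intro allI impI, rule realization)
qed

end
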